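(* Let $d_{\mathrm{av}}\in\mathbb{R}\setminus\{0\}$. Let $h:[0,\infty)\to\mathbb{R}$ be continuous on $[0,\infty)$ and continuously differentiable on $(0,\infty)$ with $\lim_{a\to 0}h'(a)a=0$, and suppose there exist increasing functions $J_1,J_2:[0,\infty)\to[0,\infty)$ such that $|h(a)|\le J_1(a)$ for all $a\ge 0$ and $|h'(a)|\le J_2(a)(1+a^{-1})$ for all $a>0$. Let $0\le\psi\in L^1(\mathbb{R})$ and $P(z)=h(|z|)z$ for $z\in\mathbb{C}$. Then the Cauchy problem $$i\partial_t u+d_{\mathrm{av}}\partial_x^2u+\int_{\mathbb{R}}T_r^{-1}\big(P(T_ru)\big)\psi(r)\,dr=0,\qquad u(\cdot,0)=u_0,$$ is locally well-posed in $H^1(\mathbb{R})$, and the mass $m(u(t))$ and energy $E(u(t))$ of solutions are conserved (constant in $t$).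
   Context: $u=u(x,t)$ is complex-valued, $x,t\in\mathbb{R}$, and $u(t)=u(\cdot,t)$. $T_r=e^{ir\partial_x^2}$, $r\in\mathbb{R}$, is the free Schrödinger group in one space dimension: $w(x,r)=(T_rf)(x)$ solves $i\partial_rw+\partial_x^2w=0$, $w(x,0)=f(x)$. Put $Q(f)=\int_{\mathbb{R}}T_r^{-1}(P(T_rf))\psi(r)\,dr$. A strong solution on $[-M_-,M_+]$ ($M_\pm>0$) with initial datum $u_0\in H^1(\mathbb{R})$ is $u\in\mathcal{C}([-M_-,M_+],H^1(\mathbb{R}))\cap\mathcal{C}^1((-M_-,M_+),H^{-1}(\mathbb{R}))$ satisfying $i\partial_tu+d_{\mathrm{av}}\partial_x^2u+Q(u)=0$ and $u(0)=u_0$; equivalently, $u\in\mathcal{C}([-M_-,M_+],H^1(\mathbb{R}))$ satisfies $u(t)=e^{itd_{\mathrm{av}}\partial_x^2}u_0+i\int_0^te^{i(t-t')d_{\mathrm{av}}\partial_x^2}Q(u(t'))\,dt'$ for all $t\in[-M_-,M_+]$. The problem is locally well-posed in $H^1(\mathbb{R})$ if for every $u_0\in H^1(\mathbb{R})$ there exist $M_\pm>0$ and a ball $B\subset H^1(\mathbb{R})$ containing $u_0$ such that for each $\phi\in B$ there is a unique strong solution $u\in\mathcal{C}([-M_-,M_+],H^1(\mathbb{R}))$ with initial datum $\phi$, and the map $\phi\mapsto u$ is continuous from $B$ to $\mathcal{C}([-M_-,M_+],H^1(\mathbb{R}))$. The mass is $m(u(t))=\|u(t)\|_{L^2}^2$.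 The energy is $E(u(t))=\frac{d_{\mathrm{av}}}{2}\|\partial_xu(t)\|_{L^2}^2-\iint_{\mathbb{R}^2}V(|T_ru(t)|)\,dx\,\psi(r)\,dr$, where $V(a)=\int_0^ah(s)s\,ds$ for $a\ge 0$. *)

theory Defs
  imports "HOL-Analysis.Analysis"
begin

text \<open>
  Elements of \<open>L\<^sup>2(\<real>)\<close> and \<open>H\<^sup>1(\<real>)\<close> are represented by Borel functions
  \<open>real \<Rightarrow> complex\<close>; equality in these spaces is equality almost everywhere.
\<close>

definition L2 :: "(real \<Rightarrow> complex) set" where
  "L2 = {f \<in> borel_measurable lborel. integrable lborel (\<lambda>x. (norm (f x))\<^sup>2)}"

definition L2_norm :: "(real \<Rightarrow> complex) \<Rightarrow> real" where
  "L2_norm f = sqrt (LINT x|lborel. (norm (f x))\<^sup>2)"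

definition test_function :: "(real \<Rightarrow> real) \<Rightarrow> bool" where
  "test_function \<phi> \<longleftrightarrow>
     (\<forall>k x. (deriv ^^ k) \<phi> field_differentiable at x) \<and>
     (\<exists>R. \<forall>x. \<bar>x\<bar> > R \<longrightarrow> \<phi> x = 0)"

definition weak_derivative :: "(real \<Rightarrow> complex) \<Rightarrow> (real \<Rightarrow> complex) \<Rightarrow> bool" where
  "weak_derivative f g \<longleftrightarrow>
     (\<forall>\<phi>. test_function \<phi> \<longrightarrow>
        (LINT x|lborel. f x * of_real (deriv \<phi> x)) = - (LINT x|lborel. g x * of_real (\<phi> x)))"

definition H1 :: "(real \<Rightarrow> complex) set" where
  "H1 = {f \<in> L2. \<exists>g\<in>L2. weak_derivative f g}"

definition Dx :: "(real \<Rightarrow> complex) \<Rightarrow> real \<Rightarrow> complex" where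
  "Dx f = (SOME g. g \<in> L2 \<and> weak_derivative f g)"

definition H1_norm :: "(real \<Rightarrow> complex) \<Rightarrow> real" where
  "H1_norm f = sqrt ((L2_norm f)\<^sup>2 + (L2_norm (Dx f))\<^sup>2)"

definition H1_ball :: "(real \<Rightarrow> complex) \<Rightarrow> real \<Rightarrow> (real \<Rightarrow> complex) set" where
  "H1_ball c \<rho> = {f \<in> H1. H1_norm (\<lambda>x. f x - c x) < \<rho>}"

definition CH1 :: "real set \<Rightarrow> (real \<Rightarrow> real \<Rightarrow> complex) set" where
  "CH1 I = {u. (\<forall>t\<in>I. u t \<in> H1) \<and>
     (\<forall>t\<in>I. ((\<lambda>s. H1_norm (\<lambda>x. u s x - u t x)) \<longlongrightarrow> 0) (at t within I))}"

definition CH1_dist ::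
  "real set \<Rightarrow> (real \<Rightarrow> real \<Rightarrow> complex) \<Rightarrow> (real \<Rightarrow> real \<Rightarrow> complex) \<Rightarrow> real" where
  "CH1_dist I u v = (SUP t\<in>I. H1_norm (\<lambda>x. u t x - v t x))"

text \<open>
  \<open>H\<^sup>-\<^sup>1(\<real>)\<close> is the dual of \<open>H\<^sup>1(\<real>)\<close>. Only the values of a functional on \<open>H1\<close> matter.
  A function acts through the bilinear (not sesquilinear) pairing, as for distributions.
\<close>

definition Hm1 :: "((real \<Rightarrow> complex) \<Rightarrow> complex) set" where
  "Hm1 = {\<Lambda>. (\<forall>f\<in>H1. \<forall>g\<in>H1. \<Lambda> (\<lambda>x. f x + g x) = \<Lambda> f + \<Lambda> g) \<and>
             (\<forall>c. \<forall>f\<in>H1. \<Lambda> (\<lambda>x. c * f x) = c * \<Lambda> f) \<and>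
             (\<exists>C. \<forall>f\<in>H1. norm (\<Lambda> f) \<le> C * H1_norm f)}"

definition Hm1_norm :: "((real \<Rightarrow> complex) \<Rightarrow> complex) \<Rightarrow> real" where
  "Hm1_norm \<Lambda> = (SUP f\<in>{f \<in> H1. H1_norm f \<le> 1}. norm (\<Lambda> f))"

definition to_Hm1 :: "(real \<Rightarrow> complex) \<Rightarrow> (real \<Rightarrow> complex) \<Rightarrow> complex" where
  "to_Hm1 f = (\<lambda>\<phi>. LINT x|lborel. f x * \<phi> x)"

definition Dxx :: "(real \<Rightarrow> complex) \<Rightarrow> (real \<Rightarrow> complex) \<Rightarrow> complex" where
  "Dxx f = (\<lambda>\<phi>. - (LINT x|lborel. Dx f x * Dx \<phi> x))"

definition has_Hm1_derivative ::
  "(real \<Rightarrow> real \<Rightarrow> complex) \<Rightarrow> ((real \<Rightarrow> complex) \<Rightarrow> complex) \<Rightarrow> real \<Rightarrow> bool" where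
  "has_Hm1_derivative u \<Lambda> t \<longleftrightarrow> \<Lambda> \<in> Hm1 \<and>
     ((\<lambda>s. Hm1_norm (\<lambda>\<phi>. (to_Hm1 (u s) \<phi> - to_Hm1 (u t) \<phi>) / of_real (s - t) - \<Lambda> \<phi>))
        \<longlongrightarrow> 0) (at t)"

text \<open>
  The Fourier transform on \<open>L\<^sup>2\<close>, as the \<open>L\<^sup>2\<close>-limit of the Fourier integrals of the
  truncations of \<open>f\<close> to \<open>[-n, n]\<close>.
\<close>

definition fourier_integral :: "(real \<Rightarrow> complex) \<Rightarrow> real \<Rightarrow> complex" where
  "fourier_integral f \<xi> =
     of_real (1 / sqrt (2 * pi)) * (LINT x|lborel. exp (- (\<i> * of_real (\<xi> * x))) * f x)"

definition is_L2_fourier :: "(real \<Rightarrow> complex) \<Rightarrow> (real \<Rightarrow> complex) \<Rightarrow> bool" where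
  "is_L2_fourier f F \<longleftrightarrow> f \<in> L2 \<and> F \<in> L2 \<and>
     (\<lambda>n. L2_norm (\<lambda>\<xi>. F \<xi> -
        fourier_integral (\<lambda>x. indicator {- real n..real n} x * f x) \<xi>)) \<longlonglongrightarrow> 0"

text \<open>
  \<open>T\<^sub>r = exp (\<i> r \<partial>\<^sub>x\<^sup>2)\<close> on \<open>L\<^sup>2\<close> is the Fourier multiplier with symbol \<open>exp (- \<i> r \<xi>\<^sup>2)\<close>.
  Its value is a class modulo null sets; the continuous representative is chosen whenever there
  is one (in particular for \<open>f \<in> H\<^sup>1\<close>), so that \<open>T\<^sub>r f\<close> can be evaluated pointwise and is
  continuous in \<open>(r, x)\<close>.
\<close>

definition is_schroedinger ::
  "real \<Rightarrow> (real \<Rightarrow> complex) \<Rightarrow> (real \<Rightarrow> complex) \<Rightarrow> bool" where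
  "is_schroedinger r f g \<longleftrightarrow>
     (\<exists>F. is_L2_fourier f F \<and> is_L2_fourier g (\<lambda>\<xi>. exp (- (\<i> * of_real (r * \<xi>\<^sup>2))) * F \<xi>))"

definition T :: "real \<Rightarrow> (real \<Rightarrow> complex) \<Rightarrow> real \<Rightarrow> complex" where
  "T r f = (SOME g. is_schroedinger r f g \<and>
     ((\<exists>k. is_schroedinger r f k \<and> continuous_on UNIV k) \<longrightarrow> continuous_on UNIV g))"

text \<open>
  The inverse of \<open>T\<^sub>r\<close> in the group is \<open>T\<^sub>-\<^sub>r\<close>. The integral over \<open>r\<close> is taken at each
  point \<open>x\<close>; for \<open>f \<in> H\<^sup>1\<close> the integrand is the continuous representative of an element of
  \<open>H\<^sup>1\<close>, on which evaluation at \<open>x\<close> is a bounded functional, so this is the continuous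
  representative of the vector-valued integral.
\<close>

definition Q :: "(complex \<Rightarrow> complex) \<Rightarrow> (real \<Rightarrow> real) \<Rightarrow> (real \<Rightarrow> complex) \<Rightarrow> real \<Rightarrow> complex" where
  "Q P \<psi> f = (\<lambda>x. LINT r|lborel. T (- r) (\<lambda>y. P (T r f y)) x * of_real (\<psi> r))"

definition strong_solution ::
  "real \<Rightarrow> (complex \<Rightarrow> complex) \<Rightarrow> (real \<Rightarrow> real) \<Rightarrow> real \<Rightarrow> real \<Rightarrow>
   (real \<Rightarrow> complex) \<Rightarrow> (real \<Rightarrow> real \<Rightarrow> complex) \<Rightarrow> bool" where
  "strong_solution d P \<psi> Mm Mp u0 u \<longleftrightarrow>
     u \<in> CH1 {-Mm..Mp} \<and>
     (\<exists>u'. (\<forall>t\<in>{-Mm<..<Mp}. has_Hm1_derivative u (u' t) t) \<and>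
           (\<forall>t\<in>{-Mm<..<Mp}. ((\<lambda>s. Hm1_norm (\<lambda>\<phi>. u' s \<phi> - u' t \<phi>)) \<longlongrightarrow> 0) (at t)) \<and>
           (\<forall>t\<in>{-Mm<..<Mp}. \<forall>\<phi>\<in>H1.
              \<i> * u' t \<phi> + of_real d * Dxx (u t) \<phi> + to_Hm1 (Q P \<psi> (u t)) \<phi> = 0)) \<and>
     (AE x in lborel. u 0 x = u0 x)"

definition locally_well_posed ::
  "real \<Rightarrow> (complex \<Rightarrow> complex) \<Rightarrow> (real \<Rightarrow> real) \<Rightarrow> bool" where
  "locally_well_posed d P \<psi> \<longleftrightarrow>
     (\<forall>u0\<in>H1. \<exists>Mm>0. \<exists>Mp>0. \<exists>c\<in>H1. \<exists>\<rho>>0. u0 \<in> H1_ball c \<rho> \<and>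
        (\<exists>S. (\<forall>\<phi>\<in>H1_ball c \<rho>.
                strong_solution d P \<psi> Mm Mp \<phi> (S \<phi>) \<and>
                (\<forall>v. strong_solution d P \<psi> Mm Mp \<phi> v \<longrightarrow>
                   (\<forall>t\<in>{-Mm..Mp}. AE x in lborel. v t x = S \<phi> t x))) \<and>
             (\<forall>\<phi>\<in>H1_ball c \<rho>. \<forall>\<epsilon>>0. \<exists>\<delta>>0. \<forall>\<eta>\<in>H1_ball c \<rho>.
                H1_norm (\<lambda>x. \<eta> x - \<phi> x) < \<delta> \<longrightarrow> CH1_dist {-Mm..Mp} (S \<eta>) (S \<phi>) < \<epsilon>)))"

definition mass :: "(real \<Rightarrow> complex) \<Rightarrow> real" where
  "mass f = (L2_norm f)\<^sup>2"

definition V :: "(real \<Rightarrow> real) \<Rightarrow> real \<Rightarrow> real" where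
  "V h a = integral {0..a} (\<lambda>s. h s * s)"

definition energy :: "real \<Rightarrow> (real \<Rightarrow> real) \<Rightarrow> (real \<Rightarrow> real) \<Rightarrow> (real \<Rightarrow> complex) \<Rightarrow> real" where
  "energy d h \<psi> f = d / 2 * (L2_norm (Dx f))\<^sup>2 -
     (LINT r|lborel. (LINT x|lborel. V h (norm (T r f x))) * \<psi> r)"

end

theory Submission
  imports Defs "HOL-Probability.Probability"
begin

text \<open>
An \<open>H\<^sup>1\<close> function \<open>f\<close> is represented by the \<open>L\<^sup>2\<close> function \<open>\<langle>\<xi>\<rangle> f^(\<xi>)\<close>; in these coordinates the
\<open>H\<^sup>1\<close> norm is the \<open>L\<^sup>2\<close> norm and the free group is multiplication by \<open>exp(-i r \<xi>\<^sup>2)\<close>. Passing to the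
interaction picture \<open>w(t) = exp(-i t d \<partial>\<^sup>2) u(t)\<close> turns the equation into an ordinary differential
equation \<open>w' = G(t, w)\<close> in \<open>H\<^sup>1\<close>, free of unbounded operators.

Since \<open>P\<close> is only \<open>C\<^sup>1\<close>, \<open>G\<close> is not locally Lipschitz in \<open>H\<^sup>1\<close>. On bounded subsets of \<open>H\<^sup>1\<close> it is,
however, Lipschitz in the \<open>L\<^sup>2\<close> norm, and the \<open>H\<^sup>1\<close> norm of \<open>G(t, v) - G(t, w)\<close> is at most \<open>C\<close> times
the \<open>H\<^sup>1\<close> norm of \<open>v - w\<close> plus a modulus of continuity in its \<open>L\<^sup>2\<close> norm. These two estimates make the
Picard iterates converge in \<open>C(I, H\<^sup>1)\<close> and give continuous dependence; uniqueness is Gronwall's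
inequality in \<open>L\<^sup>2\<close>.

Mass conservation is gauge invariance. For the energy, the potential part is differentiable up to an
error quadratic in the \<open>L\<^sup>2\<close> norm, and the square of the \<open>L\<^sup>2\<close> norm of \<open>u(t) - u(s)\<close> is bounded by the
product of its \<open>H\<^sup>1\<close> and \<open>H\<^sup>-\<^sup>1\<close> norms, hence is \<open>o(t - s)\<close>.
\<close>

subsection \<open>The Hilbert space of square integrable functions\<close>

text \<open>Let \<open>DP\<close> be the real derivative of \<open>P\<close>. The derivative of
  \<open>P(f) - P(g)\<close> contains \<open>(DP(f) - DP(g)) g'\<close>, and a merely continuous
  \<open>DP\<close> gives no rate for this term. It is small once \<open>f - g\<close> is uniformly
  small, and on bounded sets of H^1 uniform smallness follows from smallness in L^2 by
  interpolation. Hence iterates are first brought close in L^2, and only then is their distance in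
  H^1 estimated. The time \<open>M\<close> satisfies \<open>M * KR R \<le> 1/2\<close>, so that one
  integration in time turns a bound \<open>c\<close> on a difference into \<open>c / 2\<close>, up
  to the modulus of continuity. No smoothing of the data is needed for the conservation laws. In the
  interaction picture a solution is differentiable in time with values in H^1 itself, and the free
  group preserves the L^2 norms of a function and of its derivative, so mass and kinetic energy can
  be differentiated directly. Only the potential energy has to be differentiated along
  \<open>u\<close>, for which a time derivative is available in H^-1 alone.\<close>

lemma borel_measurable_cnj [measurable (raw)]:
  "f \<in> borel_measurable M \<Longrightarrow> (\<lambda>x. cnj (f x)) \<in> borel_measurable M"
  by (rule borel_measurable_continuous_on[where f=cnj]) (auto intro!: continuous_intros)

lemma L2_iff: "f \<in> L2 \<longleftrightarrow> f \<in> borel_measurable borel \<and> integrable lborel (\<lambda>x. (norm (f x))\<^sup>2)"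
  by (simp add: L2_def)

lemma L2_measurable [measurable_dest]: "f \<in> L2 \<Longrightarrow> f \<in> borel_measurable borel"
  by (simp add: L2_iff)

lemma L2_square_integrable: "f \<in> L2 \<Longrightarrow> integrable lborel (\<lambda>x. (norm (f x))\<^sup>2)"
  by (simp add: L2_iff)

lemma L2_dominated:
  assumes "f \<in> borel_measurable borel" "integrable lborel w" "\<And>x. (norm (f x))\<^sup>2 \<le> w x"
  shows "f \<in> L2"
  unfolding L2_iff
proof (intro conjI)
  show "integrable lborel (\<lambda>x. (norm (f x))\<^sup>2)"
    by (rule Bochner_Integration.integrable_bound[OF assms(2)])
       (use assms(1,3) in \<open>auto intro: order_trans[OF _ abs_ge_self]\<close>)
qed (use assms in simp)

lemma norm_add_square_le: "(norm (a + b))\<^sup>2 \<le> 2 * (norm a)\<^sup>2 + 2 * (norm (b::'a::real_normed_vector))\<^sup>2"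
proof -
  have "(norm (a + b))\<^sup>2 \<le> (norm a + norm b)\<^sup>2"
    by (simp add: norm_triangle_ineq power_mono)
  also have "\<dots> \<le> 2 * (norm a)\<^sup>2 + 2 * (norm b)\<^sup>2"
    using zero_le_power2[of "norm a - norm b"] by (simp add: power2_sum power2_diff)
  finally show ?thesis .
qed

lemma L2_add: "f \<in> L2 \<Longrightarrow> g \<in> L2 \<Longrightarrow> (\<lambda>x. f x + g x) \<in> L2"
  by (rule L2_dominated[where w="\<lambda>x. 2 * (norm (f x))\<^sup>2 + 2 * (norm (g x))\<^sup>2"])
     (auto simp: norm_add_square_le L2_square_integrable dest: L2_measurable
           intro!: Bochner_Integration.integrable_add)

lemma L2_bounded_mult:
  assumes "m \<in> borel_measurable borel" "\<And>x. norm (m x) \<le> B" "f \<in> L2"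
  shows "(\<lambda>x. m x * f x) \<in> L2"
proof (rule L2_dominated[where w="\<lambda>x. B\<^sup>2 * (norm (f x))\<^sup>2"])
  fix x
  show "(norm (m x * f x))\<^sup>2 \<le> B\<^sup>2 * (norm (f x))\<^sup>2"
    using assms(2)[of x] by (auto simp: norm_mult power_mult_distrib intro!: mult_right_mono power_mono)
qed (use assms in \<open>auto simp: L2_square_integrable dest: L2_measurable\<close>)

lemma L2_cmult: "f \<in> L2 \<Longrightarrow> (\<lambda>x. c * f x) \<in> L2"
  by (rule L2_bounded_mult[where B="norm c"]) auto

lemma L2_uminus: "f \<in> L2 \<Longrightarrow> (\<lambda>x. - f x) \<in> L2"
  using L2_cmult[of f "-1"] by simp

lemma L2_diff: "f \<in> L2 \<Longrightarrow> g \<in> L2 \<Longrightarrow> (\<lambda>x. f x - g x) \<in> L2"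
  using L2_add[of f "\<lambda>x. - g x"] L2_uminus[of g] by simp

lemma L2_cnj: "f \<in> L2 \<Longrightarrow> (\<lambda>x. cnj (f x)) \<in> L2"
  by (auto simp: L2_iff intro: borel_measurable_cnj)

lemma L2_norm_square_integrable: "f \<in> L2 \<Longrightarrow> integrable lborel (\<lambda>x. complex_of_real ((norm (f x))\<^sup>2))"
  by (rule integrable_of_real[OF L2_square_integrable])

lemma L2_zero: "(\<lambda>x. 0) \<in> L2"
  by (simp add: L2_iff)

lemma L2_mult_integrable:
  assumes "f \<in> L2" "g \<in> L2"
  shows "integrable lborel (\<lambda>x. f x * g x)"
proof (rule Bochner_Integration.integrable_bound)
  show "integrable lborel (\<lambda>x. (norm (f x))\<^sup>2 + (norm (g x))\<^sup>2)"
    using assms by (simp add: L2_square_integrable)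
  have "norm (f x * g x) \<le> norm ((norm (f x))\<^sup>2 + (norm (g x))\<^sup>2)" for x
    using zero_le_power2[of "norm (f x) - norm (g x)"] zero_le_power2[of "norm (f x)"] zero_le_power2[of "norm (g x)"]
    unfolding norm_mult power2_diff real_norm_def by linarith
  then show "AE x in lborel. norm (f x * g x) \<le> norm ((norm (f x))\<^sup>2 + (norm (g x))\<^sup>2)" by simp
qed (use assms in measurable)

\<comment> \<open>Classes modulo null sets are made a type so that the norm separates points and the
  type can become a separable Hilbert space. The averaged nonlinearity is a Bochner integral with
  values in it, and the evolution an ordinary differential equation.\<close>
quotient_type l2 = "real \<Rightarrow> complex" / partial: "\<lambda>f g. f \<in> L2 \<and> g \<in> L2 \<and> (AE x in lborel. f x = g x)"
  morphisms rep cls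
proof (rule part_equivpI)
  show "\<exists>x. x \<in> L2 \<and> x \<in> L2 \<and> (AE y in lborel. x y = x y)"
    using L2_zero by auto
  show "symp (\<lambda>f g. f \<in> L2 \<and> g \<in> L2 \<and> (AE x in lborel. f x = g x))"
    by (rule sympI) auto
  show "transp (\<lambda>f g. f \<in> L2 \<and> g \<in> L2 \<and> (AE x in lborel. f x = g x))"
    by (rule transpI) auto
qed

lemma rep_L2 [simp]: "rep f \<in> L2"
  using Quotient_rep_reflp[OF Quotient_l2, of f] by simp

lemma rep_measurable [measurable]: "rep f \<in> borel_measurable borel"
  using rep_L2 L2_measurable by blast

lemma cls_rep [simp]: "cls (rep f) = f"
  by (rule Quotient_abs_rep[OF Quotient_l2])

lemma cls_eq_iff: "f \<in> L2 \<Longrightarrow> g \<in> L2 \<Longrightarrow> cls f = cls g \<longleftrightarrow> (AE x in lborel. f x = g x)"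
  using Quotient_rel[OF Quotient_l2, of f g] by auto

lemma cls_eqI: "f \<in> L2 \<Longrightarrow> g \<in> L2 \<Longrightarrow> (AE x in lborel. f x = g x) \<Longrightarrow> cls f = cls g"
  by (simp add: cls_eq_iff)

lemma rep_cls: "f \<in> L2 \<Longrightarrow> AE x in lborel. rep (cls f) x = f x"
  using cls_eq_iff[of "rep (cls f)" f] by simp

lemma l2_eqI: "(AE x in lborel. rep f x = rep g x) \<Longrightarrow> f = g"
  using cls_eq_iff[of "rep f" "rep g"] by simp

instantiation l2 :: real_vector
begin
definition "0 = cls (\<lambda>x. 0)"
definition "f + g = cls (\<lambda>x. rep f x + rep g x)"
definition "- f = cls (\<lambda>x. - rep f x)"
definition "f - g = cls (\<lambda>x. rep f x - rep g x)"
definition "scaleR c f = cls (\<lambda>x. c *\<^sub>R rep f x)"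

lemma rep_add: "AE x in lborel. rep (f + g) x = rep f x + rep g x"
  unfolding plus_l2_def by (rule rep_cls) (simp add: L2_add)
lemma rep_zero: "AE x in lborel. rep 0 x = 0"
  unfolding zero_l2_def by (rule rep_cls) (simp add: L2_zero)
lemma rep_uminus: "AE x in lborel. rep (- f) x = - rep f x"
  unfolding uminus_l2_def by (rule rep_cls) (simp add: L2_uminus)
lemma rep_diff: "AE x in lborel. rep (f - g) x = rep f x - rep g x"
  unfolding minus_l2_def by (rule rep_cls) (simp add: L2_diff)
lemma rep_scaleR: "AE x in lborel. rep (c *\<^sub>R f) x = c *\<^sub>R rep f x"
  unfolding scaleR_l2_def by (rule rep_cls) (simp add: scaleR_conv_of_real L2_cmult)

instance
proof
  fix f g k :: l2 and a b :: real
  show "f + g + k = f + (g + k)"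
    by (rule l2_eqI) (use rep_add[of "f+g" k] rep_add[of f g] rep_add[of f "g+k"] rep_add[of g k] in eventually_elim, simp)
  show "f + g = g + f" by (simp add: plus_l2_def add.commute)
  show "0 + f = f"
    by (rule l2_eqI) (use rep_add[of 0 f] rep_zero in eventually_elim, simp)
  show "- f + f = 0"
    by (rule l2_eqI) (use rep_add[of "-f" f] rep_uminus[of f] rep_zero in eventually_elim, simp)
  show "f - g = f + - g"
    by (rule l2_eqI) (use rep_add[of f "-g"] rep_uminus[of g] rep_diff[of f g] in eventually_elim, simp)
  show "a *\<^sub>R (f + g) = a *\<^sub>R f + a *\<^sub>R g"
    by (rule l2_eqI) (use rep_scaleR[of a "f+g"] rep_scaleR[of a f] rep_scaleR[of a g] rep_add[of f g]
          rep_add[of "a *\<^sub>R f" "a *\<^sub>R g"] in eventually_elim, simp add: algebra_simps)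
  show "(a + b) *\<^sub>R f = a *\<^sub>R f + b *\<^sub>R f"
    by (rule l2_eqI) (use rep_scaleR[of "a+b" f] rep_scaleR[of a f] rep_scaleR[of b f]
          rep_add[of "a *\<^sub>R f" "b *\<^sub>R f"] in eventually_elim, simp add: algebra_simps)
  show "a *\<^sub>R b *\<^sub>R f = (a * b) *\<^sub>R f"
    by (rule l2_eqI) (use rep_scaleR[of "a*b" f] rep_scaleR[of a "b *\<^sub>R f"] rep_scaleR[of b f]
           in eventually_elim, simp add: algebra_simps)
  show "1 *\<^sub>R f = f"
    by (rule l2_eqI) (use rep_scaleR[of 1 f] in eventually_elim, simp)
qed
end

lemma rep_mult_cnj_integrable [simp]: "integrable lborel (\<lambda>x. rep f x * cnj (rep g x))"
  by (intro L2_mult_integrable L2_cnj) simp_all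

lemma Re_LINT: "integrable M f \<Longrightarrow> Re (LINT x|M. f x) = (LINT x|M. Re (f x))"
  by simp

text \<open>Only the real part of the Hermitian product is taken, so that real inner product spaces
  and real derivatives apply. Complex scalars return as the multiplication operators
  \<open>cscale\<close>, and the full Hermitian product as \<open>cinner\<close>.\<close>

instantiation l2 :: real_inner
begin
definition "inner f g = Re (LINT x|lborel. rep f x * cnj (rep g x))"
definition "norm (f::l2) = sqrt (inner f f)"
definition "dist (f::l2) g = norm (f - g)"
definition "sgn (f::l2) = f /\<^sub>R norm f"
definition "uniformity = (INF e\<in>{0<..}. principal {(x::l2, y). dist x y < e})"
definition "open (U :: l2 set) \<longleftrightarrow> (\<forall>x\<in>U. \<forall>\<^sub>F (x', y) in uniformity. x' = x \<longrightarrow> y \<in> U)"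

instance
proof
  fix f g k :: l2 and r :: real
  show "dist f g = norm (f - g)" by (rule dist_l2_def)
  show "sgn f = f /\<^sub>R norm f" by (rule sgn_l2_def)
  show "uniformity = (INF e\<in>{0<..}. principal {(x::l2, y). dist x y < e})" by (rule uniformity_l2_def)
  show "open (U :: l2 set) \<longleftrightarrow> (\<forall>x\<in>U. \<forall>\<^sub>F (x', y) in uniformity. x' = x \<longrightarrow> y \<in> U)" for U
    by (rule open_l2_def)
  show "norm f = sqrt (inner f f)" by (rule norm_l2_def)
  have "(LINT x|lborel. rep g x * cnj (rep f x)) = (LINT x|lborel. cnj (rep f x * cnj (rep g x)))"
    by (simp add: mult.commute)
  also have "\<dots> = cnj (LINT x|lborel. rep f x * cnj (rep g x))" by (rule Bochner_Integration.integral_cnj)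
  finally show "inner f g = inner g f" unfolding inner_l2_def by simp
  have "(LINT x|lborel. rep (f + g) x * cnj (rep k x)) =
      (LINT x|lborel. rep f x * cnj (rep k x) + rep g x * cnj (rep k x))"
    by (rule integral_cong_AE, simp, simp) (use rep_add[of f g] in eventually_elim, simp add: algebra_simps)
  then show "inner (f + g) k = inner f k + inner g k" by (simp add: inner_l2_def)
  have "(LINT x|lborel. rep (r *\<^sub>R f) x * cnj (rep g x)) =
      (LINT x|lborel. r *\<^sub>R (rep f x * cnj (rep g x)))"
    by (rule integral_cong_AE, simp, simp) (use rep_scaleR[of r f] in eventually_elim, simp)
  then show "inner (r *\<^sub>R f) g = r * inner f g" by (simp add: inner_l2_def)
  have ff: "inner f f = (LINT x|lborel. (norm (rep f x))\<^sup>2)" for f :: l2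
    unfolding inner_l2_def
    by (subst Re_LINT) (simp_all add: complex_norm_square[symmetric] L2_norm_square_integrable del: of_real_power)
  show "0 \<le> inner f f" by (simp add: ff)
  show "(inner f f = 0) = (f = 0)"
  proof
    assume "inner f f = 0"
    then have "AE x in lborel. (norm (rep f x))\<^sup>2 = 0"
      unfolding ff by (subst (asm) integral_nonneg_eq_0_iff_AE) (auto simp: L2_square_integrable)
    with rep_zero have "AE x in lborel. rep f x = rep 0 x" by eventually_elim simp
    then show "f = 0" by (rule l2_eqI)
  next
    assume "f = 0"
    have *: "AE x in lborel. (norm (rep f x))\<^sup>2 = 0"
      using rep_zero by eventually_elim (simp add: \<open>f = 0\<close>)
    have "inner f f = (LINT (x::real)|lborel. (0::real))"
      unfolding ff by (rule integral_cong_AE) (use * in simp_all)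
    then show "inner f f = 0" by simp
  qed
qed
end

lemma norm_l2: "norm f = sqrt (LINT x|lborel. (norm (rep f x))\<^sup>2)"
  unfolding norm_l2_def inner_l2_def
  by (subst Re_LINT) (simp_all add: complex_norm_square[symmetric] L2_norm_square_integrable del: of_real_power)

lemma norm_l2_sq: "(norm f)\<^sup>2 = (LINT x|lborel. (norm (rep f x))\<^sup>2)"
  by (simp add: norm_l2)

lemma norm_cls_sq:
  assumes [measurable]: "f \<in> L2"
  shows "(norm (cls f))\<^sup>2 = (LINT x|lborel. (norm (f x))\<^sup>2)"
  unfolding norm_l2_sq
proof (rule integral_cong_AE)
  show "AE x in lborel. (norm (rep (cls f) x))\<^sup>2 = (norm (f x))\<^sup>2"
    using rep_cls[OF assms] by eventually_elim simp
qed simp_all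

lemma norm_cls: "f \<in> L2 \<Longrightarrow> norm (cls f) = L2_norm f"
  unfolding L2_norm_def by (simp flip: norm_cls_sq)

lemma cls_add:
  assumes "f \<in> L2" "g \<in> L2"
  shows "cls (\<lambda>x. f x + g x) = cls f + cls g"
  unfolding plus_l2_def
proof (rule cls_eqI)
  show "AE x in lborel. f x + g x = rep (cls f) x + rep (cls g) x"
    using rep_cls[OF assms(1)] rep_cls[OF assms(2)] by eventually_elim simp
qed (simp_all add: L2_add assms)

lemma cls_diff:
  assumes "f \<in> L2" "g \<in> L2"
  shows "cls (\<lambda>x. f x - g x) = cls f - cls g"
  unfolding minus_l2_def
proof (rule cls_eqI)
  show "AE x in lborel. f x - g x = rep (cls f) x - rep (cls g) x"
    using rep_cls[OF assms(1)] rep_cls[OF assms(2)] by eventually_elim simp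
qed (simp_all add: L2_diff assms)

lemma cls_zero: "cls (\<lambda>x. 0) = 0"
  by (simp add: zero_l2_def)

lemma norm_cls_le:
  assumes "f \<in> L2" "g \<in> L2" "AE x in lborel. norm (f x) \<le> norm (g x)"
  shows "norm (cls f) \<le> norm (cls g)"
proof (rule power2_le_imp_le)
  show "(norm (cls f))\<^sup>2 \<le> (norm (cls g))\<^sup>2"
    unfolding norm_cls_sq[OF assms(1)] norm_cls_sq[OF assms(2)]
  proof (rule integral_mono_AE)
    show "AE x in lborel. (norm (f x))\<^sup>2 \<le> (norm (g x))\<^sup>2"
      using assms(3) by eventually_elim (simp add: power_mono)
  qed (simp_all add: L2_square_integrable assms)
qed simp

lemma inner_cls:
  assumes [measurable]: "f \<in> L2" "g \<in> L2"
  shows "inner (cls f) (cls g) = Re (LINT x|lborel. f x * cnj (g x))"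
  unfolding inner_l2_def
proof (intro arg_cong[where f=Re] integral_cong_AE)
  show "AE x in lborel. rep (cls f) x * cnj (rep (cls g) x) = f x * cnj (g x)"
    using rep_cls[OF assms(1)] rep_cls[OF assms(2)] by eventually_elim simp
qed simp_all

text \<open>Dominated convergence for the squared error, with four times the square of
  \<open>w\<close> as majorant.\<close>

lemma cls_tendsto_dominated:
  assumes "\<And>n. f n \<in> borel_measurable borel" "g \<in> borel_measurable borel"
    and "integrable lborel (\<lambda>x. (w x)\<^sup>2)"
    and bd: "\<And>n x. norm (f n x) \<le> w x"
    and lim: "AE x in lborel. (\<lambda>n. f n x) \<longlonglongrightarrow> g x"
  shows "\<And>n. f n \<in> L2" "g \<in> L2" "(\<lambda>n. cls (f n)) \<longlonglongrightarrow> cls g"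
proof -
  show f: "f n \<in> L2" for n
    by (rule L2_dominated[OF assms(1,3)]) (intro power_mono bd norm_ge_zero)
  have gb: "AE x in lborel. norm (g x) \<le> w x"
    using lim
  proof eventually_elim
    case (elim x)
    show ?case by (rule LIMSEQ_le_const2[OF tendsto_norm[OF elim]]) (use bd in auto)
  qed
  have "integrable lborel (\<lambda>x. (norm (g x))\<^sup>2)"
  proof (rule Bochner_Integration.integrable_bound[OF assms(3)])
    show "AE x in lborel. norm ((norm (g x))\<^sup>2) \<le> norm ((w x)\<^sup>2)"
      using gb by eventually_elim (simp add: power_mono)
  qed (use assms(2) in simp)
  then show g: "g \<in> L2" using assms(2) by (simp add: L2_iff)
  have "(\<lambda>n. LINT x|lborel. (norm (f n x - g x))\<^sup>2) \<longlonglongrightarrow> (LINT (x::real)|lborel. 0)"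
  proof (rule integral_dominated_convergence[where w="\<lambda>x. 4 * (w x)\<^sup>2"])
    show "AE x in lborel. (\<lambda>n. (norm (f n x - g x))\<^sup>2) \<longlonglongrightarrow> 0"
      using lim
    proof eventually_elim
      case (elim x)
      show ?case using tendsto_power[OF tendsto_norm[OF LIM_zero[OF elim]], of 2] by simp
    qed
    show "AE x in lborel. norm ((norm (f n x - g x))\<^sup>2) \<le> 4 * (w x)\<^sup>2" for n
      using gb
    proof eventually_elim
      case (elim x)
      have "norm (f n x - g x) \<le> 2 * w x"
        using norm_triangle_ineq4[of "f n x" "g x"] bd[of n x] elim by linarith
      then have "(norm (f n x - g x))\<^sup>2 \<le> (2 * w x)\<^sup>2" by (intro power_mono) auto
      then show ?case by (simp add: power_mult_distrib)
    qed
  qed (use assms in simp_all)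
  then have "(\<lambda>n. (norm (cls (f n) - cls g))\<^sup>2) \<longlonglongrightarrow> 0"
    using f g by (simp add: cls_diff[symmetric] norm_cls_sq L2_diff)
  then have "(\<lambda>n. sqrt ((norm (cls (f n) - cls g))\<^sup>2)) \<longlonglongrightarrow> sqrt 0" by (rule tendsto_real_sqrt)
  then show "(\<lambda>n. cls (f n)) \<longlonglongrightarrow> cls g"
    by (simp add: LIM_zero_iff tendsto_norm_zero_iff)
qed

text \<open>Weighting the \<open>k\<close>-th squared increment by \<open>2\<^sup>k\<close> keeps the sum integrable, so almost everywhere the
increments themselves decay geometrically.\<close>
lemma l2_fast_Cauchy_converges:
  fixes X :: "nat \<Rightarrow> l2"
  assumes X: "\<And>k m. k \<le> m \<Longrightarrow> dist (X m) (X k) \<le> (1/2)^k"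
  shows "convergent X"
proof -
  define d where "d k x = (norm (rep (X (Suc k)) x - rep (X k) x))\<^sup>2" for k x
  have nd: "(\<integral>\<^sup>+x. ennreal ((norm (rep (X m) x - rep (X k) x))\<^sup>2) \<partial>lborel) \<le> ennreal ((1/4)^k)" if "k \<le> m" for k m
  proof -
    have "(\<integral>\<^sup>+x. ennreal ((norm (rep (X m) x - rep (X k) x))\<^sup>2) \<partial>lborel)
      = ennreal (LINT x|lborel. (norm (rep (X m) x - rep (X k) x))\<^sup>2)"
      by (rule nn_integral_eq_integral) (auto simp: L2_diff L2_square_integrable)
    also have "(LINT x|lborel. (norm (rep (X m) x - rep (X k) x))\<^sup>2) = (norm (X m - X k))\<^sup>2"
      by (subst norm_cls_sq[symmetric]) (simp_all add: L2_diff cls_diff)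
    also have "\<dots> \<le> ((1/2)^k)\<^sup>2"
      using X[OF that] by (intro power_mono) (auto simp: dist_norm)
    also have "\<dots> = (1/4)^k" unfolding power2_eq_square power_mult_distrib[symmetric] by simp
    finally show ?thesis by (simp add: ennreal_leI)
  qed
  have "(\<integral>\<^sup>+x. (\<Sum>k. ennreal (2^k * d k x)) \<partial>lborel) = (\<Sum>k. \<integral>\<^sup>+x. ennreal (2^k * d k x) \<partial>lborel)"
    by (rule nn_integral_suminf) (simp add: d_def)
  also have "\<dots> \<le> (\<Sum>k. ennreal ((1/2)^k))"
  proof (rule suminf_le)
    fix k
    have "(\<integral>\<^sup>+x. ennreal (2^k * d k x) \<partial>lborel) = ennreal (2^k) * (\<integral>\<^sup>+x. ennreal (d k x) \<partial>lborel)"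
      by (subst nn_integral_cmult[symmetric]) (auto simp: d_def ennreal_mult)
    also have "\<dots> \<le> ennreal (2^k) * ennreal ((1/4)^k)"
      using nd[of k "Suc k"] by (intro mult_left_mono) (auto simp: d_def)
    also have "\<dots> = ennreal ((1/2)^k)"
      by (simp flip: ennreal_mult power_mult_distrib)
    finally show "(\<integral>\<^sup>+x. ennreal (2^k * d k x) \<partial>lborel) \<le> ennreal ((1/2)^k)" .
  qed auto
  also have "\<dots> = ennreal (\<Sum>k. (1/2)^k)"
    by (rule suminf_ennreal2) (auto simp: summable_geometric)
  also have "\<dots> < \<infinity>" by simp
  finally have fin: "AE x in lborel. (\<Sum>k. ennreal (2^k * d k x)) \<noteq> \<infinity>"
    by (intro nn_integral_PInf_AE) (auto simp: d_def)
  have conv: "AE x in lborel. convergent (\<lambda>k. rep (X k) x)"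
    using fin
  proof eventually_elim
    case (elim x)
    then obtain s where s: "(\<Sum>k. ennreal (2^k * d k x)) = ennreal s" "s \<ge> 0"
      by (cases "\<Sum>k. ennreal (2^k * d k x)") auto
    have "d k x \<le> s * (1/2)^k" for k
    proof -
      have "(\<Sum>i\<in>{k}. ennreal (2^i * d i x)) \<le> (\<Sum>k. ennreal (2^k * d k x))"
        by (rule sum_le_suminf) auto
      then have "ennreal (2^k * d k x) \<le> ennreal s" using s by simp
      then have "2^k * d k x \<le> s" using s by (simp add: ennreal_le_iff)
      then show ?thesis by (simp add: field_simps)
    qed
    then have *: "norm (rep (X (Suc k)) x - rep (X k) x) \<le> sqrt s * (sqrt (1/2))^k" for k
      using real_le_rsqrt[of "norm (rep (X (Suc k)) x - rep (X k) x)" "s * (1/2)^k"]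
      by (simp add: d_def real_sqrt_mult real_sqrt_power)
    have "summable (\<lambda>k. sqrt s * (sqrt (1/2))^k)"
      by (intro summable_mult summable_geometric) (simp add: real_sqrt_lt_1_iff real_sqrt_divide)
    then have "summable (\<lambda>k. rep (X (Suc k)) x - rep (X k) x)"
      by (rule summable_comparison_test'[where N=0]) (use * in auto)
    then have "convergent (\<lambda>n. \<Sum>k<n. rep (X (Suc k)) x - rep (X k) x)"
      by (simp add: summable_iff_convergent)
    then have "convergent (\<lambda>n. rep (X n) x - rep (X 0) x)"
      by (simp only: sum_lessThan_telescope[of "\<lambda>k. rep (X k) x" for x])
    then have "convergent (\<lambda>n. (rep (X n) x - rep (X 0) x) + rep (X 0) x)"
      by (intro convergent_add) (auto simp: convergent_const)
    then show ?case by simp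
  qed
  define l where "l x = lim (\<lambda>k. rep (X k) x)" for x
  have [measurable]: "l \<in> borel_measurable borel"
    unfolding l_def by (rule borel_measurable_lim_metric) simp
  have lim: "AE x in lborel. (\<lambda>k. rep (X k) x) \<longlonglongrightarrow> l x"
    using conv by eventually_elim (simp add: l_def convergent_LIMSEQ_iff)
  \<comment> \<open>Fatou's lemma carries the bound on \<open>X m - X k\<close> over to the
    pointwise limit; it also shows that the limit is square integrable.\<close>
  have fatou: "(\<integral>\<^sup>+x. ennreal ((norm (l x - rep (X k) x))\<^sup>2) \<partial>lborel) \<le> ennreal ((1/4)^k)" for k
  proof -
    have "(\<integral>\<^sup>+x. ennreal ((norm (l x - rep (X k) x))\<^sup>2) \<partial>lborel)
      = (\<integral>\<^sup>+x. liminf (\<lambda>m. ennreal ((norm (rep (X m) x - rep (X k) x))\<^sup>2)) \<partial>lborel)"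
      using lim
    proof (intro nn_integral_cong_AE, eventually_elim)
      case (elim x)
      have "(\<lambda>m. ennreal ((norm (rep (X m) x - rep (X k) x))\<^sup>2)) \<longlonglongrightarrow> ennreal ((norm (l x - rep (X k) x))\<^sup>2)"
        by (intro tendsto_ennrealI tendsto_intros elim)
      then show ?case by (rule lim_imp_Liminf[OF sequentially_bot, symmetric])
    qed
    also have "\<dots> \<le> liminf (\<lambda>m. \<integral>\<^sup>+x. ennreal ((norm (rep (X m) x - rep (X k) x))\<^sup>2) \<partial>lborel)"
      by (rule nn_integral_liminf) simp
    also have "\<dots> \<le> ennreal ((1/4)^k)"
    proof (rule Liminf_le[OF sequentially_bot])
      show "\<forall>\<^sub>F m in sequentially. (\<integral>\<^sup>+x. ennreal ((norm (rep (X m) x - rep (X k) x))\<^sup>2) \<partial>lborel) \<le> ennreal ((1/4)^k)"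
        unfolding eventually_sequentially using nd by blast
    qed
    finally show ?thesis .
  qed
  have lX: "(\<lambda>x. l x - rep (X k) x) \<in> L2" for k
    unfolding L2_iff
  proof (intro conjI integrableI_bounded)
    show "(\<integral>\<^sup>+x. ennreal (norm ((norm (l x - rep (X k) x))\<^sup>2)) \<partial>lborel) < \<infinity>"
      using order_le_less_trans[OF fatou[of k]] by simp
  qed simp_all
  have l: "l \<in> L2" using L2_add[OF lX[of 0] rep_L2[of "X 0"]] by simp
  have "norm (X k - cls l) \<le> (1/2)^k" for k
  proof -
    have "(norm (cls l - X k))\<^sup>2 = (norm (cls (\<lambda>x. l x - rep (X k) x)))\<^sup>2"
      using l by (simp add: cls_diff)
    also have "\<dots> = (LINT x|lborel. (norm (l x - rep (X k) x))\<^sup>2)" by (rule norm_cls_sq[OF lX])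
    also have "ennreal \<dots> \<le> ennreal ((1/4)^k)"
      using fatou[of k] by (subst nn_integral_eq_integral[symmetric]) (use L2_square_integrable[OF lX[of k]] in simp_all)
    finally have "(norm (cls l - X k))\<^sup>2 \<le> (1/4)^k" by (subst (asm) ennreal_le_iff) auto
    also have "(1/4)^k = ((1/2::real)^k)\<^sup>2" unfolding power2_eq_square power_mult_distrib[symmetric] by simp
    finally have "norm (cls l - X k) \<le> (1/2)^k" by (rule power2_le_imp_le) simp
    then show ?thesis by (simp only: norm_minus_commute)
  qed
  then have "\<forall>\<^sub>F k in sequentially. norm (X k - cls l) \<le> (1/2)^k" by simp
  moreover have "(\<lambda>k. (1/2::real)^k) \<longlonglongrightarrow> 0" by (rule LIMSEQ_power_zero) simp
  ultimately have "(\<lambda>k. X k - cls l) \<longlonglongrightarrow> 0" by (rule Lim_null_comparison)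
  then have "X \<longlonglongrightarrow> cls l" by (rule LIM_zero_cancel)
  then show ?thesis by (rule convergentI)
qed

instance l2 :: complete_space
proof
  fix X :: "nat \<Rightarrow> l2"
  assume C: "Cauchy X"
  have "\<exists>N. \<forall>m\<ge>N. \<forall>n\<ge>N. dist (X m) (X n) < (1/2)^k" for k
    using C unfolding Cauchy_def by simp
  then obtain N where N: "\<And>k m n. m \<ge> N k \<Longrightarrow> n \<ge> N k \<Longrightarrow> dist (X m) (X n) < (1/2)^k"
    by metis
  \<comment> \<open>Summing makes \<open>r m\<close> at least \<open>N k\<close> for all
    \<open>k \<le> m\<close>, and the added \<open>k\<close> makes \<open>r\<close> strictly
    increasing.\<close>
  define r where "r k = (\<Sum>i\<le>k. N i) + k" for k
  have r: "strict_mono r" by (rule strict_mono_Suc_iff[THEN iffD2]) (simp add: r_def)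
  have rN: "r m \<ge> N k" if "k \<le> m" for k m
    using member_le_sum[of k "{..m}" N] that by (simp add: r_def)
  have "convergent (X \<circ> r)"
    by (rule l2_fast_Cauchy_converges) (use N rN in \<open>force intro: less_imp_le\<close>)
  then obtain l where "(X \<circ> r) \<longlonglongrightarrow> l" by (auto simp: convergent_def)
  then show "convergent X" using Cauchy_converges_subseq[OF C r] by (auto simp: convergent_def)
qed

instance l2 :: banach ..

subsection \<open>Density of step functions and separability\<close>

definition step :: "complex \<Rightarrow> real \<Rightarrow> real \<Rightarrow> l2" where
  "step c a b = cls (\<lambda>x. c * indicator {a..b} x)"

lemma integrable_indicator_Icc [simp]: "integrable lborel (indicat_real {a..b::real})"
  by (rule integrable_real_indicator) (simp_all add: emeasure_lborel_Icc_eq)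

lemma integrable_indicator_Icc_square [simp]: "integrable lborel (\<lambda>x. (C * indicat_real {a..b::real} x)\<^sup>2)"
proof -
  have "(\<lambda>x. (C * indicat_real {a..b} x)\<^sup>2) = (\<lambda>x. C\<^sup>2 * indicat_real {a..b} x)"
    by (auto simp: indicator_def)
  then show ?thesis by simp
qed

lemma indicator_L2:
  assumes "A \<in> sets borel" "A \<subseteq> {a..b}"
  shows "(\<lambda>x. c * indicator A x) \<in> L2"
proof (rule L2_dominated[where w="\<lambda>x. (norm c)\<^sup>2 * indicator {a..b} x"])
  show "(norm (c * indicator A x))\<^sup>2 \<le> (norm c)\<^sup>2 * indicator {a..b} x" for x
    using assms(2) by (auto simp: indicator_def)
qed (use assms(1) in auto)

text \<open>Dynkin's pi-lambda argument on the half-lines \<open>{..a}\<close>. The set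
  \<open>S\<close> is closed under sums but not assumed closed under scalar multiples, so the
  induction runs over all \<open>c\<close> at once: the complement calls on the coefficient
  \<open>- c\<close>.\<close>

lemma borel_set_in_closed:
  assumes S: "closed S" "0 \<in> S" "\<And>f g. f \<in> S \<Longrightarrow> g \<in> S \<Longrightarrow> f + g \<in> S" "\<And>c a b. step c a b \<in> S"
    and A: "A \<in> sets borel"
  shows "cls (\<lambda>x. c * indicator (A \<inter> {a..b}) x) \<in> S"
proof -
  have "Int_stable (range (\<lambda>a::real. {..a}))"
    by (auto simp: Int_stable_def)
  moreover have "range (\<lambda>a::real. {..a}) \<subseteq> Pow UNIV" by simp
  moreover have "A \<in> sigma_sets UNIV (range (\<lambda>a::real. {..a}))"
    using A unfolding borel_eq_atMost by simp
  ultimately have "\<forall>c. cls (\<lambda>x. c * indicator (A \<inter> {a..b}) x) \<in> S"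
  proof (induction rule: sigma_sets_induct_disjoint)
    case (basic A)
    then obtain x where "A = {..x}" by auto
    then have "A \<inter> {a..b} = {a..min x b}" by auto
    then show ?case using S(4)[of _ a "min x b"] by (simp add: step_def)
  next
    case empty
    then show ?case using S(2) by (simp add: cls_zero)
  next
    case (compl A)
    have A: "A \<in> sets borel" using compl(1) unfolding borel_eq_atMost by simp
    have "cls (\<lambda>x. c * indicator ((UNIV - A) \<inter> {a..b}) x) = step c a b + cls (\<lambda>x. (- c) * indicator (A \<inter> {a..b}) x)" for c
    proof -
      have "cls (\<lambda>x. c * indicator ((UNIV - A) \<inter> {a..b}) x)
        = cls (\<lambda>x. c * indicator {a..b} x + (- c) * indicator (A \<inter> {a..b}) x)"
        by (rule arg_cong[where f=cls]) (auto simp: indicator_def)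
      also have "\<dots> = step c a b + cls (\<lambda>x. (- c) * indicator (A \<inter> {a..b}) x)"
        unfolding step_def by (rule cls_add; rule indicator_L2[where a=a and b=b]) (use A in auto)
      finally show ?thesis .
    qed
    then show ?case using S(3)[OF S(4) compl(2)[rule_format]] by metis
  next
    case (union A)
    have A: "A i \<in> sets borel" for i using union(2) unfolding borel_eq_atMost by auto
    show ?case
    proof
      fix c :: complex
      have part: "cls (\<lambda>x. c * indicator ((\<Union>i<n. A i) \<inter> {a..b}) x) \<in> S" for n :: nat
      proof (induction n)
        case 0
        then show ?case using S(2) by (simp add: cls_zero)
      next
        case (Suc n)
        have "x \<notin> A i" if "x \<in> A n" "i < n" for x i
          using union(1) that unfolding disjoint_family_on_def by (metis UNIV_I disjoint_iff nless_le)
        then have "(\<lambda>x. c * indicator ((\<Union>i<Suc n. A i) \<inter> {a..b}) x)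
          = (\<lambda>x. c * indicator ((\<Union>i<n. A i) \<inter> {a..b}) x + c * indicator (A n \<inter> {a..b}) x)"
          by (fastforce simp: indicator_def less_Suc_eq)
        then have "cls (\<lambda>x. c * indicator ((\<Union>i<Suc n. A i) \<inter> {a..b}) x)
          = cls (\<lambda>x. c * indicator ((\<Union>i<n. A i) \<inter> {a..b}) x + c * indicator (A n \<inter> {a..b}) x)"
          by (rule arg_cong)
        also have "\<dots> = cls (\<lambda>x. c * indicator ((\<Union>i<n. A i) \<inter> {a..b}) x) + cls (\<lambda>x. c * indicator (A n \<inter> {a..b}) x)"
          by (rule cls_add; rule indicator_L2[where a=a and b=b]) (use A in auto)
        finally show ?case using S(3) Suc.IH union(3) by simp
      qed
      have "(\<lambda>n. cls (\<lambda>x. c * indicator ((\<Union>i<n. A i) \<inter> {a..b}) x)) \<longlonglongrightarrow>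
         cls (\<lambda>x. c * indicator ((\<Union>i. A i) \<inter> {a..b}) x)"
      proof (rule cls_tendsto_dominated(3)[where w="\<lambda>x. norm c * indicator {a..b} x"])
        show "norm (c * indicator ((\<Union>i<n. A i) \<inter> {a..b}) x) \<le> norm c * indicator {a..b} x" for n x
          by (auto simp: indicator_def)
        show "AE x in lborel. (\<lambda>n. c * indicator ((\<Union>i<n. A i) \<inter> {a..b}) x) \<longlonglongrightarrow> c * indicator ((\<Union>i. A i) \<inter> {a..b}) x"
        proof (intro AE_I2 tendsto_mult tendsto_const)
          fix x
          show "(\<lambda>n. indicator ((\<Union>i<n. A i) \<inter> {a..b}) x :: complex) \<longlonglongrightarrow> indicator ((\<Union>i. A i) \<inter> {a..b}) x"
          proof (cases "\<exists>i. x \<in> A i")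
            case True
            then obtain i where i: "x \<in> A i" by auto
            then have "indicator ((\<Union>i<n. A i) \<inter> {a..b}) x = (indicator ((\<Union>i. A i) \<inter> {a..b}) x :: complex)" if "n \<ge> Suc i" for n
              using that by (auto simp: indicator_def Suc_le_eq)
            then show ?thesis
              by (intro tendsto_eventually) (auto simp: eventually_sequentially)
          next
            case False
            then show ?thesis by (simp add: indicator_def)
          qed
        qed
      qed (use A in simp_all)
      then show "cls (\<lambda>x. c * indicator ((\<Union>i. A i) \<inter> {a..b}) x) \<in> S"
        by (rule closed_sequentially[OF S(1) part])
    qed
  qed
  then show ?thesis by blast
qed

text \<open>An induction principle: a property stable under sums and limits need only be checked for
  a single interval. Simple functions converging to \<open>rep f\<close> are truncated to
  \<open>[-i, i]\<close>, so that each of their level sets falls under the previous lemma.\<close>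

theorem step_dense:
  assumes S: "closed S" "0 \<in> S" "\<And>f g. f \<in> S \<Longrightarrow> g \<in> S \<Longrightarrow> f + g \<in> S" "\<And>c a b. step c a b \<in> S"
  shows "f \<in> S"
proof -
  obtain s where s: "\<And>i. simple_function borel (s i)" "\<And>x. (\<lambda>i. s i x) \<longlonglongrightarrow> rep f x"
    "\<And>i x. dist (s i x) 0 \<le> 2 * dist (rep f x) 0"
    using borel_measurable_implies_sequence_metric[of "rep f" borel 0] by auto
  have [measurable]: "s i \<in> borel_measurable borel" for i
    using borel_measurable_simple_function[OF s(1)] by simp
  define g where "g i x = s i x * indicator {- real i..real i} x" for i x
  have "cls (g i) \<in> S" for i
  proof -
    have fin: "finite (range (s i))" using simple_functionD(1)[OF s(1)] by simp
    have set: "s i -` {y} \<in> sets borel" for y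
      using measurable_sets[of "s i" borel borel "{y}"] by simp
    define k where "k y x = y * indicator (s i -` {y} \<inter> {- real i..real i}) x" for y x
    have *: "cls (\<lambda>x. \<Sum>y\<in>Y. k y x) \<in> S \<and> (\<lambda>x. \<Sum>y\<in>Y. k y x) \<in> L2" if "finite Y" for Y
      using that
    proof (induction Y)
      case empty
      then show ?case using S(2) by (simp add: cls_zero L2_zero)
    next
      case (insert y Y)
      have "k y \<in> L2"
        unfolding k_def by (rule indicator_L2[where a="- real i" and b="real i"]) (use set in auto)
      moreover have "cls (k y) \<in> S"
        unfolding k_def by (rule borel_set_in_closed[OF S set])
      ultimately show ?case
        using insert S(3) by (simp add: cls_add L2_add)
    qed
    have "(\<Sum>y\<in>range (s i). k y x) = g i x" for x
    proof -
      have "(\<Sum>y\<in>range (s i). k y x)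
         = (\<Sum>y\<in>range (s i). if y = s i x then g i x else 0)"
        by (rule sum.cong) (auto simp: g_def k_def indicator_def)
      then show ?thesis using fin by simp
    qed
    then have "(\<lambda>x. \<Sum>y\<in>range (s i). k y x) = g i" by (rule ext)
    with *[OF fin] show ?thesis by simp
  qed
  moreover have "(\<lambda>i. cls (g i)) \<longlonglongrightarrow> cls (rep f)"
  proof (rule cls_tendsto_dominated(3)[where w="\<lambda>x. 2 * norm (rep f x)"])
    show "norm (g n x) \<le> 2 * norm (rep f x)" for n x
      using s(3)[of n x] by (auto simp: g_def indicator_def)
    show "AE x in lborel. (\<lambda>n. g n x) \<longlonglongrightarrow> rep f x"
    proof (rule AE_I2)
      fix x :: real
      obtain N where N: "\<bar>x\<bar> \<le> real N" using real_arch_simple by blast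
      have "g n x = s n x" if "n \<ge> N" for n
        using N that by (auto simp: g_def indicator_def)
      then have "\<forall>\<^sub>F n in sequentially. s n x = g n x"
        unfolding eventually_sequentially by metis
      then show "(\<lambda>n. g n x) \<longlonglongrightarrow> rep f x" by (rule Lim_transform_eventually[OF s(2)])
    qed
    show "integrable lborel (\<lambda>x. (2 * norm (rep f x))\<^sup>2)"
      by (simp add: power_mult_distrib L2_square_integrable)
  qed (simp_all add: g_def[abs_def])
  ultimately show ?thesis by (metis closed_sequentially[OF S(1)] cls_rep)
qed

lemma step_L2 [simp]: "(\<lambda>x. c * indicator {a..b} x) \<in> L2"
  by (rule indicator_L2[where a=a and b=b]) auto

text \<open>The indicators converge pointwise except possibly at the two limiting endpoints, which
  form a null set.\<close>

lemma step_tendsto: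
  assumes "c \<longlonglongrightarrow> c'" "a \<longlonglongrightarrow> a'" "b \<longlonglongrightarrow> b'"
  shows "(\<lambda>n. step (c n) (a n) (b n)) \<longlonglongrightarrow> step c' a' b'"
  unfolding step_def
proof -
  obtain C where C: "\<And>n. norm (c n) \<le> C" using assms(1) convergent_imp_Bseq convergentI BseqE by metis
  obtain A where A: "\<And>n. norm (a n) \<le> A" using assms(2) convergent_imp_Bseq convergentI BseqE by metis
  obtain B where B: "\<And>n. norm (b n) \<le> B" using assms(3) convergent_imp_Bseq convergentI BseqE by metis
  have C0: "C \<ge> 0" using C[of 0] norm_ge_zero order_trans by blast
  show "(\<lambda>n. cls (\<lambda>x. c n * indicator {a n..b n} x)) \<longlonglongrightarrow> cls (\<lambda>x. c' * indicator {a'..b'} x)"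
  proof (rule cls_tendsto_dominated(3)[where w="\<lambda>x. C * indicator {-A..B} x"])
    show "norm (c n * indicator {a n..b n} x) \<le> C * indicator {-A..B} x" for n x
      using C[of n] A[of n] B[of n] C0 by (auto simp: indicator_def norm_mult)
    have "AE x in lborel. x \<noteq> a' \<and> x \<noteq> b'"
      using AE_lborel_singleton[of a'] AE_lborel_singleton[of b'] by eventually_elim simp
    then show "AE x in lborel. (\<lambda>n. c n * indicator {a n..b n} x) \<longlonglongrightarrow> c' * indicator {a'..b'} x"
    proof eventually_elim
      case (elim x)
      have "\<forall>\<^sub>F n in sequentially. (indicator {a'..b'} x :: complex) = indicator {a n..b n} x"
      proof -
        have "\<forall>\<^sub>F n in sequentially. (a n \<le> x) = (a' \<le> x)"
        proof (cases "a' < x")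
          case True
          then show ?thesis using order_tendstoD(2)[OF assms(2) True] by (auto elim!: eventually_mono)
        next
          case False
          then have "x < a'" using elim by simp
          then show ?thesis using order_tendstoD(1)[OF assms(2) \<open>x < a'\<close>] by (auto elim!: eventually_mono)
        qed
        moreover have "\<forall>\<^sub>F n in sequentially. (x \<le> b n) = (x \<le> b')"
        proof (cases "b' < x")
          case True
          then show ?thesis using order_tendstoD(2)[OF assms(3) True] by (auto elim!: eventually_mono)
        next
          case False
          then have "x < b'" using elim by simp
          then show ?thesis using order_tendstoD(1)[OF assms(3) \<open>x < b'\<close>] by (auto elim!: eventually_mono)
        qed
        ultimately show ?thesis by eventually_elim (simp add: indicator_def)
      qed
      then have "(\<lambda>n. indicator {a n..b n} x :: complex) \<longlonglongrightarrow> indicator {a'..b'} x"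
        by (rule tendsto_eventually[OF eventually_mono]) simp
      then show ?case by (intro tendsto_mult assms)
    qed
  qed simp_all
qed

lemma rat_seq: "\<exists>q :: nat \<Rightarrow> rat. (\<lambda>n. real_of_rat (q n)) \<longlonglongrightarrow> x"
proof -
  have "\<exists>q. dist (real_of_rat q) x < 1 / Suc n" for n
  proof -
    obtain q where "x < real_of_rat q" "real_of_rat q < x + 1 / Suc n"
      using of_rat_dense[of x "x + 1 / Suc n"] by auto
    then show ?thesis by (auto simp: dist_real_def intro!: exI[of _ q])
  qed
  then obtain q where q: "\<And>n. dist (real_of_rat (q n)) x < 1 / Suc n" by metis
  have "(\<lambda>n. real_of_rat (q n)) \<longlonglongrightarrow> x"
  proof (rule metric_LIMSEQ_I)
    fix e :: real assume "e > 0"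
    then obtain N where N: "1 / real (Suc N) < e" by (rule nat_approx_posE)
    have "dist (real_of_rat (q n)) x < e" if "n \<ge> N" for n
    proof -
      have "1 / real (Suc n) \<le> 1 / real (Suc N)" using that by (intro divide_left_mono) auto
      then show ?thesis using q[of n] N by linarith
    qed
    then show "\<exists>N. \<forall>n\<ge>N. dist (real_of_rat (q n)) x < e" by blast
  qed
  then show ?thesis by blast
qed

text \<open>Finite sums of steps with rational data, coded as images of lists so that countability
  is immediate. Their closure is stable under sums and contains every step by continuity in the
  data, hence is everything.\<close>

lemma l2_separable: "\<exists>D::l2 set. countable D \<and> closure D = UNIV"
proof -
  define st where "st = (\<lambda>(p, q, a, b). step (Complex (of_rat p) (of_rat q)) (of_rat a) (of_rat b))"
  define D where "D = range (\<lambda>xs. sum_list (map st xs))"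
  have D0: "0 \<in> D" unfolding D_def by (rule image_eqI[of _ _ "[]"]) auto
  have Dadd: "f + g \<in> D" if "f \<in> D" "g \<in> D" for f g
  proof -
    obtain xs ys where "f = sum_list (map st xs)" "g = sum_list (map st ys)"
      using \<open>f \<in> D\<close> \<open>g \<in> D\<close> unfolding D_def by auto
    then have "f + g = sum_list (map st (xs @ ys))" by simp
    then show ?thesis unfolding D_def by blast
  qed
  have Dst: "st x \<in> D" for x unfolding D_def by (rule image_eqI[of _ _ "[x]"]) auto
  have "f \<in> closure D" for f
  proof (rule step_dense)
    show "f + g \<in> closure D" if fg: "f \<in> closure D" "g \<in> closure D" for f g
    proof -
      obtain F where F: "\<forall>n. F n \<in> D" "F \<longlonglongrightarrow> f"
        using fg(1) unfolding closure_sequential by blast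
      obtain G where G: "\<forall>n. G n \<in> D" "G \<longlonglongrightarrow> g"
        using fg(2) unfolding closure_sequential by blast
      have "\<forall>n. F n + G n \<in> D" using F(1) G(1) Dadd by simp
      moreover have "(\<lambda>n. F n + G n) \<longlonglongrightarrow> f + g" using F(2) G(2) by (rule tendsto_add)
      ultimately show ?thesis unfolding closure_sequential by (intro exI conjI)
    qed
    show "step c a b \<in> closure D" for c a b
    proof -
      obtain p where p: "(\<lambda>n. real_of_rat (p n)) \<longlonglongrightarrow> Re c" using rat_seq by blast
      obtain q where q: "(\<lambda>n. real_of_rat (q n)) \<longlonglongrightarrow> Im c" using rat_seq by blast
      obtain r where r: "(\<lambda>n. real_of_rat (r n)) \<longlonglongrightarrow> a" using rat_seq by blast
      obtain s where s: "(\<lambda>n. real_of_rat (s n)) \<longlonglongrightarrow> b" using rat_seq by blast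
      have "(\<lambda>n. Complex (of_rat (p n)) (of_rat (q n))) \<longlonglongrightarrow> Complex (Re c) (Im c)"
        by (intro tendsto_Complex p q)
      then have "(\<lambda>n. st (p n, q n, r n, s n)) \<longlonglongrightarrow> step c a b"
        unfolding st_def using step_tendsto[OF _ r s] by simp
      moreover have "\<forall>n. st (p n, q n, r n, s n) \<in> D" using Dst by simp
      ultimately show ?thesis unfolding closure_sequential by (intro exI conjI)
    qed
  qed (use D0 closure_subset in auto)
  moreover have "countable D" unfolding D_def by simp
  ultimately show ?thesis by auto
qed

instance l2 :: second_countable_topology
proof
  obtain D :: "l2 set" where D: "countable D" "closure D = UNIV" using l2_separable by blast
  define B where "B = (\<lambda>(x, n). ball x (1 / real (Suc n))) ` (D \<times> UNIV)"
  have "topological_basis B"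
  proof (rule topological_basisI)
    show "open b" if "b \<in> B" for b using that by (auto simp: B_def)
    fix U :: "l2 set" and x assume U: "open U" "x \<in> U"
    then obtain e where e: "e > 0" "ball x e \<subseteq> U" using open_contains_ball by blast
    obtain n where n: "1 / real (Suc n) < e / 2" using nat_approx_posE[of "e/2"] e by auto
    have "x \<in> closure D" using D by simp
    then obtain y where y: "y \<in> D" "dist y x < 1 / real (Suc n)"
      unfolding closure_approachable by (metis of_nat_0_less_iff zero_less_Suc zero_less_divide_1_iff)
    have "ball y (1 / real (Suc n)) \<subseteq> U"
    proof
      fix z assume "z \<in> ball y (1 / real (Suc n))"
      then have "dist x z < e"
        using dist_triangle[of x z y] y n by (simp add: dist_commute)
      then show "z \<in> U" using e by auto
    qed
    then show "\<exists>b'\<in>B. x \<in> b' \<and> b' \<subseteq> U"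
      using y unfolding B_def by (intro bexI[of _ "ball y (1 / real (Suc n))"]) auto
  qed
  moreover have "countable B" unfolding B_def using D by simp
  ultimately show "\<exists>B::l2 set set. countable B \<and> open = generate_topology B"
    using topological_basis_imp_subbasis by blast
qed

subsection \<open>Multiplication operators\<close>

definition bdd_meas :: "(real \<Rightarrow> complex) \<Rightarrow> bool" where
  "bdd_meas m \<longleftrightarrow> m \<in> borel_measurable borel \<and> (\<exists>B. \<forall>x. norm (m x) \<le> B)"

definition mul :: "(real \<Rightarrow> complex) \<Rightarrow> l2 \<Rightarrow> l2" where
  "mul m f = cls (\<lambda>x. m x * rep f x)"

lemma bdd_measI: "m \<in> borel_measurable borel \<Longrightarrow> (\<And>x. norm (m x) \<le> B) \<Longrightarrow> bdd_meas m"
  by (auto simp: bdd_meas_def)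

lemma bdd_meas_measurable [measurable_dest]: "bdd_meas m \<Longrightarrow> m \<in> borel_measurable borel"
  by (simp add: bdd_meas_def)

lemma mul_L2: "bdd_meas m \<Longrightarrow> f \<in> L2 \<Longrightarrow> (\<lambda>x. m x * f x) \<in> L2"
  by (auto simp: bdd_meas_def intro: L2_bounded_mult)

lemma rep_mul: "bdd_meas m \<Longrightarrow> AE x in lborel. rep (mul m f) x = m x * rep f x"
  unfolding mul_def by (rule rep_cls) (simp add: mul_L2)

lemma mul_cls:
  assumes "bdd_meas m" "f \<in> L2"
  shows "mul m (cls f) = cls (\<lambda>x. m x * f x)"
  unfolding mul_def
  by (rule cls_eqI) (use assms rep_cls[OF assms(2)] in \<open>auto simp: mul_L2\<close>)

lemma bdd_meas_const [simp]: "bdd_meas (\<lambda>x. c)"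
  by (auto simp: bdd_meas_def)

lemma bdd_meas_mult [simp]:
  assumes "bdd_meas m" "bdd_meas n" shows "bdd_meas (\<lambda>x. m x * n x)"
proof -
  obtain B C where B: "\<And>x. norm (m x) \<le> B" and C: "\<And>x. norm (n x) \<le> C"
    using assms by (auto simp: bdd_meas_def)
  have "norm (m x * n x) \<le> B * C" for x
    unfolding norm_mult using B[of x] C[of x] norm_ge_zero by (meson mult_mono order_trans)
  then show ?thesis using assms by (auto simp: bdd_meas_def)
qed

lemma bdd_meas_add [simp]:
  assumes "bdd_meas m" "bdd_meas n" shows "bdd_meas (\<lambda>x. m x + n x)"
proof -
  obtain B C where B: "\<And>x. norm (m x) \<le> B" and C: "\<And>x. norm (n x) \<le> C"
    using assms by (auto simp: bdd_meas_def)
  have "norm (m x + n x) \<le> B + C" for x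
    using B[of x] C[of x] norm_triangle_ineq[of "m x" "n x"] by linarith
  then show ?thesis using assms by (auto simp: bdd_meas_def)
qed

lemma bdd_meas_cnj [simp]: "bdd_meas m \<Longrightarrow> bdd_meas (\<lambda>x. cnj (m x))"
  by (auto simp: bdd_meas_def intro: borel_measurable_cnj)

lemma bdd_meas_indicator [simp]: "A \<in> sets borel \<Longrightarrow> bdd_meas (indicator A)"
  by (rule bdd_measI[where B=1]) (auto simp: indicator_def)

lemma mul_mul:
  assumes "bdd_meas m" "bdd_meas n"
  shows "mul m (mul n f) = mul (\<lambda>x. m x * n x) f"
  by (rule l2_eqI)
     (use rep_mul[OF assms(1), of "mul n f"] rep_mul[OF assms(2), of f] rep_mul[OF bdd_meas_mult[OF assms], of f]
      in eventually_elim, simp)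

lemma mul_add: "bdd_meas m \<Longrightarrow> mul m (f + g) = mul m f + mul m g"
proof (rule l2_eqI)
  assume m: "bdd_meas m"
  show "AE x in lborel. rep (mul m (f + g)) x = rep (mul m f + mul m g) x"
    using rep_mul[OF m, of f] rep_mul[OF m, of g] rep_mul[OF m, of "f + g"] rep_add[of f g] rep_add[of "mul m f" "mul m g"]
    by eventually_elim (simp add: algebra_simps)
qed

lemma mul_scaleR: "bdd_meas m \<Longrightarrow> mul m (c *\<^sub>R f) = c *\<^sub>R mul m f"
proof (rule l2_eqI)
  assume m: "bdd_meas m"
  show "AE x in lborel. rep (mul m (c *\<^sub>R f)) x = rep (c *\<^sub>R mul m f) x"
    using rep_mul[OF m, of f] rep_mul[OF m, of "c *\<^sub>R f"] rep_scaleR[of c f] rep_scaleR[of c "mul m f"]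
    by eventually_elim simp
qed

lemma mul_plus:
  assumes "bdd_meas m" "bdd_meas n"
  shows "mul (\<lambda>x. m x + n x) f = mul m f + mul n f"
  by (rule l2_eqI)
     (use rep_mul[OF assms(1), of f] rep_mul[OF assms(2), of f] rep_mul[OF bdd_meas_add[OF assms], of f]
         rep_add[of "mul m f" "mul n f"]
      in eventually_elim, simp add: algebra_simps)

lemma mul_norm_le:
  assumes "bdd_meas m" "bdd_meas n" "\<And>x. norm (m x) \<le> norm (n x)"
  shows "norm (mul m f) \<le> norm (mul n f)"
  unfolding mul_def
  by (rule norm_cls_le) (use assms in \<open>auto simp: mul_L2 norm_mult mult_right_mono\<close>)

lemma mul_norm_eq:
  assumes "bdd_meas m" "bdd_meas n" "\<And>x. norm (m x) = norm (n x)"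
  shows "norm (mul m f) = norm (mul n f)"
  by (rule antisym; rule mul_norm_le) (use assms in auto)

lemma mul_of_real: "mul (\<lambda>x. of_real c) f = c *\<^sub>R f"
  by (rule l2_eqI) (use rep_mul[OF bdd_meas_const, of "of_real c" f] rep_scaleR[of c f] in eventually_elim,
      simp add: scaleR_conv_of_real)

lemma mul_1 [simp]: "mul (\<lambda>x. 1) f = f"
  using mul_of_real[of 1 f] by simp

lemma mul_bound:
  assumes "bdd_meas m" "\<And>x. norm (m x) \<le> B"
  shows "norm (mul m f) \<le> B * norm f"
proof -
  have "B \<ge> 0" using assms(2)[of 0] norm_ge_zero order_trans by blast
  have "norm (mul m f) \<le> norm (mul (\<lambda>x. of_real B) f)"
    by (rule mul_norm_le) (use assms \<open>B \<ge> 0\<close> in auto)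
  then show ?thesis using \<open>B \<ge> 0\<close> by (simp add: mul_of_real)
qed

lemma bounded_linear_mul: "bdd_meas m \<Longrightarrow> bounded_linear (mul m)"
proof -
  assume m: "bdd_meas m"
  then obtain B where "\<And>x. norm (m x) \<le> B" by (auto simp: bdd_meas_def)
  then show ?thesis
    by (intro bounded_linear_intro[where K=B]) (use mul_bound[OF m] in \<open>auto simp: mul_add mul_scaleR m mult.commute\<close>)
qed

lemma mul_diff: "bdd_meas m \<Longrightarrow> mul m (f - g) = mul m f - mul m g"
  by (rule linear_diff) (rule bounded_linear.linear[OF bounded_linear_mul])

lemma mul_zero [simp]: "bdd_meas m \<Longrightarrow> mul m 0 = 0"
  by (rule linear_0) (rule bounded_linear.linear[OF bounded_linear_mul])

lemma mul_isometry: "bdd_meas m \<Longrightarrow> (\<And>x. norm (m x) = 1) \<Longrightarrow> norm (mul m f) = norm f"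
  using mul_norm_eq[of m "\<lambda>x. 1" f] by simp

lemma inner_mul_left:
  assumes "bdd_meas m"
  shows "inner (mul m f) g = inner f (mul (\<lambda>x. cnj (m x)) g)"
  unfolding inner_l2_def
proof (intro arg_cong[where f=Re] integral_cong_AE)
  show "AE x in lborel. rep (mul m f) x * cnj (rep g x) = rep f x * cnj (rep (mul (\<lambda>x. cnj (m x)) g) x)"
    using rep_mul[OF assms, of f] rep_mul[OF bdd_meas_cnj[OF assms], of g] by eventually_elim simp
qed simp_all

text \<open>Convergence is asserted for each fixed \<open>f\<close> only: symbols such as
  \<open>exp (\<i> a \<xi>)\<close> do not converge uniformly in \<open>\<xi>\<close>, but they are
  dominated, and pointwise convergence is then enough.\<close>

lemma mul_strong_LIMSEQ:
  assumes "\<And>n. bdd_meas (m n)" "bdd_meas m'" "\<And>n x. norm (m n x) \<le> B" "\<And>x. (\<lambda>n. m n x) \<longlonglongrightarrow> m' x"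
  shows "(\<lambda>n. mul (m n) f) \<longlonglongrightarrow> mul m' f"
  unfolding mul_def
proof (rule cls_tendsto_dominated(3)[where w="\<lambda>x. B * norm (rep f x)"])
  show "norm (m n x * rep f x) \<le> B * norm (rep f x)" for n x
    using assms(3) by (simp add: norm_mult mult_right_mono)
  show "AE x in lborel. (\<lambda>n. m n x * rep f x) \<longlonglongrightarrow> m' x * rep f x"
    using assms(4) by (auto intro!: tendsto_intros)
qed (use assms in \<open>simp_all add: power_mult_distrib L2_square_integrable bdd_meas_measurable borel_measurable_times\<close>)

lemma mul_strong_tendsto:
  fixes m :: "'a::first_countable_topology \<Rightarrow> real \<Rightarrow> complex"
  assumes "\<And>t. bdd_meas (m t)" "bdd_meas m'" "\<And>t x. norm (m t x) \<le> B" "\<And>x. ((\<lambda>t. m t x) \<longlongrightarrow> m' x) (at t within A)"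
  shows "((\<lambda>t. mul (m t) f) \<longlongrightarrow> mul m' f) (at t within A)"
  unfolding tendsto_at_iff_sequentially comp_def
proof (intro allI impI)
  fix X :: "nat \<Rightarrow> 'a" assume X: "\<forall>i. X i \<in> A - {t}" "X \<longlonglongrightarrow> t"
  show "(\<lambda>n. mul (m (X n)) f) \<longlonglongrightarrow> mul m' f"
    by (rule mul_strong_LIMSEQ[where B=B])
       (use assms X in \<open>auto simp: tendsto_at_iff_sequentially comp_def\<close>)
qed

lemma mul_inj:
  assumes "bdd_meas m" "\<And>x. m x \<noteq> 0" "mul m f = mul m g"
  shows "f = g"
proof (rule l2_eqI)
  have "AE x in lborel. rep (mul m f) x = rep (mul m g) x" using assms(3) by simp
  with rep_mul[OF assms(1), of f] rep_mul[OF assms(1), of g]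
  show "AE x in lborel. rep f x = rep g x" by eventually_elim (use assms(2) in simp)
qed

subsection \<open>Translations\<close>

lemma AE_lborel_shift: "AE x in lborel. P x \<Longrightarrow> AE x in lborel. P (x + (a::real))"
proof -
  assume P: "AE x in lborel. P x"
  have "AE x in distr lborel borel ((+) a). P x" unfolding lborel_distr_plus by (rule P)
  then have "AE x in lborel. P (a + x)" by (rule AE_distrD[rotated]) simp
  then show ?thesis by (simp add: add.commute)
qed

lemma L2_shift: "f \<in> L2 \<Longrightarrow> (\<lambda>x. f (x + a)) \<in> L2"
  using lborel_integrable_real_affine[of "\<lambda>x. (norm (f x))\<^sup>2" 1 a] by (auto simp: L2_iff add.commute)

lemma LINT_shift:
  fixes f :: "real \<Rightarrow> 'a::{banach, second_countable_topology}"
  shows "(LINT x|lborel. f (x + a)) = (LINT x|lborel. f x)"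
  using lborel_integral_real_affine[of 1 f a] by (simp add: add.commute)

definition tr :: "real \<Rightarrow> l2 \<Rightarrow> l2" where
  "tr a f = cls (\<lambda>x. rep f (x + a))"

lemma tr_cls: "f \<in> L2 \<Longrightarrow> tr a (cls f) = cls (\<lambda>x. f (x + a))"
  unfolding tr_def by (rule cls_eqI) (auto simp: L2_shift intro: AE_lborel_shift rep_cls)

lemma norm_tr [simp]: "norm (tr a f) = norm f"
proof -
  have "(norm (tr a f))\<^sup>2 = (norm f)\<^sup>2"
    unfolding tr_def norm_l2_sq[of f] norm_cls_sq[OF L2_shift[OF rep_L2]]
    by (rule LINT_shift[of "\<lambda>x. (norm (rep f x))\<^sup>2"])
  then show ?thesis by simp
qed

lemma tr_add: "tr a (f + g) = tr a f + tr a g"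
proof -
  have "tr a (f + g) = tr a (cls (\<lambda>x. rep f x + rep g x))" by (simp add: cls_add)
  also have "\<dots> = tr a f + tr a g" by (subst tr_cls) (simp_all add: L2_add cls_add L2_shift tr_def)
  finally show ?thesis .
qed

lemma tr_diff: "tr a (f - g) = tr a f - tr a g"
  using tr_add[of a "f - g" g] by simp

lemma tr_step: "tr a (step c p q) = step c (p - a) (q - a)"
proof -
  have "(\<lambda>x. c * indicator {p..q} (x + a)) = (\<lambda>x. c * indicator {p - a..q - a} x)"
    by (auto simp: indicator_def fun_eq_iff)
  then show ?thesis unfolding step_def by (subst tr_cls) (simp_all only: step_L2)
qed

text \<open>Since translations are isometries, an epsilon/3 argument shows that the functions with
  this property form a closed set; it is stable under sums, and for a step translation merely moves
  the endpoints.\<close>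

lemma tr_tendsto: "((\<lambda>a. tr a f) \<longlongrightarrow> f) (at 0)"
proof -
  have "f \<in> {f. ((\<lambda>a. tr a f) \<longlongrightarrow> f) (at 0)}"
  proof (rule step_dense)
    show "closed {f. ((\<lambda>a. tr a f) \<longlongrightarrow> f) (at 0)}"
      unfolding closed_sequential_limits
    proof (intro allI impI, elim conjE)
      fix X l assume X: "\<forall>n. X n \<in> {f. ((\<lambda>a. tr a f) \<longlongrightarrow> f) (at 0)}" "X \<longlonglongrightarrow> l"
      show "l \<in> {f. ((\<lambda>a. tr a f) \<longlongrightarrow> f) (at 0)}"
        unfolding mem_Collect_eq tendsto_iff
      proof (intro allI impI)
        fix e :: real assume e: "e > 0"
        obtain n where n: "dist (X n) l < e / 3"
          using X(2) e unfolding lim_sequentially by (meson order_refl zero_less_divide_iff zero_less_numeral)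
        have "\<forall>\<^sub>F a in at 0. dist (tr a (X n)) (X n) < e / 3"
          using X(1) e unfolding mem_Collect_eq tendsto_iff by (metis zero_less_divide_iff zero_less_numeral)
        then show "\<forall>\<^sub>F a in at 0. dist (tr a l) l < e"
        proof eventually_elim
          case (elim a)
          have "dist (tr a l) (tr a (X n)) = dist l (X n)"
            unfolding dist_norm tr_diff[symmetric] by simp
          then show ?case
            using n elim dist_triangle[of "tr a l" l "tr a (X n)"] dist_triangle[of "tr a (X n)" l "X n"]
            by (simp add: dist_commute)
        qed
      qed
    qed
    have "tr a 0 = 0" for a using tr_diff[of a 0 0] by simp
    then show "0 \<in> {f. ((\<lambda>a. tr a f) \<longlongrightarrow> f) (at 0)}" by simp
    show "f + g \<in> {f. ((\<lambda>a. tr a f) \<longlongrightarrow> f) (at 0)}"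
      if "f \<in> {f. ((\<lambda>a. tr a f) \<longlongrightarrow> f) (at 0)}" "g \<in> {f. ((\<lambda>a. tr a f) \<longlongrightarrow> f) (at 0)}" for f g
      using that by (auto simp: tr_add intro: tendsto_add)
    show "step c p q \<in> {f. ((\<lambda>a. tr a f) \<longlongrightarrow> f) (at 0)}" for c p q
      unfolding mem_Collect_eq tr_step tendsto_at_iff_sequentially comp_def
    proof (intro allI impI)
      fix X :: "nat \<Rightarrow> real" assume "X \<longlonglongrightarrow> 0"
      then have "(\<lambda>n. p - X n) \<longlonglongrightarrow> p" "(\<lambda>n. q - X n) \<longlonglongrightarrow> q" by (auto intro!: tendsto_eq_intros)
      then show "(\<lambda>n. step c (p - X n) (q - X n)) \<longlonglongrightarrow> step c p q" by (intro step_tendsto tendsto_const)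
    qed
  qed
  then show ?thesis by simp
qed

lemma tr_tr: "tr a (tr b f) = tr (a + b) f"
  by (subst (2) tr_def, subst tr_cls) (simp_all add: L2_shift tr_def add.assoc)

lemma continuous_tr: "continuous_on UNIV (\<lambda>a. tr a f)"
proof -
  have "((\<lambda>a. tr a f) \<longlongrightarrow> tr b f) (at b)" for b
  proof -
    have "((\<lambda>h. tr h (tr b f)) \<longlongrightarrow> tr b f) (at 0)" by (rule tr_tendsto)
    then have "((\<lambda>h. tr (b + h) f) \<longlongrightarrow> tr b f) (at 0)" by (simp add: tr_tr add.commute)
    then show ?thesis by (rule LIM_offset_zero_cancel)
  qed
  then show ?thesis by (simp add: continuous_on_def)
qed

subsection \<open>The Plancherel theorem\<close>

lemma fourier_integral_measurable [measurable]:
  assumes [measurable]: "f \<in> borel_measurable borel"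
  shows "fourier_integral f \<in> borel_measurable borel"
  unfolding fourier_integral_def by measurable

lemma exp_i_measurable [measurable]: "(\<lambda>x. exp (\<i> * complex_of_real x)) \<in> borel_measurable borel"
  by (intro borel_measurable_continuous_onI continuous_intros)

lemma norm_exp_i [simp]: "norm (exp (\<i> * complex_of_real x)) = 1" "norm (exp (- (\<i> * complex_of_real x))) = 1"
  by (simp_all add: norm_exp_eq_Re)

lemma integrable_exp_i:
  assumes "integrable lborel f"
  shows "integrable lborel (\<lambda>x. exp (- (\<i> * of_real (t * x))) * f x)" "integrable lborel (\<lambda>x. exp (\<i> * of_real (t * x)) * f x)"
  by (rule Bochner_Integration.integrable_bound[OF assms]; use assms in \<open>auto simp: norm_mult simp del: of_real_mult\<close>)+

lemma fourier_integral_bound: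
  assumes "integrable lborel f"
  shows "norm (fourier_integral f \<xi>) \<le> (LINT x|lborel. norm (f x))"
proof -
  have pi1: "1 \<le> sqrt (2 * pi)" using pi_ge_two by simp
  have "norm (LINT x|lborel. exp (- (\<i> * of_real (\<xi> * x))) * f x) \<le> (LINT x|lborel. norm (exp (- (\<i> * of_real (\<xi> * x))) * f x))"
    by (rule integral_norm_bound)
  also have "\<dots> = (LINT x|lborel. norm (f x))" by (simp add: norm_mult del: of_real_mult)
  finally have *: "norm (LINT x|lborel. exp (- (\<i> * of_real (\<xi> * x))) * f x) \<le> (LINT x|lborel. norm (f x))" .
  have "norm (fourier_integral f \<xi>) = 1 / sqrt (2 * pi) * norm (LINT x|lborel. exp (- (\<i> * of_real (\<xi> * x))) * f x)"
    unfolding fourier_integral_def norm_mult norm_of_real by simp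
  also have "\<dots> \<le> 1 * norm (LINT x|lborel. exp (- (\<i> * of_real (\<xi> * x))) * f x)"
    using pi1 by (intro mult_right_mono) (auto simp: divide_le_eq_1)
  finally show ?thesis using * by simp
qed

lemma fourier_integral_add:
  "integrable lborel f \<Longrightarrow> integrable lborel g \<Longrightarrow>
   fourier_integral (\<lambda>x. f x + g x) \<xi> = fourier_integral f \<xi> + fourier_integral g \<xi>"
  unfolding fourier_integral_def
  by (simp add: distrib_left integrable_exp_i Bochner_Integration.integral_add del: of_real_mult)

lemma fourier_integral_diff:
  "integrable lborel f \<Longrightarrow> integrable lborel g \<Longrightarrow>
   fourier_integral (\<lambda>x. f x - g x) \<xi> = fourier_integral f \<xi> - fourier_integral g \<xi>"
  unfolding fourier_integral_def
  by (simp add: right_diff_distrib integrable_exp_i Bochner_Integration.integral_diff del: of_real_mult)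

lemma fourier_integral_cmult: "fourier_integral (\<lambda>x. c * f x) \<xi> = c * fourier_integral f \<xi>"
  unfolding fourier_integral_def by (simp add: mult.left_commute[of _ c] del: of_real_mult)

lemma fourier_integral_cong_AE:
  assumes [measurable]: "f \<in> borel_measurable borel" "g \<in> borel_measurable borel"
    and "AE x in lborel. f x = g x"
  shows "fourier_integral f = fourier_integral g"
proof
  fix \<xi>
  have "(LINT x|lborel. exp (- (\<i> * of_real (\<xi> * x))) * f x) = (LINT x|lborel. exp (- (\<i> * of_real (\<xi> * x))) * g x)"
    by (rule integral_cong_AE) (use assms(3) in \<open>auto elim: eventually_mono simp del: of_real_mult\<close>)
  then show "fourier_integral f \<xi> = fourier_integral g \<xi>" unfolding fourier_integral_def by simp
qed

lemma integrable_prod_bound: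
  fixes F :: "real \<times> real \<Rightarrow> complex"
  assumes [measurable]: "F \<in> borel_measurable (lborel \<Otimes>\<^sub>M lborel)"
    and f: "integrable lborel f" and g: "integrable lborel g"
    and le: "\<And>x y. norm (F (x, y)) \<le> norm (f x :: complex) * norm (g y :: complex)"
  shows "integrable (lborel \<Otimes>\<^sub>M lborel) F"
proof (rule Bochner_Integration.integrable_bound)
  have [measurable]: "f \<in> borel_measurable borel" "g \<in> borel_measurable borel" using f g by auto
  show "integrable (lborel \<Otimes>\<^sub>M lborel) (\<lambda>(x, y). norm (f x) * norm (g y))"
  proof (rule lborel_pair.Fubini_integrable)
    show "integrable lborel (\<lambda>x. LINT y|lborel. norm (case (x, y) of (x, y) \<Rightarrow> norm (f x) * norm (g y)))"
      using f by (simp add: norm_mult)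
    show "AE x in lborel. integrable lborel (\<lambda>y. case (x, y) of (x, y) \<Rightarrow> norm (f x) * norm (g y))"
      using g by simp
  qed simp
  show "AE x in lborel \<Otimes>\<^sub>M lborel. norm (F x) \<le> norm (case x of (x, y) \<Rightarrow> norm (f x) * norm (g y))"
    using le by (auto simp: split_beta)
qed simp

text \<open>Both sides are the same double integral, because the kernel is symmetric in its two
  variables.\<close>

lemma fourier_integral_multiplication:
  assumes f: "integrable lborel f" and g: "integrable lborel g"
  shows "(LINT x|lborel. fourier_integral f x * g x) = (LINT x|lborel. f x * fourier_integral g x)"
proof -
  have [measurable]: "f \<in> borel_measurable borel" "g \<in> borel_measurable borel" using f g by auto
  define K where "K = complex_of_real (1 / sqrt (2 * pi))"
  have int: "integrable (lborel \<Otimes>\<^sub>M lborel) (\<lambda>(x, y). exp (- (\<i> * of_real (x * y))) * f x * g y)"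
    by (rule integrable_prod_bound[OF _ f g]) (auto simp: norm_mult simp del: of_real_mult)
  have "(LINT y|lborel. fourier_integral f y * g y) = (LINT y|lborel. K * (LINT x|lborel. exp (- (\<i> * of_real (x * y))) * f x * g y))"
    by (simp add: fourier_integral_def K_def mult.commute[of _ "x::real" for x] mult.assoc del: of_real_mult flip: integral_mult_left_zero)
  also have "\<dots> = K * (LINT y|lborel. LINT x|lborel. exp (- (\<i> * of_real (x * y))) * f x * g y)" by simp
  also have "\<dots> = K * (LINT x|lborel. LINT y|lborel. exp (- (\<i> * of_real (x * y))) * f x * g y)"
    by (subst lborel_pair.Fubini_integral[OF int]) simp
  also have "\<dots> = (LINT x|lborel. f x * fourier_integral g x)"
  proof -
    have "K * (LINT y|lborel. exp (- (\<i> * of_real (x * y))) * f x * g y) = f x * fourier_integral g x" for x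
    proof -
      have "(LINT y|lborel. exp (- (\<i> * of_real (x * y))) * f x * g y) = (LINT y|lborel. f x * (exp (- (\<i> * of_real (x * y))) * g y))"
        by (simp add: mult_ac)
      then show ?thesis by (simp add: fourier_integral_def K_def)
    qed
    then show ?thesis by (simp flip: integral_mult_right_zero)
  qed
  finally show ?thesis .
qed

text \<open>The transform of the Gaussian is read off from the characteristic function of the
  standard normal distribution.\<close>

lemma std_normal_fourier:
  "(LINT z|lborel. of_real (std_normal_density z) * exp (\<i> * of_real (t * z))) = complex_of_real (exp (- t\<^sup>2 / 2))"
proof -
  have "char std_normal_distribution t = (LINT z|lborel. std_normal_density z *\<^sub>R exp (\<i> * of_real (t * z)))"
    unfolding char_def by (rule integral_density) (auto simp: normal_density_nonneg simp del: of_real_mult)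
  then show ?thesis by (simp add: char_std_normal_distribution scaleR_conv_of_real)
qed

lemma std_normal_integrable [simp]: "integrable lborel std_normal_density"
  using integrable_std_normal_moment[of 0] by simp

lemma integrable_gaussian: "\<epsilon> > 0 \<Longrightarrow> integrable lborel (\<lambda>\<xi>. complex_of_real (exp (- (\<epsilon> * \<xi>)\<^sup>2 / 2)))"
proof -
  assume "\<epsilon> > 0"
  have "(\<lambda>\<xi>. exp (- (\<epsilon> * \<xi>)\<^sup>2 / 2)) = (\<lambda>\<xi>. sqrt (2 * pi) * std_normal_density (0 + \<epsilon> * \<xi>))"
    by (auto simp: std_normal_density_def)
  moreover have "integrable lborel \<dots>"
    using \<open>\<epsilon> > 0\<close> by (intro integrable_mult_right lborel_integrable_real_affine) auto
  ultimately have "integrable lborel (\<lambda>\<xi>. exp (- (\<epsilon> * \<xi>)\<^sup>2 / 2))" by simp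
  then show ?thesis by (rule integrable_of_real)
qed

text \<open>Divided by \<open>sqrt (2 * pi)\<close>, the right-hand side is the normal density with
  mean \<open>x\<close> and standard deviation \<open>\<epsilon>\<close>: the approximate identity
  behind Plancherel's theorem.\<close>

lemma gaussian_kernel:
  assumes "\<epsilon> > 0"
  shows "fourier_integral (\<lambda>\<xi>. exp (\<i> * of_real (\<xi> * x)) * of_real (exp (- (\<epsilon> * \<xi>)\<^sup>2 / 2))) y
    = of_real (1 / \<epsilon> * exp (- ((y - x) / \<epsilon>)\<^sup>2 / 2))"
proof -
  define K where "K = complex_of_real (1 / sqrt (2 * pi))"
  define h where "h \<xi> = exp (- (\<i> * of_real (y * \<xi>))) * (exp (\<i> * of_real (\<xi> * x)) * complex_of_real (exp (- (\<epsilon> * \<xi>)\<^sup>2 / 2)))" for \<xi>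
  have "(LINT \<xi>|lborel. h \<xi>) = (1 / \<epsilon>) *\<^sub>R (LINT \<xi>|lborel. h (0 + 1 / \<epsilon> * \<xi>))"
    using assms lborel_integral_real_affine[of "1 / \<epsilon>" h 0] by simp
  moreover have "K * h (0 + 1 / \<epsilon> * \<xi>) = of_real (std_normal_density \<xi>) * exp (\<i> * of_real ((x - y) / \<epsilon> * \<xi>))" for \<xi>
    using assms by (simp add: h_def K_def std_normal_density_def field_simps flip: exp_add)
  then have "K * (LINT \<xi>|lborel. h (0 + 1 / \<epsilon> * \<xi>)) = complex_of_real (exp (- ((x - y) / \<epsilon>)\<^sup>2 / 2))"
    unfolding std_normal_fourier[symmetric] by (subst integral_mult_right_zero[symmetric]) (simp only:)
  ultimately have "K * (LINT \<xi>|lborel. h \<xi>) = (1 / \<epsilon>) *\<^sub>R complex_of_real (exp (- ((x - y) / \<epsilon>)\<^sup>2 / 2))"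
    by (simp only: mult_scaleR_right)
  also have "((x - y) / \<epsilon>)\<^sup>2 = ((y - x) / \<epsilon>)\<^sup>2" by (simp add: power2_commute power_divide)
  finally show ?thesis unfolding fourier_integral_def h_def[symmetric] K_def[symmetric]
    by (simp add: scaleR_conv_of_real)
qed

text \<open>The Gaussian factor makes all double integrals absolutely convergent, so Fubini applies.
  As \<open>\<epsilon>\<close> tends to 0 the left side increases to the squared norm of the
  transform, while the right side, a Gaussian average of the autocorrelation of \<open>f\<close>,
  tends to the squared norm of \<open>f\<close>.\<close>

lemma gaussian_plancherel:
  assumes f: "integrable lborel f" and f2: "f \<in> L2" and \<epsilon>: "\<epsilon> > 0"
  shows "(LINT \<xi>|lborel. exp (- (\<epsilon> * \<xi>)\<^sup>2 / 2) * (norm (fourier_integral f \<xi>))\<^sup>2)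
    = (LINT z|lborel. std_normal_density z * inner (cls f) (tr (\<epsilon> * z) (cls f)))"
proof -
  have [measurable]: "f \<in> borel_measurable borel" using f by auto
  define G where "G \<xi> = complex_of_real (exp (- (\<epsilon> * \<xi>)\<^sup>2 / 2))" for \<xi>
  have [measurable]: "G \<in> borel_measurable borel" unfolding G_def by measurable
  \<comment> \<open>Chosen so that the product of the transform of \<open>f\<close> with
    \<open>g\<close> is the damped square on the left; the multiplication formula then moves the
    transform onto \<open>g\<close>.\<close>
  define g where "g \<xi> = G \<xi> * cnj (fourier_integral f \<xi>)" for \<xi>
  have iG: "integrable lborel G" unfolding G_def by (rule integrable_gaussian[OF \<epsilon>])
  have ig: "integrable lborel g"
  proof (rule Bochner_Integration.integrable_bound)
    show "integrable lborel (\<lambda>\<xi>. G \<xi> * of_real (LINT x|lborel. norm (f x)))" using iG by simp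
    show "AE x in lborel. norm (g x) \<le> norm (G x * complex_of_real (LINT x|lborel. norm (f x)))"
      by (auto simp: g_def norm_mult intro!: mult_left_mono order_trans[OF fourier_integral_bound[OF f]])
  qed (simp add: g_def[abs_def])
  \<comment> \<open>The transform of \<open>g\<close> is a Gaussian average of \<open>cnj f\<close>
    around \<open>x\<close>: a second use of the multiplication formula moves the transform from
    \<open>f\<close> to the modulated Gaussian \<open>k\<close>, where it is known.\<close>
  have gx: "fourier_integral g x = (LINT z|lborel. of_real (std_normal_density z) * cnj (f (x + \<epsilon> * z)))" for x
  proof -
    define k where "k \<xi> = exp (\<i> * of_real (\<xi> * x)) * G \<xi>" for \<xi>
    have ik: "integrable lborel k"
      unfolding k_def using integrable_exp_i(2)[OF iG, of x] by (simp add: mult.commute)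
    have "(LINT \<xi>|lborel. exp (- (\<i> * of_real (x * \<xi>))) * g \<xi>) = (LINT \<xi>|lborel. cnj (fourier_integral f \<xi> * k \<xi>))"
      by (simp add: g_def k_def exp_cnj G_def mult_ac)
    also have "\<dots> = cnj (LINT \<xi>|lborel. f \<xi> * fourier_integral k \<xi>)"
      unfolding Bochner_Integration.integral_cnj fourier_integral_multiplication[OF f ik] ..
    also have "(LINT \<xi>|lborel. f \<xi> * fourier_integral k \<xi>) = (LINT y|lborel. f y * of_real (1 / \<epsilon> * exp (- ((y - x) / \<epsilon>)\<^sup>2 / 2)))"
      unfolding k_def G_def gaussian_kernel[OF \<epsilon>] ..
    also have "\<dots> = \<epsilon> *\<^sub>R (LINT z|lborel. f (x + \<epsilon> * z) * of_real (1 / \<epsilon> * exp (- ((x + \<epsilon> * z - x) / \<epsilon>)\<^sup>2 / 2)))"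
      using \<epsilon> lborel_integral_real_affine[of \<epsilon> "\<lambda>y. f y * of_real (1 / \<epsilon> * exp (- ((y - x) / \<epsilon>)\<^sup>2 / 2))" x] by simp
    also have "\<dots> = (LINT z|lborel. \<epsilon> *\<^sub>R (f (x + \<epsilon> * z) * of_real (1 / \<epsilon> * exp (- ((x + \<epsilon> * z - x) / \<epsilon>)\<^sup>2 / 2))))"
      by (rule integral_scaleR_right[symmetric])
    also have "\<dots> = (LINT z|lborel. f (x + \<epsilon> * z) * of_real (exp (- z\<^sup>2 / 2)))"
      using \<epsilon> by (intro Bochner_Integration.integral_cong) (auto simp: scaleR_conv_of_real)
    finally have "fourier_integral g x = of_real (1 / sqrt (2 * pi)) * cnj (LINT z|lborel. f (x + \<epsilon> * z) * of_real (exp (- z\<^sup>2 / 2)))"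
      unfolding fourier_integral_def by simp
    also have "\<dots> = (LINT z|lborel. of_real (1 / sqrt (2 * pi)) * cnj (f (x + \<epsilon> * z) * of_real (exp (- z\<^sup>2 / 2))))"
      by (simp only: Bochner_Integration.integral_cnj integral_mult_right_zero)
    finally show ?thesis by (simp add: std_normal_density_def mult_ac)
  qed
  have int: "integrable (lborel \<Otimes>\<^sub>M lborel) (\<lambda>(z, x). of_real (std_normal_density z) * (f x * cnj (f (x + \<epsilon> * z))))"
  proof (rule lborel_pair.Fubini_integrable)
    have ff: "integrable lborel (\<lambda>x. f x * cnj (f (x + a)))" for a
      by (rule L2_mult_integrable[OF f2 L2_cnj[OF L2_shift[OF f2]]])
    show "AE z in lborel. integrable lborel (\<lambda>x. case (z, x) of (z, x) \<Rightarrow> complex_of_real (std_normal_density z) * (f x * cnj (f (x + \<epsilon> * z))))"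
      using ff by simp
    have le: "(LINT x|lborel. norm (f x * cnj (f (x + a)))) \<le> 2 * (LINT x|lborel. (norm (f x))\<^sup>2)" for a
    proof -
      have "(LINT x|lborel. norm (f x * cnj (f (x + a)))) \<le> (LINT x|lborel. (norm (f x))\<^sup>2 + (norm (f (x + a)))\<^sup>2)"
      proof (rule integral_mono)
        show "norm (f x * cnj (f (x + a))) \<le> (norm (f x))\<^sup>2 + (norm (f (x + a)))\<^sup>2" for x
          using zero_le_power2[of "norm (f x) - norm (f (x + a))"] zero_le_power2[of "norm (f x)"] zero_le_power2[of "norm (f (x+a))"]
          unfolding norm_mult complex_mod_cnj power2_diff by linarith
      qed (use ff L2_square_integrable[OF f2] L2_square_integrable[OF L2_shift[OF f2]] in auto)
      also have "\<dots> = 2 * (LINT x|lborel. (norm (f x))\<^sup>2)"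
        using L2_square_integrable[OF f2] L2_square_integrable[OF L2_shift[OF f2]] LINT_shift[of "\<lambda>x. (norm (f x))\<^sup>2" a]
        by simp
      finally show ?thesis .
    qed
    show "integrable lborel (\<lambda>z. LINT x|lborel. norm (case (z, x) of (z, x) \<Rightarrow> complex_of_real (std_normal_density z) * (f x * cnj (f (x + \<epsilon> * z)))))"
    proof (rule Bochner_Integration.integrable_bound)
      show "integrable lborel (\<lambda>z. std_normal_density z * (2 * (LINT x|lborel. (norm (f x))\<^sup>2)))" by simp
      show "AE z in lborel. norm (LINT x|lborel. norm (case (z, x) of (z, x) \<Rightarrow> complex_of_real (std_normal_density z) * (f x * cnj (f (x + \<epsilon> * z)))))
        \<le> norm (std_normal_density z * (2 * (LINT x|lborel. (norm (f x))\<^sup>2)))"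
      proof (rule AE_I2)
        fix z
        have "(LINT x|lborel. norm (case (z, x) of (z, x) \<Rightarrow> complex_of_real (std_normal_density z) * (f x * cnj (f (x + \<epsilon> * z)))))
          = std_normal_density z * (LINT x|lborel. norm (f x * cnj (f (x + \<epsilon> * z))))"
          by (simp add: norm_mult mult.assoc del: complex_mod_cnj)
        also have "norm \<dots> \<le> norm (std_normal_density z * (2 * (LINT x|lborel. (norm (f x))\<^sup>2)))"
          using le[of "\<epsilon> * z"] by (simp add: abs_mult mult_left_mono integral_nonneg_AE)
        finally show "norm (LINT x|lborel. norm (case (z, x) of (z, x) \<Rightarrow> complex_of_real (std_normal_density z) * (f x * cnj (f (x + \<epsilon> * z)))))
          \<le> norm (std_normal_density z * (2 * (LINT x|lborel. (norm (f x))\<^sup>2)))" .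
      qed
    qed measurable
  qed measurable
  have "complex_of_real (LINT \<xi>|lborel. exp (- (\<epsilon> * \<xi>)\<^sup>2 / 2) * (norm (fourier_integral f \<xi>))\<^sup>2)
     = (LINT \<xi>|lborel. complex_of_real (exp (- (\<epsilon> * \<xi>)\<^sup>2 / 2) * (norm (fourier_integral f \<xi>))\<^sup>2))"
    by (rule integral_complex_of_real[symmetric])
  also have "\<dots> = (LINT \<xi>|lborel. fourier_integral f \<xi> * g \<xi>)"
    by (rule Bochner_Integration.integral_cong) (simp_all add: g_def G_def complex_norm_square mult_ac del: of_real_power)
  also have "\<dots> = (LINT x|lborel. f x * fourier_integral g x)" by (rule fourier_integral_multiplication[OF f ig])
  also have "\<dots> = (LINT x|lborel. LINT z|lborel. of_real (std_normal_density z) * (f x * cnj (f (x + \<epsilon> * z))))"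
    unfolding gx by (simp add: mult.left_commute flip: integral_mult_right_zero)
  also have "\<dots> = (LINT z|lborel. LINT x|lborel. of_real (std_normal_density z) * (f x * cnj (f (x + \<epsilon> * z))))"
    by (rule lborel_pair.Fubini_integral[OF int])
  finally have "(LINT \<xi>|lborel. exp (- (\<epsilon> * \<xi>)\<^sup>2 / 2) * (norm (fourier_integral f \<xi>))\<^sup>2)
    = Re (LINT z|lborel. LINT x|lborel. of_real (std_normal_density z) * (f x * cnj (f (x + \<epsilon> * z))))"
    by (metis Re_complex_of_real)
  also have "\<dots> = (LINT z|lborel. Re (LINT x|lborel. of_real (std_normal_density z) * (f x * cnj (f (x + \<epsilon> * z)))))"
    by (rule Re_LINT) (use lborel_pair.integrable_fst'[OF int] in simp)
  also have "\<dots> = (LINT z|lborel. std_normal_density z * inner (cls f) (tr (\<epsilon> * z) (cls f)))"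
    by (simp add: tr_cls f2 inner_cls L2_shift)
  finally show ?thesis .
qed

text \<open>The damping is removed along \<open>\<epsilon> = 1 / (n + 1)\<close>: dominated
  convergence and continuity of translations on one side, monotone convergence on the other, which
  also yields that the transform is square integrable.\<close>

lemma plancherel_L1:
  assumes f: "integrable lborel f" and f2: "f \<in> L2"
  shows "fourier_integral f \<in> L2" "norm (cls (fourier_integral f)) = norm (cls f)"
proof -
  have [measurable]: "f \<in> borel_measurable borel" using f by auto
  define e where "e n = 1 / real (Suc n)" for n
  have e: "e n > 0" "e \<longlonglongrightarrow> 0" "decseq e" for n
    using LIMSEQ_inverse_real_of_nat by (auto simp: e_def[abs_def] inverse_eq_divide decseq_def divide_simps)
  define u where "u n \<xi> = exp (- (e n * \<xi>)\<^sup>2 / 2) * (norm (fourier_integral f \<xi>))\<^sup>2" for n \<xi>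
  have lim: "(\<lambda>n. integral\<^sup>L lborel (u n)) \<longlonglongrightarrow> (norm (cls f))\<^sup>2"
  proof -
    have "(\<lambda>n. LINT z|lborel. std_normal_density z * inner (cls f) (tr (e n * z) (cls f))) \<longlonglongrightarrow>
      (LINT z|lborel. std_normal_density z * (norm (cls f))\<^sup>2)"
    proof (rule integral_dominated_convergence[where w="\<lambda>z. std_normal_density z * (norm (cls f))\<^sup>2"])
      have "(\<lambda>n. inner (cls f) (tr (e n * z) (cls f))) \<longlonglongrightarrow> inner (cls f) (tr 0 (cls f))" for z
      proof (intro tendsto_inner tendsto_const)
        have "(\<lambda>n. e n * z) \<longlonglongrightarrow> 0" using tendsto_mult_left_zero[OF e(2)] by simp
        then show "(\<lambda>n. tr (e n * z) (cls f)) \<longlonglongrightarrow> tr 0 (cls f)"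
          using continuous_on_tendsto_compose[OF continuous_tr[of "cls f"], of "\<lambda>n. e n * z" 0 sequentially] by simp
      qed
      moreover have "tr 0 (cls f) = cls f" by (simp add: tr_def)
      ultimately show "AE z in lborel. (\<lambda>n. std_normal_density z * inner (cls f) (tr (e n * z) (cls f))) \<longlonglongrightarrow> std_normal_density z * (norm (cls f))\<^sup>2"
        by (auto intro!: tendsto_mult simp: power2_norm_eq_inner)
      show "AE z in lborel. norm (std_normal_density z * inner (cls f) (tr (e n * z) (cls f))) \<le> std_normal_density z * (norm (cls f))\<^sup>2" for n
        using Cauchy_Schwarz_ineq2[of "cls f" "tr (e n * z) (cls f)" for z]
        by (auto simp: abs_mult power2_eq_square normal_density_nonneg intro!: mult_left_mono)
      show "(\<lambda>z. std_normal_density z * inner (cls f) (tr (e n * z) (cls f))) \<in> borel_measurable lborel" for n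
        by (intro borel_measurable_times borel_measurable_continuous_on[where f="\<lambda>a. inner (cls f) (tr a (cls f))"] continuous_intros)
           (auto intro!: continuous_on_inner continuous_tr continuous_on_const)
    qed auto
    then show ?thesis unfolding u_def gaussian_plancherel[OF f f2 e(1)] by simp
  qed
  have iu: "integrable lborel (u n)" for n
  proof (rule Bochner_Integration.integrable_bound)
    show "integrable lborel (\<lambda>\<xi>. complex_of_real (exp (- (e n * \<xi>)\<^sup>2 / 2)) * of_real ((LINT x|lborel. norm (f x))\<^sup>2))"
      using integrable_gaussian[OF e(1)] by simp
    show "AE \<xi> in lborel. norm (u n \<xi>) \<le> norm (complex_of_real (exp (- (e n * \<xi>)\<^sup>2 / 2)) * of_real ((LINT x|lborel. norm (f x))\<^sup>2))"
      by (auto simp: u_def norm_mult abs_mult simp del: of_real_power intro!: power_mono fourier_integral_bound[OF f])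
  qed (simp add: u_def[abs_def])
  have mono: "AE \<xi> in lborel. mono (\<lambda>n. u n \<xi>)"
    proof (intro AE_I2 monoI)
      fix \<xi> :: real and m n :: nat assume "m \<le> n"
      then have "(e n)\<^sup>2 \<le> (e m)\<^sup>2"
        using e(1)[of n] e(3) by (intro power_mono) (auto simp: decseq_def)
      then have "(e n * \<xi>)\<^sup>2 \<le> (e m * \<xi>)\<^sup>2" by (simp add: power_mult_distrib mult_right_mono)
      then show "u m \<xi> \<le> u n \<xi>" unfolding u_def by (intro mult_right_mono) auto
    qed
  have u: "AE \<xi> in lborel. (\<lambda>n. u n \<xi>) \<longlonglongrightarrow> (norm (fourier_integral f \<xi>))\<^sup>2"
    unfolding u_def by (rule AE_I2) (auto intro!: tendsto_eq_intros e(2))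
  have pos: "AE \<xi> in lborel. 0 \<le> u i \<xi>" for i by (simp add: u_def)
  have meas: "(\<lambda>\<xi>. (norm (fourier_integral f \<xi>))\<^sup>2) \<in> borel_measurable lborel" by simp
  note integral_monotone_convergence_nonneg[OF iu mono pos u lim meas]
  then show "fourier_integral f \<in> L2" "norm (cls (fourier_integral f)) = norm (cls f)"
    using norm_cls_sq[of "fourier_integral f"] by (auto simp: L2_iff)
qed

subsection \<open>The Fourier transform as a unitary operator\<close>

definition cut :: "nat \<Rightarrow> l2 \<Rightarrow> l2" where
  "cut n = mul (indicator {- real n..real n})"

lemma cut_tendsto: "(\<lambda>n. cut n f) \<longlonglongrightarrow> f"
proof -
  have "(\<lambda>n. mul (indicator {- real n..real n}) f) \<longlonglongrightarrow> mul (\<lambda>x. 1) f"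
  proof (rule mul_strong_LIMSEQ[where B=1])
    fix x :: real
    obtain N where N: "\<bar>x\<bar> \<le> real N" using real_arch_simple by blast
    have "(indicator {- real n..real n} x :: complex) = 1" if "n \<ge> N" for n
      using N that by (auto simp: indicator_def)
    then show "(\<lambda>n. indicator {- real n..real n} x :: complex) \<longlonglongrightarrow> 1"
      by (intro tendsto_eventually) (auto simp: eventually_sequentially)
  qed (auto simp: indicator_def)
  then show ?thesis by (simp add: cut_def)
qed

lemma trunc_L2: "f \<in> L2 \<Longrightarrow> (\<lambda>x. indicator {- real n..real n} x * f x) \<in> L2"
  by (rule mul_L2[OF bdd_meas_indicator]) simp_all

lemma trunc_integrable: "f \<in> L2 \<Longrightarrow> integrable lborel (\<lambda>x. indicator {- real n..real n} x * f x)"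
  using L2_mult_integrable[OF step_L2[of 1 "- real n" "real n"]] by simp

lemma cut_cls: "f \<in> L2 \<Longrightarrow> cut n (cls f) = cls (\<lambda>x. indicator {- real n..real n} x * f x)"
  unfolding cut_def by (rule mul_cls) simp_all

definition Fou_cut :: "nat \<Rightarrow> l2 \<Rightarrow> l2" where
  "Fou_cut n f = cls (fourier_integral (\<lambda>x. indicator {- real n..real n} x * rep f x))"

definition Fou :: "l2 \<Rightarrow> l2" where
  "Fou f = lim (\<lambda>n. Fou_cut n f)"

lemma Fou_cut_cls:
  assumes [measurable]: "f \<in> L2"
  shows "Fou_cut n (cls f) = cls (fourier_integral (\<lambda>x. indicator {- real n..real n} x * f x))"
  unfolding Fou_cut_def
proof (rule arg_cong[where f=cls], rule fourier_integral_cong_AE)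
  show "AE x in lborel. indicator {- real n..real n} x * rep (cls f) x = indicator {- real n..real n} x * f x"
    using rep_cls[OF assms] by eventually_elim simp
qed simp_all

lemma fourier_cls_diff:
  assumes "integrable lborel f" "f \<in> L2" "integrable lborel g" "g \<in> L2"
  shows "norm (cls (fourier_integral f) - cls (fourier_integral g)) = norm (cls f - cls g)"
proof -
  have "cls (fourier_integral f) - cls (fourier_integral g) = cls (\<lambda>x. fourier_integral f x - fourier_integral g x)"
    using assms by (simp add: cls_diff plancherel_L1)
  also have "(\<lambda>x. fourier_integral f x - fourier_integral g x) = fourier_integral (\<lambda>x. f x - g x)"
    using assms by (simp add: fourier_integral_diff fun_eq_iff)
  also have "norm (cls \<dots>) = norm (cls (\<lambda>x. f x - g x))"
    using assms by (intro plancherel_L1) (auto simp: L2_diff)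
  finally show ?thesis using assms by (simp add: cls_diff)
qed

text \<open>By Plancherel the transforms of two truncations are as far apart as the truncations
  themselves, so they form a Cauchy sequence and the \<open>lim\<close> in the definition of
  \<open>Fou\<close> is a genuine limit.\<close>

lemma Fou_cut_tendsto: "(\<lambda>n. Fou_cut n f) \<longlonglongrightarrow> Fou f"
proof -
  have "norm (Fou_cut m f - Fou_cut n f) = norm (cut m f - cut n f)" for m n
    unfolding Fou_cut_def cut_def mul_def
    by (intro fourier_cls_diff trunc_L2 trunc_integrable rep_L2)
  then have "dist (Fou_cut m f) (Fou_cut n f) = dist (cut m f) (cut n f)" for m n by (simp add: dist_norm)
  moreover have "Cauchy (\<lambda>n. cut n f)" using cut_tendsto LIMSEQ_imp_Cauchy by blast
  ultimately have "Cauchy (\<lambda>n. Fou_cut n f)" unfolding Cauchy_def by simp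
  then show ?thesis unfolding Fou_def by (simp add: Cauchy_convergent_iff convergent_LIMSEQ_iff)
qed

lemma norm_Fou [simp]: "norm (Fou f) = norm f"
proof -
  have "norm (Fou_cut n f) = norm (cut n f)" for n
    unfolding Fou_cut_def cut_def mul_def
    by (intro plancherel_L1 trunc_L2 trunc_integrable rep_L2)
  moreover have "(\<lambda>n. norm (cut n f)) \<longlonglongrightarrow> norm f" by (intro tendsto_norm cut_tendsto)
  moreover have "(\<lambda>n. norm (Fou_cut n f)) \<longlonglongrightarrow> norm (Fou f)" by (intro tendsto_norm Fou_cut_tendsto)
  ultimately show ?thesis using LIMSEQ_unique by auto
qed

lemma Fou_cls:
  assumes "integrable lborel f" "f \<in> L2"
  shows "Fou (cls f) = cls (fourier_integral f)"
proof -
  have "norm (Fou_cut n (cls f) - cls (fourier_integral f)) = norm (cut n (cls f) - cls f)" for n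
    unfolding Fou_cut_cls[OF assms(2)] cut_cls[OF assms(2)]
    by (intro fourier_cls_diff trunc_L2 trunc_integrable assms)
  moreover have "(\<lambda>n. norm (cut n (cls f) - cls f)) \<longlonglongrightarrow> 0"
    using cut_tendsto by (intro tendsto_norm_zero LIM_zero)
  ultimately have "(\<lambda>n. norm (Fou_cut n (cls f) - cls (fourier_integral f))) \<longlonglongrightarrow> 0" by simp
  then have "(\<lambda>n. Fou_cut n (cls f)) \<longlonglongrightarrow> cls (fourier_integral f)"
    by (simp add: tendsto_norm_zero_iff LIM_zero_iff)
  then show ?thesis using LIMSEQ_unique[OF Fou_cut_tendsto] by blast
qed

text \<open>Translates the relation in which the problem is stated into the operator
  \<open>Fou\<close>, which replaces it from here on.\<close>

lemma is_L2_fourier_iff: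
  assumes f: "f \<in> L2" and F: "F \<in> L2"
  shows "is_L2_fourier f F \<longleftrightarrow> cls F = Fou (cls f)"
proof -
  have "L2_norm (\<lambda>\<xi>. F \<xi> - fourier_integral (\<lambda>x. indicator {- real n..real n} x * f x) \<xi>) = norm (Fou_cut n (cls f) - cls F)" for n
    unfolding Fou_cut_cls[OF f] norm_minus_commute[of "cls (fourier_integral _)"]
    using F f by (simp add: cls_diff[symmetric] norm_cls[symmetric] L2_diff plancherel_L1 trunc_L2 trunc_integrable)
  then have "is_L2_fourier f F \<longleftrightarrow> (\<lambda>n. norm (Fou_cut n (cls f) - cls F)) \<longlonglongrightarrow> 0"
    unfolding is_L2_fourier_def using f F by (simp add: indicator_def)
  also have "\<dots> \<longleftrightarrow> (\<lambda>n. Fou_cut n (cls f)) \<longlonglongrightarrow> cls F"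
    by (simp add: tendsto_norm_zero_iff LIM_zero_iff)
  also have "\<dots> \<longleftrightarrow> cls F = Fou (cls f)"
    using Fou_cut_tendsto[of "cls f"] LIMSEQ_unique[OF _ Fou_cut_tendsto[of "cls f"]] by metis
  finally show ?thesis .
qed

lemma Fou_cut_add: "Fou_cut n (f + g) = Fou_cut n f + Fou_cut n g"
proof -
  define c where "c f = (\<lambda>x. indicator {- real n..real n} x * rep f x)" for f
  have c: "c f \<in> L2" "integrable lborel (c f)" for f
    unfolding c_def by (auto simp: trunc_L2 trunc_integrable)
  have "fourier_integral (c (f + g)) = fourier_integral (\<lambda>x. c f x + c g x)"
  proof (rule fourier_integral_cong_AE)
    show "AE x in lborel. c (f + g) x = c f x + c g x"
      using rep_add[of f g] by eventually_elim (simp add: c_def algebra_simps)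
  qed (simp_all add: c_def[abs_def])
  also have "\<dots> = (\<lambda>\<xi>. fourier_integral (c f) \<xi> + fourier_integral (c g) \<xi>)"
    by (intro ext fourier_integral_add c)
  finally show ?thesis
    unfolding Fou_cut_def c_def[symmetric] by (simp add: cls_add plancherel_L1 c)
qed

lemma Fou_add: "Fou (f + g) = Fou f + Fou g"
  by (rule LIMSEQ_unique[OF Fou_cut_tendsto[of "f + g", unfolded Fou_cut_add] tendsto_add[OF Fou_cut_tendsto Fou_cut_tendsto]])

text \<open>The type \<open>l2\<close> is a vector space over the reals only; multiplication by a
  complex scalar is the multiplication operator with constant symbol.\<close>

abbreviation cscale :: "complex \<Rightarrow> l2 \<Rightarrow> l2" where
  "cscale c \<equiv> mul (\<lambda>x. c)"

lemma continuous_mul: "bdd_meas m \<Longrightarrow> (f \<longlongrightarrow> l) F \<Longrightarrow> ((\<lambda>x. mul m (f x)) \<longlongrightarrow> mul m l) F"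
  by (rule bounded_linear.tendsto[OF bounded_linear_mul])

lemma Fou_cut_cscale: "Fou_cut n (cscale c f) = cscale c (Fou_cut n f)"
proof -
  define k where "k f = (\<lambda>x. indicator {- real n..real n} x * rep f x)" for f
  have k: "k f \<in> L2" "integrable lborel (k f)" for f
    unfolding k_def by (auto simp: trunc_L2 trunc_integrable)
  have "fourier_integral (k (cscale c f)) = fourier_integral (\<lambda>x. c * k f x)"
  proof (rule fourier_integral_cong_AE)
    show "AE x in lborel. k (cscale c f) x = c * k f x"
      using rep_mul[OF bdd_meas_const[of c], of f] by eventually_elim (simp add: k_def algebra_simps)
  qed (simp_all add: k_def[abs_def])
  also have "\<dots> = (\<lambda>\<xi>. c * fourier_integral (k f) \<xi>)"
    by (simp add: fourier_integral_cmult fun_eq_iff)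
  finally show ?thesis
    unfolding Fou_cut_def k_def[symmetric] by (simp add: mul_cls plancherel_L1 k)
qed

lemma Fou_cscale: "Fou (cscale c f) = cscale c (Fou f)"
  by (rule LIMSEQ_unique[OF Fou_cut_tendsto[of "cscale c f", unfolded Fou_cut_cscale]
        continuous_mul[OF bdd_meas_const Fou_cut_tendsto]])

lemma Fou_scaleR: "Fou (r *\<^sub>R f) = r *\<^sub>R Fou f"
  using Fou_cscale[of "of_real r" f] by (simp add: mul_of_real)

lemma bounded_linear_Fou: "bounded_linear Fou"
  by (rule bounded_linear_intro[where K=1]) (auto simp: Fou_add Fou_scaleR)

lemma Fou_diff: "Fou (f - g) = Fou f - Fou g"
  by (rule linear_diff) (rule bounded_linear.linear[OF bounded_linear_Fou])

text \<open>Polarization; over the reals additivity of \<open>A\<close> is all it takes.\<close>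

lemma isometry_inner:
  fixes A :: "'a::real_inner \<Rightarrow> 'b::real_inner"
  assumes "\<And>f g. A (f + g) = A f + A g" "\<And>f. norm (A f) = norm f"
  shows "inner (A f) (A g) = inner f g"
proof -
  have *: "inner (A f) (A f) = inner f f" for f
    using assms(2)[of f] by (simp flip: power2_norm_eq_inner)
  show ?thesis
    using *[of "f + g"] *[of f] *[of g] unfolding assms(1)
    by (simp add: inner_add_left inner_add_right inner_commute)
qed

section \<open>Conjugation and the inverse Fourier transform\<close>

definition cj :: "l2 \<Rightarrow> l2" where
  "cj f = cls (\<lambda>x. cnj (rep f x))"

lemma cj_cls: "f \<in> L2 \<Longrightarrow> cj (cls f) = cls (\<lambda>x. cnj (f x))"
  unfolding cj_def by (rule cls_eqI) (use rep_cls[of f] in \<open>auto simp: L2_cnj\<close>)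

lemma rep_cj: "AE x in lborel. rep (cj f) x = cnj (rep f x)"
  unfolding cj_def by (rule rep_cls) (simp add: L2_cnj)

lemma cj_cj [simp]: "cj (cj f) = f"
  unfolding cj_def[of f] by (subst cj_cls) (simp_all add: L2_cnj)

lemma norm_cj [simp]: "norm (cj f) = norm f"
proof -
  have "(norm (cj f))\<^sup>2 = (norm f)\<^sup>2"
    unfolding cj_def by (subst norm_cls_sq) (simp_all add: L2_cnj norm_l2_sq)
  then show ?thesis by simp
qed

lemma cj_add: "cj (f + g) = cj f + cj g"
proof (rule l2_eqI)
  show "AE x in lborel. rep (cj (f + g)) x = rep (cj f + cj g) x"
    using rep_cj[of "f + g"] rep_cj[of f] rep_cj[of g] rep_add[of f g] rep_add[of "cj f" "cj g"]
    by eventually_elim simp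
qed

lemma cj_mul:
  assumes "bdd_meas m"
  shows "cj (mul m f) = mul (\<lambda>x. cnj (m x)) (cj f)"
proof (rule l2_eqI)
  show "AE x in lborel. rep (cj (mul m f)) x = rep (mul (\<lambda>x. cnj (m x)) (cj f)) x"
    using rep_cj[of "mul m f"] rep_cj[of f] rep_mul[OF assms, of f] rep_mul[OF bdd_meas_cnj[OF assms], of "cj f"]
    by eventually_elim simp
qed

text \<open>The inverse transform: conjugating before and after \<open>Fou\<close> changes the sign
  in the exponential. In this form linearity and isometry are inherited from
  \<open>Fou\<close>.\<close>

definition Fou' :: "l2 \<Rightarrow> l2" where
  "Fou' f = cj (Fou (cj f))"

lemma norm_Fou' [simp]: "norm (Fou' f) = norm f"
  by (simp add: Fou'_def)

lemma Fou'_add: "Fou' (f + g) = Fou' f + Fou' g"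
  by (simp add: Fou'_def cj_add Fou_add)

lemma Fou'_cscale: "Fou' (cscale c f) = cscale c (Fou' f)"
  by (simp add: Fou'_def cj_mul Fou_cscale)

lemma Fou'_scaleR: "Fou' (r *\<^sub>R f) = r *\<^sub>R Fou' f"
  using Fou'_cscale[of "of_real r" f] by (simp add: mul_of_real)

lemma bounded_linear_Fou': "bounded_linear Fou'"
  by (rule bounded_linear_intro[where K=1]) (auto simp: Fou'_add Fou'_scaleR)

lemma Fou'_diff: "Fou' (f - g) = Fou' f - Fou' g"
  by (rule linear_diff) (rule bounded_linear.linear[OF bounded_linear_Fou'])

lemma Fou_adjoint_cut: "inner (Fou (cut n f)) (cut m g) = inner (cut n f) (Fou' (cut m g))"
proof -
  define a where "a = (\<lambda>x. indicator {- real n..real n} x * rep f x)"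
  define b where "b = (\<lambda>x. indicator {- real m..real m} x * rep g x)"
  have a: "a \<in> L2" "integrable lborel a" and b: "b \<in> L2" "integrable lborel b"
    unfolding a_def b_def by (auto simp: trunc_L2 trunc_integrable)
  have cb: "integrable lborel (\<lambda>x. cnj (b x))" "(\<lambda>x. cnj (b x)) \<in> L2" using b by (auto simp: L2_cnj)
  have ca: "cut n f = cls a" and cm: "cut m g = cls b"
    unfolding a_def b_def cut_def mul_def by auto
  have "Fou' (cls b) = cls (\<lambda>x. cnj (fourier_integral (\<lambda>x. cnj (b x)) x))"
    unfolding Fou'_def using b cb by (simp add: cj_cls Fou_cls plancherel_L1)
  then have "inner (cls a) (Fou' (cls b)) = Re (LINT x|lborel. a x * fourier_integral (\<lambda>x. cnj (b x)) x)"
    using a cb by (simp add: inner_cls plancherel_L1 L2_cnj)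
  also have "\<dots> = Re (LINT x|lborel. fourier_integral a x * cnj (b x))"
    by (simp add: fourier_integral_multiplication[OF a(2) cb(1)])
  also have "\<dots> = inner (Fou (cls a)) (cls b)"
    using a b by (simp add: Fou_cls inner_cls plancherel_L1)
  finally show ?thesis unfolding ca cm by simp
qed

text \<open>The multiplication formula for truncations, passed to the limit. Since
  \<open>Fou\<close> and \<open>Fou'\<close> are both isometric, being adjoint to each other makes
  them mutually inverse; surjectivity needs no separate argument.\<close>

lemma Fou_adjoint: "inner (Fou f) g = inner f (Fou' g)"
proof (rule LIMSEQ_unique)
  show "(\<lambda>n. inner (Fou (cut n f)) (cut n g)) \<longlonglongrightarrow> inner (Fou f) g"
    by (intro tendsto_inner cut_tendsto bounded_linear.tendsto[OF bounded_linear_Fou])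
  show "(\<lambda>n. inner (Fou (cut n f)) (cut n g)) \<longlonglongrightarrow> inner f (Fou' g)"
    unfolding Fou_adjoint_cut
    by (intro tendsto_inner cut_tendsto bounded_linear.tendsto[OF bounded_linear_Fou'])
qed

lemma Fou_inner [simp]: "inner (Fou f) (Fou g) = inner f g"
  by (rule isometry_inner) (simp_all add: Fou_add)

lemma Fou'_inner [simp]: "inner (Fou' f) (Fou' g) = inner f g"
  by (rule isometry_inner) (simp_all add: Fou'_add)

lemma Fou'_Fou [simp]: "Fou' (Fou f) = f"
proof -
  have "inner g (Fou' (Fou f) - f) = 0" for g
    by (simp add: inner_diff_right flip: Fou_adjoint)
  from this[of "Fou' (Fou f) - f"] have "Fou' (Fou f) - f = 0" by simp
  then show ?thesis by simp
qed

lemma Fou_Fou' [simp]: "Fou (Fou' f) = f"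
proof -
  have "inner (Fou (Fou' f) - f) g = 0" for g
    by (simp add: inner_diff_left Fou_adjoint)
  from this[of "Fou (Fou' f) - f"] have "Fou (Fou' f) - f = 0" by simp
  then show ?thesis by simp
qed

lemma Fou_eq_iff [simp]: "Fou f = Fou g \<longleftrightarrow> f = g"
  by (metis Fou'_Fou)

lemma Fou'_cls:
  assumes "integrable lborel F" "F \<in> L2"
  shows "Fou' (cls F) = cls (\<lambda>x. fourier_integral F (- x))"
proof -
  have "cnj (fourier_integral (\<lambda>x. cnj (F x)) x) = fourier_integral F (- x)" for x
    unfolding fourier_integral_def by (simp add: exp_cnj flip: Bochner_Integration.integral_cnj)
  then show ?thesis
    unfolding Fou'_def using assms by (simp add: cj_cls Fou_cls plancherel_L1 L2_cnj)
qed

lemma bdd_meas_exp_i [simp]: "bdd_meas (\<lambda>x. exp (\<i> * of_real (g x)))" if [measurable]: "g \<in> borel_measurable borel" for g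
  by (rule bdd_measI[where B=1]) simp_all

lemma fourier_integral_shift:
  "fourier_integral (\<lambda>x. f (x + a)) \<xi> = exp (\<i> * of_real (a * \<xi>)) * fourier_integral f \<xi>"
proof -
  define h where "h x = exp (- (\<i> * of_real (\<xi> * x))) * f x" for x
  have "(LINT x|lborel. exp (- (\<i> * of_real (\<xi> * x))) * f (x + a)) = (LINT x|lborel. exp (\<i> * of_real (a * \<xi>)) * h (x + a))"
    by (rule Bochner_Integration.integral_cong) (simp_all add: h_def algebra_simps flip: exp_add)
  also have "\<dots> = exp (\<i> * of_real (a * \<xi>)) * (LINT x|lborel. h x)"
    using LINT_shift[of h a] by simp
  finally show ?thesis unfolding fourier_integral_def h_def by simp
qed

lemma Fou_tr: "Fou (tr a f) = mul (\<lambda>\<xi>. exp (\<i> * of_real (a * \<xi>))) (Fou f)"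
proof -
  have cut: "Fou (tr a (cut n f)) = mul (\<lambda>\<xi>. exp (\<i> * of_real (a * \<xi>))) (Fou (cut n f))" for n
  proof -
    define k where "k = (\<lambda>x. indicator {- real n..real n} x * rep f x)"
    have k: "k \<in> L2" "integrable lborel k" unfolding k_def by (auto simp: trunc_L2 trunc_integrable)
    have k': "integrable lborel (\<lambda>x. k (x + a))"
      using lborel_integrable_real_affine[OF k(2), of 1 a] by (simp add: add.commute)
    have "fourier_integral (\<lambda>x. k (x + a)) = (\<lambda>\<xi>. exp (\<i> * of_real (a * \<xi>)) * fourier_integral k \<xi>)"
      by (rule ext) (rule fourier_integral_shift)
    moreover have "cut n f = cls k" unfolding k_def cut_def mul_def ..
    ultimately show ?thesis
      using k k' by (simp add: tr_cls Fou_cls L2_shift mul_cls plancherel_L1 del: of_real_mult)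
  qed
  have "bounded_linear (tr a)"
  proof (rule bounded_linear_intro[where K=1])
    show "tr a (c *\<^sub>R f) = c *\<^sub>R tr a f" for c f
    proof -
      have "tr a (c *\<^sub>R f) = cls (\<lambda>x. c *\<^sub>R rep f (x + a))"
        unfolding scaleR_l2_def by (rule tr_cls) (simp add: scaleR_conv_of_real L2_cmult)
      also have "\<dots> = mul (\<lambda>x. of_real c) (tr a f)"
        unfolding tr_def by (subst mul_cls) (simp_all add: L2_shift scaleR_conv_of_real)
      finally show ?thesis by (simp add: mul_of_real)
    qed
  qed (simp_all add: tr_add)
  then have "(\<lambda>n. Fou (tr a (cut n f))) \<longlonglongrightarrow> Fou (tr a f)"
    by (intro bounded_linear.tendsto[OF bounded_linear_Fou] bounded_linear.tendsto[of "tr a"] cut_tendsto)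
  moreover have "(\<lambda>n. Fou (tr a (cut n f))) \<longlonglongrightarrow> mul (\<lambda>\<xi>. exp (\<i> * of_real (a * \<xi>))) (Fou f)"
    unfolding cut by (intro continuous_mul bdd_meas_exp_i bounded_linear.tendsto[OF bounded_linear_Fou] cut_tendsto) simp
  ultimately show ?thesis by (rule LIMSEQ_unique)
qed

subsection \<open>A smooth bump function\<close>

text \<open>Functions of this shape are closed under differentiation, with an explicit action on the
  polynomial. A single derivative rule therefore gives smoothness of all orders, also at the
  origin.\<close>

definition flat :: "real poly \<Rightarrow> real \<Rightarrow> real" where
  "flat p x = (if x \<le> 0 then 0 else poly p (1 / x) * exp (- (1 / x)))"

text \<open>With \<open>y = 1 / x\<close>, the derivative of \<open>p(y) exp(-y)\<close> with
  respect to \<open>x\<close> is \<open>y^2 (p(y) - p'(y)) exp(-y)\<close>; the two leading zeros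
  supply the factor \<open>y^2\<close>.\<close>

definition flat_deriv :: "real poly \<Rightarrow> real poly" where
  "flat_deriv p = pCons 0 (pCons 0 (p - pderiv p))"

lemma poly_exp_tendsto_0: "((\<lambda>y. poly p y * exp (- y)) \<longlongrightarrow> 0) (at_top :: real filter)"
proof -
  have "((\<lambda>y. \<Sum>i\<le>degree p. coeff p i * (y ^ i / exp y)) \<longlongrightarrow> (\<Sum>i\<le>degree p. coeff p i * 0)) at_top"
    by (intro tendsto_sum tendsto_mult tendsto_const tendsto_power_div_exp_0)
  then show ?thesis
    by (simp add: poly_altdef exp_minus sum_distrib_right divide_inverse mult.assoc)
qed

lemma flat_has_derivative: "(flat p has_real_derivative flat (flat_deriv p) x) (at x)"
proof -
  consider "x > 0" | "x < 0" | "x = 0" by linarith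
  then show ?thesis
  proof cases
    case 1
    have "((\<lambda>x. poly p (1 / x) * exp (- (1 / x))) has_real_derivative flat (flat_deriv p) x) (at x)"
      using 1 by (auto intro!: derivative_eq_intros simp: flat_def flat_deriv_def field_simps power2_eq_square)
    then show ?thesis
    proof (rule has_field_derivative_transform_within_open[where S="{0<..}"])
      show "poly p (1 / y) * exp (- (1 / y)) = flat p y" if "y \<in> {0<..}" for y
        using that by (simp add: flat_def)
    qed (use 1 in auto)
  next
    case 2
    have "((\<lambda>x. 0) has_real_derivative flat (flat_deriv p) x) (at x)"
      using 2 by (simp add: flat_def)
    then show ?thesis
    proof (rule has_field_derivative_transform_within_open[where S="{..<0}"])
      show "0 = flat p y" if "y \<in> {..<0}" for y
        using that by (simp add: flat_def)
    qed (use 2 in auto)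
  next
    case 3
    have right: "((\<lambda>h. flat p h / h) \<longlongrightarrow> 0) (at_right 0)"
    proof -
      \<comment> \<open>With \<open>y = 1 / h\<close> the difference quotient at 0 is
        \<open>y p(y) exp(-y)\<close>, hence the polynomial \<open>pCons 0 p\<close>.\<close>
      have "((\<lambda>y. poly (pCons 0 p) y * exp (- y)) \<longlongrightarrow> 0) at_top" by (rule poly_exp_tendsto_0)
      then have "((\<lambda>h. poly (pCons 0 p) (inverse h) * exp (- inverse h)) \<longlongrightarrow> 0) (at_right 0)"
        by (rule filterlim_compose) (rule filterlim_inverse_at_top_right)
      then show ?thesis
      proof (rule Lim_transform_eventually)
        show "\<forall>\<^sub>F h in at_right 0. poly (pCons 0 p) (inverse h) * exp (- inverse h) = flat p h / h"
          using eventually_at_right_less[of "0::real"]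
          by eventually_elim (simp add: flat_def field_simps)
      qed
    qed
    have left: "((\<lambda>h. flat p h / h) \<longlongrightarrow> 0) (at_left 0)"
    proof (rule tendsto_eventually)
      show "\<forall>\<^sub>F h in at_left 0. flat p h / h = 0"
        unfolding eventually_at_left_field by (auto simp: flat_def intro!: exI[of _ "-1"])
    qed
    have "((\<lambda>h. flat p h / h) \<longlongrightarrow> 0) (at 0)" using left right by (simp add: filterlim_at_split)
    then show ?thesis unfolding DERIV_def 3 by (simp add: flat_def)
  qed
qed

lemma flat_minus: "flat (- p) x = - flat p x"
  by (simp add: flat_def)

text \<open>Finite sums of products vanishing outside the unit interval: the smallest family that
  contains the bump and is stable under the product rule. Lists allow repeated terms.\<close>

definition flats :: "(real poly \<times> real poly) list \<Rightarrow> real \<Rightarrow> real" where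
  "flats xs x = (\<Sum>(p, q)\<leftarrow>xs. flat p x * flat q (1 - x))"

fun flats_deriv :: "(real poly \<times> real poly) list \<Rightarrow> (real poly \<times> real poly) list" where
  "flats_deriv [] = []"
| "flats_deriv ((p, q) # xs) = (flat_deriv p, q) # (p, - flat_deriv q) # flats_deriv xs"

lemma flats_has_derivative: "(flats xs has_real_derivative flats (flats_deriv xs) x) (at x)"
proof (induction xs rule: flats_deriv.induct)
  case 1
  then show ?case by (simp add: flats_def)
next
  case (2 p q xs)
  have q: "((\<lambda>x. flat q (1 - x)) has_real_derivative flat (- flat_deriv q) (1 - x)) (at x)"
  proof -
    have "((\<lambda>x. 1 - x) has_real_derivative -1) (at x)" by (auto intro!: derivative_eq_intros)
    from DERIV_chain2[OF flat_has_derivative[of q "1 - x"] this] show ?thesis by (simp add: flat_minus)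
  qed
  have "((\<lambda>x. flat p x * flat q (1 - x) + flats xs x) has_real_derivative
     (flat (flat_deriv p) x * flat q (1 - x) + flat (- flat_deriv q) (1 - x) * flat p x) + flats (flats_deriv xs) x) (at x)"
    by (intro DERIV_add DERIV_mult flat_has_derivative q 2)
  moreover have "flats ((p, q) # xs) = (\<lambda>x. flat p x * flat q (1 - x) + flats xs x)"
    by (simp add: flats_def fun_eq_iff)
  ultimately show ?case by (simp add: flats_def mult.commute add.assoc)
qed

definition bump :: "real \<Rightarrow> real" where
  "bump = flats [(1, 1)]"

lemma bump_eq: "bump x = flat 1 x * flat 1 (1 - x)"
  by (simp add: bump_def flats_def)

lemma bump_nonneg: "bump x \<ge> 0"
  by (simp add: bump_eq flat_def)

lemma bump_pos: "0 < x \<Longrightarrow> x < 1 \<Longrightarrow> bump x > 0"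
  by (simp add: bump_eq flat_def)

lemma bump_outside: "x \<le> 0 \<or> x \<ge> 1 \<Longrightarrow> bump x = 0"
  by (auto simp: bump_eq flat_def)

lemma test_function_bump: "test_function bump"
proof -
  have "(deriv ^^ k) bump = flats ((flats_deriv ^^ k) [(1, 1)])" for k
  proof (induction k)
    case 0
    then show ?case by (simp add: bump_def)
  next
    case (Suc k)
    have "deriv (flats xs) = flats (flats_deriv xs)" for xs
      by (rule ext) (rule DERIV_imp_deriv[OF flats_has_derivative])
    then show ?case by (simp add: Suc)
  qed
  then have "(deriv ^^ k) bump field_differentiable at x" for k x
    using flats_has_derivative by (auto simp: field_differentiable_def)
  moreover have "\<forall>x. \<bar>x\<bar> > 1 \<longrightarrow> bump x = 0" by (auto intro!: bump_outside)
  ultimately show ?thesis unfolding test_function_def by blast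
qed

subsection \<open>Test functions\<close>

lemma test_function_affine:
  assumes "test_function \<phi>" "c \<noteq> 0"
  shows "test_function (\<lambda>x. \<phi> (c * x + b))" "deriv (\<lambda>x. \<phi> (c * x + b)) x = c * deriv \<phi> (c * x + b)"
proof -
  have d: "((deriv ^^ k) \<phi> has_real_derivative (deriv ^^ Suc k) \<phi> x) (at x)" for k x
    using assms(1) unfolding test_function_def by (simp add: DERIV_deriv_iff_field_differentiable)
  have d': "((\<lambda>x. (deriv ^^ k) \<phi> (c * x + b)) has_real_derivative c * (deriv ^^ Suc k) \<phi> (c * x + b)) (at x)" for k x
  proof -
    have "((\<lambda>x. c * x + b) has_real_derivative c) (at x)" by (auto intro!: derivative_eq_intros)
    from DERIV_chain2[OF d[of k "c * x + b"] this] show ?thesis by (simp add: mult.commute)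
  qed
  have k: "(deriv ^^ k) (\<lambda>x. \<phi> (c * x + b)) = (\<lambda>x. c ^ k * (deriv ^^ k) \<phi> (c * x + b))" for k
  proof (induction k)
    case (Suc k)
    have "deriv (\<lambda>x. c ^ k * (deriv ^^ k) \<phi> (c * x + b)) x = c ^ k * (c * (deriv ^^ Suc k) \<phi> (c * x + b))" for x
      by (intro DERIV_imp_deriv DERIV_cmult d')
    then show ?case by (simp add: Suc fun_eq_iff)
  qed simp
  have "(deriv ^^ k) (\<lambda>x. \<phi> (c * x + b)) field_differentiable at x" for k x
    unfolding k field_differentiable_def using DERIV_cmult[OF d'] by blast
  moreover obtain R where R: "\<And>x. \<bar>x\<bar> > R \<Longrightarrow> \<phi> x = 0"
    using assms(1) unfolding test_function_def by blast
  have "\<phi> (c * x + b) = 0" if "\<bar>x\<bar> > (\<bar>R\<bar> + \<bar>b\<bar>) / \<bar>c\<bar>" for x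
  proof (rule R)
    have "\<bar>R\<bar> + \<bar>b\<bar> < \<bar>c\<bar> * \<bar>x\<bar>" using that assms(2) by (simp add: field_simps)
    moreover have "\<bar>c\<bar> * \<bar>x\<bar> \<le> \<bar>c * x + b\<bar> + \<bar>b\<bar>" unfolding abs_mult[symmetric] by linarith
    ultimately show "R < \<bar>c * x + b\<bar>" by linarith
  qed
  ultimately show "test_function (\<lambda>x. \<phi> (c * x + b))" unfolding test_function_def by blast
  show "deriv (\<lambda>x. \<phi> (c * x + b)) x = c * deriv \<phi> (c * x + b)"
    using d'[of 0] by (intro DERIV_imp_deriv) simp
qed

lemma test_function_DERIV: "test_function \<phi> \<Longrightarrow> (\<phi> has_real_derivative deriv \<phi> x) (at x)"
proof -
  assume "test_function \<phi>"
  then have "(deriv ^^ 0) \<phi> field_differentiable at x" unfolding test_function_def by blast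
  then show ?thesis by (simp add: DERIV_deriv_iff_field_differentiable)
qed

lemma test_function_continuous:
  assumes "test_function \<phi>"
  shows "continuous_on A \<phi>" "continuous_on A (deriv \<phi>)"
proof -
  have "(deriv ^^ 1) \<phi> field_differentiable at x" for x
    using assms unfolding test_function_def by blast
  then have "isCont (deriv \<phi>) x" for x
    using field_differentiable_imp_continuous_at by force
  then show "continuous_on A (deriv \<phi>)" by (simp add: continuous_at_imp_continuous_on)
  show "continuous_on A \<phi>"
    using DERIV_isCont[OF test_function_DERIV[OF assms]] by (simp add: continuous_at_imp_continuous_on)
qed

lemma test_function_support:
  assumes "test_function \<phi>"
  obtains R where "R > 0" "\<And>x. x \<notin> {-R..R} \<Longrightarrow> \<phi> x = 0" "\<And>x. x \<notin> {-R..R} \<Longrightarrow> deriv \<phi> x = 0" "\<phi> R = 0" "\<phi> (-R) = 0"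
proof -
  obtain r where r: "\<And>x. \<bar>x\<bar> > r \<Longrightarrow> \<phi> x = 0" using assms unfolding test_function_def by blast
  have "deriv \<phi> x = 0" if "\<bar>x\<bar> > \<bar>r\<bar>" for x
  proof -
    have "((\<lambda>x. 0) has_real_derivative 0) (at x)" by simp
    then have "(\<phi> has_real_derivative 0) (at x)"
    proof (rule has_field_derivative_transform_within_open[where S="- {- \<bar>r\<bar>..\<bar>r\<bar>}"])
      show "0 = \<phi> y" if "y \<in> - {- \<bar>r\<bar>..\<bar>r\<bar>}" for y
      proof -
        have "\<bar>y\<bar> > r" using that by auto
        then show ?thesis using r by simp
      qed
    qed (use that in \<open>auto simp: open_Compl\<close>)
    then show ?thesis by (rule DERIV_imp_deriv)
  qed
  \<comment> \<open>The added 1 puts the endpoints themselves outside the support, so that boundary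
    terms in the integration by parts vanish.\<close>
  then show thesis
    using r by (intro that[of "\<bar>r\<bar> + 1"]) (auto simp: not_le abs_if split: if_splits)
qed

lemma continuous_support_integrable:
  fixes f :: "real \<Rightarrow> complex"
  assumes "continuous_on UNIV f" "\<And>x. x \<notin> {-R..R} \<Longrightarrow> f x = 0"
  shows "integrable lborel f" "f \<in> L2"
proof -
  have [measurable]: "f \<in> borel_measurable borel" using assms(1) by (rule borel_measurable_continuous_onI)
  have "compact (f ` {-R..R})" by (intro compact_continuous_image continuous_on_subset[OF assms(1)]) auto
  then obtain B where B: "\<And>x. x \<in> {-R..R} \<Longrightarrow> norm (f x) \<le> B"
    using compact_imp_bounded bounded_iff by (metis imageI)
  have le: "norm (f x) \<le> \<bar>B\<bar> * indicator {-R..R} x" for x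
    using B[of x] assms(2)[of x] by (auto simp: indicator_def)
  show "integrable lborel f"
    by (rule Bochner_Integration.integrable_bound[where f="\<lambda>x. \<bar>B\<bar> * indicator {-R..R} x"]) (use le in auto)
  show "f \<in> L2"
    by (rule L2_dominated[where w="\<lambda>x. (\<bar>B\<bar> * indicator {-R..R} x)\<^sup>2"]) (use le in \<open>auto intro: power_mono simp del: power_mult_distrib\<close>)
qed

lemma test_function_L2:
  assumes "test_function \<phi>"
  shows "(\<lambda>x. complex_of_real (\<phi> x)) \<in> L2" "integrable lborel (\<lambda>x. complex_of_real (\<phi> x))"
    "(\<lambda>x. complex_of_real (deriv \<phi> x)) \<in> L2" "integrable lborel (\<lambda>x. complex_of_real (deriv \<phi> x))"
proof -
  obtain R where R: "R > 0" "\<And>x. x \<notin> {-R..R} \<Longrightarrow> \<phi> x = 0" "\<And>x. x \<notin> {-R..R} \<Longrightarrow> deriv \<phi> x = 0" "\<phi> R = 0" "\<phi> (-R) = 0"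
    using test_function_support[OF assms] by blast
  show "(\<lambda>x. complex_of_real (\<phi> x)) \<in> L2" "integrable lborel (\<lambda>x. complex_of_real (\<phi> x))"
    by (rule continuous_support_integrable[where R=R]; use R test_function_continuous(1)[OF assms, of UNIV] in \<open>simp add: continuous_on_of_real\<close>)+
  show "(\<lambda>x. complex_of_real (deriv \<phi> x)) \<in> L2" "integrable lborel (\<lambda>x. complex_of_real (deriv \<phi> x))"
    by (rule continuous_support_integrable[where R=R]; use R test_function_continuous(2)[OF assms, of UNIV] in \<open>simp add: continuous_on_of_real\<close>)+
qed

text \<open>Integration by parts: \<open>F'\<close> is the derivative of
  \<open>exp(-i \<xi> x) \<phi>(x)\<close>, and its integral over an interval containing the support
  is a difference of two vanishing boundary values.\<close>

lemma fourier_integral_deriv: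
  assumes "test_function \<phi>"
  shows "fourier_integral (\<lambda>x. complex_of_real (deriv \<phi> x)) \<xi> = \<i> * of_real \<xi> * fourier_integral (\<lambda>x. complex_of_real (\<phi> x)) \<xi>"
proof -
  obtain R where R: "R > 0" "\<And>x. x \<notin> {-R..R} \<Longrightarrow> \<phi> x = 0" "\<And>x. x \<notin> {-R..R} \<Longrightarrow> deriv \<phi> x = 0" "\<phi> R = 0" "\<phi> (-R) = 0"
    using test_function_support[OF assms] by blast
  define e where "e x = exp (- (\<i> * complex_of_real (\<xi> * x)))" for x
  define F where "F x = e x * complex_of_real (\<phi> x)" for x
  define F' where "F' x = e x * complex_of_real (deriv \<phi> x) - \<i> * of_real \<xi> * (e x * complex_of_real (\<phi> x))" for x
  have e': "(e has_vector_derivative - (\<i> * of_real \<xi>) * e x) (at x within A)" for x A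
  proof -
    have "e = (\<lambda>x. exp (x *\<^sub>R (- (\<i> * of_real \<xi>))))"
      by (simp add: e_def fun_eq_iff scaleR_conv_of_real mult_ac)
    then show ?thesis
      using exp_scaleR_has_vector_derivative_right[of "- (\<i> * of_real \<xi>)" x A] by (simp add: mult.commute)
  qed
  have ce: "continuous_on A e" for A unfolding e_def by (intro continuous_intros)
  have "(F has_vector_derivative F' x) (at x within A)" for x A
  proof -
    have "((\<lambda>x. complex_of_real (\<phi> x)) has_vector_derivative complex_of_real (deriv \<phi> x)) (at x within A)"
      using test_function_DERIV[OF assms, of x]
      by (intro has_vector_derivative_of_real) (auto simp: has_real_derivative_iff_has_vector_derivative intro: has_vector_derivative_at_within)
    from has_vector_derivative_mult[OF e' this] show ?thesis
      unfolding F_def F'_def by (simp add: algebra_simps)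
  qed
  moreover have cF': "continuous_on A F'" for A
    unfolding F'_def by (intro continuous_on_diff continuous_on_mult continuous_on_const continuous_on_of_real ce test_function_continuous[OF assms])
  ultimately have "(LINT x|lborel. indicator {-R..R} x *\<^sub>R F' x) = F R - F (-R)"
    using R(1) by (intro integral_FTC_Icc) auto
  moreover have "(\<lambda>x. indicator {-R..R} x *\<^sub>R F' x) = F'"
    using R by (auto simp: fun_eq_iff F'_def indicator_def)
  ultimately have "(LINT x|lborel. F' x) = 0" using R by (simp add: F_def)
  moreover have "integrable lborel (\<lambda>x. e x * complex_of_real (deriv \<phi> x))" "integrable lborel (\<lambda>x. e x * complex_of_real (\<phi> x))"
    unfolding e_def by (intro integrable_exp_i test_function_L2[OF assms])+
  ultimately have "(LINT x|lborel. e x * complex_of_real (deriv \<phi> x)) = \<i> * of_real \<xi> * (LINT x|lborel. e x * complex_of_real (\<phi> x))"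
    unfolding F'_def by simp
  then show ?thesis unfolding fourier_integral_def e_def by simp
qed

subsection \<open>Weak derivatives on the Fourier side\<close>

definition cinner :: "l2 \<Rightarrow> l2 \<Rightarrow> complex" where
  "cinner f g = (LINT x|lborel. rep f x * cnj (rep g x))"

lemma cinner_cls:
  assumes [measurable]: "f \<in> L2" "g \<in> L2"
  shows "cinner (cls f) (cls g) = (LINT x|lborel. f x * cnj (g x))"
  unfolding cinner_def
proof (rule integral_cong_AE)
  show "AE x in lborel. rep (cls f) x * cnj (rep (cls g) x) = f x * cnj (g x)"
    using rep_cls[OF assms(1)] rep_cls[OF assms(2)] by eventually_elim simp
qed simp_all

text \<open>The imaginary part of the Hermitian product is the real product with
  \<open>\<i> g\<close>. Identities for the real product therefore extend to \<open>cinner\<close>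
  as soon as the operators involved commute with \<open>cscale \<i>\<close>.\<close>

lemma cinner_eq: "cinner f g = Complex (inner f g) (inner f (cscale \<i> g))"
proof (rule complex_eqI)
  show "Re (cinner f g) = Re (Complex (inner f g) (inner f (cscale \<i> g)))"
    by (simp add: cinner_def inner_l2_def)
  have "inner f (cscale \<i> g) = Re (LINT x|lborel. rep f x * cnj (\<i> * rep g x))"
    using inner_cls[OF rep_L2[of f] mul_L2[OF bdd_meas_const[of \<i>] rep_L2[of g]]] by (simp add: mul_def)
  also have "(LINT x|lborel. rep f x * cnj (\<i> * rep g x)) = (LINT x|lborel. - \<i> * (rep f x * cnj (rep g x)))"
    by (rule Bochner_Integration.integral_cong) simp_all
  also have "\<dots> = - \<i> * cinner f g"
    unfolding cinner_def by (rule integral_mult_right_zero)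
  finally show "Im (cinner f g) = Im (Complex (inner f g) (inner f (cscale \<i> g)))" by simp
qed

lemma cinner_Fou [simp]: "cinner (Fou f) (Fou g) = cinner f g"
  unfolding cinner_eq by (simp flip: Fou_cscale)

lemma cinner_Fou' [simp]: "cinner (Fou' f) (Fou' g) = cinner f g"
  unfolding cinner_eq by (simp flip: Fou'_cscale)

lemma fourier_test_bounded:
  assumes "test_function \<phi>"
  shows "bdd_meas (fourier_integral (\<lambda>x. complex_of_real (\<phi> x)))"
    "bdd_meas (\<lambda>\<xi>. \<i> * of_real \<xi> * fourier_integral (\<lambda>x. complex_of_real (\<phi> x)) \<xi>)"
    "fourier_integral (\<lambda>x. complex_of_real (\<phi> x)) \<in> L2"
    "(\<lambda>\<xi>. \<i> * of_real \<xi> * fourier_integral (\<lambda>x. complex_of_real (\<phi> x)) \<xi>) \<in> L2"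
proof -
  note t = test_function_L2[OF assms]
  have "fourier_integral (\<lambda>x. complex_of_real (deriv \<phi> x)) = (\<lambda>\<xi>. \<i> * of_real \<xi> * fourier_integral (\<lambda>x. complex_of_real (\<phi> x)) \<xi>)"
    by (rule ext) (rule fourier_integral_deriv[OF assms])
  then have *: "(\<lambda>\<xi>. \<i> * of_real \<xi> * fourier_integral (\<lambda>x. complex_of_real (\<phi> x)) \<xi>)
    = fourier_integral (\<lambda>x. complex_of_real (deriv \<phi> x))" by simp
  show "bdd_meas (\<lambda>\<xi>. \<i> * of_real \<xi> * fourier_integral (\<lambda>x. complex_of_real (\<phi> x)) \<xi>)"
    unfolding * by (rule bdd_measI[OF _ fourier_integral_bound[OF t(4)]]) (rule L2_measurable[OF plancherel_L1(1)[OF t(4,3)]])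
  show "(\<lambda>\<xi>. \<i> * of_real \<xi> * fourier_integral (\<lambda>x. complex_of_real (\<phi> x)) \<xi>) \<in> L2"
    unfolding * by (rule plancherel_L1(1)[OF t(4,3)])
  show "bdd_meas (fourier_integral (\<lambda>x. complex_of_real (\<phi> x)))"
    by (rule bdd_measI[OF _ fourier_integral_bound[OF t(2)]]) (rule L2_measurable[OF plancherel_L1(1)[OF t(2,1)]])
  show "fourier_integral (\<lambda>x. complex_of_real (\<phi> x)) \<in> L2" by (rule plancherel_L1(1)[OF t(2,1)])
qed

lemma weak_pairing:
  assumes f: "f \<in> L2" and \<phi>: "test_function \<phi>"
  shows "(LINT x|lborel. f x * of_real (\<phi> x))
      = (LINT \<xi>|lborel. rep (Fou (cls f)) \<xi> * cnj (fourier_integral (\<lambda>x. of_real (\<phi> x)) \<xi>))"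
    and "(LINT x|lborel. f x * of_real (deriv \<phi> x))
      = (LINT \<xi>|lborel. rep (Fou (cls f)) \<xi> * cnj (\<i> * of_real \<xi> * fourier_integral (\<lambda>x. of_real (\<phi> x)) \<xi>))"
proof -
  note t = test_function_L2[OF \<phi>]
  have *: "(LINT x|lborel. f x * of_real (\<psi> x)) = (LINT \<xi>|lborel. rep (Fou (cls f)) \<xi> * cnj (fourier_integral (\<lambda>x. of_real (\<psi> x)) \<xi>))"
    if "(\<lambda>x. complex_of_real (\<psi> x)) \<in> L2" "integrable lborel (\<lambda>x. complex_of_real (\<psi> x))" for \<psi> :: "real \<Rightarrow> real"
  proof -
    have "(LINT x|lborel. f x * of_real (\<psi> x)) = cinner (cls f) (cls (\<lambda>x. of_real (\<psi> x)))"
      using f that by (simp add: cinner_cls)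
    also have "\<dots> = cinner (Fou (cls f)) (Fou (cls (\<lambda>x. of_real (\<psi> x))))" by simp
    also have "\<dots> = cinner (cls (rep (Fou (cls f)))) (cls (fourier_integral (\<lambda>x. of_real (\<psi> x))))"
      using that by (simp add: Fou_cls)
    finally show ?thesis using that by (subst (asm) cinner_cls) (simp_all add: plancherel_L1)
  qed
  show "(LINT x|lborel. f x * of_real (\<phi> x))
      = (LINT \<xi>|lborel. rep (Fou (cls f)) \<xi> * cnj (fourier_integral (\<lambda>x. of_real (\<phi> x)) \<xi>))"
    by (rule *[OF t(1,2)])
  show "(LINT x|lborel. f x * of_real (deriv \<phi> x))
      = (LINT \<xi>|lborel. rep (Fou (cls f)) \<xi> * cnj (\<i> * of_real \<xi> * fourier_integral (\<lambda>x. of_real (\<phi> x)) \<xi>))"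
    unfolding *[OF t(3,4)] fourier_integral_deriv[OF \<phi>] ..
qed

text \<open>The dilated bump lives on \<open>[0, 1/n]\<close>, where
  \<open>\<bar>\<xi> x\<bar> \<le> 1 < pi / 2\<close>; there the cosine is positive, so the real
  part of the transform is the integral of a nonnegative function that is positive on an
  interval.\<close>

lemma fourier_bump_nonzero:
  assumes "n > 0" "\<bar>\<xi>\<bar> \<le> n"
  shows "fourier_integral (\<lambda>x. complex_of_real (bump (n * x + 0))) \<xi> \<noteq> 0"
proof
  assume "fourier_integral (\<lambda>x. complex_of_real (bump (n * x + 0))) \<xi> = 0"
  then have 0: "(LINT x|lborel. exp (- (\<i> * of_real (\<xi> * x))) * complex_of_real (bump (n * x + 0))) = 0"
    unfolding fourier_integral_def by simp
  have t: "test_function (\<lambda>x. bump (n * x + 0))"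
    using test_function_affine(1)[OF test_function_bump, of n 0] assms by simp
  have int: "integrable lborel (\<lambda>x. exp (- (\<i> * of_real (\<xi> * x))) * complex_of_real (bump (n * x + 0)))"
    by (rule integrable_exp_i(1)) (rule test_function_L2(2)[OF t])
  have Re: "Re (exp (- (\<i> * of_real (\<xi> * x))) * complex_of_real (bump (n * x + 0))) = cos (\<xi> * x) * bump (n * x)" for x
    by (simp add: Re_exp)
  have "(LINT x|lborel. cos (\<xi> * x) * bump (n * x)) = 0"
    using Re_LINT[OF int] unfolding 0 Re by simp
  moreover have int': "integrable lborel (\<lambda>x. cos (\<xi> * x) * bump (n * x))"
    using integrable_Re[OF int] unfolding Re .
  have cospos: "cos (\<xi> * x) > 0" if "0 < n * x" "n * x < 1" for x
  proof (rule cos_gt_zero_pi)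
    have "x > 0" using that assms(1) by (simp add: zero_less_mult_iff)
    have "\<bar>\<xi> * x\<bar> \<le> n * x" using assms \<open>x > 0\<close> by (simp add: abs_mult mult_right_mono)
    then show "- (pi / 2) < \<xi> * x" "\<xi> * x < pi / 2" using that pi_gt3 by auto
  qed
  have "cos (\<xi> * x) * bump (n * x) \<ge> 0" for x
    using cospos[of x] bump_outside[of "n * x"] bump_nonneg[of "n * x"]
    by (cases "0 < n * x \<and> n * x < 1") (auto simp: not_less)
  ultimately have "AE x in lborel. cos (\<xi> * x) * bump (n * x) = 0"
    using integral_nonneg_eq_0_iff_AE[OF int'] by simp
  then have "AE x in lborel. x \<notin> {0<..<1/n}"
  proof eventually_elim
    case (elim x)
    show ?case
    proof
      assume "x \<in> {0<..<1/n}"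
      then have "0 < n * x" "n * x < 1" using assms(1) by (auto simp: field_simps)
      then show False using elim cospos[of x] bump_pos[of "n * x"] by simp
    qed
  qed
  then have "emeasure lborel {0<..<1/n} = 0" by (subst (asm) AE_iff_measurable[where N="{0<..<1/n}"]) auto
  then show False using assms(1) by simp
qed

text \<open>For the direct implication, translates of one test function determine an integrable function, and
dilating the bump keeps its Fourier transform from vanishing at a given frequency.\<close>
theorem weak_derivative_iff_Fourier:
  assumes f: "f \<in> L2" and g: "g \<in> L2"
  shows "weak_derivative f g \<longleftrightarrow> (AE \<xi> in lborel. rep (Fou (cls g)) \<xi> = \<i> * of_real \<xi> * rep (Fou (cls f)) \<xi>)"
proof
  assume *: "AE \<xi> in lborel. rep (Fou (cls g)) \<xi> = \<i> * of_real \<xi> * rep (Fou (cls f)) \<xi>"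
  show "weak_derivative f g"
    unfolding weak_derivative_def
  proof (intro allI impI)
    fix \<phi> assume \<phi>: "test_function \<phi>"
    note fourier_test_bounded[OF \<phi>, measurable]
    let ?p = "fourier_integral (\<lambda>x. complex_of_real (\<phi> x))"
    have [measurable]: "?p \<in> borel_measurable borel" using fourier_test_bounded(3)[OF \<phi>] by simp
    have "(LINT x|lborel. f x * of_real (deriv \<phi> x)) = (LINT \<xi>|lborel. - (rep (Fou (cls g)) \<xi> * cnj (?p \<xi>)))"
      unfolding weak_pairing(2)[OF f \<phi>]
    proof (rule integral_cong_AE)
      show "AE \<xi> in lborel. rep (Fou (cls f)) \<xi> * cnj (\<i> * of_real \<xi> * ?p \<xi>) = - (rep (Fou (cls g)) \<xi> * cnj (?p \<xi>))"
        using * by eventually_elim simp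
    qed measurable
    then show "(LINT x|lborel. f x * of_real (deriv \<phi> x)) = - (LINT x|lborel. g x * of_real (\<phi> x))"
      unfolding weak_pairing(1)[OF g \<phi>] by simp
  qed
next
  assume w: "weak_derivative f g"
  define F where "F = rep (Fou (cls f))"
  define G where "G = rep (Fou (cls g))"
  have FG [measurable]: "F \<in> L2" "G \<in> L2" unfolding F_def G_def by simp_all
  have "AE \<xi> in lborel. (G \<xi> - \<i> * of_real \<xi> * F \<xi>) * cnj (fourier_integral (\<lambda>x. complex_of_real (bump (n * x + 0))) \<xi>) = 0"
    if "n > 0" for n
  proof -
    define \<eta> where "\<eta> x = bump (n * x + 0)" for x
    have \<eta>: "test_function \<eta>"
      unfolding \<eta>_def using test_function_affine(1)[OF test_function_bump, of n 0] \<open>n > 0\<close> by simp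
    define p where "p = fourier_integral (\<lambda>x. complex_of_real (\<eta> x))"
    note p = fourier_test_bounded[OF \<eta>, folded p_def]
    \<comment> \<open>Its Fourier integral at \<open>a\<close> is, up to a constant, the weak
      derivative identity tested with the translate of \<open>\<eta>\<close> by \<open>a\<close>. It
      vanishes for all \<open>a\<close>, and Plancherel gives \<open>H = 0\<close> almost
      everywhere.\<close>
    define H where "H \<xi> = F \<xi> * cnj (\<i> * of_real \<xi> * p \<xi>) + G \<xi> * cnj (p \<xi>)" for \<xi>
    have H2: "H \<in> L2"
      unfolding H_def using mul_L2[OF bdd_meas_cnj[OF p(2)] FG(1)] mul_L2[OF bdd_meas_cnj[OF p(1)] FG(2)]
      by (intro L2_add) (simp_all add: mult.commute)
    have i1: "integrable lborel (\<lambda>\<xi>. F \<xi> * cnj (\<i> * of_real \<xi> * p \<xi>))" by (rule L2_mult_integrable[OF FG(1) L2_cnj[OF p(4)]])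
    have i2: "integrable lborel (\<lambda>\<xi>. G \<xi> * cnj (p \<xi>))" by (rule L2_mult_integrable[OF FG(2) L2_cnj[OF p(3)]])
    have H1: "integrable lborel H" unfolding H_def by (rule Bochner_Integration.integrable_add[OF i1 i2])
    have "fourier_integral H a = 0" for a
    proof -
      have ta: "test_function (\<lambda>x. \<eta> (1 * x + a))" by (rule test_function_affine(1)[OF \<eta>]) simp
      have pa: "fourier_integral (\<lambda>x. complex_of_real (\<eta> (1 * x + a))) \<xi> = exp (\<i> * of_real (a * \<xi>)) * p \<xi>" for \<xi>
        using fourier_integral_shift[of "\<lambda>x. complex_of_real (\<eta> x)" a \<xi>] by (simp add: p_def)
      have "(LINT x|lborel. f x * of_real (deriv (\<lambda>x. \<eta> (1 * x + a)) x)) = - (LINT x|lborel. g x * of_real (\<eta> (1 * x + a)))"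
        using w ta unfolding weak_derivative_def by blast
      then have "(LINT \<xi>|lborel. F \<xi> * cnj (\<i> * of_real \<xi> * (exp (\<i> * of_real (a * \<xi>)) * p \<xi>)))
        + (LINT \<xi>|lborel. G \<xi> * cnj (exp (\<i> * of_real (a * \<xi>)) * p \<xi>)) = 0"
        unfolding weak_pairing(1)[OF g ta] weak_pairing(2)[OF f ta] pa F_def[symmetric] G_def[symmetric] by simp
      moreover have "exp (- (\<i> * of_real (a * \<xi>))) * H \<xi> =
         F \<xi> * cnj (\<i> * of_real \<xi> * (exp (\<i> * of_real (a * \<xi>)) * p \<xi>)) + G \<xi> * cnj (exp (\<i> * of_real (a * \<xi>)) * p \<xi>)" for \<xi>
        by (simp add: H_def exp_cnj algebra_simps)
      moreover have "integrable lborel (\<lambda>\<xi>. F \<xi> * cnj (\<i> * of_real \<xi> * (exp (\<i> * of_real (a * \<xi>)) * p \<xi>)))"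
        "integrable lborel (\<lambda>\<xi>. G \<xi> * cnj (exp (\<i> * of_real (a * \<xi>)) * p \<xi>))"
        using integrable_exp_i(1)[OF i1, of a] integrable_exp_i(1)[OF i2, of a] by (simp_all add: exp_cnj mult_ac)
      ultimately have "(LINT \<xi>|lborel. exp (- (\<i> * of_real (a * \<xi>))) * H \<xi>) = 0"
        by (simp only: Bochner_Integration.integral_add)
      then show ?thesis unfolding fourier_integral_def by simp
    qed
    then have "fourier_integral H = (\<lambda>x. 0)" by (rule ext)
    then have "cls H = 0" using plancherel_L1(2)[OF H1 H2] by (simp add: cls_zero)
    then have "AE \<xi> in lborel. H \<xi> = 0" using cls_eq_iff[OF H2 L2_zero] by (simp add: cls_zero)
    then show ?thesis
      unfolding H_def \<eta>_def[symmetric] p_def[symmetric] by eventually_elim (simp add: algebra_simps)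
  qed
  then have "AE \<xi> in lborel. \<forall>n::nat. n > 0 \<longrightarrow> (G \<xi> - \<i> * of_real \<xi> * F \<xi>) * cnj (fourier_integral (\<lambda>x. complex_of_real (bump (real n * x + 0))) \<xi>) = 0"
    unfolding AE_all_countable by (auto intro: AE_impI)
  then show "AE \<xi> in lborel. rep (Fou (cls g)) \<xi> = \<i> * of_real \<xi> * rep (Fou (cls f)) \<xi>"
    unfolding F_def[symmetric] G_def[symmetric]
  proof eventually_elim
    case (elim \<xi>)
    obtain m where m: "\<bar>\<xi>\<bar> \<le> real m" using real_arch_simple by blast
    then have "\<bar>\<xi>\<bar> \<le> real (Suc m)" by simp
    then have "fourier_integral (\<lambda>x. complex_of_real (bump (real (Suc m) * x + 0))) \<xi> \<noteq> 0"
      by (intro fourier_bump_nonzero) simp_all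
    then show ?case using elim[rule_format, of "Suc m"] by simp
  qed
qed

subsection \<open>Fourier coordinates on the Sobolev space\<close>

text \<open>If \<open>g\<close> is the coordinate of \<open>f\<close>, the transforms of
  \<open>f\<close> and of its derivative are \<open>lam * g\<close> and \<open>dmu * g\<close>. Both
  symbols are bounded and the squares of their moduli add up to 1, so the derivative becomes a
  bounded operator and the H^1 norm of \<open>f\<close> becomes the norm of
  \<open>g\<close>.\<close>

definition lam :: "real \<Rightarrow> complex" where
  "lam \<xi> = of_real (1 / sqrt (1 + \<xi>\<^sup>2))"

definition dmu :: "real \<Rightarrow> complex" where
  "dmu \<xi> = \<i> * of_real (\<xi> / sqrt (1 + \<xi>\<^sup>2))"

abbreviation Lam :: "l2 \<Rightarrow> l2" where "Lam \<equiv> mul lam"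
abbreviation Dm :: "l2 \<Rightarrow> l2" where "Dm \<equiv> mul dmu"

lemma jap_pos: "0 < 1 + (\<xi>::real)\<^sup>2" "1 + (\<xi>::real)\<^sup>2 \<noteq> 0"
  using zero_le_power2[of \<xi>] by linarith+

lemma lam_dmu_square: "(norm (lam \<xi>))\<^sup>2 + (norm (dmu \<xi>))\<^sup>2 = 1"
  using jap_pos[of \<xi>] by (simp add: lam_def dmu_def norm_mult norm_divide power_divide add_divide_distrib[symmetric])

lemma lam_le: "norm (lam \<xi>) \<le> 1" "norm (dmu \<xi>) \<le> 1"
proof -
  have "(norm (lam \<xi>))\<^sup>2 \<le> 1\<^sup>2" "(norm (dmu \<xi>))\<^sup>2 \<le> 1\<^sup>2"
    using lam_dmu_square[of \<xi>] zero_le_power2[of "norm (lam \<xi>)"] zero_le_power2[of "norm (dmu \<xi>)"]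
    unfolding one_power2 by linarith+
  then show "norm (lam \<xi>) \<le> 1" "norm (dmu \<xi>) \<le> 1" by (auto intro: power2_le_imp_le)
qed

lemma lam_nonzero: "lam \<xi> \<noteq> 0"
  using jap_pos[of \<xi>] by (simp add: lam_def)

lemma bdd_meas_lam [simp]: "bdd_meas lam"
  by (rule bdd_measI[OF _ lam_le(1)]) (simp add: lam_def[abs_def])

lemma lam_measurable [measurable]: "lam \<in> borel_measurable borel"
  by (rule bdd_meas_measurable[OF bdd_meas_lam])

lemma bdd_meas_dmu [simp]: "bdd_meas dmu"
  by (rule bdd_measI[OF _ lam_le(2)]) (simp add: dmu_def[abs_def])

lemma cnj_lam [simp]: "cnj (lam \<xi>) = lam \<xi>"
  by (simp add: lam_def)

lemma lam_dmu_split: "lam \<xi> * lam \<xi> + cnj (dmu \<xi>) * dmu \<xi> = 1"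
proof -
  have "lam \<xi> * lam \<xi> = complex_of_real ((norm (lam \<xi>))\<^sup>2)"
    using complex_norm_square[of "lam \<xi>"] unfolding cnj_lam by (rule sym)
  moreover have "cnj (dmu \<xi>) * dmu \<xi> = complex_of_real ((norm (dmu \<xi>))\<^sup>2)"
    unfolding mult.commute[of "cnj _"] by (rule complex_norm_square[symmetric])
  ultimately show ?thesis by (simp only: lam_dmu_square of_real_1 flip: of_real_add)
qed

lemma inner_Lam_Dm: "inner (Lam f) (Lam g) + inner (Dm f) (Dm g) = inner f g"
proof -
  have "mul (\<lambda>\<xi>. lam \<xi> * lam \<xi>) g + mul (\<lambda>\<xi>. cnj (dmu \<xi>) * dmu \<xi>) g
     = mul (\<lambda>\<xi>. lam \<xi> * lam \<xi> + cnj (dmu \<xi>) * dmu \<xi>) g"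
    by (rule mul_plus[symmetric]) simp_all
  also have "\<dots> = g" unfolding lam_dmu_split by simp
  finally have *: "mul (\<lambda>\<xi>. lam \<xi> * lam \<xi>) g + mul (\<lambda>\<xi>. cnj (dmu \<xi>) * dmu \<xi>) g = g" .
  have "inner (Lam f) (Lam g) = inner f (mul (\<lambda>\<xi>. lam \<xi> * lam \<xi>) g)"
    by (simp add: inner_mul_left mul_mul)
  moreover have "inner (Dm f) (Dm g) = inner f (mul (\<lambda>\<xi>. cnj (dmu \<xi>) * dmu \<xi>) g)"
    by (simp add: inner_mul_left mul_mul)
  ultimately show ?thesis by (metis * inner_add_right)
qed

lemma norm_Lam_Dm: "(norm (Lam g))\<^sup>2 + (norm (Dm g))\<^sup>2 = (norm g)\<^sup>2"
  by (simp add: power2_norm_eq_inner inner_Lam_Dm)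

lemma norm_Lam_le: "norm (Lam g) \<le> norm g"
  using mul_bound[OF bdd_meas_lam lam_le(1)] by simp

lemma norm_Dm_le: "norm (Dm g) \<le> norm g"
  using mul_bound[OF bdd_meas_dmu lam_le(2)] by simp

lemma norm_le_Lam_Dm: "norm g \<le> norm (Lam g) + norm (Dm g)"
proof (rule power2_le_imp_le)
  show "(norm g)\<^sup>2 \<le> (norm (Lam g) + norm (Dm g))\<^sup>2"
    unfolding norm_Lam_Dm[of g, symmetric] by (simp add: power2_sum)
qed simp

lemma Lam_eq_iff: "Lam f = Lam g \<longleftrightarrow> f = g"
  by (auto intro: mul_inj[OF bdd_meas_lam lam_nonzero])

text \<open>If \<open>p\<close> and \<open>\<xi> p\<close> are square integrable, so is
  \<open>sqrt (1 + \<xi>\<^sup>2) p\<close>, because the squares of the first two add up to the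
  square of the last; this product is the coordinate sought.\<close>

lemma weighted_lift:
  assumes "AE \<xi> in lborel. rep q \<xi> = \<i> * of_real \<xi> * rep p \<xi>"
  shows "\<exists>g. Lam g = p \<and> Dm g = q"
proof -
  define g where "g \<xi> = of_real (sqrt (1 + \<xi>\<^sup>2)) * rep p \<xi>" for \<xi>
  have [measurable]: "g \<in> borel_measurable borel" unfolding g_def by measurable
  have "integrable lborel (\<lambda>\<xi>. (norm (rep p \<xi>))\<^sup>2 + (norm (rep q \<xi>))\<^sup>2)"
    by (simp add: L2_square_integrable)
  moreover have "AE \<xi> in lborel. (norm (rep p \<xi>))\<^sup>2 + (norm (rep q \<xi>))\<^sup>2 = (norm (g \<xi>))\<^sup>2"
    using assms by eventually_elim
      (use jap_pos in \<open>auto simp: g_def norm_mult power_mult_distrib algebra_simps add_nonneg_nonneg\<close>)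
  ultimately have "integrable lborel (\<lambda>\<xi>. (norm (g \<xi>))\<^sup>2)"
    by (subst (asm) integrable_cong_AE) simp_all
  then have g: "g \<in> L2" by (simp add: L2_iff)
  have "Lam (cls g) = cls (rep p)"
    unfolding mul_cls[OF bdd_meas_lam g]
    by (rule arg_cong[where f=cls]) (use jap_pos in \<open>simp add: fun_eq_iff g_def lam_def\<close>)
  moreover have "Dm (cls g) = cls (rep q)"
    unfolding mul_cls[OF bdd_meas_dmu g]
  proof (rule cls_eqI)
    show "AE \<xi> in lborel. dmu \<xi> * g \<xi> = rep q \<xi>"
      using assms by eventually_elim (use jap_pos in \<open>simp add: g_def dmu_def\<close>)
  qed (simp_all add: mul_L2 g)
  ultimately show ?thesis by auto
qed

lemma AE_Dm_Lam: "AE \<xi> in lborel. rep (Dm g) \<xi> = \<i> * of_real \<xi> * rep (Lam g) \<xi>"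
  using rep_mul[OF bdd_meas_lam, of g] rep_mul[OF bdd_meas_dmu, of g]
  by eventually_elim (simp add: lam_def dmu_def)

lemma weak_derivative_Fourier:
  assumes "f \<in> L2" "Fou (cls f) = Lam g" "k \<in> L2"
  shows "weak_derivative f k \<longleftrightarrow> Fou (cls k) = Dm g"
proof
  assume "Fou (cls k) = Dm g"
  then show "weak_derivative f k"
    unfolding weak_derivative_iff_Fourier[OF assms(1,3)] assms(2) by (simp add: AE_Dm_Lam)
next
  assume "weak_derivative f k"
  then have "AE \<xi> in lborel. rep (Fou (cls k)) \<xi> = \<i> * of_real \<xi> * rep (Lam g) \<xi>"
    unfolding weak_derivative_iff_Fourier[OF assms(1,3)] assms(2) .
  with AE_Dm_Lam[of g] have "AE \<xi> in lborel. rep (Fou (cls k)) \<xi> = rep (Dm g) \<xi>"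
    by eventually_elim simp
  then show "Fou (cls k) = Dm g" by (rule l2_eqI)
qed

text \<open>For \<open>f\<close> in \<open>H1\<close> the choice is unique, since \<open>Lam\<close>
  is injective.\<close>

definition crd :: "(real \<Rightarrow> complex) \<Rightarrow> l2" where
  "crd f = (SOME g. Fou (cls f) = Lam g)"

text \<open>The dictionary between \<open>H1\<close> and \<open>l2\<close>. Every weak derivative of
  \<open>f\<close> in \<open>L2\<close> has transform \<open>Dm g\<close>, so the arbitrary choice
  made in \<open>Dx\<close> does not affect its class.\<close>

lemma H1_intro:
  assumes "f \<in> L2" "Fou (cls f) = Lam g"
  shows "f \<in> H1" "crd f = g" "Dx f \<in> L2" "cls (Dx f) = Fou' (Dm g)" "H1_norm f = norm g"
proof -
  have *: "rep (Fou' (Dm g)) \<in> L2 \<and> weak_derivative f (rep (Fou' (Dm g)))"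
    using weak_derivative_Fourier[OF assms, of "rep (Fou' (Dm g))"] by simp
  then show "f \<in> H1" unfolding H1_def using assms(1) by blast
  have D: "Dx f \<in> L2 \<and> weak_derivative f (Dx f)"
    unfolding Dx_def by (rule someI[where P="\<lambda>g. g \<in> L2 \<and> weak_derivative f g"]) (rule *)
  then show D2: "Dx f \<in> L2" by simp
  then have "Fou (cls (Dx f)) = Dm g" using D weak_derivative_Fourier[OF assms D2] by simp
  then show cD: "cls (Dx f) = Fou' (Dm g)" by (metis Fou'_Fou)
  show "crd f = g"
    unfolding crd_def assms(2) Lam_eq_iff by (rule some_equality) simp_all
  have "norm (cls f) = norm (Lam g)" using norm_Fou[of "cls f"] assms(2) by simp
  moreover have "norm (cls (Dx f)) = norm (Dm g)" by (simp add: cD)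
  ultimately show "H1_norm f = norm g"
    unfolding H1_norm_def norm_cls[OF assms(1), symmetric] norm_cls[OF D2, symmetric]
    by (simp add: norm_Lam_Dm)
qed

lemma H1_crd:
  assumes "f \<in> H1"
  shows "f \<in> L2" "Fou (cls f) = Lam (crd f)"
proof -
  obtain k where k: "f \<in> L2" "k \<in> L2" "weak_derivative f k" using assms unfolding H1_def by blast
  then show "f \<in> L2" by simp
  have "\<exists>g. Lam g = Fou (cls f) \<and> Dm g = Fou (cls k)"
    using k weak_derivative_iff_Fourier[OF k(1,2)] by (intro weighted_lift) simp
  then have "\<exists>g. Fou (cls f) = Lam g" by metis
  then show "Fou (cls f) = Lam (crd f)" unfolding crd_def by (rule someI_ex)
qed

lemmas H1_facts = H1_intro[OF H1_crd]

lemma cls_H1: "f \<in> H1 \<Longrightarrow> cls f = Fou' (Lam (crd f))"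
  by (metis H1_crd(2) Fou'_Fou)

lemma H1_norm_eq: "f \<in> H1 \<Longrightarrow> H1_norm f = norm (crd f)"
  by (rule H1_facts(5))

lemma cls_Dx: "f \<in> H1 \<Longrightarrow> cls (Dx f) = Fou' (Dm (crd f))"
  by (rule H1_facts(4))

lemma Dx_L2: "f \<in> H1 \<Longrightarrow> Dx f \<in> L2"
  by (rule H1_facts(3))

lemma crd_add:
  assumes "f \<in> H1" "g \<in> H1"
  shows "(\<lambda>x. f x + g x) \<in> H1" "crd (\<lambda>x. f x + g x) = crd f + crd g"
  using assms H1_crd[OF assms(1)] H1_crd[OF assms(2)]
  by (auto intro!: H1_intro(1)[where g="crd f + crd g"] H1_intro(2) simp: L2_add cls_add Fou_add mul_add)

lemma crd_diff:
  assumes "f \<in> H1" "g \<in> H1"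
  shows "(\<lambda>x. f x - g x) \<in> H1" "crd (\<lambda>x. f x - g x) = crd f - crd g"
  using assms H1_crd[OF assms(1)] H1_crd[OF assms(2)]
  by (auto intro!: H1_intro(1)[where g="crd f - crd g"] H1_intro(2) simp: L2_diff cls_diff Fou_diff mul_diff)

lemma crd_cmult:
  assumes "f \<in> H1"
  shows "(\<lambda>x. c * f x) \<in> H1" "crd (\<lambda>x. c * f x) = cscale c (crd f)"
proof -
  have "Fou (cls (\<lambda>x. c * f x)) = Lam (cscale c (crd f))"
    using H1_crd[OF assms] by (simp add: mul_cls[of "\<lambda>x. c", symmetric] Fou_cscale mul_mul mult.commute)
  then show "(\<lambda>x. c * f x) \<in> H1" "crd (\<lambda>x. c * f x) = cscale c (crd f)"
    using H1_intro[of "\<lambda>x. c * f x" "cscale c (crd f)"] H1_crd[OF assms] by (auto simp: L2_cmult)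
qed

lemma crd_AE_cong:
  assumes "f \<in> H1" "g \<in> L2" "AE x in lborel. f x = g x"
  shows "g \<in> H1" "crd g = crd f"
proof -
  have "cls f = cls g" by (rule cls_eqI[OF H1_crd(1)[OF assms(1)] assms(2,3)])
  then have "Fou (cls g) = Lam (crd f)" using H1_crd(2)[OF assms(1)] by simp
  then show "g \<in> H1" "crd g = crd f" by (rule H1_intro[OF assms(2)])+
qed

lemma crd_eq_iff: "f \<in> H1 \<Longrightarrow> g \<in> H1 \<Longrightarrow> crd f = crd g \<longleftrightarrow> (AE x in lborel. f x = g x)"
proof
  assume "f \<in> H1" "g \<in> H1" "crd f = crd g"
  then have "cls f = cls g" by (simp add: cls_H1)
  then show "AE x in lborel. f x = g x" using \<open>f \<in> H1\<close> \<open>g \<in> H1\<close> cls_eq_iff H1_crd(1) by blast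
qed (use crd_AE_cong(2) H1_crd(1) in metis)

lemma weak_derivative_cnj:
  assumes "weak_derivative f g"
  shows "weak_derivative (\<lambda>x. cnj (f x)) (\<lambda>x. cnj (g x))"
  unfolding weak_derivative_def
proof (intro allI impI)
  fix \<phi> assume "test_function \<phi>"
  then have "(LINT x|lborel. f x * of_real (deriv \<phi> x)) = - (LINT x|lborel. g x * of_real (\<phi> x))"
    using assms unfolding weak_derivative_def by blast
  then have "cnj (LINT x|lborel. f x * of_real (deriv \<phi> x)) = cnj (- (LINT x|lborel. g x * of_real (\<phi> x)))" by simp
  then show "(LINT x|lborel. cnj (f x) * of_real (deriv \<phi> x)) = - (LINT x|lborel. cnj (g x) * of_real (\<phi> x))"
    by (simp flip: Bochner_Integration.integral_cnj)
qed

text \<open>Needed because the duality pairing is bilinear. Conjugation in \<open>x\<close> becomes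
  conjugation combined with a reflection on the Fourier side, so the argument goes through weak
  derivatives rather than through coordinates.\<close>

lemma H1_cnj:
  assumes "f \<in> H1"
  shows "(\<lambda>x. cnj (f x)) \<in> H1" "H1_norm (\<lambda>x. cnj (f x)) = H1_norm f" "cls (Dx (\<lambda>x. cnj (f x))) = cj (cls (Dx f))"
proof -
  have f: "f \<in> L2" and D: "Dx f \<in> L2" "weak_derivative f (Dx f)"
    using assms Dx_L2[OF assms] weak_derivative_Fourier[OF H1_crd[OF assms] Dx_L2[OF assms]]
    by (auto simp: cls_Dx H1_crd)
  have w: "weak_derivative (\<lambda>x. cnj (f x)) (\<lambda>x. cnj (Dx f x))" by (rule weak_derivative_cnj[OF D(2)])
  show *: "(\<lambda>x. cnj (f x)) \<in> H1"
    unfolding H1_def using f D w by (auto intro: L2_cnj)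
  have "Fou (cls (\<lambda>x. cnj (Dx f x))) = Dm (crd (\<lambda>x. cnj (f x)))"
    using weak_derivative_Fourier[OF H1_crd[OF *] L2_cnj[OF D(1)]] w by simp
  then show **: "cls (Dx (\<lambda>x. cnj (f x))) = cj (cls (Dx f))"
    unfolding cls_Dx[OF *] by (metis cj_cls[OF D(1)] Fou'_Fou)
  then have "norm (cls (Dx (\<lambda>x. cnj (f x)))) = norm (cls (Dx f))" by simp
  then have "L2_norm (Dx (\<lambda>x. cnj (f x))) = L2_norm (Dx f)"
    by (simp add: norm_cls D Dx_L2[OF *])
  then show "H1_norm (\<lambda>x. cnj (f x)) = H1_norm f"
    unfolding H1_norm_def by (simp add: L2_norm_def)
qed

subsection \<open>The continuous representative\<close>

text \<open>Inverse Fourier integral of \<open>lam * g\<close>, written as a forward integral at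
  \<open>- x\<close>. It converges absolutely because \<open>lam\<close> is itself square
  integrable, so it is a definite value at every point and not only a class.\<close>

definition ev :: "l2 \<Rightarrow> real \<Rightarrow> complex" where
  "ev g x = fourier_integral (\<lambda>\<xi>. lam \<xi> * rep g \<xi>) (- x)"

lemma inverse_square_integral:
  assumes "\<epsilon> > 0"
  shows "integrable lborel (\<lambda>\<xi>::real. 1 / (1 + (\<epsilon> * \<xi>)\<^sup>2))" "(LINT \<xi>|lborel. 1 / (1 + (\<epsilon> * \<xi>)\<^sup>2)) = pi / \<epsilon>"
proof -
  have i: "integrable lborel (\<lambda>x::real. 1 / (1 + x\<^sup>2))"
    using integrable_inverse_1_plus_square unfolding set_integrable_def by (simp add: inverse_eq_divide)
  have v: "(LINT x|lborel. 1 / (1 + (x::real)\<^sup>2)) = pi"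
    using LBINT_inverse_1_plus_square
    unfolding interval_lebesgue_integral_def set_lebesgue_integral_def by (simp add: inverse_eq_divide)
  show "integrable lborel (\<lambda>\<xi>::real. 1 / (1 + (\<epsilon> * \<xi>)\<^sup>2))"
    using lborel_integrable_real_affine[OF i, of \<epsilon> 0] assms by simp
  show "(LINT \<xi>|lborel. 1 / (1 + (\<epsilon> * \<xi>)\<^sup>2)) = pi / \<epsilon>"
    using lborel_integral_real_affine[of \<epsilon> "\<lambda>x. 1 / (1 + x\<^sup>2)" 0] assms unfolding v by (simp add: field_simps)
qed

lemma lam_L2: "lam \<in> L2"
proof -
  have "(\<lambda>\<xi>. (norm (lam \<xi>))\<^sup>2) = (\<lambda>\<xi>. 1 / (1 + (1 * \<xi>)\<^sup>2))"
    using jap_pos by (auto simp: lam_def norm_divide power_divide fun_eq_iff)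
  then show ?thesis
    unfolding L2_iff using inverse_square_integral(1)[of 1] bdd_meas_measurable[OF bdd_meas_lam] by simp
qed

lemma lam_mult_L1: "f \<in> L2 \<Longrightarrow> integrable lborel (\<lambda>\<xi>. lam \<xi> * f \<xi>)"
  by (rule L2_mult_integrable[OF lam_L2])

lemma ev_L2 [simp]: "ev g \<in> L2" and cls_ev: "cls (ev g) = Fou' (Lam g)"
proof -
  have i: "integrable lborel (\<lambda>\<xi>. lam \<xi> * rep g \<xi>)" "(\<lambda>\<xi>. lam \<xi> * rep g \<xi>) \<in> L2"
    by (simp_all add: lam_mult_L1 mul_L2)
  have "fourier_integral (\<lambda>\<xi>. lam \<xi> * rep g \<xi>) \<in> L2" by (rule plancherel_L1(1)[OF i])
  then have "integrable lborel (\<lambda>x. (norm (fourier_integral (\<lambda>\<xi>. lam \<xi> * rep g \<xi>) (0 + (-1) * x)))\<^sup>2)"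
    by (intro lborel_integrable_real_affine[where f="\<lambda>x. (norm (fourier_integral (\<lambda>\<xi>. lam \<xi> * rep g \<xi>) x))\<^sup>2"] L2_square_integrable) auto
  then show "ev g \<in> L2" by (simp add: L2_iff ev_def[abs_def])
  show "cls (ev g) = Fou' (Lam g)"
    unfolding mul_def Fou'_cls[OF i] ev_def[abs_def] ..
qed

lemma ev_H1 [simp]: "ev g \<in> H1" and crd_ev [simp]: "crd (ev g) = g"
  using H1_intro(1,2)[of "ev g" g] by (simp_all add: cls_ev)

lemma crd_eq_AE_ev: "f \<in> H1 \<Longrightarrow> AE x in lborel. f x = ev (crd f) x"
  using crd_eq_iff[of f "ev (crd f)"] by simp

lemma ev_cls: "g \<in> L2 \<Longrightarrow> ev (cls g) x = fourier_integral (\<lambda>\<xi>. lam \<xi> * g \<xi>) (- x)"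
proof -
  assume g: "g \<in> L2"
  have "fourier_integral (\<lambda>\<xi>. lam \<xi> * rep (cls g) \<xi>) = fourier_integral (\<lambda>\<xi>. lam \<xi> * g \<xi>)"
  proof (rule fourier_integral_cong_AE)
    show "AE x in lborel. lam x * rep (cls g) x = lam x * g x"
      using rep_cls[OF g] by eventually_elim simp
  qed (use g bdd_meas_measurable[OF bdd_meas_lam] in \<open>simp_all add: L2_measurable\<close>)
  then show ?thesis unfolding ev_def by simp
qed

lemma ev_add: "ev (f + g) x = ev f x + ev g x"
  unfolding plus_l2_def ev_cls[OF L2_add[OF rep_L2 rep_L2]]
  unfolding ev_def distrib_left by (rule fourier_integral_add) (simp_all add: lam_mult_L1)

lemma ev_cscale: "ev (cscale c f) x = c * ev f x"
  unfolding mul_def ev_cls[OF L2_cmult[OF rep_L2]]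
  unfolding ev_def mult.left_commute[of _ c] by (rule fourier_integral_cmult)

lemma ev_scaleR: "ev (r *\<^sub>R f) x = r *\<^sub>R ev f x"
  using ev_cscale[of "of_real r" f x] by (simp add: mul_of_real scaleR_conv_of_real)

lemma ev_diff: "ev (f - g) x = ev f x - ev g x"
  using ev_add[of "f - g" g x] by simp

lemma ev_shift: "ev (mul (\<lambda>\<xi>. exp (\<i> * of_real (a * \<xi>))) g) x = ev g (x + a)"
proof -
  have "(LINT \<xi>|lborel. exp (- (\<i> * of_real (- x * \<xi>))) * (lam \<xi> * (exp (\<i> * of_real (a * \<xi>)) * rep g \<xi>)))
     = (LINT \<xi>|lborel. exp (- (\<i> * of_real (- (x + a) * \<xi>))) * (lam \<xi> * rep g \<xi>))"
    by (rule Bochner_Integration.integral_cong) (simp_all add: algebra_simps exp_add)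
  then show ?thesis
    unfolding mul_def ev_cls[OF mul_L2[OF bdd_meas_exp_i rep_L2, of "\<lambda>\<xi>. a * \<xi>", OF borel_measurable_times[OF borel_measurable_const measurable_ident_sets[OF refl]]]]
    unfolding ev_def fourier_integral_def by simp
qed

lemma L2_Cauchy_Schwarz:
  assumes "f \<in> L2" "g \<in> L2" "\<And>x. f x \<in> \<real>" "\<And>x. g x \<in> \<real>"
  shows "Re (LINT x|lborel. f x * g x) \<le> norm (cls f) * norm (cls g)"
proof -
  have "cnj (g x) = g x" for x using assms(4) by (simp add: Reals_cnj_iff)
  then have "inner (cls f) (cls g) = Re (LINT x|lborel. f x * g x)" using assms by (simp add: inner_cls)
  then show ?thesis using Cauchy_Schwarz_ineq2[of "cls f" "cls g"] by simp
qed

text \<open>Splitting the weight as \<open>(\<langle>\<xi>\<rangle>\<^sup>-\<^sup>2 + \<epsilon>\<^sup>2)\<^sup>1\<^sup>/\<^sup>2\<close> times its reciprocal keeps the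
  constant explicit and replaces the interpolation inequality \<open>\<parallel>f\<parallel>\<^sub>\<infinity>\<^sup>2 \<le> \<parallel>f\<parallel> \<parallel>f'\<parallel>\<close>.\<close>

lemma ev_bound:
  assumes e: "\<epsilon> > 0"
  shows "(norm (ev g x))\<^sup>2 \<le> ((norm (Lam g))\<^sup>2 / \<epsilon> + \<epsilon> * (norm g)\<^sup>2) / 2"
proof -
  define s where "s \<xi> = sqrt ((norm (lam \<xi>))\<^sup>2 + \<epsilon>\<^sup>2)" for \<xi>
  have s_sq: "(s \<xi>)\<^sup>2 = (norm (lam \<xi>))\<^sup>2 + \<epsilon>\<^sup>2" for \<xi> by (simp add: s_def)
  have s_pos: "s \<xi> > 0" for \<xi> using e by (simp add: s_def add_nonneg_pos)
  have [measurable]: "lam \<in> borel_measurable borel" by (rule bdd_meas_measurable[OF bdd_meas_lam])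
  have [measurable]: "s \<in> borel_measurable borel" unfolding s_def by measurable
  define a where "a \<xi> = complex_of_real (s \<xi> * norm (rep g \<xi>))" for \<xi>
  define b where "b \<xi> = complex_of_real (norm (lam \<xi>) / s \<xi>)" for \<xi>
  have lg: "(\<lambda>\<xi>. lam \<xi> * rep g \<xi>) \<in> L2" by (simp add: mul_L2)
  have a_sq: "(norm (a \<xi>))\<^sup>2 = (norm (lam \<xi> * rep g \<xi>))\<^sup>2 + \<epsilon>\<^sup>2 * (norm (rep g \<xi>))\<^sup>2" for \<xi>
    by (simp add: a_def norm_mult power_mult_distrib s_sq algebra_simps)
  have a: "a \<in> L2"
    unfolding L2_iff a_sq using L2_square_integrable[OF lg] by (auto simp: a_def[abs_def] L2_square_integrable)
  have na: "(norm (cls a))\<^sup>2 = (norm (Lam g))\<^sup>2 + \<epsilon>\<^sup>2 * (norm g)\<^sup>2"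
  proof -
    have "(norm (cls a))\<^sup>2 = (norm (cls (\<lambda>\<xi>. lam \<xi> * rep g \<xi>)))\<^sup>2 + \<epsilon>\<^sup>2 * (LINT \<xi>|lborel. (norm (rep g \<xi>))\<^sup>2)"
      unfolding norm_cls_sq[OF a] a_sq norm_cls_sq[OF lg]
      using L2_square_integrable[OF lg] by (subst Bochner_Integration.integral_add) (simp_all add: L2_square_integrable)
    then show ?thesis unfolding norm_l2_sq[of g, symmetric] mul_def .
  qed
  \<comment> \<open>The square of \<open>b\<close> is
    \<open>1 / (1 + \<epsilon>\<^sup>2 + (\<epsilon> \<xi>)\<^sup>2)\<close>; dropping the middle
    term leaves a dilate of \<open>1 / (1 + x\<^sup>2)\<close> with integral
    \<open>pi / \<epsilon>\<close>.\<close>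
  have b_sq: "(norm (b \<xi>))\<^sup>2 \<le> 1 / (1 + (\<epsilon> * \<xi>)\<^sup>2)" for \<xi>
  proof -
    have l: "(norm (lam \<xi>))\<^sup>2 = 1 / (1 + \<xi>\<^sup>2)"
      using jap_pos by (simp add: lam_def norm_divide power_divide)
    have "(norm (b \<xi>))\<^sup>2 = (norm (lam \<xi>))\<^sup>2 / ((norm (lam \<xi>))\<^sup>2 + \<epsilon>\<^sup>2)"
      by (simp add: b_def norm_divide power_divide s_sq)
    also have "\<dots> = 1 / (1 + \<epsilon>\<^sup>2 * (1 + \<xi>\<^sup>2))"
      unfolding l using jap_pos[of \<xi>] by (simp add: divide_simps)
    also have "\<dots> \<le> 1 / (1 + (\<epsilon> * \<xi>)\<^sup>2)"
      by (rule divide_left_mono)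
         (auto simp: power_mult_distrib distrib_left intro!: mult_pos_pos add_pos_nonneg)
    finally show ?thesis .
  qed
  have b: "b \<in> L2" by (rule L2_dominated[OF _ inverse_square_integral(1)[OF e] b_sq]) (simp add: b_def[abs_def])
  have nb: "(norm (cls b))\<^sup>2 \<le> pi / \<epsilon>"
    unfolding norm_cls_sq[OF b] inverse_square_integral(2)[OF e, symmetric]
    by (rule integral_mono) (use b_sq b inverse_square_integral(1)[OF e] in \<open>auto simp: L2_square_integrable\<close>)
  have i: "integrable lborel (\<lambda>\<xi>. lam \<xi> * rep g \<xi>)" by (simp add: lam_mult_L1)
  have K: "0 \<le> 1 / sqrt (2 * pi)" by simp
  have "norm (ev g x) = 1 / sqrt (2 * pi) * norm (LINT \<xi>|lborel. exp (- (\<i> * of_real (- x * \<xi>))) * (lam \<xi> * rep g \<xi>))"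
    unfolding ev_def fourier_integral_def norm_mult norm_of_real by simp
  also have "\<dots> \<le> 1 / sqrt (2 * pi) * (LINT \<xi>|lborel. norm (lam \<xi> * rep g \<xi>))"
  proof (rule mult_left_mono)
    have "norm (LINT \<xi>|lborel. exp (- (\<i> * of_real (- x * \<xi>))) * (lam \<xi> * rep g \<xi>))
      \<le> (LINT \<xi>|lborel. norm (exp (- (\<i> * of_real (- x * \<xi>))) * (lam \<xi> * rep g \<xi>)))" by (rule integral_norm_bound)
    then show "norm (LINT \<xi>|lborel. exp (- (\<i> * of_real (- x * \<xi>))) * (lam \<xi> * rep g \<xi>)) \<le> (LINT \<xi>|lborel. norm (lam \<xi> * rep g \<xi>))"
      unfolding norm_mult[of "exp _"] norm_exp_i by simp
  qed simp
  finally have i1: "norm (ev g x) \<le> 1 / sqrt (2 * pi) * (LINT \<xi>|lborel. norm (lam \<xi> * rep g \<xi>))" .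
  have i2: "(LINT \<xi>|lborel. norm (lam \<xi> * rep g \<xi>)) \<le> norm (cls a) * norm (cls b)"
  proof -
    have ab: "a \<xi> * b \<xi> = complex_of_real (norm (lam \<xi> * rep g \<xi>))" for \<xi>
      using s_pos[of \<xi>] by (simp add: a_def b_def norm_mult)
    show ?thesis
      using L2_Cauchy_Schwarz[OF a b] unfolding ab by (simp add: a_def b_def)
  qed
  have le: "norm (ev g x) \<le> 1 / sqrt (2 * pi) * (norm (cls a) * norm (cls b))"
    by (rule order_trans[OF i1 mult_left_mono[OF i2 K]])
  have "(norm (ev g x))\<^sup>2 \<le> (1 / sqrt (2 * pi) * (norm (cls a) * norm (cls b)))\<^sup>2"
    by (rule power_mono[OF le]) simp
  also have "\<dots> = 1 / (2 * pi) * ((norm (cls a))\<^sup>2 * (norm (cls b))\<^sup>2)"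
    by (simp add: power_mult_distrib power_divide)
  also have "\<dots> \<le> 1 / (2 * pi) * ((norm (cls a))\<^sup>2 * (pi / \<epsilon>))"
    by (intro mult_left_mono nb) auto
  also have "\<dots> = ((norm (Lam g))\<^sup>2 / \<epsilon> + \<epsilon> * (norm g)\<^sup>2) / 2"
    unfolding na using e by (simp add: field_simps power2_eq_square)
  finally show ?thesis .
qed

text \<open>The Sobolev embedding, from \<open>\<epsilon> = 1\<close>. Having constant 1, it lets
  the same radius \<open>R\<close> bound a coordinate in norm and the function pointwise.\<close>

lemma ev_le_norm: "norm (ev g x) \<le> norm g"
proof (rule power2_le_imp_le)
  have "(norm (ev g x))\<^sup>2 \<le> ((norm (Lam g))\<^sup>2 + (norm g)\<^sup>2) / 2"
    using ev_bound[OF zero_less_one, of g x] by simp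
  also have "\<dots> \<le> ((norm g)\<^sup>2 + (norm g)\<^sup>2) / 2"
    by (intro divide_right_mono add_right_mono power_mono norm_Lam_le) simp_all
  finally show "(norm (ev g x))\<^sup>2 \<le> (norm g)\<^sup>2" by simp
qed simp

lemma bounded_linear_ev: "bounded_linear (\<lambda>g. ev g x)"
  by (rule bounded_linear_intro[where K=1]) (simp_all add: ev_add ev_scaleR ev_le_norm)

lemma shift_mul_tendsto: "((\<lambda>a. mul (\<lambda>\<xi>. exp (\<i> * of_real (a * \<xi>))) g) \<longlongrightarrow> g) (at 0)"
proof -
  have "((\<lambda>a. mul (\<lambda>\<xi>. exp (\<i> * of_real (a * \<xi>))) g) \<longlongrightarrow> mul (\<lambda>\<xi>. 1) g) (at 0)"
  proof (rule mul_strong_tendsto[where B=1])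
    fix \<xi> :: real
    have "((\<lambda>a. exp (\<i> * of_real (a * \<xi>))) \<longlongrightarrow> exp (\<i> * of_real (0 * \<xi>))) (at 0)"
      by (intro tendsto_intros)
    then show "((\<lambda>a. exp (\<i> * complex_of_real (a * \<xi>))) \<longlongrightarrow> 1) (at 0)" by simp
  qed (simp_all del: of_real_mult)
  then show ?thesis by simp
qed

lemma continuous_ev: "continuous_on A (ev g)"
proof -
  have "((\<lambda>a. ev g (x + a)) \<longlongrightarrow> ev g x) (at 0)" for x
    unfolding ev_shift[symmetric]
    by (rule bounded_linear.tendsto[OF bounded_linear_ev shift_mul_tendsto])
  then have "isCont (ev g) x" for x unfolding isCont_def using LIM_offset_zero_cancel by blast
  then show ?thesis by (simp add: continuous_at_imp_continuous_on)
qed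

lemma continuous_AE_eq:
  fixes f g :: "real \<Rightarrow> complex"
  assumes "continuous_on UNIV f" "continuous_on UNIV g" "AE x in lborel. f x = g x"
  shows "f = g"
proof -
  have "open {x. f x \<noteq> g x}" by (rule open_Collect_neq[OF assms(1,2)])
  moreover have "negligible {x. f x \<noteq> g x}"
  proof -
    have "{x. f x \<noteq> g x} \<in> sets borel" using \<open>open _\<close> by simp
    then have "{x. f x \<noteq> g x} \<in> null_sets lborel"
      using assms(3) by (simp add: AE_iff_null_sets)
    then show ?thesis by (simp add: negligible_iff_null_sets null_sets_completionI)
  qed
  ultimately show ?thesis using open_not_negligible by blast
qed

subsection \<open>The Schroedinger group\<close>

definition sch :: "real \<Rightarrow> real \<Rightarrow> complex" where
  "sch r \<xi> = exp (- (\<i> * of_real (r * \<xi>\<^sup>2)))"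

abbreviation U :: "real \<Rightarrow> l2 \<Rightarrow> l2" where
  "U r \<equiv> mul (sch r)"

lemma norm_sch [simp]: "norm (sch r \<xi>) = 1"
  unfolding sch_def by (rule norm_exp_i)

lemma bdd_meas_sch [simp]: "bdd_meas (sch r)"
proof (rule bdd_measI[where B=1])
  show "sch r \<in> borel_measurable borel"
    unfolding sch_def by (intro borel_measurable_continuous_onI continuous_intros)
qed simp

lemma norm_U [simp]: "norm (U r f) = norm f"
  by (rule mul_isometry) simp_all

lemma sch_mult: "sch r \<xi> * sch s \<xi> = sch (r + s) \<xi>"
  unfolding sch_def exp_add[symmetric] by (simp add: distrib_right distrib_left)

lemma cnj_sch: "cnj (sch r \<xi>) = sch (- r) \<xi>"
  by (simp add: sch_def exp_cnj)

lemma U_U: "U r (U s f) = U (r + s) f"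
  by (simp add: mul_mul sch_mult)

lemma U_0 [simp]: "U 0 f = f"
  unfolding sch_def by simp

lemma mul_commute: "bdd_meas m \<Longrightarrow> bdd_meas n \<Longrightarrow> mul m (mul n f) = mul n (mul m f)"
  by (simp add: mul_mul mult.commute)

lemma inner_U: "inner (U r f) g = inner f (U (- r) g)"
  by (simp add: inner_mul_left cnj_sch)

lemma norm_Lam_U_diff: "norm (Lam (U r f - U r g)) = norm (Lam (f - g))"
  unfolding mul_diff[OF bdd_meas_sch, symmetric] mul_commute[OF bdd_meas_lam bdd_meas_sch] by simp

lemma continuous_U:
  assumes "continuous_on A f"
  shows "continuous_on A (\<lambda>r. U (c * r) (f r))"
  unfolding continuous_on_def
proof
  fix r assume r: "r \<in> A"
  have 1: "((\<lambda>s. U (c * s) (f r)) \<longlongrightarrow> U (c * r) (f r)) (at r within A)"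
  proof (rule mul_strong_tendsto[where B=1])
    show "((\<lambda>s. sch (c * s) \<xi>) \<longlongrightarrow> sch (c * r) \<xi>) (at r within A)" for \<xi>
      unfolding sch_def by (intro tendsto_intros)
  qed simp_all
  have "((\<lambda>s. norm (f s - f r)) \<longlongrightarrow> 0) (at r within A)"
    by (rule tendsto_norm_zero[OF LIM_zero]) (use assms r in \<open>simp add: continuous_on_def\<close>)
  then have 2: "((\<lambda>s. U (c * s) (f s - f r)) \<longlongrightarrow> 0) (at r within A)"
    by (subst tendsto_norm_zero_iff[symmetric]) simp
  have "((\<lambda>s. U (c * s) (f s - f r) + U (c * s) (f r)) \<longlongrightarrow> 0 + U (c * r) (f r)) (at r within A)"
    by (intro tendsto_add 1 2)
  then show "((\<lambda>s. U (c * s) (f s)) \<longlongrightarrow> U (c * r) (f r)) (at r within A)" by (simp add: mul_diff)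
qed

lemma is_schroedinger_iff:
  assumes "f \<in> H1"
  shows "is_schroedinger r f k \<longleftrightarrow> k \<in> L2 \<and> cls k = Fou' (Lam (U r (crd f)))"
proof
  assume "is_schroedinger r f k"
  then obtain F where F: "is_L2_fourier f F" "is_L2_fourier k (\<lambda>\<xi>. sch r \<xi> * F \<xi>)"
    unfolding is_schroedinger_def sch_def by blast
  then have L: "f \<in> L2" "F \<in> L2" "k \<in> L2" "(\<lambda>\<xi>. sch r \<xi> * F \<xi>) \<in> L2"
    unfolding is_L2_fourier_def by auto
  have "cls F = Lam (crd f)" using F(1) L H1_crd(2)[OF assms] by (simp add: is_L2_fourier_iff)
  moreover have "U r (cls F) = Fou (cls k)" using F(2) L by (simp add: is_L2_fourier_iff mul_cls)
  ultimately have "Fou (cls k) = Lam (U r (crd f))"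
    using mul_commute[OF bdd_meas_sch bdd_meas_lam, of r "crd f"] by simp
  then have "Fou' (Fou (cls k)) = Fou' (Lam (U r (crd f)))" by simp
  then have "cls k = Fou' (Lam (U r (crd f)))" by simp
  then show "k \<in> L2 \<and> cls k = Fou' (Lam (U r (crd f)))" using L by simp
next
  assume k: "k \<in> L2 \<and> cls k = Fou' (Lam (U r (crd f)))"
  define F where "F = rep (Lam (crd f))"
  have F: "F \<in> L2" "(\<lambda>\<xi>. sch r \<xi> * F \<xi>) \<in> L2" by (simp_all add: F_def mul_L2)
  have "cls F = Fou (cls f)" unfolding F_def H1_crd(2)[OF assms] by (rule cls_rep)
  then have "is_L2_fourier f F"
    unfolding is_L2_fourier_iff[OF H1_crd(1)[OF assms] F(1)] .
  moreover have "cls (\<lambda>\<xi>. sch r \<xi> * F \<xi>) = U r (Lam (crd f))"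
    using mul_cls[OF bdd_meas_sch F(1)] by (simp add: F_def)
  then have "cls (\<lambda>\<xi>. sch r \<xi> * F \<xi>) = Fou (cls k)"
    using k mul_commute[OF bdd_meas_sch bdd_meas_lam, of r "crd f"] by simp
  then have "is_L2_fourier k (\<lambda>\<xi>. sch r \<xi> * F \<xi>)"
    using k F(2) by (simp only: is_L2_fourier_iff)
  ultimately show "is_schroedinger r f k" unfolding is_schroedinger_def sch_def by blast
qed

text \<open>A continuous representative exists, and two continuous functions that agree almost
  everywhere are equal. The identity thus holds at every point, which is what the pointwise integral
  in \<open>Q\<close> requires.\<close>

lemma T_eq_ev:
  assumes "f \<in> H1"
  shows "T r f = ev (U r (crd f))"
proof -
  define E where "E = ev (U r (crd f))"
  have E: "is_schroedinger r f E" "continuous_on UNIV E"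
    unfolding is_schroedinger_iff[OF assms] E_def by (simp_all add: cls_ev continuous_ev)
  have "is_schroedinger r f (T r f) \<and> ((\<exists>k. is_schroedinger r f k \<and> continuous_on UNIV k) \<longrightarrow> continuous_on UNIV (T r f))"
    unfolding T_def by (rule someI[where x=E]) (use E in blast)
  then have Tr: "is_schroedinger r f (T r f)" "continuous_on UNIV (T r f)" using E by blast+
  have "T r f \<in> L2" "E \<in> L2" "cls (T r f) = cls E"
    using Tr(1) E(1) unfolding is_schroedinger_iff[OF assms] by auto
  then have "AE x in lborel. T r f x = E x" by (simp add: cls_eq_iff)
  then have "T r f = E" by (rule continuous_AE_eq[OF Tr(2) E(2)])
  then show ?thesis by (simp add: E_def)
qed

subsection \<open>Difference quotients\<close>

lemma cls_scaleR: "f \<in> L2 \<Longrightarrow> cls (\<lambda>x. c *\<^sub>R f x) = c *\<^sub>R cls f"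
  using mul_cls[OF bdd_meas_const[of "of_real c"], of f] by (simp add: scaleR_conv_of_real mul_of_real)

lemma bounded_linear_cj: "bounded_linear cj"
proof (rule bounded_linear_intro[where K=1])
  show "cj (r *\<^sub>R f) = r *\<^sub>R cj f" for r f
    using cj_mul[OF bdd_meas_const[of "of_real r"], of f] by (simp add: mul_of_real)
qed (simp_all add: cj_add)

definition quo :: "real \<Rightarrow> real \<Rightarrow> complex" where
  "quo a \<xi> = (exp (\<i> * of_real (a * \<xi>)) - 1) / of_real a"

text \<open>The first bound is uniform in \<open>a\<close> and, after multiplication by
  \<open>lam\<close>, provides the domination as \<open>a\<close> tends to 0; the second makes the
  symbol bounded for each fixed \<open>a\<close>. At \<open>a = 0\<close> the quotient is 0 by
  convention.\<close>

lemma norm_quo_le: "norm (quo a \<xi>) \<le> \<bar>\<xi>\<bar>" "norm (quo a \<xi>) \<le> 2 / \<bar>a\<bar>"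
proof -
  have "norm (exp (\<i> * of_real (a * \<xi>)) - 1) \<le> \<bar>a * \<xi>\<bar>"
    using iexp_approx1[of "a * \<xi>" 0] by simp
  then show "norm (quo a \<xi>) \<le> \<bar>\<xi>\<bar>"
    by (cases "a = 0") (auto simp: quo_def norm_divide divide_le_eq abs_mult mult.commute simp del: of_real_mult)
  have "norm (exp (\<i> * of_real (a * \<xi>)) - 1) \<le> 2"
    using norm_triangle_ineq4[of "exp (\<i> * of_real (a * \<xi>))" 1] by (simp del: of_real_mult)
  then show "norm (quo a \<xi>) \<le> 2 / \<bar>a\<bar>"
    by (simp add: quo_def norm_divide divide_right_mono del: of_real_mult)
qed

lemma quo_measurable [measurable]: "quo a \<in> borel_measurable borel"
  unfolding quo_def by measurable

lemma bdd_meas_quo [simp]: "bdd_meas (quo a)"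
  by (rule bdd_measI[OF quo_measurable norm_quo_le(2)])

lemma quo_tendsto: "((\<lambda>a. quo a \<xi>) \<longlongrightarrow> \<i> * of_real \<xi>) (at 0)"
proof -
  have "((\<lambda>z. exp (\<i> * of_real \<xi> * z)) has_field_derivative \<i> * of_real \<xi>) (at 0)"
    by (auto intro!: derivative_eq_intros)
  then have "((\<lambda>h. (exp (\<i> * of_real \<xi> * h) - 1) / h) \<longlongrightarrow> \<i> * of_real \<xi>) (at 0)"
    unfolding DERIV_def by simp
  moreover have "filterlim complex_of_real (at 0) (at 0)"
  proof (rule filterlim_atI)
    show "(complex_of_real \<longlongrightarrow> 0) (at 0)" using tendsto_of_real[OF tendsto_ident_at[of "0::real" UNIV]] by simp
    show "\<forall>\<^sub>F x in at 0. complex_of_real x \<noteq> 0" by (simp add: eventually_at_filter)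
  qed
  ultimately have "((\<lambda>a. (exp (\<i> * of_real \<xi> * of_real a) - 1) / of_real a) \<longlongrightarrow> \<i> * of_real \<xi>) (at 0)"
    by (rule filterlim_compose)
  then show ?thesis by (simp add: quo_def mult_ac)
qed

lemma mul_quo_lam_tendsto: "((\<lambda>a. mul (\<lambda>\<xi>. quo a \<xi> * lam \<xi>) g) \<longlongrightarrow> Dm g) (at 0)"
proof (rule mul_strong_tendsto[where B=1])
  fix \<xi> :: real and a :: real
  have "norm (quo a \<xi> * lam \<xi>) \<le> \<bar>\<xi>\<bar> * norm (lam \<xi>)"
    unfolding norm_mult by (rule mult_right_mono[OF norm_quo_le(1)]) simp
  also have "\<dots> = norm (dmu \<xi>)" by (simp add: lam_def dmu_def norm_mult norm_divide)
  finally show "norm (quo a \<xi> * lam \<xi>) \<le> 1" using lam_le(2)[of \<xi>] by linarith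
next
  fix \<xi> :: real
  have "((\<lambda>a. quo a \<xi> * lam \<xi>) \<longlongrightarrow> \<i> * of_real \<xi> * lam \<xi>) (at 0)"
    by (intro tendsto_mult quo_tendsto tendsto_const)
  then show "((\<lambda>a. quo a \<xi> * lam \<xi>) \<longlongrightarrow> dmu \<xi>) (at 0)" by (simp add: lam_def dmu_def)
qed simp_all

definition dq :: "real \<Rightarrow> l2 \<Rightarrow> l2" where
  "dq a p = (1 / a) *\<^sub>R (tr a p - p)"

lemma Fou_dq: "Fou (dq a p) = mul (quo a) (Fou p)"
proof -
  define e where "e \<xi> = exp (\<i> * complex_of_real (a * \<xi>))" for \<xi>
  have e: "bdd_meas e" unfolding e_def by (rule bdd_meas_exp_i) simp
  define q where "q = Fou p"
  have "(1 / a) *\<^sub>R (mul e q - q) = mul (quo a) q"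
  proof (rule l2_eqI)
    show "AE x in lborel. rep ((1 / a) *\<^sub>R (mul e q - q)) x = rep (mul (quo a) q) x"
      using rep_scaleR[of "1 / a" "mul e q - q"] rep_diff[of "mul e q" q] rep_mul[OF e, of q] rep_mul[OF bdd_meas_quo[of a], of q]
    proof eventually_elim
      case (elim x)
      show ?case unfolding elim quo_def e_def by (simp add: scaleR_conv_of_real algebra_simps diff_divide_distrib)
    qed
  qed
  then show ?thesis
    unfolding dq_def Fou_scaleR Fou_diff Fou_tr e_def[abs_def, symmetric] q_def .
qed

lemma dq_ev_tendsto: "((\<lambda>a. dq a (Fou' (Lam g))) \<longlongrightarrow> Fou' (Dm g)) (at 0)"
proof -
  have "dq a (Fou' (Lam g)) = Fou' (mul (\<lambda>\<xi>. quo a \<xi> * lam \<xi>) g)" for a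
    using Fou_dq[of a "Fou' (Lam g)"] by (simp add: mul_mul) (metis Fou'_Fou)
  then show ?thesis
    using bounded_linear.tendsto[OF bounded_linear_Fou' mul_quo_lam_tendsto] by simp
qed

text \<open>Applying \<open>Lam\<close> turns the difference quotients of \<open>p\<close> into
  bounded symbols acting on \<open>Fou p\<close>, whose limit is \<open>Dm (Fou p)\<close> in any
  case. Comparing the two limits and cancelling \<open>lam\<close> pointwise gives the relation that
  characterizes a weak derivative.\<close>

lemma dq_tendsto_lift:
  assumes "((\<lambda>a. dq a p) \<longlongrightarrow> q) (at 0)"
  shows "\<exists>n. Lam n = Fou p \<and> Dm n = Fou q"
proof (rule weighted_lift)
  have "((\<lambda>a. Lam (Fou (dq a p))) \<longlongrightarrow> Lam (Fou q)) (at 0)"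
    by (intro continuous_mul bdd_meas_lam bounded_linear.tendsto[OF bounded_linear_Fou] assms)
  moreover have "Lam (Fou (dq a p)) = mul (\<lambda>\<xi>. quo a \<xi> * lam \<xi>) (Fou p)" for a
    unfolding Fou_dq mul_commute[OF bdd_meas_lam bdd_meas_quo] by (simp add: mul_mul)
  ultimately have "((\<lambda>a. mul (\<lambda>\<xi>. quo a \<xi> * lam \<xi>) (Fou p)) \<longlongrightarrow> Lam (Fou q)) (at 0)" by simp
  then have *: "Lam (Fou q) = Dm (Fou p)"
    by (rule tendsto_unique[OF trivial_limit_at _ mul_quo_lam_tendsto])
  show "AE \<xi> in lborel. rep (Fou q) \<xi> = \<i> * of_real \<xi> * rep (Fou p) \<xi>"
    using rep_mul[OF bdd_meas_lam, of "Fou q"] rep_mul[OF bdd_meas_dmu, of "Fou p"]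
  proof eventually_elim
    case (elim \<xi>)
    then have "lam \<xi> * rep (Fou q) \<xi> = dmu \<xi> * rep (Fou p) \<xi>" using * by simp
    also have "dmu \<xi> = lam \<xi> * (\<i> * of_real \<xi>)" by (simp add: lam_def dmu_def)
    finally show ?case using lam_nonzero[of \<xi>] by simp
  qed
qed

subsection \<open>Continuity from estimates in two norms\<close>

text \<open>The error \<open>e\<close> is arbitrary once the arguments are close in the weaker norm,
  and closeness in norm implies that because \<open>Lam\<close> is a contraction.\<close>

lemma quasi_lipschitz_continuous:
  fixes F :: "l2 \<Rightarrow> l2"
  assumes F: "\<And>R e. e > 0 \<Longrightarrow> R \<ge> 0 \<Longrightarrow> \<exists>\<delta>>0. \<forall>f g. norm f \<le> R \<and> norm g \<le> R \<and> norm (Lam (f - g)) < \<delta> \<longrightarrow>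
      norm (F f - F g) \<le> C R * norm (f - g) + e"
    and C: "\<And>R. C R \<ge> 0"
  shows "continuous_on S F"
proof -
  have "isCont F g" for g
    unfolding continuous_at_eps_delta
  proof (intro allI impI)
    fix e :: real assume "e > 0"
    define R where "R = norm g + 1"
    have "R \<ge> 0" by (simp add: R_def)
    obtain \<delta> where \<delta>: "\<delta> > 0" "\<And>f. norm f \<le> R \<Longrightarrow> norm g \<le> R \<Longrightarrow> norm (Lam (f - g)) < \<delta> \<Longrightarrow> norm (F f - F g) \<le> C R * norm (f - g) + e / 2"
      using F[of "e/2" R] \<open>e > 0\<close> \<open>R \<ge> 0\<close> by (metis half_gt_zero)
    \<comment> \<open>Three demands on \<open>norm (f - g)\<close>: less than
      \<open>\<delta>\<close> for the hypothesis, less than 1 to keep \<open>f\<close> in the ball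
      of radius \<open>R\<close>, and small enough that the Lipschitz term stays below
      \<open>e / 2\<close>. The added 1 avoids division by zero.\<close>
    define c where "c = min (min \<delta> 1) (e / (2 * (C R + 1)))"
    have "c > 0" using \<delta> \<open>e > 0\<close> C[of R] by (simp add: c_def)
    moreover have "dist (F f) (F g) < e" if "dist f g < c" for f
    proof -
      have fg: "norm (f - g) < \<delta>" "norm (f - g) < 1" "norm (f - g) < e / (2 * (C R + 1))" using that by (auto simp: c_def dist_norm)
      have "norm f \<le> R" using norm_triangle_ineq[of "f - g" g] fg(2) by (simp add: R_def)
      moreover have "norm (Lam (f - g)) < \<delta>" using norm_Lam_le[of "f - g"] fg(1) by linarith
      ultimately have "norm (F f - F g) \<le> C R * norm (f - g) + e / 2" by (intro \<delta>(2)) (auto simp: R_def)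
      also have "C R * norm (f - g) \<le> (C R + 1) * norm (f - g)" by (intro mult_right_mono) auto
      also have "(C R + 1) * norm (f - g) < e / 2"
        using fg(3) C[of R] by (simp add: field_simps)
      finally show ?thesis by (simp add: dist_norm)
    qed
    ultimately show "\<exists>c>0. \<forall>x'. dist x' g < c \<longrightarrow> dist (F x') (F g) < e" by blast
  qed
  then show ?thesis by (simp add: continuous_at_imp_continuous_on)
qed

lemma taylor_continuous:
  fixes \<Phi> :: "l2 \<Rightarrow> real" and X :: "l2 \<Rightarrow> l2"
  assumes \<Phi>: "\<And>R f g. norm f \<le> R \<Longrightarrow> norm g \<le> R \<Longrightarrow>
      \<bar>\<Phi> f - \<Phi> g - inner (Lam (X g)) (Lam (f - g))\<bar> \<le> L R * (norm (Lam (f - g)))\<^sup>2"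
    and L: "\<And>R. L R \<ge> 0"
  shows "continuous_on S \<Phi>"
proof -
  have "(\<Phi> \<longlongrightarrow> \<Phi> g) (at g)" for g
  proof -
    define R where "R = norm g + 1"
    define C where "C = norm (Lam (X g))"
    have "((\<lambda>f. norm (f - g)) \<longlongrightarrow> norm (g - g)) (at g)" by (intro tendsto_intros)
    then have n: "((\<lambda>f. norm (f - g)) \<longlongrightarrow> 0) (at g)" by simp
    have ev: "\<forall>\<^sub>F f in at g. norm (f - g) < 1" by (rule order_tendstoD(2)[OF n]) simp
    have "((\<lambda>f. C * norm (f - g) + L R * (norm (f - g))\<^sup>2) \<longlongrightarrow> C * 0 + L R * 0\<^sup>2) (at g)"
      by (intro tendsto_add tendsto_mult tendsto_const tendsto_power n)
    then have lim: "((\<lambda>f. C * norm (f - g) + L R * (norm (f - g))\<^sup>2) \<longlongrightarrow> 0) (at g)" by simp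
    have "((\<lambda>f. \<Phi> f - \<Phi> g) \<longlongrightarrow> 0) (at g)"
    proof (rule Lim_null_comparison[OF _ lim])
      show "\<forall>\<^sub>F f in at g. norm (\<Phi> f - \<Phi> g) \<le> C * norm (f - g) + L R * (norm (f - g))\<^sup>2"
        using ev
      proof eventually_elim
        case (elim f)
        have "norm f \<le> R" using norm_triangle_ineq[of "f - g" g] elim by (simp add: R_def)
        then have "\<bar>\<Phi> f - \<Phi> g - inner (Lam (X g)) (Lam (f - g))\<bar> \<le> L R * (norm (Lam (f - g)))\<^sup>2"
          by (intro \<Phi>) (simp_all add: R_def)
        also have "\<dots> \<le> L R * (norm (f - g))\<^sup>2" by (intro mult_left_mono power_mono norm_Lam_le L) simp
        finally have "\<bar>\<Phi> f - \<Phi> g - inner (Lam (X g)) (Lam (f - g))\<bar> \<le> L R * (norm (f - g))\<^sup>2" .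
        moreover have "\<bar>inner (Lam (X g)) (Lam (f - g))\<bar> \<le> C * norm (f - g)"
          unfolding C_def
          using Cauchy_Schwarz_ineq2[of "Lam (X g)" "Lam (f - g)"] mult_left_mono[OF norm_Lam_le[of "f - g"] norm_ge_zero[of "Lam (X g)"]] by linarith
        ultimately show ?case unfolding real_norm_def by linarith
      qed
    qed
    then show ?thesis by (rule LIM_zero_cancel)
  qed
  then show ?thesis by (intro continuous_at_imp_continuous_on) (simp add: isCont_def)
qed

subsection \<open>Superposition operators\<close>

text \<open>A real C^1 map of the plane: \<open>A\<close> and \<open>B\<close> are its Wirtinger
  derivatives with respect to \<open>z\<close> and to the conjugate of \<open>z\<close>.\<close>

locale c1_map =
  fixes P A B :: "complex \<Rightarrow> complex"
  assumes continuous_A: "continuous_on UNIV A" and continuous_B: "continuous_on UNIV B"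
    and P_derivative: "\<And>z. (P has_derivative (\<lambda>w. A z * w + B z * cnj w)) (at z)"
    and P_0: "P 0 = 0"
begin

lemma AB_bounded: "\<exists>L\<ge>0. \<forall>z. norm z \<le> R \<longrightarrow> norm (A z) + norm (B z) \<le> L"
proof -
  have "compact ((\<lambda>z. norm (A z) + norm (B z)) ` cball 0 R)"
    by (intro compact_continuous_image continuous_on_add continuous_on_norm
        continuous_on_subset[OF continuous_A] continuous_on_subset[OF continuous_B]) auto
  then have "bounded ((\<lambda>z. norm (A z) + norm (B z)) ` cball 0 R)" by (rule compact_imp_bounded)
  then obtain b where b: "\<And>z. z \<in> cball 0 R \<Longrightarrow> norm (norm (A z) + norm (B z)) \<le> b"
    unfolding bounded_iff by blast
  have "norm (A z) + norm (B z) \<le> \<bar>b\<bar>" if "norm z \<le> R" for z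
    using b[of z] that by simp
  then show ?thesis by (intro exI[of _ "\<bar>b\<bar>"]) auto
qed

text \<open>A choice, so that the constant becomes a function of the radius alone; \<open>KR\<close>
  and the existence time are built from it.\<close>

definition Lip :: "real \<Rightarrow> real" where
  "Lip R = (SOME L. L \<ge> 0 \<and> (\<forall>z. norm z \<le> R \<longrightarrow> norm (A z) + norm (B z) \<le> L))"

lemma Lip: "Lip R \<ge> 0" "norm z \<le> R \<Longrightarrow> norm (A z) + norm (B z) \<le> Lip R"
  using someI_ex[OF AB_bounded[of R]] unfolding Lip_def[symmetric] by auto

lemma norm_DP_le: "norm (a * w + b * cnj w) \<le> (norm a + norm b) * norm (w::complex)"
  using norm_triangle_ineq[of "a * w" "b * cnj w"] by (simp add: norm_mult distrib_right)

lemma P_lipschitz: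
  assumes "norm z \<le> R" "norm w \<le> R"
  shows "norm (P z - P w) \<le> Lip R * norm (z - w)"
proof (rule differentiable_bound[OF convex_cball[of 0 R]])
  show "(P has_derivative (\<lambda>w. A x * w + B x * cnj w)) (at x within cball 0 R)" for x
    by (rule has_derivative_at_withinI[OF P_derivative])
  show "onorm (\<lambda>w. A x * w + B x * cnj w) \<le> Lip R" if "x \<in> cball 0 R" for x
  proof (rule onorm_bound)
    show "norm (A x * w + B x * cnj w) \<le> Lip R * norm w" for w
      using norm_DP_le[of "A x" w "B x"] Lip(2)[of x R] that
      by (simp add: order_trans[OF _ mult_right_mono])
  qed (rule Lip)
qed (use assms in auto)

lemma AB_uniformly_continuous:
  assumes "e > 0"
  shows "\<exists>\<delta>>0. \<forall>z w. norm z \<le> R \<and> norm w \<le> R \<and> norm (z - w) < \<delta> \<longrightarrow> norm (A z - A w) + norm (B z - B w) \<le> e"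
proof -
  have "uniformly_continuous_on (cball 0 R) A" "uniformly_continuous_on (cball 0 R) B"
    by (intro compact_uniformly_continuous continuous_on_subset[OF continuous_A] continuous_on_subset[OF continuous_B]; simp)+
  then have "\<exists>d>0. \<forall>z\<in>cball 0 R. \<forall>w\<in>cball 0 R. dist w z < d \<longrightarrow> dist (A w) (A z) < e / 2"
    "\<exists>d>0. \<forall>z\<in>cball 0 R. \<forall>w\<in>cball 0 R. dist w z < d \<longrightarrow> dist (B w) (B z) < e / 2"
    using assms unfolding uniformly_continuous_on_def by (meson half_gt_zero)+
  then obtain d1 d2 where d: "d1 > 0" "d2 > 0"
    "\<And>z w. z \<in> cball 0 R \<Longrightarrow> w \<in> cball 0 R \<Longrightarrow> dist w z < d1 \<Longrightarrow> dist (A w) (A z) < e / 2"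
    "\<And>z w. z \<in> cball 0 R \<Longrightarrow> w \<in> cball 0 R \<Longrightarrow> dist w z < d2 \<Longrightarrow> dist (B w) (B z) < e / 2" by blast
  have "norm (A z - A w) + norm (B z - B w) \<le> e" if "norm z \<le> R \<and> norm w \<le> R \<and> norm (z - w) < min d1 d2" for z w
    using d(3)[of w z] d(4)[of w z] that by (simp add: dist_norm)
  then show ?thesis using d(1,2) by (intro exI[of _ "min d1 d2"]) simp
qed

text \<open>Uniform continuity of \<open>A\<close> and \<open>B\<close> on the ball makes
  \<open>\<delta>\<close> independent of \<open>z\<close>, so the expansion can be used at all
  points of the line simultaneously.\<close>

lemma P_taylor:
  assumes "e > 0"
  shows "\<exists>\<delta>>0. \<forall>z w. norm z \<le> R \<and> norm w \<le> R \<and> norm (w - z) < \<delta> \<longrightarrow>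
    norm (P w - P z - (A z * (w - z) + B z * cnj (w - z))) \<le> e * norm (w - z)"
proof -
  obtain \<delta> where \<delta>: "\<delta> > 0" "\<And>z w. norm z \<le> R \<Longrightarrow> norm w \<le> R \<Longrightarrow> norm (z - w) < \<delta> \<Longrightarrow> norm (A z - A w) + norm (B z - B w) \<le> e"
    using AB_uniformly_continuous[OF assms, of R] by blast
  have "norm (P w - P z - (A z * (w - z) + B z * cnj (w - z))) \<le> norm (w - z) * e"
    if zw: "norm z \<le> R" "norm w \<le> R" "norm (w - z) < \<delta>" for z w
  proof (rule differentiable_bound_linearization[where S="closed_segment z w" and f'="\<lambda>z w. A z * w + B z * cnj w"])
    show "z + t *\<^sub>R (w - z) \<in> closed_segment z w" if "t \<in> {0..1}" for t
      using that unfolding closed_segment_def by (auto intro!: exI[of _ t] simp: algebra_simps)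
    show "(P has_derivative (\<lambda>w. A x * w + B x * cnj w)) (at x within closed_segment z w)" for x
      by (rule has_derivative_at_withinI[OF P_derivative])
    show "onorm ((\<lambda>w. A x * w + B x * cnj w) - (\<lambda>w. A z * w + B z * cnj w)) \<le> e" if x: "x \<in> closed_segment z w" for x
    proof (rule onorm_bound)
      have "closed_segment z w \<subseteq> cball 0 R" using zw by (intro closed_segment_subset) auto
      then have "norm x \<le> R" using x by auto
      moreover have "norm (x - z) < \<delta>"
        using segment_bound(1)[OF x] zw(3) by linarith
      ultimately have *: "norm (A x - A z) + norm (B x - B z) \<le> e" using \<delta>(2) zw(1) by blast
      show "norm (((\<lambda>w. A x * w + B x * cnj w) - (\<lambda>w. A z * w + B z * cnj w)) y) \<le> e * norm y" for y
      proof -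
        have "norm (((\<lambda>w. A x * w + B x * cnj w) - (\<lambda>w. A z * w + B z * cnj w)) y)
          = norm ((A x - A z) * y + (B x - B z) * cnj y)" by (simp add: algebra_simps)
        also have "\<dots> \<le> (norm (A x - A z) + norm (B x - B z)) * norm y" by (rule norm_DP_le)
        also have "\<dots> \<le> e * norm y" by (rule mult_right_mono[OF *]) simp
        finally show ?thesis .
      qed
    qed (use assms in simp)
  qed simp
  then show ?thesis using \<delta>(1) by (intro exI[of _ \<delta>]) (simp add: mult.commute)
qed

lemma continuous_P: "continuous_on S P"
  using has_derivative_continuous[OF P_derivative] by (simp add: continuous_at_imp_continuous_on)

lemma P_measurable [measurable]: "P \<in> borel_measurable borel"
  by (rule borel_measurable_continuous_onI[OF continuous_P])

end

lemma ev_measurable [measurable]: "ev g \<in> borel_measurable borel"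
  by (rule L2_measurable[OF ev_L2])

text \<open>\<open>W\<close> is a potential whose real gradient is \<open>P\<close>, with quadratic
  remainder; \<open>P_gauge\<close> says that \<open>P z\<close> is orthogonal to
  \<open>\<i> * z\<close>. The former drives energy conservation, the latter mass
  conservation.\<close>

locale nonlinearity = c1_map +
  fixes W :: "complex \<Rightarrow> real"
  assumes P_gauge: "\<And>z. Re (P z * cnj (\<i> * z)) = 0"
    and continuous_W: "continuous_on UNIV W" and W_0: "W 0 = 0"
    and W_taylor: "\<And>R. \<exists>L\<ge>0. \<forall>z w. norm z \<le> R \<and> norm w \<le> R \<longrightarrow>
        \<bar>W w - W z - Re (P z * cnj (w - z))\<bar> \<le> L * (norm (w - z))\<^sup>2"
begin

lemma W_measurable [measurable]: "W \<in> borel_measurable borel"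
  by (rule borel_measurable_continuous_onI[OF continuous_W])

lemma P_ev_L2: "(\<lambda>x. P (ev g x)) \<in> L2"
proof (rule L2_dominated[where w="\<lambda>x. (Lip (norm g))\<^sup>2 * (norm (ev g x))\<^sup>2"])
  fix x
  have "norm (P (ev g x)) \<le> Lip (norm g) * norm (ev g x)"
    using P_lipschitz[of "ev g x" "norm g" 0] ev_le_norm[of g x] by (simp add: P_0)
  then have "(norm (P (ev g x)))\<^sup>2 \<le> (Lip (norm g) * norm (ev g x))\<^sup>2" by (intro power_mono) simp_all
  then show "(norm (P (ev g x)))\<^sup>2 \<le> (Lip (norm g))\<^sup>2 * (norm (ev g x))\<^sup>2" by (simp only: power_mult_distrib)
qed (simp_all add: L2_square_integrable)

lemma bdd_meas_compose:
  assumes "continuous_on UNIV C"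
  shows "bdd_meas (\<lambda>x. C (ev g x))"
proof -
  have "compact (C ` cball 0 (norm g))" by (intro compact_continuous_image continuous_on_subset[OF assms]) auto
  then have "bounded (C ` cball 0 (norm g))" by (rule compact_imp_bounded)
  then obtain b where "\<And>z. z \<in> cball 0 (norm g) \<Longrightarrow> norm (C z) \<le> b" unfolding bounded_iff by blast
  then have "norm (C (ev g x)) \<le> b" for x using ev_le_norm[of g x] by simp
  moreover have "(\<lambda>x. C (ev g x)) \<in> borel_measurable borel"
    using borel_measurable_continuous_onI[OF assms] by measurable
  ultimately show ?thesis by (rule bdd_measI[rotated])
qed

lemmas bdd_AB [simp] = bdd_meas_compose[OF continuous_A] bdd_meas_compose[OF continuous_B]

text \<open>The chain rule's candidate for the derivative of \<open>P(f)\<close>, where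
  \<open>f = ev g\<close>: the class \<open>Fou' (Dm g)\<close> represents the derivative of
  \<open>f\<close>.\<close>

definition dN :: "l2 \<Rightarrow> l2" where
  "dN g = mul (\<lambda>x. A (ev g x)) (Fou' (Dm g)) + mul (\<lambda>x. B (ev g x)) (cj (Fou' (Dm g)))"

lemma dq_P_bound:
  assumes "a \<noteq> 0" "e \<ge> 0" and
    le: "\<And>x. norm (P (ev g (x + a)) - P (ev g x) - (A (ev g x) * (ev g (x + a) - ev g x) + B (ev g x) * cnj (ev g (x + a) - ev g x)))
      \<le> e * norm (ev g (x + a) - ev g x)"
  shows "norm (dq a (cls (\<lambda>x. P (ev g x))) - (mul (\<lambda>x. A (ev g x)) (dq a (cls (ev g))) + mul (\<lambda>x. B (ev g x)) (cj (dq a (cls (ev g))))))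
    \<le> e * norm (dq a (cls (ev g)))"
proof -
  define f where "f = ev g"
  define d where "d x = f (x + a) - f x" for x
  have f: "f \<in> L2" "(\<lambda>x. P (f x)) \<in> L2" unfolding f_def by (simp_all add: P_ev_L2)
  have d: "d \<in> L2" unfolding d_def by (intro L2_diff L2_shift f)
  have 1: "dq a (cls f) = (1 / a) *\<^sub>R cls d"
    unfolding dq_def d_def using f by (simp add: tr_cls cls_diff L2_shift)
  define p where "p x = P (f (x + a)) - P (f x)" for x
  have p: "p \<in> L2" unfolding p_def by (intro L2_diff L2_shift[of "\<lambda>x. P (f x)"] f)
  have 2: "dq a (cls (\<lambda>x. P (f x))) = (1 / a) *\<^sub>R cls p"
    unfolding dq_def p_def using f L2_shift[OF f(2)] by (simp add: tr_cls cls_diff)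
  define q where "q x = A (f x) * d x + B (f x) * cnj (d x)" for x
  have Ad: "(\<lambda>x. A (f x) * d x) \<in> L2" "(\<lambda>x. B (f x) * cnj (d x)) \<in> L2"
    unfolding f_def by (intro mul_L2 bdd_AB d L2_cnj)+
  have q: "q \<in> L2" unfolding q_def by (intro L2_add Ad)
  have 3: "mul (\<lambda>x. A (f x)) (dq a (cls f)) + mul (\<lambda>x. B (f x)) (cj (dq a (cls f))) = (1 / a) *\<^sub>R cls q"
  proof -
    have "cls q = mul (\<lambda>x. A (f x)) (cls d) + mul (\<lambda>x. B (f x)) (cj (cls d))"
      unfolding q_def cls_add[OF Ad] using d by (simp add: mul_cls cj_cls L2_cnj f_def)
    then show ?thesis
      unfolding 1 by (simp add: f_def mul_scaleR linear_scale[OF bounded_linear.linear[OF bounded_linear_cj]] scaleR_add_right)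
  qed
  have "norm (cls p - cls q) \<le> norm (cls (\<lambda>x. of_real e * d x))"
    unfolding cls_diff[OF p q, symmetric]
    by (rule norm_cls_le[OF L2_diff[OF p q] L2_cmult[OF d]])
       (use le \<open>e \<ge> 0\<close> in \<open>simp add: p_def q_def d_def f_def norm_mult\<close>)
  also have "cls (\<lambda>x. of_real e * d x) = e *\<^sub>R cls d"
    using cls_scaleR[OF d, of e] by (simp add: scaleR_conv_of_real)
  finally have "norm (cls p - cls q) \<le> e * norm (cls d)" using \<open>e \<ge> 0\<close> by simp
  then have "\<bar>1 / a\<bar> * norm (cls p - cls q) \<le> \<bar>1 / a\<bar> * (e * norm (cls d))" by (rule mult_left_mono) simp
  moreover have "(1 / a) *\<^sub>R cls p - (1 / a) *\<^sub>R cls q = (1 / a) *\<^sub>R (cls p - cls q)" by (simp add: scaleR_diff_right)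
  ultimately have "norm ((1 / a) *\<^sub>R cls p - (1 / a) *\<^sub>R cls q) \<le> e * norm ((1 / a) *\<^sub>R cls d)"
    by (simp add: mult.left_commute)
  then show ?thesis
    unfolding 1[symmetric] 2[symmetric] 3[symmetric] f_def .
qed

text \<open>The chain rule via difference quotients. By the Sobolev embedding \<open>f\<close> and
  its translate are uniformly close, so the linearization error is at most \<open>e'\<close> times
  the increment of \<open>f\<close>; divided by \<open>a\<close>, that increment stays bounded in
  L^2.\<close>

lemma dq_P_tendsto: "((\<lambda>a. dq a (cls (\<lambda>x. P (ev g x)))) \<longlongrightarrow> dN g) (at 0)"
proof -
  define E where "E a = mul (\<lambda>x. A (ev g x)) (dq a (cls (ev g))) + mul (\<lambda>x. B (ev g x)) (cj (dq a (cls (ev g))))" for a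
  have lim: "((\<lambda>a. dq a (cls (ev g))) \<longlongrightarrow> Fou' (Dm g)) (at 0)"
    unfolding cls_ev by (rule dq_ev_tendsto)
  have E: "(E \<longlongrightarrow> dN g) (at 0)"
    unfolding E_def dN_def
    by (intro tendsto_add continuous_mul bdd_AB bounded_linear.tendsto[OF bounded_linear_cj] lim)
  define K where "K = norm (Fou' (Dm g)) + 1"
  have "K > 0" unfolding K_def by (simp add: add_nonneg_pos)
  have K: "\<forall>\<^sub>F a in at 0. norm (dq a (cls (ev g))) < K"
    by (rule order_tendstoD(2)[OF tendsto_norm[OF lim]]) (simp add: K_def)
  have "((\<lambda>a. dq a (cls (\<lambda>x. P (ev g x))) - E a) \<longlongrightarrow> 0) (at 0)"
    unfolding tendsto_iff dist_0_norm dist_commute[of _ "0::l2"]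
  proof (intro allI impI)
    fix e :: real assume "e > 0"
    define e' where "e' = e / (2 * K)"
    have e': "e' > 0" using \<open>e > 0\<close> \<open>K > 0\<close> by (simp add: e'_def)
    obtain \<delta> where \<delta>: "\<delta> > 0" "\<And>z w. norm z \<le> norm g \<Longrightarrow> norm w \<le> norm g \<Longrightarrow> norm (w - z) < \<delta> \<Longrightarrow>
      norm (P w - P z - (A z * (w - z) + B z * cnj (w - z))) \<le> e' * norm (w - z)"
      using P_taylor[OF e', of "norm g"] by blast
    have "\<forall>\<^sub>F a in at 0. dist (mul (\<lambda>\<xi>. exp (\<i> * of_real (a * \<xi>))) g) g < \<delta>"
      by (rule tendstoD[OF shift_mul_tendsto \<delta>(1)])
    moreover have "\<forall>\<^sub>F a in at 0. a \<noteq> (0::real)" by (simp add: eventually_at_filter)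
    ultimately show "\<forall>\<^sub>F a in at 0. norm (dq a (cls (\<lambda>x. P (ev g x))) - E a) < e"
      using K
    proof eventually_elim
      case (elim a)
      have "norm (ev g (x + a) - ev g x) < \<delta>" for x
        using ev_le_norm[of "mul (\<lambda>\<xi>. exp (\<i> * of_real (a * \<xi>))) g - g" x] elim(1)
        unfolding ev_diff ev_shift dist_norm by linarith
      then have "norm (dq a (cls (\<lambda>x. P (ev g x))) - E a) \<le> e' * norm (dq a (cls (ev g)))"
        unfolding E_def using elim e' by (intro dq_P_bound \<delta>(2) ev_le_norm) auto
      also have "\<dots> \<le> e' * K" using elim(3) e' by (intro mult_left_mono) auto
      also have "\<dots> < e" using \<open>e > 0\<close> \<open>K > 0\<close> by (simp add: e'_def)
      finally show ?case .
    qed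
  qed
  from tendsto_add[OF this E] show ?thesis by simp
qed

text \<open>The map \<open>f \<mapsto> P(f)\<close> in coordinates. The difference quotients of
  \<open>P(f)\<close> converge, so \<open>P(f)\<close> lies in \<open>H1\<close> and such an
  \<open>n\<close> exists.\<close>

definition N :: "l2 \<Rightarrow> l2" where
  "N g = (SOME n. Lam n = Fou (cls (\<lambda>x. P (ev g x))) \<and> Dm n = Fou (dN g))"

lemma Lam_N: "Lam (N g) = Fou (cls (\<lambda>x. P (ev g x)))" and Dm_N: "Dm (N g) = Fou (dN g)"
  using someI_ex[OF dq_tendsto_lift[OF dq_P_tendsto]] unfolding N_def[symmetric] by auto

lemma P_ev_H1: "(\<lambda>x. P (ev g x)) \<in> H1" "crd (\<lambda>x. P (ev g x)) = N g"
  using H1_intro[OF P_ev_L2 Lam_N[symmetric]] by auto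

lemma norm_cls_ev_diff: "norm (cls (\<lambda>x. ev f x - ev g x)) = norm (Lam (f - g))"
  by (simp add: cls_diff cls_ev mul_diff flip: Fou'_diff)

text \<open>Since \<open>norm (Lam g)\<close> is the L^2 norm of the function with coordinate
  \<open>g\<close>, this is the pointwise Lipschitz bound for \<open>P\<close>, integrated.\<close>

lemma N_lipschitz_Lam:
  assumes "norm f \<le> R" "norm g \<le> R"
  shows "norm (Lam (N f - N g)) \<le> Lip R * norm (Lam (f - g))"
proof -
  have "norm (Lam (N f - N g)) = norm (cls (\<lambda>x. P (ev f x) - P (ev g x)))"
    by (simp add: mul_diff Lam_N cls_diff P_ev_L2 flip: Fou_diff)
  also have "\<dots> \<le> norm (cls (\<lambda>x. of_real (Lip R) * (ev f x - ev g x)))"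
  proof (rule norm_cls_le)
    show "AE x in lborel. norm (P (ev f x) - P (ev g x)) \<le> norm (of_real (Lip R) * (ev f x - ev g x))"
      using P_lipschitz[of "ev f x" R "ev g x" for x] order_trans[OF ev_le_norm assms(1)] order_trans[OF ev_le_norm assms(2)] Lip(1)[of R]
      by (simp add: norm_mult)
  qed (intro L2_diff L2_cmult P_ev_L2 ev_L2)+
  also have "cls (\<lambda>x. of_real (Lip R) * (ev f x - ev g x)) = Lip R *\<^sub>R cls (\<lambda>x. ev f x - ev g x)"
    using cls_scaleR[OF L2_diff[OF ev_L2 ev_L2], of "Lip R" f g] by (simp add: scaleR_conv_of_real)
  finally show ?thesis using Lip(1)[of R] by (simp add: norm_cls_ev_diff)
qed

lemma N_0: "N 0 = 0"
proof -
  have "ev 0 x = 0" for x using ev_diff[of 0 0 x] by simp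
  then have "Lam (N 0) = Lam 0" unfolding Lam_N by (simp add: P_0 cls_zero linear_0[OF bounded_linear.linear[OF bounded_linear_Fou]])
  then show ?thesis by (simp only: Lam_eq_iff)
qed

text \<open>Only the modulus of continuity \<open>e\<close> of the derivative of \<open>P\<close> stands between this estimate and
  Lipschitz continuity in \<open>H\<^sup>1\<close>, and it is controlled by the weaker norm.\<close>

lemma N_quasi_lipschitz:
  assumes e: "e > 0" and R: "R \<ge> 0"
  shows "\<exists>\<delta>>0. \<forall>f g. norm f \<le> R \<and> norm g \<le> R \<and> norm (Lam (f - g)) < \<delta> \<longrightarrow> norm (N f - N g) \<le> 2 * Lip R * norm (f - g) + e"
proof -
  \<comment> \<open>Will multiply \<open>norm (Dm g)\<close>, which is at most \<open>R\<close>; the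
    added 1 covers \<open>R = 0\<close>.\<close>
  define e' where "e' = e / (R + 1)"
  have e': "e' > 0" using e R by (simp add: e'_def)
  obtain d where d: "d > 0" "\<And>z w. norm z \<le> R \<Longrightarrow> norm w \<le> R \<Longrightarrow> norm (z - w) < d \<Longrightarrow> norm (A z - A w) + norm (B z - B w) \<le> e'"
    using AB_uniformly_continuous[OF e', of R] by blast
  \<comment> \<open>Both terms of \<open>ev_bound\<close> for \<open>f - g\<close> are to be at most
    \<open>d\<^sup>2\<close>. This \<open>\<epsilon>\<close> settles the one with
    \<open>norm (f - g) \<le> 2 * R\<close>, and \<open>\<delta> = sqrt \<epsilon> * d\<close> the
    one with \<open>norm (Lam (f - g))\<close>, which even becomes strictly smaller.\<close>
  define \<epsilon> where "\<epsilon> = d\<^sup>2 / (4 * R\<^sup>2 + 1)"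
  have R1: "4 * R\<^sup>2 + 1 > 0" by (simp add: add_nonneg_pos)
  then have \<epsilon>: "\<epsilon> > 0" using d by (simp add: \<epsilon>_def)
  define \<delta> where "\<delta> = sqrt \<epsilon> * d"
  have \<delta>: "\<delta> > 0" using \<epsilon> d by (simp add: \<delta>_def)
  have "norm (N f - N g) \<le> 2 * Lip R * norm (f - g) + e" if fg: "norm f \<le> R" "norm g \<le> R" "norm (Lam (f - g)) < \<delta>" for f g
  proof -
    have sup: "norm (ev f x - ev g x) < d" for x
    proof (rule power2_less_imp_less)
      have "(norm (Lam (f - g)))\<^sup>2 < \<delta>\<^sup>2" using fg(3) by (intro power_strict_mono) auto
      then have a: "(norm (Lam (f - g)))\<^sup>2 / \<epsilon> < d\<^sup>2"
        using \<epsilon> by (simp add: \<delta>_def power_mult_distrib divide_less_eq mult.commute)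
      have "norm (f - g) \<le> 2 * R" using norm_triangle_ineq4[of f g] fg by linarith
      then have "(norm (f - g))\<^sup>2 \<le> (2 * R)\<^sup>2" by (intro power_mono) auto
      then have "\<epsilon> * (norm (f - g))\<^sup>2 \<le> \<epsilon> * (4 * R\<^sup>2)" using \<epsilon> by (intro mult_left_mono) (auto simp: power_mult_distrib)
      also have "\<dots> \<le> d\<^sup>2"
      proof -
        have "d\<^sup>2 * (4 * R\<^sup>2) \<le> d\<^sup>2 * (4 * R\<^sup>2 + 1)" by (intro mult_left_mono) auto
        then show ?thesis using R1 by (simp add: \<epsilon>_def divide_le_eq)
      qed
      finally have b: "\<epsilon> * (norm (f - g))\<^sup>2 \<le> d\<^sup>2" .
      show "(norm (ev f x - ev g x))\<^sup>2 < d\<^sup>2"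
        using ev_bound[OF \<epsilon>, of "f - g" x] a b unfolding ev_diff by (simp add: field_simps)
    qed (use d in simp)
    have AB: "norm (A (ev f x) - A (ev g x)) + norm (B (ev f x) - B (ev g x)) \<le> e'" for x
      using d(2) sup order_trans[OF ev_le_norm fg(1)] order_trans[OF ev_le_norm fg(2)] by blast
    have LR: "norm (A (ev f x)) + norm (B (ev f x)) \<le> Lip R" for x
      using Lip(2) order_trans[OF ev_le_norm fg(1)] by blast
    define D where "D = Fou' (Dm (f - g))"
    define G where "G = Fou' (Dm g)"
    have DG: "Fou' (Dm f) = D + G" by (simp add: D_def G_def mul_diff Fou'_diff)
    \<comment> \<open>The product rule splitting: \<open>k\<close> carries the difference of the
      derivatives with the coefficients at \<open>f\<close> and is Lipschitz, while \<open>l\<close>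
      carries the difference of the coefficients against the fixed derivative of \<open>g\<close>
      and is only small.\<close>
    define k where "k x = (A (ev f x) * rep D x + B (ev f x) * cnj (rep D x))" for x
    define l where "l x = ((A (ev f x) - A (ev g x)) * rep G x + (B (ev f x) - B (ev g x)) * cnj (rep G x))" for x
    have bd: "bdd_meas (\<lambda>x. A (ev f x) - A (ev g x))" "bdd_meas (\<lambda>x. B (ev f x) - B (ev g x))"
      using bdd_meas_add[OF bdd_AB(1)[of f] bdd_meas_mult[OF bdd_meas_const[of "-1"] bdd_AB(1)[of g]]]
        bdd_meas_add[OF bdd_AB(2)[of f] bdd_meas_mult[OF bdd_meas_const[of "-1"] bdd_AB(2)[of g]]] by simp_all
    have k: "k \<in> L2" unfolding k_def by (intro L2_add mul_L2 bdd_AB rep_L2 L2_cnj)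
    have l: "l \<in> L2" unfolding l_def by (intro L2_add mul_L2 bd rep_L2 L2_cnj)
    define m where "m x = k x + l x" for x
    have "dN f - dN g = cls m"
    proof (rule l2_eqI)
      have m: "m \<in> L2" unfolding m_def by (rule L2_add[OF k l])
      show "AE x in lborel. rep (dN f - dN g) x = rep (cls m) x"
        unfolding dN_def DG G_def[symmetric]
        using rep_cls[OF m] rep_diff[of "mul (\<lambda>x. A (ev f x)) (D + G) + mul (\<lambda>x. B (ev f x)) (cj (D + G))"
            "mul (\<lambda>x. A (ev g x)) G + mul (\<lambda>x. B (ev g x)) (cj G)"]
          rep_add[of "mul (\<lambda>x. A (ev f x)) (D + G)" "mul (\<lambda>x. B (ev f x)) (cj (D + G))"]
          rep_add[of "mul (\<lambda>x. A (ev g x)) G" "mul (\<lambda>x. B (ev g x)) (cj G)"]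
          rep_mul[OF bdd_AB(1)[of f], of "D + G"] rep_mul[OF bdd_AB(2)[of f], of "cj (D + G)"]
          rep_mul[OF bdd_AB(1)[of g], of G] rep_mul[OF bdd_AB(2)[of g], of "cj G"]
          rep_cj[of "D + G"] rep_cj[of G] rep_add[of D G]
        
      proof eventually_elim
        case (elim x)
        show ?case by (simp only: elim m_def k_def l_def) (simp add: algebra_simps)
      qed
    qed
    also have "\<dots> = cls k + cls l" unfolding m_def by (rule cls_add[OF k l])
    finally have "norm (dN f - dN g) \<le> norm (cls k) + norm (cls l)" by (simp add: norm_triangle_ineq)
    also have "norm (cls k) \<le> norm (cls (\<lambda>x. of_real (Lip R) * rep D x))"
    proof (rule norm_cls_le[OF k L2_cmult[OF rep_L2]], rule AE_I2)
      fix x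
      have "norm (k x) \<le> (norm (A (ev f x)) + norm (B (ev f x))) * norm (rep D x)"
        unfolding k_def by (rule norm_DP_le)
      also have "\<dots> \<le> Lip R * norm (rep D x)" by (rule mult_right_mono[OF LR]) simp
      finally show "norm (k x) \<le> norm (of_real (Lip R) * rep D x)" using Lip(1)[of R] by (simp add: norm_mult)
    qed
    also have "\<dots> = Lip R * norm (Dm (f - g))"
      using cls_scaleR[of "rep D" "Lip R"] Lip(1)[of R] by (simp add: scaleR_conv_of_real D_def)
    also have "norm (cls l) \<le> norm (cls (\<lambda>x. of_real e' * rep G x))"
    proof (rule norm_cls_le[OF l L2_cmult[OF rep_L2]], rule AE_I2)
      fix x
      have "norm (l x) \<le> (norm (A (ev f x) - A (ev g x)) + norm (B (ev f x) - B (ev g x))) * norm (rep G x)"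
        unfolding l_def by (rule norm_DP_le)
      also have "\<dots> \<le> e' * norm (rep G x)" by (rule mult_right_mono[OF AB]) simp
      finally show "norm (l x) \<le> norm (of_real e' * rep G x)" using e' by (simp add: norm_mult)
    qed
    also have "\<dots> = e' * norm (Dm g)"
      using cls_scaleR[of "rep G" e'] e' by (simp add: scaleR_conv_of_real G_def)
    also have "\<dots> \<le> e' * R" using e' norm_Dm_le[of g] fg(2) by (intro mult_left_mono) auto
    also have "\<dots> \<le> e" using e R by (simp add: e'_def divide_le_eq)
    finally have dN: "norm (dN f - dN g) \<le> Lip R * norm (Dm (f - g)) + e" by simp
    have "norm (N f - N g) \<le> norm (Lam (N f - N g)) + norm (Dm (N f - N g))" by (rule norm_le_Lam_Dm)
    also have "norm (Dm (N f - N g)) = norm (dN f - dN g)"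
      by (simp add: mul_diff Dm_N flip: Fou_diff)
    also have "norm (Lam (N f - N g)) \<le> Lip R * norm (Lam (f - g))" by (rule N_lipschitz_Lam[OF fg(1,2)])
    finally have "norm (N f - N g) \<le> Lip R * norm (Lam (f - g)) + norm (dN f - dN g)" by simp
    moreover have "Lip R * norm (Lam (f - g)) \<le> Lip R * norm (f - g)" "Lip R * norm (Dm (f - g)) \<le> Lip R * norm (f - g)"
      by (intro mult_left_mono norm_Lam_le norm_Dm_le Lip(1))+
    ultimately show ?thesis using dN by linarith
  qed
  then show ?thesis using \<delta> by blast
qed

text \<open>The quasi-Lipschitz estimate would leave an additive error here. Estimating
  \<open>dN g\<close> directly gives a bound linear in \<open>norm g\<close>, which keeps the Picard
  iterates in a ball.\<close>

lemma N_bound: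
  assumes "norm g \<le> R"
  shows "norm (N g) \<le> 2 * Lip R * norm g"
proof -
  have LR: "norm (A (ev g x)) + norm (B (ev g x)) \<le> Lip R" for x
    using Lip(2) order_trans[OF ev_le_norm assms] by blast
  define D where "D = Fou' (Dm g)"
  define k where "k x = (A (ev g x) * rep D x + B (ev g x) * cnj (rep D x))" for x
  have k: "k \<in> L2" "(\<lambda>x. A (ev g x) * rep D x) \<in> L2" "(\<lambda>x. B (ev g x) * cnj (rep D x)) \<in> L2"
    unfolding k_def by (intro L2_add mul_L2 bdd_AB rep_L2 L2_cnj)+
  have "dN g = cls k"
    unfolding dN_def k_def cls_add[OF k(2,3)] D_def[symmetric] cj_def
    by (simp add: mul_cls[symmetric] L2_cnj)
  also have "norm (cls k) \<le> norm (cls (\<lambda>x. of_real (Lip R) * rep D x))"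
  proof (rule norm_cls_le[OF k(1) L2_cmult[OF rep_L2]], rule AE_I2)
    fix x
    have "norm (k x) \<le> (norm (A (ev g x)) + norm (B (ev g x))) * norm (rep D x)"
      unfolding k_def by (rule norm_DP_le)
    also have "\<dots> \<le> Lip R * norm (rep D x)" by (rule mult_right_mono[OF LR]) simp
    finally show "norm (k x) \<le> norm (of_real (Lip R) * rep D x)" using Lip(1)[of R] by (simp add: norm_mult)
  qed
  also have "\<dots> = Lip R * norm (Dm g)"
    using cls_scaleR[of "rep D" "Lip R"] Lip(1)[of R] by (simp add: scaleR_conv_of_real D_def)
  finally have "norm (Dm (N g)) \<le> Lip R * norm (Dm g)" by (simp add: Dm_N)
  moreover have "norm (Lam (N g)) \<le> Lip R * norm (Lam g)"
    using N_lipschitz_Lam[of g R 0] assms order_trans[OF norm_ge_zero assms] by (simp add: N_0)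
  moreover have "Lip R * norm (Lam g) \<le> Lip R * norm g" "Lip R * norm (Dm g) \<le> Lip R * norm g"
    by (intro mult_left_mono norm_Lam_le norm_Dm_le Lip(1))+
  ultimately show ?thesis using norm_le_Lam_Dm[of "N g"] by linarith
qed

lemma continuous_N: "continuous_on S N"
  by (rule quasi_lipschitz_continuous[OF N_quasi_lipschitz]) (simp_all add: Lip(1))

lemma N_gauge: "inner (Lam (N g)) (Lam (cscale \<i> g)) = 0"
proof -
  have "Lam (cscale \<i> g) = Fou (cls (\<lambda>x. \<i> * ev g x))"
    by (simp add: mul_cls[of "\<lambda>x. \<i>", symmetric] Fou_cscale cls_ev mul_commute[of lam])
  then have "inner (Lam (N g)) (Lam (cscale \<i> g)) = Re (LINT x|lborel. P (ev g x) * cnj (\<i> * ev g x))"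
    unfolding Lam_N by (simp add: inner_cls P_ev_L2 L2_cmult del: complex_cnj_mult)
  also have "\<dots> = (LINT x|lborel. Re (P (ev g x) * cnj (\<i> * ev g x)))"
    by (rule Re_LINT[OF L2_mult_integrable[OF P_ev_L2 L2_cnj[OF L2_cmult[OF ev_L2]]]])
  finally show ?thesis by (simp only: P_gauge) simp
qed

section \<open>The potential energy and its first-order expansion\<close>

definition pot :: "l2 \<Rightarrow> real" where
  "pot g = (LINT x|lborel. W (ev g x))"

lemma W_ev_integrable: "integrable lborel (\<lambda>x. W (ev g x))"
proof -
  obtain L where L: "L \<ge> 0" "\<And>z w. norm z \<le> norm g \<Longrightarrow> norm w \<le> norm g \<Longrightarrow> \<bar>W w - W z - Re (P z * cnj (w - z))\<bar> \<le> L * (norm (w - z))\<^sup>2"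
    using W_taylor[of "norm g"] by blast
  show ?thesis
  proof (rule Bochner_Integration.integrable_bound[where f="\<lambda>x. L * (norm (ev g x))\<^sup>2"])
    show "AE x in lborel. norm (W (ev g x)) \<le> norm (L * (norm (ev g x))\<^sup>2)"
      using L(2)[of 0 "ev g x" for x] L(1) ev_le_norm[of g] by (simp add: W_0 P_0)
  qed (simp_all add: L2_square_integrable)
qed

definition Lpot :: "real \<Rightarrow> real" where
  "Lpot R = (SOME L. L \<ge> 0 \<and> (\<forall>z w. norm z \<le> R \<and> norm w \<le> R \<longrightarrow>
        \<bar>W w - W z - Re (P z * cnj (w - z))\<bar> \<le> L * (norm (w - z))\<^sup>2))"

text \<open>The pointwise expansion of \<open>W\<close>, integrated. It matters that the remainder
  contains the L^2 norm only: this is the quantity that is \<open>o(t - s)\<close> along a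
  solution.\<close>

lemma pot_taylor:
  assumes "norm f \<le> R" "norm g \<le> R"
  shows "\<bar>pot f - pot g - inner (Lam (N g)) (Lam (f - g))\<bar> \<le> Lpot R * (norm (Lam (f - g)))\<^sup>2"
proof -
  have L: "\<bar>W w - W z - Re (P z * cnj (w - z))\<bar> \<le> Lpot R * (norm (w - z))\<^sup>2" if "norm z \<le> R" "norm w \<le> R" for z w
    using someI_ex[OF W_taylor[of R]] that unfolding Lpot_def[symmetric] by blast
  define k where "k x = P (ev g x) * cnj (ev f x - ev g x)" for x
  have k: "integrable lborel k"
    unfolding k_def by (rule L2_mult_integrable[OF P_ev_L2 L2_cnj[OF L2_diff[OF ev_L2 ev_L2]]])
  have fg: "Lam (f - g) = Fou (cls (\<lambda>x. ev f x - ev g x))"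
    by (simp add: cls_diff cls_ev Fou_diff mul_diff)
  have "inner (Lam (N g)) (Lam (f - g)) = Re (LINT x|lborel. k x)"
    unfolding Lam_N fg k_def by (simp add: inner_cls P_ev_L2 L2_diff)
  also have "\<dots> = (LINT x|lborel. Re (k x))" by (rule Re_LINT[OF k])
  finally have "pot f - pot g - inner (Lam (N g)) (Lam (f - g)) = (LINT x|lborel. W (ev f x) - W (ev g x) - Re (k x))"
    unfolding pot_def using k by (simp add: W_ev_integrable)
  also have "\<bar>\<dots>\<bar> \<le> (LINT x|lborel. \<bar>W (ev f x) - W (ev g x) - Re (k x)\<bar>)"
    by (rule integral_abs_bound)
  also have "\<dots> \<le> (LINT x|lborel. Lpot R * (norm (ev f x - ev g x))\<^sup>2)"
  proof (rule integral_mono)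
    show "\<bar>W (ev f x) - W (ev g x) - Re (k x)\<bar> \<le> Lpot R * (norm (ev f x - ev g x))\<^sup>2" for x
      unfolding k_def by (intro L order_trans[OF ev_le_norm] assms)
    show "integrable lborel (\<lambda>x. \<bar>W (ev f x) - W (ev g x) - Re (k x)\<bar>)"
      using k by (intro integrable_abs Bochner_Integration.integrable_diff W_ev_integrable integrable_Re)
    show "integrable lborel (\<lambda>x. Lpot R * (norm (ev f x - ev g x))\<^sup>2)"
      using L2_square_integrable[OF L2_diff[OF ev_L2 ev_L2, of f g]] by simp
  qed
  also have "\<dots> = Lpot R * (norm (Lam (f - g)))\<^sup>2"
    by (simp add: norm_cls_sq[symmetric] L2_diff norm_cls_ev_diff)
  finally show ?thesis .
qed

lemma Lpot_nonneg: "Lpot R \<ge> 0"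
  using someI_ex[OF W_taylor[of R]] unfolding Lpot_def[symmetric] by blast

end

subsection \<open>The averaged nonlinearity\<close>

locale averaged_nonlinearity = nonlinearity +
  fixes \<psi> :: "real \<Rightarrow> real" and d :: real
  assumes psi_integrable: "integrable lborel \<psi>" and psi_nonneg: "AE r in lborel. \<psi> r \<ge> 0"
begin

definition mass_psi :: real where
  "mass_psi = (LINT r|lborel. \<psi> r)"

lemma mass_psi_nonneg: "mass_psi \<ge> 0"
  unfolding mass_psi_def by (rule integral_nonneg_AE[OF psi_nonneg])

lemma psi_weighted:
  fixes X :: "real \<Rightarrow> 'b::{banach, second_countable_topology}"
  assumes X: "X \<in> borel_measurable borel" and le: "\<And>r. norm (X r) \<le> c"
  shows "integrable lborel (\<lambda>r. \<psi> r *\<^sub>R X r)" "norm (LINT r|lborel. \<psi> r *\<^sub>R X r) \<le> mass_psi * c"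
proof -
  have [measurable]: "\<psi> \<in> borel_measurable borel" using psi_integrable by simp
  note X [measurable]
  have c: "c \<ge> 0" using le[of 0] norm_ge_zero order_trans by blast
  show i: "integrable lborel (\<lambda>r. \<psi> r *\<^sub>R X r)"
  proof (rule Bochner_Integration.integrable_bound[where f="\<lambda>r. \<psi> r * c"])
    show "AE r in lborel. norm (\<psi> r *\<^sub>R X r) \<le> norm (\<psi> r * c)"
      using le c by (auto simp: abs_mult intro!: mult_left_mono)
  qed (use psi_integrable in simp_all)
  have "norm (LINT r|lborel. \<psi> r *\<^sub>R X r) \<le> (LINT r|lborel. norm (\<psi> r *\<^sub>R X r))" by (rule integral_norm_bound)
  also have "\<dots> \<le> (LINT r|lborel. \<psi> r * c)"
  proof (rule integral_mono_AE)
    show "AE r in lborel. norm (\<psi> r *\<^sub>R X r) \<le> \<psi> r * c"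
      using psi_nonneg by eventually_elim (use le in \<open>simp add: mult_left_mono\<close>)
  qed (use integrable_norm[OF i] psi_integrable in simp_all)
  finally show "norm (LINT r|lborel. \<psi> r *\<^sub>R X r) \<le> mass_psi * c" by (simp add: mass_psi_def)
qed

text \<open>The coordinate of \<open>T (- r) (P (T r f))\<close>, where \<open>g\<close> is the
  coordinate of \<open>f\<close>; its average \<open>Qt g\<close> is the coordinate of the nonlinear
  term \<open>Q P \<psi> f\<close>. Continuity in \<open>r\<close> supplies measurability for the
  Bochner integral.\<close>

definition twist :: "l2 \<Rightarrow> real \<Rightarrow> l2" where
  "twist g r = U (- r) (N (U r g))"

lemma continuous_twist: "continuous_on S (twist g)"
proof -
  have "continuous_on S (\<lambda>r. U (1 * r) g)" by (rule continuous_U[OF continuous_on_const])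
  then have "continuous_on S (\<lambda>r. N (U r g))"
    using continuous_on_compose2[OF continuous_N[of UNIV], of S "\<lambda>r. U r g"] by simp
  from continuous_U[OF this, of "-1"] show ?thesis by (simp add: twist_def[abs_def])
qed

lemma twist_measurable [measurable]: "twist g \<in> borel_measurable borel"
  by (rule borel_measurable_continuous_onI[OF continuous_twist])

definition Qt :: "l2 \<Rightarrow> l2" where
  "Qt g = (LINT r|lborel. \<psi> r *\<^sub>R twist g r)"

lemma norm_twist_le: "norm g \<le> R \<Longrightarrow> norm (twist g r) \<le> 2 * Lip R * norm g"
  using N_bound[of "U r g" R] by (simp add: twist_def)

lemma psi_twist_integrable: "integrable lborel (\<lambda>r. \<psi> r *\<^sub>R twist g r)"
  by (rule psi_weighted(1)[OF twist_measurable norm_twist_le[OF order_refl]])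

text \<open>One constant for the growth bound, the Lipschitz bound in L^2 and the quasi-Lipschitz
  bound in H^1. The factor 2 comes from adding the \<open>Lam\<close> and \<open>Dm\<close> parts of
  the norm.\<close>

definition KR :: "real \<Rightarrow> real" where
  "KR R = mass_psi * (2 * Lip R)"

lemma KR_nonneg: "KR R \<ge> 0"
  unfolding KR_def using mass_psi_nonneg Lip(1) by simp

lemma Qt_bound: "norm g \<le> R \<Longrightarrow> norm (Qt g) \<le> KR R * norm g"
  using psi_weighted(2)[OF twist_measurable norm_twist_le[of g R]] by (simp add: Qt_def KR_def mult.assoc)

lemma Qt_diff: "Qt f - Qt g = (LINT r|lborel. \<psi> r *\<^sub>R (twist f r - twist g r))"
  unfolding Qt_def scaleR_diff_right
  by (rule Bochner_Integration.integral_diff[OF psi_twist_integrable psi_twist_integrable, symmetric])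

lemma twist_diff: "twist f r - twist g r = U (- r) (N (U r f) - N (U r g))"
  by (simp add: twist_def mul_diff)

lemma Qt_lipschitz_Lam:
  assumes "norm f \<le> R" "norm g \<le> R"
  shows "norm (Lam (Qt f - Qt g)) \<le> KR R * norm (Lam (f - g))"
proof -
  have le: "norm (Lam (twist f r - twist g r)) \<le> 2 * Lip R * norm (Lam (f - g))" for r
  proof -
    have "norm (Lam (twist f r - twist g r)) = norm (Lam (N (U r f) - N (U r g)))"
      unfolding twist_diff mul_commute[OF bdd_meas_lam bdd_meas_sch] by simp
    also have "\<dots> \<le> Lip R * norm (Lam (U r f - U r g))" using assms by (intro N_lipschitz_Lam) simp_all
    also have "norm (Lam (U r f - U r g)) = norm (Lam (f - g))" by (rule norm_Lam_U_diff)
    finally show ?thesis using mult_nonneg_nonneg[OF Lip(1)[of R] norm_ge_zero[of "Lam (f - g)"]] by linarith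
  qed
  have i: "integrable lborel (\<lambda>r. \<psi> r *\<^sub>R (twist f r - twist g r))"
    unfolding scaleR_diff_right by (rule Bochner_Integration.integrable_diff[OF psi_twist_integrable psi_twist_integrable])
  have "continuous_on UNIV (\<lambda>r. Lam (twist f r - twist g r))"
    by (intro bounded_linear.continuous_on[OF bounded_linear_mul[OF bdd_meas_lam]] continuous_on_diff continuous_twist)
  then have m: "(\<lambda>r. Lam (twist f r - twist g r)) \<in> borel_measurable borel" by (rule borel_measurable_continuous_onI)
  have "Lam (Qt f - Qt g) = (LINT r|lborel. \<psi> r *\<^sub>R Lam (twist f r - twist g r))"
    unfolding Qt_diff using integral_bounded_linear[OF bounded_linear_mul[OF bdd_meas_lam] i] by (simp add: mul_scaleR)
  then show ?thesis using psi_weighted(2)[OF m le] by (simp add: KR_def mult.assoc)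
qed

lemma Qt_quasi_lipschitz:
  assumes "e > 0" "R \<ge> 0"
  shows "\<exists>\<delta>>0. \<forall>f g. norm f \<le> R \<and> norm g \<le> R \<and> norm (Lam (f - g)) < \<delta> \<longrightarrow> norm (Qt f - Qt g) \<le> KR R * norm (f - g) + e"
proof -
  define e' where "e' = e / (mass_psi + 1)"
  have m1: "mass_psi + 1 > 0" using mass_psi_nonneg by simp
  have e': "e' > 0" using assms m1 by (simp add: e'_def)
  obtain \<delta> where \<delta>: "\<delta> > 0" "\<And>f g. norm f \<le> R \<Longrightarrow> norm g \<le> R \<Longrightarrow> norm (Lam (f - g)) < \<delta> \<Longrightarrow> norm (N f - N g) \<le> 2 * Lip R * norm (f - g) + e'"
    using N_quasi_lipschitz[OF e' assms(2)] by blast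
  have "norm (Qt f - Qt g) \<le> KR R * norm (f - g) + e" if fg: "norm f \<le> R" "norm g \<le> R" "norm (Lam (f - g)) < \<delta>" for f g
  proof -
    have le: "norm (twist f r - twist g r) \<le> 2 * Lip R * norm (f - g) + e'" for r
    proof -
      have "norm (N (U r f) - N (U r g)) \<le> 2 * Lip R * norm (U r f - U r g) + e'"
        using fg by (intro \<delta>(2)) (simp_all add: norm_Lam_U_diff)
      then show ?thesis unfolding twist_diff by (simp flip: mul_diff)
    qed
    have "norm (Qt f - Qt g) \<le> mass_psi * (2 * Lip R * norm (f - g) + e')"
      unfolding Qt_diff by (rule psi_weighted(2)[OF _ le]) simp
    also have "\<dots> \<le> KR R * norm (f - g) + e"
    proof -
      have "mass_psi * e' \<le> e" using m1 assms(1) by (simp add: e'_def divide_le_eq distrib_left)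
      then show ?thesis by (simp add: KR_def algebra_simps)
    qed
    finally show ?thesis .
  qed
  then show ?thesis using \<delta>(1) by blast
qed

lemma continuous_Qt: "continuous_on S Qt"
  by (rule quasi_lipschitz_continuous[OF Qt_quasi_lipschitz KR_nonneg])

text \<open>The group is unitary and commutes with \<open>Lam\<close>, so it can be moved to the
  other factor under the integral. Gauge invariance of \<open>N\<close> and its role as gradient of
  \<open>pot\<close> thereby pass to the average.\<close>

lemma Qt_inner: "inner (Lam (Qt g)) (Lam k) = (LINT r|lborel. \<psi> r * inner (Lam (N (U r g))) (Lam (U r k)))"
proof -
  have "inner (Lam (Qt g)) (Lam k) = inner (Qt g) (Lam (Lam k))"
    by (simp add: inner_mul_left)
  also have "\<dots> = (LINT r|lborel. inner (\<psi> r *\<^sub>R twist g r) (Lam (Lam k)))"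
    unfolding Qt_def by (rule integral_inner_left[symmetric]) (rule psi_twist_integrable)
  also have "\<dots> = (LINT r|lborel. \<psi> r * inner (Lam (N (U r g))) (Lam (U r k)))"
  proof (rule Bochner_Integration.integral_cong)
    fix r
    have "inner (twist g r) (Lam (Lam k)) = inner (N (U r g)) (U r (Lam (Lam k)))"
      using inner_U[of "- r" "N (U r g)" "Lam (Lam k)"] by (simp add: twist_def)
    also have "U r (Lam (Lam k)) = Lam (Lam (U r k))"
      by (simp only: mul_commute[OF bdd_meas_sch bdd_meas_lam])
    also have "inner (N (U r g)) (Lam (Lam (U r k))) = inner (Lam (N (U r g))) (Lam (U r k))"
      by (simp add: inner_mul_left)
    finally show "inner (\<psi> r *\<^sub>R twist g r) (Lam (Lam k)) = \<psi> r * inner (Lam (N (U r g))) (Lam (U r k))" by simp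
  qed simp
  finally show ?thesis .
qed

lemma Qt_gauge: "inner (Lam (Qt g)) (Lam (cscale \<i> g)) = 0"
  unfolding Qt_inner mul_commute[OF bdd_meas_sch bdd_meas_const] by (simp add: N_gauge)

section \<open>The averaged potential energy\<close>

definition Pot :: "l2 \<Rightarrow> real" where
  "Pot g = (LINT r|lborel. pot (U r g) * \<psi> r)"

lemma pot_0: "pot 0 = 0"
proof -
  have "ev 0 x = 0" for x using ev_diff[of 0 0 x] by simp
  then show ?thesis by (simp add: pot_def W_0)
qed

lemma continuous_pot: "continuous_on S pot"
  by (rule taylor_continuous[OF pot_taylor Lpot_nonneg])

lemma abs_pot_le: "norm g \<le> R \<Longrightarrow> \<bar>pot g\<bar> \<le> Lpot R * R\<^sup>2"
proof -
  assume g: "norm g \<le> R"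
  have "\<bar>pot g\<bar> \<le> Lpot R * (norm (Lam g))\<^sup>2"
    using pot_taylor[of g R 0] g order_trans[OF norm_ge_zero g] by (simp add: pot_0 N_0)
  also have "\<dots> \<le> Lpot R * R\<^sup>2"
    using order_trans[OF norm_Lam_le g] by (intro mult_left_mono power_mono Lpot_nonneg) simp_all
  finally show ?thesis .
qed

lemma pot_U_measurable [measurable]: "(\<lambda>r. pot (U r g)) \<in> borel_measurable borel"
proof (rule borel_measurable_continuous_onI)
  show "continuous_on UNIV (\<lambda>r. pot (U r g))"
    using continuous_on_compose2[OF continuous_pot[of UNIV] continuous_U[OF continuous_on_const, of UNIV 1 g]] by simp
qed

lemma psi_pot_integrable: "integrable lborel (\<lambda>r. pot (U r g) * \<psi> r)"
  using psi_weighted(1)[OF pot_U_measurable, of g "Lpot (norm g) * (norm g)\<^sup>2"] abs_pot_le[of "U r g" "norm g" for r]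
  by (simp add: mult.commute)

text \<open>\<open>Qt\<close> is the L^2 gradient of \<open>Pot\<close>: the expansion of
  \<open>pot\<close> is integrated along the orbit \<open>U r g\<close>, and its remainder does not
  depend on \<open>r\<close> because the group preserves the L^2 norm.\<close>

lemma Pot_taylor:
  assumes "norm f \<le> R" "norm g \<le> R"
  shows "\<bar>Pot f - Pot g - inner (Lam (Qt g)) (Lam (f - g))\<bar> \<le> mass_psi * (Lpot R * (norm (Lam (f - g)))\<^sup>2)"
proof -
  define X where "X r = pot (U r f) - pot (U r g) - inner (Lam (N (U r g))) (Lam (U r (f - g)))" for r
  have le: "norm (X r) \<le> Lpot R * (norm (Lam (f - g)))\<^sup>2" for r
    using pot_taylor[of "U r f" R "U r g"] norm_Lam_U_diff[of r f g] assms by (simp add: X_def mul_diff[of "sch r"])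
  have cN: "continuous_on UNIV (\<lambda>r. N (U r g))"
    using continuous_on_compose2[OF continuous_N[of UNIV] continuous_U[OF continuous_on_const, of UNIV 1 g]] by simp
  have cU: "continuous_on UNIV (\<lambda>r. U r (f - g))"
    using continuous_U[OF continuous_on_const, of UNIV 1 "f - g"] by simp
  have c: "continuous_on UNIV (\<lambda>r. inner (Lam (N (U r g))) (Lam (U r (f - g))))"
    by (intro continuous_on_inner bounded_linear.continuous_on[OF bounded_linear_mul[OF bdd_meas_lam]] cN cU)
  have m: "(\<lambda>r. inner (Lam (N (U r g))) (Lam (U r (f - g)))) \<in> borel_measurable borel"
    by (rule borel_measurable_continuous_onI[OF c])
  have bd: "norm (inner (Lam (N (U r g))) (Lam (U r (f - g)))) \<le> 2 * Lip R * R * norm (f - g)" for r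
  proof -
    have "norm (Lam (N (U r g))) \<le> 2 * Lip R * norm g"
      using norm_Lam_le[of "N (U r g)"] N_bound[of "U r g" R] assms by simp
    also have "\<dots> \<le> 2 * Lip R * R" using assms Lip(1)[of R] by (intro mult_left_mono) auto
    finally have 1: "norm (Lam (N (U r g))) \<le> 2 * Lip R * R" .
    have 2: "norm (Lam (U r (f - g))) \<le> norm (f - g)" using norm_Lam_le[of "U r (f - g)"] by simp
    have "norm (inner (Lam (N (U r g))) (Lam (U r (f - g)))) \<le> norm (Lam (N (U r g))) * norm (Lam (U r (f - g)))"
      unfolding real_norm_def by (rule Cauchy_Schwarz_ineq2)
    also have "\<dots> \<le> 2 * Lip R * R * norm (f - g)"
      using 1 2 order_trans[OF norm_ge_zero 1] by (intro mult_mono) auto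
    finally show ?thesis .
  qed
  have i3: "integrable lborel (\<lambda>r. \<psi> r * inner (Lam (N (U r g))) (Lam (U r (f - g))))"
    using psi_weighted(1)[OF m bd] by simp
  have "Pot f - Pot g - inner (Lam (Qt g)) (Lam (f - g)) = (LINT r|lborel. pot (U r f) * \<psi> r - pot (U r g) * \<psi> r - \<psi> r * inner (Lam (N (U r g))) (Lam (U r (f - g))))"
    unfolding Pot_def Qt_inner
    by (simp add: psi_pot_integrable i3)
  also have "\<dots> = (LINT r|lborel. \<psi> r *\<^sub>R X r)"
    by (rule Bochner_Integration.integral_cong) (simp_all add: X_def algebra_simps)
  also have "norm \<dots> \<le> mass_psi * (Lpot R * (norm (Lam (f - g)))\<^sup>2)"
    by (rule psi_weighted(2)[OF _ le]) (use m in \<open>simp add: X_def[abs_def]\<close>)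
  finally show ?thesis by simp
qed

lemma continuous_Pot: "continuous_on S Pot"
  by (rule taylor_continuous[where X=Qt and L="\<lambda>R. mass_psi * Lpot R"])
     (use Pot_taylor mass_psi_nonneg Lpot_nonneg in \<open>simp_all add: mult.assoc\<close>)

subsection \<open>The equation in the interaction picture\<close>

definition G :: "real \<Rightarrow> l2 \<Rightarrow> l2" where
  "G t w = cscale \<i> (U (- (d * t)) (Qt (U (d * t) w)))"

lemma norm_cscale_i [simp]: "norm (cscale \<i> f) = norm f"
  by (rule mul_isometry) simp_all

lemma norm_G_le: "norm w \<le> R \<Longrightarrow> norm (G t w) \<le> KR R * norm w"
  using Qt_bound[of "U (d * t) w" R] by (simp add: G_def)

lemma G_diff: "G t f - G t g = cscale \<i> (U (- (d * t)) (Qt (U (d * t) f) - Qt (U (d * t) g)))"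
  by (simp add: G_def mul_diff)

lemma G_lipschitz_Lam:
  assumes "norm f \<le> R" "norm g \<le> R"
  shows "norm (Lam (G t f - G t g)) \<le> KR R * norm (Lam (f - g))"
proof -
  have "Lam (G t f - G t g) = cscale \<i> (U (- (d * t)) (Lam (Qt (U (d * t) f) - Qt (U (d * t) g))))"
    unfolding G_diff mul_commute[OF bdd_meas_lam bdd_meas_const] mul_commute[OF bdd_meas_lam bdd_meas_sch] ..
  then have "norm (Lam (G t f - G t g)) = norm (Lam (Qt (U (d * t) f) - Qt (U (d * t) g)))" by simp
  also have "\<dots> \<le> KR R * norm (Lam (U (d * t) f - U (d * t) g))" using assms by (intro Qt_lipschitz_Lam) simp_all
  finally show ?thesis by (simp only: norm_Lam_U_diff)
qed

lemma G_quasi_lipschitz: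
  assumes "e > 0" "R \<ge> 0"
  shows "\<exists>\<delta>>0. \<forall>t f g. norm f \<le> R \<and> norm g \<le> R \<and> norm (Lam (f - g)) < \<delta> \<longrightarrow> norm (G t f - G t g) \<le> KR R * norm (f - g) + e"
proof -
  obtain \<delta> where \<delta>: "\<delta> > 0" "\<And>f g. norm f \<le> R \<Longrightarrow> norm g \<le> R \<Longrightarrow> norm (Lam (f - g)) < \<delta> \<Longrightarrow> norm (Qt f - Qt g) \<le> KR R * norm (f - g) + e"
    using Qt_quasi_lipschitz[OF assms] by blast
  have "norm (G t f - G t g) \<le> KR R * norm (f - g) + e" if fg: "norm f \<le> R" "norm g \<le> R" "norm (Lam (f - g)) < \<delta>" for t f g
  proof -
    have "norm (G t f - G t g) = norm (Qt (U (d * t) f) - Qt (U (d * t) g))" unfolding G_diff by simp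
    also have "\<dots> \<le> KR R * norm (U (d * t) f - U (d * t) g) + e"
      using fg norm_Lam_U_diff by (intro \<delta>(2)) simp_all
    also have "norm (U (d * t) f - U (d * t) g) = norm (f - g)" by (simp flip: mul_diff)
    finally show ?thesis .
  qed
  then show ?thesis using \<delta>(1) by blast
qed

lemma continuous_G:
  assumes "continuous_on S w"
  shows "continuous_on S (\<lambda>t. G t (w t))"
proof -
  have "continuous_on S (\<lambda>t. Qt (U (d * t) (w t)))"
    by (rule continuous_on_compose2[OF continuous_Qt[of UNIV] continuous_U[OF assms]]) simp
  from continuous_U[OF this, of "- d"] show ?thesis
    unfolding G_def by (intro bounded_linear.continuous_on[OF bounded_linear_mul[OF bdd_meas_const]]) simp
qed

end

subsection \<open>Picard iteration in two norms\<close>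

lemma vector_derivative_bound:
  fixes F :: "real \<Rightarrow> 'a::real_normed_vector"
  assumes "\<And>t. t \<in> {-M..M} \<Longrightarrow> (F has_vector_derivative f t) (at t within {-M..M})"
    and "\<And>t. t \<in> {-M..M} \<Longrightarrow> norm (f t) \<le> c" and "t \<in> {-M..M}" and "F 0 = 0"
  shows "norm (F t) \<le> M * c"
proof -
  have M: "0 \<in> {-M..M}" using assms(3) by auto
  have "norm (F t - F 0) \<le> c * norm (t - 0)"
  proof (rule differentiable_bound[where S="{-M..M}"])
    show "(F has_derivative (\<lambda>h. h *\<^sub>R f x)) (at x within {-M..M})" if "x \<in> {-M..M}" for x
      using assms(1)[OF that] by (simp add: has_vector_derivative_def)
    show "onorm (\<lambda>h. h *\<^sub>R f x) \<le> c" if "x \<in> {-M..M}" for x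
      using assms(2)[OF that] order_trans[OF norm_ge_zero assms(2)[OF that]]
      by (intro onorm_bound) (simp_all add: mult.commute[of c] mult_left_mono)
  qed (use assms(3) M in auto)
  also have "\<dots> \<le> c * M"
    using assms(3) order_trans[OF norm_ge_zero assms(2)[OF M]] by (intro mult_left_mono) auto
  finally show ?thesis using assms(4) by (simp add: mult.commute)
qed

text \<open>A self-improving bound: the supremum \<open>s\<close> of \<open>f\<close> satisfies
  \<open>s \<le> a + s / 2\<close>. The crude bound \<open>C\<close> enters only to make
  \<open>s\<close> finite, and the result does not depend on it.\<close>

lemma half_bound:
  fixes f :: "'a \<Rightarrow> real"
  assumes bd: "\<And>t. t \<in> S \<Longrightarrow> f t \<le> C"
    and step: "\<And>c. (\<And>t. t \<in> S \<Longrightarrow> f t \<le> c) \<Longrightarrow> (\<And>t. t \<in> S \<Longrightarrow> f t \<le> a + c / 2)"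
    and t: "t \<in> S"
  shows "f t \<le> 2 * a"
proof -
  have b: "bdd_above (f ` S)" using bd by (intro bdd_aboveI2) auto
  have le: "f s \<le> Sup (f ` S)" if "s \<in> S" for s using b that by (intro cSup_upper) auto
  have "Sup (f ` S) \<le> a + Sup (f ` S) / 2"
    using t step[OF le] by (intro cSup_least) auto
  then show ?thesis using le[OF t] by linarith
qed

text \<open>For negative \<open>t\<close> the interval \<open>{0..t}\<close> is empty and the
  integral over it would be 0. Integrating from \<open>-M\<close> and subtracting gives the signed
  primitive on both sides of 0.\<close>

definition primitive :: "real \<Rightarrow> (real \<Rightarrow> 'a::banach) \<Rightarrow> real \<Rightarrow> 'a" where
  "primitive M f = (\<lambda>t. integral {-M..t} f - integral {-M..0} f)"

lemma primitive_0: "primitive M f 0 = 0"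
  by (simp add: primitive_def)

lemma primitive_has_derivative:
  "continuous_on {-M..M} f \<Longrightarrow> t \<in> {-M..M} \<Longrightarrow> (primitive M f has_vector_derivative f t) (at t within {-M..M})"
  unfolding primitive_def
  using has_vector_derivative_diff[OF integral_has_vector_derivative[of "-M" M f t] has_vector_derivative_const[of "integral {-M..0} f"]]
  by simp

context averaged_nonlinearity
begin

definition solves :: "real \<Rightarrow> (real \<Rightarrow> l2) \<Rightarrow> bool" where
  "solves M w \<longleftrightarrow> (\<forall>t\<in>{-M..M}. (w has_vector_derivative G t (w t)) (at t within {-M..M}))"

fun picard :: "real \<Rightarrow> l2 \<Rightarrow> nat \<Rightarrow> real \<Rightarrow> l2" where
  "picard M \<phi> 0 = (\<lambda>t. \<phi>)"
| "picard M \<phi> (Suc n) = (\<lambda>t. \<phi> + primitive M (\<lambda>s. G s (picard M \<phi> n s)) t)"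

context
  fixes M R :: real
  assumes R: "R > 0" and M: "M > 0" and small: "M * KR R \<le> 1/2"
begin

text \<open>One integration over time at most \<open>M\<close> multiplies a Lipschitz bound by
  \<open>M * KR R \<le> 1/2\<close>.\<close>

lemma Picard_step_le:
  assumes "\<And>t. t \<in> {-M..M} \<Longrightarrow> (F has_vector_derivative G t (v t) - G t (w t)) (at t within {-M..M})"
    and "\<And>t. t \<in> {-M..M} \<Longrightarrow> norm (v t) \<le> R" "\<And>t. t \<in> {-M..M} \<Longrightarrow> norm (w t) \<le> R"
    and "\<And>t. t \<in> {-M..M} \<Longrightarrow> norm (Lam (v t - w t)) \<le> c" and t: "t \<in> {-M..M}" and "F 0 = 0"
  shows "norm (Lam (F t)) \<le> c / 2"
proof -
  have "0 \<in> {-M..M}" using M by simp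
  from order_trans[OF norm_ge_zero assms(4)[OF this]] have c: "c \<ge> 0" .
  have "norm (Lam (F t)) \<le> M * (KR R * c)"
  proof (rule vector_derivative_bound[where F="\<lambda>t. Lam (F t)" and f="\<lambda>t. Lam (G t (v t) - G t (w t))"])
    show "((\<lambda>t. Lam (F t)) has_vector_derivative Lam (G t (v t) - G t (w t))) (at t within {-M..M})" if "t \<in> {-M..M}" for t
      using bounded_linear.has_vector_derivative[OF bounded_linear_mul[OF bdd_meas_lam] assms(1)[OF that]] by simp
    show "norm (Lam (G t (v t) - G t (w t))) \<le> KR R * c" if "t \<in> {-M..M}" for t
      using G_lipschitz_Lam[OF assms(2,3)[OF that], of t] mult_left_mono[OF assms(4)[OF that] KR_nonneg[of R]] by linarith
  qed (use assms in simp_all)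
  also have "\<dots> \<le> 1/2 * c" using mult_right_mono[OF small c] by (simp add: mult.assoc)
  finally show ?thesis by simp
qed

text \<open>As in the weak norm, but with the error \<open>e\<close> from the modulus of continuity.
  The map \<open>c \<mapsto> M * e + c / 2\<close> has fixed point \<open>2 * M * e\<close>; this is
  the distance that iteration reaches, and it is made small through \<open>e\<close>.\<close>

lemma Picard_strong_step:
  assumes "\<And>t. t \<in> {-M..M} \<Longrightarrow> (F has_vector_derivative G t (v t) - G t (w t)) (at t within {-M..M})"
    and "\<And>t. t \<in> {-M..M} \<Longrightarrow> norm (G t (v t) - G t (w t)) \<le> KR R * norm (v t - w t) + e"
    and "\<And>t. t \<in> {-M..M} \<Longrightarrow> norm (v t - w t) \<le> c" and t: "t \<in> {-M..M}" and "F 0 = 0"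
  shows "norm (F t) \<le> M * e + c / 2"
proof -
  have "0 \<in> {-M..M}" using M by simp
  from order_trans[OF norm_ge_zero assms(3)[OF this]] have c: "c \<ge> 0" .
  have "norm (F t) \<le> M * (KR R * c + e)"
  proof (rule vector_derivative_bound[where f="\<lambda>t. G t (v t) - G t (w t)"])
    show "norm (G t (v t) - G t (w t)) \<le> KR R * c + e" if "t \<in> {-M..M}" for t
      using assms(2)[OF that] mult_left_mono[OF assms(3)[OF that] KR_nonneg[of R]] by linarith
  qed (use assms in simp_all)
  also have "\<dots> \<le> M * e + c / 2" using mult_right_mono[OF small c] by (simp add: algebra_simps)
  finally show ?thesis .
qed

context
  fixes \<phi> :: l2
  assumes phi: "norm \<phi> \<le> R / 2"
begin

text \<open>The datum takes one half of the radius, and the smallness of \<open>M\<close> bounds the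
  integral term by the other half.\<close>

lemma picard_props:
  "continuous_on {-M..M} (picard M \<phi> n) \<and> (\<forall>t\<in>{-M..M}. norm (picard M \<phi> n t) \<le> R)"
proof (induction n)
  case 0
  then show ?case using phi R by auto
next
  case (Suc n)
  define f where "f = (\<lambda>s. G s (picard M \<phi> n s))"
  have f: "continuous_on {-M..M} f" unfolding f_def by (rule continuous_G) (use Suc in simp)
  have d: "(primitive M f has_vector_derivative f t) (at t within {-M..M})" if "t \<in> {-M..M}" for t
    by (rule primitive_has_derivative[OF f that])
  have "continuous_on {-M..M} (primitive M f)"
    unfolding continuous_on_eq_continuous_within using has_vector_derivative_continuous[OF d] by blast
  moreover have "norm (\<phi> + primitive M f t) \<le> R" if t: "t \<in> {-M..M}" for t
  proof -
    have "norm (primitive M f t) \<le> M * (KR R * R)"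
    proof (rule vector_derivative_bound[OF d _ t primitive_0])
      show "norm (f t) \<le> KR R * R" if "t \<in> {-M..M}" for t
        unfolding f_def using norm_G_le[of "picard M \<phi> n t" R t] Suc that
          mult_left_mono[OF _ KR_nonneg[of R], of "norm (picard M \<phi> n t)" R] by force
    qed
    also have "\<dots> \<le> R / 2" using mult_right_mono[OF small, of R] R by (simp add: mult.assoc)
    finally show ?thesis using norm_triangle_ineq[of \<phi> "primitive M f t"] phi by linarith
  qed
  ultimately show ?case by (auto simp: f_def intro!: continuous_on_add continuous_on_const)
qed

lemma picard_diff_derivative:
  "t \<in> {-M..M} \<Longrightarrow> ((\<lambda>t. picard M \<phi> (Suc m) t - picard M \<phi> (Suc n) t) has_vector_derivative
     G t (picard M \<phi> m t) - G t (picard M \<phi> n t)) (at t within {-M..M})"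
proof -
  assume t: "t \<in> {-M..M}"
  have "((\<lambda>t. primitive M (\<lambda>s. G s (picard M \<phi> m s)) t - primitive M (\<lambda>s. G s (picard M \<phi> n s)) t) has_vector_derivative
     G t (picard M \<phi> m t) - G t (picard M \<phi> n t)) (at t within {-M..M})"
    using picard_props t by (intro has_vector_derivative_diff primitive_has_derivative[where f="\<lambda>s. G s (picard M \<phi> k s)" for k] continuous_G) auto
  then show ?thesis by simp
qed

lemma picard_weak_Cauchy:
  "k \<le> m \<Longrightarrow> k \<le> n \<Longrightarrow> t \<in> {-M..M} \<Longrightarrow> norm (Lam (picard M \<phi> m t - picard M \<phi> n t)) \<le> 2 * R * (1/2)^k"
proof (induction k arbitrary: m n t)
  case 0
  have "norm (Lam (picard M \<phi> m t - picard M \<phi> n t)) \<le> norm (picard M \<phi> m t - picard M \<phi> n t)" by (rule norm_Lam_le)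
  also have "\<dots> \<le> norm (picard M \<phi> m t) + norm (picard M \<phi> n t)" by (rule norm_triangle_ineq4)
  also have "\<dots> \<le> 2 * R" using picard_props[of m] picard_props[of n] 0 by fastforce
  finally show ?case by simp
next
  case (Suc k)
  obtain m' n' where mn: "m = Suc m'" "n = Suc n'" "k \<le> m'" "k \<le> n'" using Suc.prems by (metis Suc_le_D Suc_le_mono)
  have "norm (Lam (picard M \<phi> m t - picard M \<phi> n t)) \<le> (2 * R * (1/2)^k) / 2"
    unfolding mn
    by (rule Picard_step_le[OF picard_diff_derivative]) (use picard_props Suc mn in \<open>auto simp: primitive_0\<close>)
  then show ?case by simp
qed

text \<open>The first \<open>j\<close> steps bring the iterates within \<open>\<delta>\<close> of
  each other in the L^2 norm, which makes the quasi-Lipschitz estimate with error \<open>e'\<close>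
  available; the next \<open>i\<close> steps halve the H^1 distance down to
  \<open>2 * M * e'\<close> plus at most \<open>e / 2\<close>. With \<open>e' = e / (4 * M)\<close>
  the total is at most \<open>e\<close>.\<close>

lemma picard_strong_Cauchy:
  assumes "e > 0"
  shows "\<exists>k. \<forall>m\<ge>k. \<forall>n\<ge>k. \<forall>t\<in>{-M..M}. norm (picard M \<phi> m t - picard M \<phi> n t) \<le> e"
proof -
  define e' where "e' = e / (4 * M)"
  have e': "e' > 0" using assms M by (simp add: e'_def)
  obtain \<delta> where \<delta>: "\<delta> > 0" "\<And>t f g. norm f \<le> R \<Longrightarrow> norm g \<le> R \<Longrightarrow> norm (Lam (f - g)) < \<delta> \<Longrightarrow> norm (G t f - G t g) \<le> KR R * norm (f - g) + e'"
    using G_quasi_lipschitz[OF e', of R] R by (metis less_imp_le)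
  obtain j where j: "(1/2::real)^j < \<delta> / (2 * R)"
    using real_arch_pow_inv[of "\<delta> / (2 * R)" "1/2"] \<delta>(1) R by auto
  obtain i where i: "(1/2::real)^i < e / (4 * R)"
    using real_arch_pow_inv[of "e / (4 * R)" "1/2"] assms R by auto
  have le: "norm (picard M \<phi> m t - picard M \<phi> n t) \<le> 2 * M * e' + 2 * R * (1/2)^l" if "j + l \<le> m" "j + l \<le> n" "t \<in> {-M..M}" for l m n t
    using that
  proof (induction l arbitrary: m n t)
    case 0
    have "norm (picard M \<phi> m t - picard M \<phi> n t) \<le> norm (picard M \<phi> m t) + norm (picard M \<phi> n t)" by (rule norm_triangle_ineq4)
    also have "\<dots> \<le> 2 * R" using picard_props[of m] picard_props[of n] 0 by fastforce
    finally show ?case using mult_pos_pos[OF M e'] by simp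
  next
    case (Suc l)
    obtain m' n' where mn: "m = Suc m'" "n = Suc n'" "j + l \<le> m'" "j + l \<le> n'"
      using Suc.prems by (metis Suc_le_D Suc_le_mono add_Suc_right)
    have G: "norm (G s (picard M \<phi> m' s) - G s (picard M \<phi> n' s)) \<le> KR R * norm (picard M \<phi> m' s - picard M \<phi> n' s) + e'"
      if s: "s \<in> {-M..M}" for s
    proof (rule \<delta>(2))
      have "norm (Lam (picard M \<phi> m' s - picard M \<phi> n' s)) \<le> 2 * R * (1/2)^j"
        by (rule picard_weak_Cauchy) (use mn s in auto)
      also have "\<dots> < \<delta>" using j R by (simp add: field_simps)
      finally show "norm (Lam (picard M \<phi> m' s - picard M \<phi> n' s)) < \<delta>" .
    qed (use picard_props s in auto)
    have "norm (picard M \<phi> m t - picard M \<phi> n t) \<le> M * e' + (2 * M * e' + 2 * R * (1/2)^l) / 2"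
      unfolding mn
      by (rule Picard_strong_step[OF picard_diff_derivative G]) (use Suc mn in \<open>auto simp: primitive_0\<close>)
    also have "\<dots> = 2 * M * e' + 2 * R * (1/2)^Suc l" by (simp add: field_simps)
    finally show ?case .
  qed
  have "norm (picard M \<phi> m t - picard M \<phi> n t) \<le> e" if "j + i \<le> m" "j + i \<le> n" "t \<in> {-M..M}" for m n t
  proof -
    have "2 * R * (1/2)^i \<le> e / 2" using i R by (simp add: field_simps)
    moreover have "2 * M * e' = e / 2" using M by (simp add: e'_def)
    ultimately show ?thesis using le[OF that] by linarith
  qed
  then show ?thesis by blast
qed

lemma picard_solution:
  "\<exists>w. w 0 = \<phi> \<and> continuous_on {-M..M} w \<and> (\<forall>t\<in>{-M..M}. norm (w t) \<le> R) \<and> solves M w"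
proof -
  have "uniformly_Cauchy_on {-M..M} (picard M \<phi>)"
    unfolding uniformly_Cauchy_on_def
  proof (intro allI impI)
    fix e :: real assume "e > 0"
    then obtain k where k: "\<forall>m\<ge>k. \<forall>n\<ge>k. \<forall>t\<in>{-M..M}. norm (picard M \<phi> m t - picard M \<phi> n t) \<le> e / 2"
      using picard_strong_Cauchy[of "e/2"] by auto
    have "dist (picard M \<phi> m t) (picard M \<phi> n t) < e" if "m \<ge> k" "n \<ge> k" "t \<in> {-M..M}" for m n t
    proof -
      have "norm (picard M \<phi> m t - picard M \<phi> n t) \<le> e / 2" using k that by blast
      then show ?thesis using \<open>e > 0\<close> by (simp add: dist_norm)
    qed
    then show "\<exists>k. \<forall>t\<in>{-M..M}. \<forall>m\<ge>k. \<forall>n\<ge>k. dist (picard M \<phi> m t) (picard M \<phi> n t) < e" by blast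
  qed
  then have "uniformly_convergent_on {-M..M} (picard M \<phi>)" by (rule Cauchy_uniformly_convergent)
  then obtain w where w: "uniform_limit {-M..M} (picard M \<phi>) w sequentially"
    unfolding uniformly_convergent_on_def by blast
  have cw: "continuous_on {-M..M} w"
    by (rule uniform_limit_theorem[OF _ w]) (use picard_props in auto)
  have lim: "(\<lambda>n. picard M \<phi> n t) \<longlonglongrightarrow> w t" if "t \<in> {-M..M}" for t
    by (rule tendsto_uniform_limitI[OF w that])
  have Rw: "norm (w t) \<le> R" if "t \<in> {-M..M}" for t
    by (rule LIMSEQ_le_const2[OF tendsto_norm[OF lim[OF that]]]) (use picard_props that in auto)
  \<comment> \<open>One more Picard step applied to the limit. The iterates converge to
    \<open>v\<close> as well, so \<open>v = w\<close> on the interval, and \<open>w\<close> inherits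
    the derivative of \<open>v\<close>.\<close>
  define v where "v t = \<phi> + primitive M (\<lambda>s. G s (w s)) t" for t
  have v': "(v has_vector_derivative G t (w t)) (at t within {-M..M})" if "t \<in> {-M..M}" for t
    unfolding v_def
    using has_vector_derivative_add[OF has_vector_derivative_const primitive_has_derivative[OF continuous_G[OF cw] that], of \<phi>] by simp
  have "w t = v t" if t: "t \<in> {-M..M}" for t
  proof -
    have "(\<lambda>n. picard M \<phi> (Suc n) t) \<longlonglongrightarrow> v t"
    proof (rule metric_LIMSEQ_I)
      fix e :: real assume e: "e > 0"
      define e' where "e' = e / (4 * M)"
      have e': "e' > 0" using e M by (simp add: e'_def)
      obtain \<delta> where \<delta>: "\<delta> > 0" "\<And>t f g. norm f \<le> R \<Longrightarrow> norm g \<le> R \<Longrightarrow> norm (Lam (f - g)) < \<delta> \<Longrightarrow> norm (G t f - G t g) \<le> KR R * norm (f - g) + e'"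
        using G_quasi_lipschitz[OF e', of R] R by (metis less_imp_le)
      have "min \<delta> e > 0" using \<delta> e by simp
      then obtain k where k: "\<And>n s. n \<ge> k \<Longrightarrow> s \<in> {-M..M} \<Longrightarrow> dist (picard M \<phi> n s) (w s) < min \<delta> e"
        using w unfolding uniform_limit_iff eventually_sequentially by blast
      have "dist (picard M \<phi> (Suc n) t) (v t) < e" if n: "n \<ge> k" for n
      proof -
        have "norm (picard M \<phi> (Suc n) t - v t) \<le> M * e' + e / 2"
        proof (rule Picard_strong_step[where F="\<lambda>t. picard M \<phi> (Suc n) t - v t" and v="picard M \<phi> n" and w=w])
          fix s assume s: "s \<in> {-M..M}"
          have "(picard M \<phi> (Suc n) has_vector_derivative G s (picard M \<phi> n s)) (at s within {-M..M})"
            using has_vector_derivative_add[OF has_vector_derivative_const primitive_has_derivative[OF continuous_G s], of "picard M \<phi> n" \<phi>] picard_props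
            by simp
          from has_vector_derivative_diff[OF this v'[OF s]]
          show "((\<lambda>t. picard M \<phi> (Suc n) t - v t) has_vector_derivative G s (picard M \<phi> n s) - G s (w s)) (at s within {-M..M})" .
          have "norm (picard M \<phi> n s - w s) < min \<delta> e" using k[OF n s] by (simp add: dist_norm)
          then show "norm (G s (picard M \<phi> n s) - G s (w s)) \<le> KR R * norm (picard M \<phi> n s - w s) + e'"
            using picard_props s Rw norm_Lam_le[of "picard M \<phi> n s - w s"] by (intro \<delta>(2)) auto
          show "norm (picard M \<phi> n s - w s) \<le> e" using \<open>norm (picard M \<phi> n s - w s) < min \<delta> e\<close> by simp
        qed (use t in \<open>simp_all add: v_def primitive_0\<close>)
        also have "\<dots> < e" using e M by (simp add: e'_def)
        finally show ?thesis by (simp add: dist_norm)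
      qed
      then show "\<exists>k. \<forall>n\<ge>k. dist (picard M \<phi> (Suc n) t) (v t) < e" by blast
    qed
    moreover have "(\<lambda>n. picard M \<phi> (Suc n) t) \<longlonglongrightarrow> w t" by (rule LIMSEQ_Suc[OF lim[OF t]])
    ultimately show ?thesis using LIMSEQ_unique by blast
  qed
  note wv = this
  have "w 0 = \<phi>" using wv[of 0] M by (simp add: v_def primitive_0)
  moreover have "solves M w"
    unfolding solves_def
  proof
    fix t assume t: "t \<in> {-M..M}"
    show "(w has_vector_derivative G t (w t)) (at t within {-M..M})"
      by (rule has_vector_derivative_transform[OF t _ v'[OF t]]) (use wv in auto)
  qed
  ultimately show ?thesis using cw Rw by blast
qed

end

text \<open>\<open>half_bound\<close> is used twice: in the weak norm it bounds the distance by
  twice the initial one, which brings it below \<open>\<delta>\<close>; only then does the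
  quasi-Lipschitz estimate apply, and the second use is in the full norm.\<close>

lemma solution_dependence:
  assumes v: "solves M v" "\<And>t. t \<in> {-M..M} \<Longrightarrow> norm (v t) \<le> R" and e: "e > 0"
  shows "\<exists>\<delta>>0. \<forall>w. solves M w \<and> (\<forall>t\<in>{-M..M}. norm (w t) \<le> R) \<and> norm (w 0 - v 0) < \<delta> \<longrightarrow>
    (\<forall>t\<in>{-M..M}. norm (w t - v t) \<le> e)"
proof -
  define e' where "e' = e / (4 * M)"
  have e': "e' > 0" using e M by (simp add: e'_def)
  obtain \<delta> where \<delta>: "\<delta> > 0" "\<And>t f g. norm f \<le> R \<Longrightarrow> norm g \<le> R \<Longrightarrow> norm (Lam (f - g)) < \<delta> \<Longrightarrow> norm (G t f - G t g) \<le> KR R * norm (f - g) + e'"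
    using G_quasi_lipschitz[OF e', of R] R by (metis less_imp_le)
  \<comment> \<open>An initial distance below \<open>\<delta> / 3\<close> keeps the weak distance
    below \<open>2 * \<delta> / 3\<close>; \<open>e / 4\<close> and \<open>M * e' = e / 4\<close>
    add up to \<open>e\<close> after doubling.\<close>
  have "norm (w t - v t) \<le> e" if w: "solves M w" "\<And>t. t \<in> {-M..M} \<Longrightarrow> norm (w t) \<le> R" "norm (w 0 - v 0) < min (\<delta> / 3) (e / 4)" and t: "t \<in> {-M..M}" for w t
  proof -
    define F where "F t = (w t - v t) - (w 0 - v 0)" for t
    have F: "(F has_vector_derivative G s (w s) - G s (v s)) (at s within {-M..M})" if "s \<in> {-M..M}" for s
    proof -
      have "(w has_vector_derivative G s (w s)) (at s within {-M..M})" "(v has_vector_derivative G s (v s)) (at s within {-M..M})"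
        using w(1) v(1) that unfolding solves_def by auto
      from has_vector_derivative_diff[OF has_vector_derivative_diff[OF this] has_vector_derivative_const[of "w 0 - v 0"]]
      show ?thesis unfolding F_def by simp
    qed
    have F0: "F 0 = 0" by (simp add: F_def)
    have wvF: "w s - v s = (w 0 - v 0) + F s" for s by (simp add: F_def)
    have weak: "norm (Lam (w s - v s)) \<le> 2 * norm (w 0 - v 0)" if s: "s \<in> {-M..M}" for s
    proof (rule half_bound[where S="{-M..M}" and C="2 * R" and f="\<lambda>s. norm (Lam (w s - v s))"])
      show "norm (Lam (w s - v s)) \<le> 2 * R" if "s \<in> {-M..M}" for s
        using norm_Lam_le[of "w s - v s"] norm_triangle_ineq4[of "w s" "v s"] w(2)[OF that] v(2)[OF that] by linarith
      show "norm (Lam (w s - v s)) \<le> norm (w 0 - v 0) + c / 2"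
        if c: "\<And>s. s \<in> {-M..M} \<Longrightarrow> norm (Lam (w s - v s)) \<le> c" and s: "s \<in> {-M..M}" for c s
      proof -
        have "norm (Lam (F s)) \<le> c / 2" by (rule Picard_step_le[OF F w(2) v(2) c s F0])
        moreover have "norm (Lam (w s - v s)) \<le> norm (Lam (w 0 - v 0)) + norm (Lam (F s))"
          unfolding wvF[of s] mul_add[OF bdd_meas_lam] by (rule norm_triangle_ineq)
        ultimately show ?thesis using norm_Lam_le[of "w 0 - v 0"] by linarith
      qed
    qed (rule s)
    have G: "norm (G s (w s) - G s (v s)) \<le> KR R * norm (w s - v s) + e'" if "s \<in> {-M..M}" for s
    proof -
      have "norm (Lam (w s - v s)) < \<delta>" using weak[OF that] w(3) \<delta>(1) by simp
      then show ?thesis by (intro \<delta>(2) w(2) v(2) that)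
    qed
    have "norm (w t - v t) \<le> 2 * (norm (w 0 - v 0) + M * e')"
    proof (rule half_bound[where S="{-M..M}" and C="2 * R" and f="\<lambda>s. norm (w s - v s)"])
      show "norm (w s - v s) \<le> 2 * R" if "s \<in> {-M..M}" for s
        using norm_triangle_ineq4[of "w s" "v s"] w(2)[OF that] v(2)[OF that] by linarith
      show "norm (w s - v s) \<le> norm (w 0 - v 0) + M * e' + c / 2"
        if c: "\<And>s. s \<in> {-M..M} \<Longrightarrow> norm (w s - v s) \<le> c" and s: "s \<in> {-M..M}" for c s
      proof -
        have "norm (F s) \<le> M * e' + c / 2" by (rule Picard_strong_step[OF F G c s F0])
        then show ?thesis using norm_triangle_ineq[of "w 0 - v 0" "F s"] unfolding wvF[of s] by linarith
      qed
    qed (rule t)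
    also have "\<dots> \<le> e" using w(3) M by (simp add: e'_def)
    finally show ?thesis .
  qed
  then show ?thesis using \<delta>(1) e by (intro exI[of _ "min (\<delta> / 3) (e / 4)"]) auto
qed

end

lemma solution_unique:
  assumes ab: "a < 0" "0 < b"
    and cv: "continuous_on {a..b} v" and cw: "continuous_on {a..b} w"
    and v: "\<And>t. t \<in> {a<..<b} \<Longrightarrow> (v has_vector_derivative G t (v t)) (at t)"
    and w: "\<And>t. t \<in> {a<..<b} \<Longrightarrow> (w has_vector_derivative G t (w t)) (at t)"
    and 0: "v 0 = w 0" and t: "t \<in> {a..b}"
  shows "v t = w t"
proof -
  have "bounded (v ` {a..b})" "bounded (w ` {a..b})"
    by (intro compact_imp_bounded compact_continuous_image cv cw compact_Icc)+
  then obtain R1 R2 where "\<And>s. s \<in> {a..b} \<Longrightarrow> norm (v s) \<le> R1" "\<And>s. s \<in> {a..b} \<Longrightarrow> norm (w s) \<le> R2"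
    unfolding bounded_iff by blast
  then have Rv: "norm (v s) \<le> max R1 R2" and Rw: "norm (w s) \<le> max R1 R2" if "s \<in> {a..b}" for s
    using that by (auto simp: le_max_iff_disj)
  define K where "K = KR (max R1 R2)"
  define z where "z s = Lam (v s - w s)" for s
  define D where "D s = inner (z s) (z s)" for s
  have cz: "continuous_on {a..b} z"
    unfolding z_def by (intro bounded_linear.continuous_on[OF bounded_linear_mul[OF bdd_meas_lam]] continuous_on_diff cv cw)
  then have cD: "continuous_on {a..b} D" unfolding D_def by (intro continuous_on_inner)
  define k where "k s = Lam (G s (v s) - G s (w s))" for s
  have z': "(z has_vector_derivative k s) (at s)" if "s \<in> {a<..<b}" for s
    unfolding z_def k_def
    by (rule bounded_linear.has_vector_derivative[OF bounded_linear_mul[OF bdd_meas_lam] has_vector_derivative_diff[OF v[OF that] w[OF that]]])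
  have D': "(D has_real_derivative 2 * inner (z s) (k s)) (at s)" if "s \<in> {a<..<b}" for s
  proof -
    have "(D has_derivative (\<lambda>h. inner (z s) (h *\<^sub>R k s) + inner (h *\<^sub>R k s) (z s))) (at s)"
      unfolding D_def using z'[OF that] by (intro has_derivative_inner) (simp_all add: has_vector_derivative_def)
    then show ?thesis
      by (simp add: has_field_derivative_def inner_commute algebra_simps mult_commute_abs)
  qed
  have est: "\<bar>2 * inner (z s) (k s)\<bar> \<le> 2 * K * D s" if "s \<in> {a<..<b}" for s
  proof -
    have "norm (k s) \<le> K * norm (z s)"
      unfolding k_def z_def K_def using that by (intro G_lipschitz_Lam Rv Rw) auto
    then have "norm (z s) * norm (k s) \<le> norm (z s) * (K * norm (z s))" by (rule mult_left_mono) simp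
    also have "\<dots> = K * D s" by (simp add: D_def power2_norm_eq_inner[symmetric] power2_eq_square)
    finally show ?thesis using Cauchy_Schwarz_ineq2[of "z s" "k s"] by simp
  qed
  have D0: "D 0 = 0" by (simp add: D_def z_def 0)
  have "D t \<le> 0"
  proof (cases "t \<ge> 0")
    case True
    have "exp (- 2 * K * t) * D t \<le> exp (- 2 * K * 0) * D 0"
    proof (cases "t = 0")
      case False
      show ?thesis
      proof (rule DERIV_nonpos_imp_decreasing_open[where f="\<lambda>s. exp (- 2 * K * s) * D s"])
        show "0 \<le> t" by (rule True)
        show "continuous_on {0..t} (\<lambda>s. exp (- 2 * K * s) * D s)"
          using t ab by (intro continuous_on_mult continuous_intros continuous_on_subset[OF cD]) auto
        fix s assume "0 < s" "s < t"
        then have s: "s \<in> {a<..<b}" using t ab by auto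
        have "((\<lambda>s. exp (- 2 * K * s) * D s) has_real_derivative exp (- 2 * K * s) * (2 * inner (z s) (k s) - 2 * K * D s)) (at s)"
          by (rule derivative_eq_intros D'[OF s] refl | simp add: algebra_simps)+
        moreover have "exp (- 2 * K * s) * (2 * inner (z s) (k s) - 2 * K * D s) \<le> 0"
          using est[OF s] by (intro mult_nonneg_nonpos) auto
        ultimately show "\<exists>y. ((\<lambda>s. exp (- 2 * K * s) * D s) has_real_derivative y) (at s) \<and> y \<le> 0" by blast
      qed
    qed simp
    then show ?thesis by (simp add: D0 mult_le_0_iff)
  next
    case False
    have "exp (2 * K * t) * D t \<le> exp (2 * K * 0) * D 0"
    proof (rule DERIV_nonneg_imp_increasing_open[where f="\<lambda>s. exp (2 * K * s) * D s"])
      show "t \<le> 0" using False by simp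
      show "continuous_on {t..0} (\<lambda>s. exp (2 * K * s) * D s)"
        using t ab by (intro continuous_on_mult continuous_intros continuous_on_subset[OF cD]) auto
      fix s assume "t < s" "s < 0"
      then have s: "s \<in> {a<..<b}" using t ab by auto
      have "((\<lambda>s. exp (2 * K * s) * D s) has_real_derivative exp (2 * K * s) * (2 * inner (z s) (k s) + 2 * K * D s)) (at s)"
        by (rule derivative_eq_intros D'[OF s] refl | simp add: algebra_simps)+
      moreover have "exp (2 * K * s) * (2 * inner (z s) (k s) + 2 * K * D s) \<ge> 0"
        using est[OF s] by (intro mult_nonneg_nonneg) auto
      ultimately show "\<exists>y. ((\<lambda>s. exp (2 * K * s) * D s) has_real_derivative y) (at s) \<and> y \<ge> 0" by blast
    qed
    then show ?thesis by (simp add: D0 mult_le_0_iff)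
  qed
  then have "z t = 0" unfolding D_def using inner_ge_zero[of "z t"] by (metis antisym inner_eq_zero_iff)
  then have "Lam (v t) = Lam (w t)" by (simp add: z_def mul_diff)
  then show ?thesis by (simp only: Lam_eq_iff)
qed

end

subsection \<open>The dual space in Fourier coordinates\<close>

lemma cinner_add_left: "cinner (f + g) k = cinner f k + cinner g k"
  by (simp add: cinner_eq inner_add_left complex_add)

lemma cinner_diff_left: "cinner (f - g) k = cinner f k - cinner g k"
  using cinner_add_left[of "f - g" g k] by simp

lemma inner_i: "inner (cscale \<i> f) g = - inner f (cscale \<i> g)"
proof -
  have "inner (cscale \<i> f) g = inner f (cscale (- \<i>) g)" by (simp add: inner_mul_left)
  also have "cscale (- \<i>) g = cscale (of_real (-1)) (cscale \<i> g)" by (subst mul_mul) simp_all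
  finally show ?thesis by (simp only: mul_of_real) simp
qed

lemma cinner_mul_left: "bdd_meas m \<Longrightarrow> cinner (mul m f) g = cinner f (mul (\<lambda>x. cnj (m x)) g)"
  by (simp add: cinner_eq inner_mul_left mul_commute)

lemma cinner_cscale_left: "cinner (cscale c f) g = c * cinner f g"
proof -
  have "(LINT x|lborel. rep (cscale c f) x * cnj (rep g x)) = (LINT x|lborel. c * (rep f x * cnj (rep g x)))"
  proof (rule integral_cong_AE)
    show "AE x in lborel. rep (cscale c f) x * cnj (rep g x) = c * (rep f x * cnj (rep g x))"
      using rep_mul[OF bdd_meas_const[of c], of f] by eventually_elim simp
  qed simp_all
  then show ?thesis by (simp add: cinner_def)
qed

lemma cinner_self: "cinner f f = of_real ((norm f)\<^sup>2)"
proof -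
  have "inner f (cscale \<i> f) = - inner f (cscale \<i> f)" using inner_i[of f f] by (simp add: inner_commute)
  then have "inner f (cscale \<i> f) = 0" by simp
  then show ?thesis by (simp add: cinner_eq power2_norm_eq_inner complex_of_real_def)
qed

lemma cinner_scaleR_left: "cinner (r *\<^sub>R f) g = of_real r * cinner f g"
  using cinner_cscale_left[of "of_real r" f g] by (simp add: mul_of_real)

text \<open>Multiplying \<open>f\<close> by a unimodular scalar makes the Hermitian product real and
  nonnegative, and then it equals the real inner product.\<close>

lemma norm_cinner_le: "norm (cinner f g) \<le> norm f * norm g"
proof (cases "cinner f g = 0")
  case False
  define c where "c = cnj (sgn (cinner f g))"
  have nc: "norm c = 1" using False by (simp add: c_def norm_sgn)
  have "cinner (cscale c f) g = of_real (norm (cinner f g))"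
    unfolding cinner_cscale_left c_def
    using False by (simp add: sgn_eq complex_norm_square[symmetric] power2_eq_square mult.commute[of "cnj _"] del: of_real_power)
  then have "norm (cinner f g) = inner (cscale c f) g" by (simp add: cinner_eq complex_eq_iff)
  also have "\<dots> \<le> norm (cscale c f) * norm g" using Cauchy_Schwarz_ineq2[of "cscale c f" g] by simp
  also have "norm (cscale c f) = norm f" by (rule mul_isometry) (simp_all add: nc)
  finally show ?thesis .
qed simp

text \<open>The duality between \<open>H\<^sup>-\<^sup>1\<close> and \<open>H\<^sup>1\<close> is bilinear, hence the conjugate on the second argument.\<close>
definition pair :: "l2 \<Rightarrow> (real \<Rightarrow> complex) \<Rightarrow> complex" where
  "pair k \<phi> = cinner k (crd (\<lambda>x. cnj (\<phi> x)))"

text \<open>In the coordinates given by \<open>pair\<close>, the inclusion of H^1 into H^-1 is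
  \<open>Lam2\<close>.\<close>

abbreviation Lam2 :: "l2 \<Rightarrow> l2" where "Lam2 f \<equiv> Lam (Lam f)"

text \<open>The adjoint of \<open>Dm\<close> followed after \<open>Dm\<close>, with bounded symbol
  \<open>\<xi>\<^sup>2 / (1 + \<xi>\<^sup>2)\<close>. It represents minus the second derivative as a
  map from H^1 to H^-1.\<close>

definition Dm2 :: "l2 \<Rightarrow> l2" where
  "Dm2 = mul (\<lambda>\<xi>. cnj (dmu \<xi>) * dmu \<xi>)"

lemma cinner_Lam: "cinner (Lam f) (Lam g) = cinner (Lam2 f) g"
  using cinner_mul_left[OF bdd_meas_lam, of "Lam f" g] by simp

lemma cinner_Dm: "cinner (Dm f) (Dm g) = cinner (Dm2 f) g"
proof -
  have "cinner (mul (\<lambda>\<xi>. cnj (dmu \<xi>)) (Dm f)) g = cinner (Dm f) (Dm g)"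
    by (subst cinner_mul_left) simp_all
  then show ?thesis by (simp add: Dm2_def mul_mul)
qed

lemma inner_Dm2: "inner (Dm f) (Dm g) = inner (Dm2 f) g"
  using arg_cong[OF cinner_Dm[of f g], of Re] by (simp add: cinner_eq)

lemma to_Hm1_eq:
  assumes "f \<in> H1" "\<phi> \<in> H1"
  shows "to_Hm1 f \<phi> = pair (Lam2 (crd f)) \<phi>"
proof -
  have "to_Hm1 f \<phi> = cinner (cls f) (cls (\<lambda>x. cnj (\<phi> x)))"
    unfolding to_Hm1_def using assms H1_crd(1) by (simp add: cinner_cls L2_cnj)
  also have "\<dots> = cinner (Lam (crd f)) (Lam (crd (\<lambda>x. cnj (\<phi> x))))"
    by (simp add: cls_H1 assms H1_cnj)
  finally show ?thesis by (simp add: pair_def cinner_Lam)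
qed

lemma Dxx_eq:
  assumes "f \<in> H1" "\<phi> \<in> H1"
  shows "Dxx f \<phi> = - pair (Dm2 (crd f)) \<phi>"
proof -
  have "(LINT x|lborel. Dx f x * Dx \<phi> x) = cinner (cls (Dx f)) (cj (cls (Dx \<phi>)))"
    using Dx_L2[OF assms(1)] Dx_L2[OF assms(2)] by (simp add: cinner_cls cj_cls L2_cnj)
  also have "\<dots> = cinner (Dm (crd f)) (Dm (crd (\<lambda>x. cnj (\<phi> x))))"
    unfolding H1_cnj(3)[OF assms(2), symmetric] cls_Dx[OF assms(1)] cls_Dx[OF H1_cnj(1)[OF assms(2)]] by simp
  finally show ?thesis by (simp add: Dxx_def pair_def cinner_Dm)
qed

lemma norm_pair_le: "\<phi> \<in> H1 \<Longrightarrow> norm (pair k \<phi>) \<le> norm k * H1_norm \<phi>"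
  using norm_cinner_le[of k "crd (\<lambda>x. cnj (\<phi> x))"] H1_cnj(1,2)[of \<phi>] H1_norm_eq[of "\<lambda>x. cnj (\<phi> x)"]
  by (simp add: pair_def)

lemma pair_add: "\<phi> \<in> H1 \<Longrightarrow> \<eta> \<in> H1 \<Longrightarrow> pair k (\<lambda>x. \<phi> x + \<eta> x) = pair k \<phi> + pair k \<eta>"
  unfolding pair_def by (simp add: crd_add(2) H1_cnj(1) cinner_eq inner_add_right mul_add complex_add)

lemma pair_cmult:
  assumes "\<phi> \<in> H1"
  shows "pair k (\<lambda>x. c * \<phi> x) = c * pair k \<phi>"
proof -
  have "pair k (\<lambda>x. c * \<phi> x) = cinner k (cscale (cnj c) (crd (\<lambda>x. cnj (\<phi> x))))"
    unfolding pair_def by (simp add: crd_cmult(2) H1_cnj(1) assms)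
  also have "\<dots> = cinner (cscale c k) (crd (\<lambda>x. cnj (\<phi> x)))"
    by (simp add: cinner_mul_left)
  finally show ?thesis by (simp add: cinner_cscale_left pair_def)
qed

text \<open>The Cauchy-Schwarz bound is attained, so \<open>pair\<close> carries the norm of
  \<open>l2\<close> exactly to that of H^-1. Limits in H^-1 can then be taken in
  \<open>l2\<close>.\<close>

lemma Hm1_pair:
  assumes \<Lambda>: "\<And>\<phi>. \<phi> \<in> H1 \<Longrightarrow> \<Lambda> \<phi> = pair k \<phi>"
  shows "\<Lambda> \<in> Hm1" "Hm1_norm \<Lambda> = norm k"
proof -
  show "\<Lambda> \<in> Hm1"
    unfolding Hm1_def mem_Collect_eq
  proof (intro conjI ballI allI)
    show "\<Lambda> (\<lambda>x. f x + g x) = \<Lambda> f + \<Lambda> g" if "f \<in> H1" "g \<in> H1" for f g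
      using that by (simp add: \<Lambda> crd_add(1) pair_add)
    show "\<Lambda> (\<lambda>x. c * f x) = c * \<Lambda> f" if "f \<in> H1" for c f
      using that by (simp add: \<Lambda> crd_cmult(1) pair_cmult)
    show "\<exists>C. \<forall>f\<in>H1. norm (\<Lambda> f) \<le> C * H1_norm f"
      by (intro exI[of _ "norm k"]) (simp add: \<Lambda> norm_pair_le)
  qed
  define A where "A = (\<lambda>f. norm (\<Lambda> f)) ` {f \<in> H1. H1_norm f \<le> 1}"
  have le: "a \<le> norm k" if aA: "a \<in> A" for a
  proof -
    obtain f where f: "f \<in> H1" "H1_norm f \<le> 1" "a = norm (\<Lambda> f)" using aA unfolding A_def by blast
    have "norm (pair k f) \<le> norm k * 1"
      using norm_pair_le[OF f(1), of k] mult_left_mono[OF f(2), of "norm k"] by simp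
    then show ?thesis using f by (simp add: \<Lambda>)
  qed
  have "norm k \<in> A"
  proof -
    \<comment> \<open>The maximizer is the conjugate of the function with coordinate
      \<open>k / norm k\<close>. For \<open>k = 0\<close> the division convention gives
      \<open>e = 0\<close>, and the claim still holds.\<close>
    define e where "e = (1 / norm k) *\<^sub>R k"
    define \<phi> where "\<phi> x = cnj (ev e x)" for x
    have phi: "\<phi> \<in> H1" "H1_norm \<phi> = norm e"
      unfolding \<phi>_def using H1_cnj(1,2)[OF ev_H1[of e]] by (simp_all add: H1_norm_eq)
    have "pair k \<phi> = cinner k e" by (simp add: pair_def \<phi>_def)
    also have "\<dots> = cnj (cinner e k)"
      unfolding cinner_def by (simp add: mult.commute flip: Bochner_Integration.integral_cnj)
    also have "\<dots> = of_real (norm k)"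
      by (simp add: e_def cinner_scaleR_left cinner_self power2_eq_square)
    finally have "norm (\<Lambda> \<phi>) = norm k" by (simp add: \<Lambda> phi)
    moreover have "H1_norm \<phi> \<le> 1" by (simp add: phi e_def)
    ultimately show ?thesis unfolding A_def using phi(1) by force
  qed
  then show "Hm1_norm \<Lambda> = norm k"
    unfolding Hm1_norm_def A_def[symmetric] using le by (rule cSup_eq_maximum)
qed

lemma has_vector_derivative_iff_quotient:
  fixes k :: "real \<Rightarrow> 'a::real_normed_vector"
  shows "(k has_vector_derivative l) (at t) \<longleftrightarrow> ((\<lambda>s. (1 / (s - t)) *\<^sub>R (k s - k t)) \<longlongrightarrow> l) (at t)"
proof -
  have "(k has_vector_derivative l) (at t) \<longleftrightarrow> ((\<lambda>s. norm ((k s - k t) - (s - t) *\<^sub>R l) / norm (s - t)) \<longlongrightarrow> 0) (at t)"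
    unfolding has_vector_derivative_def has_derivative_iff_norm
    by (simp add: bounded_linear_scaleR_left)
  also have "\<dots> \<longleftrightarrow> ((\<lambda>s. norm ((1 / (s - t)) *\<^sub>R (k s - k t) - l)) \<longlongrightarrow> 0) (at t)"
  proof (rule tendsto_cong)
    show "\<forall>\<^sub>F s in at t. norm ((k s - k t) - (s - t) *\<^sub>R l) / norm (s - t) = norm ((1 / (s - t)) *\<^sub>R (k s - k t) - l)"
      unfolding eventually_at_filter
    proof (intro always_eventually allI impI)
      fix s assume "s \<noteq> t"
      then have "(1 / (s - t)) *\<^sub>R (k s - k t) - l = (1 / (s - t)) *\<^sub>R ((k s - k t) - (s - t) *\<^sub>R l)"
        by (simp add: scaleR_diff_right)
      then show "norm ((k s - k t) - (s - t) *\<^sub>R l) / norm (s - t) = norm ((1 / (s - t)) *\<^sub>R (k s - k t) - l)"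
        by (simp add: divide_inverse mult.commute)
    qed
  qed
  also have "\<dots> \<longleftrightarrow> ((\<lambda>s. (1 / (s - t)) *\<^sub>R (k s - k t)) \<longlongrightarrow> l) (at t)"
    by (simp add: tendsto_norm_zero_iff LIM_zero_iff)
  finally show ?thesis .
qed

text \<open>The difference quotients of functionals are pairings with those of
  \<open>Lam2 (crd (u s))\<close>, and the norms agree. As a derivative is local, membership in
  \<open>H1\<close> is required on a neighbourhood of \<open>t\<close> only.\<close>

lemma has_Hm1_derivative_iff:
  assumes I: "open I" "t \<in> I" "\<And>s. s \<in> I \<Longrightarrow> u s \<in> H1" and \<Lambda>: "\<And>\<phi>. \<phi> \<in> H1 \<Longrightarrow> \<Lambda> \<phi> = pair l \<phi>"
  shows "has_Hm1_derivative u \<Lambda> t \<longleftrightarrow> ((\<lambda>s. Lam2 (crd (u s))) has_vector_derivative l) (at t)"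
proof -
  have "Hm1_norm (\<lambda>\<phi>. (to_Hm1 (u s) \<phi> - to_Hm1 (u t) \<phi>) / of_real (s - t) - \<Lambda> \<phi>)
    = norm ((1 / (s - t)) *\<^sub>R (Lam2 (crd (u s)) - Lam2 (crd (u t))) - l)" if "s \<in> I" for s
  proof (rule Hm1_pair(2))
    fix \<phi> assume "\<phi> \<in> H1"
    then show "(to_Hm1 (u s) \<phi> - to_Hm1 (u t) \<phi>) / of_real (s - t) - \<Lambda> \<phi> =
       pair ((1 / (s - t)) *\<^sub>R (Lam2 (crd (u s)) - Lam2 (crd (u t))) - l) \<phi>"
      using I that by (simp add: to_Hm1_eq \<Lambda> pair_def cinner_diff_left cinner_scaleR_left)
  qed
  moreover have "\<forall>\<^sub>F s in at t. s \<in> I" using I(1,2) by (simp add: eventually_at_topological) blast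
  ultimately have ev: "\<forall>\<^sub>F s in at t. Hm1_norm (\<lambda>\<phi>. (to_Hm1 (u s) \<phi> - to_Hm1 (u t) \<phi>) / of_real (s - t) - \<Lambda> \<phi>)
    = norm ((1 / (s - t)) *\<^sub>R (Lam2 (crd (u s)) - Lam2 (crd (u t))) - l)"
    by (auto elim: eventually_mono)
  show ?thesis
    unfolding has_Hm1_derivative_def has_vector_derivative_iff_quotient tendsto_cong[OF ev]
    using Hm1_pair(1)[OF \<Lambda>] by (simp add: tendsto_norm_zero_iff LIM_zero_iff)
qed

lemma CH1_iff:
  assumes "\<And>t. t \<in> I \<Longrightarrow> u t \<in> H1"
  shows "u \<in> CH1 I \<longleftrightarrow> continuous_on I (\<lambda>t. crd (u t))"
proof -
  have "((\<lambda>s. H1_norm (\<lambda>x. u s x - u t x)) \<longlongrightarrow> 0) (at t within I) \<longleftrightarrow> ((\<lambda>s. crd (u s)) \<longlongrightarrow> crd (u t)) (at t within I)"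
    if t: "t \<in> I" for t
  proof -
    have "((\<lambda>s. H1_norm (\<lambda>x. u s x - u t x)) \<longlongrightarrow> 0) (at t within I) \<longleftrightarrow> ((\<lambda>s. norm (crd (u s) - crd (u t))) \<longlongrightarrow> 0) (at t within I)"
    proof (rule tendsto_cong)
      show "\<forall>\<^sub>F s in at t within I. H1_norm (\<lambda>x. u s x - u t x) = norm (crd (u s) - crd (u t))"
        unfolding eventually_at_filter
        by (intro always_eventually allI impI) (simp add: H1_norm_eq crd_diff assms t)
    qed
    then show ?thesis by (simp add: tendsto_norm_zero_iff LIM_zero_iff)
  qed
  then show ?thesis unfolding CH1_def continuous_on_def using assms by auto
qed

subsection \<open>Differentiating along the Schroedinger group\<close>

lemma U_tendsto:
  assumes "(f \<longlongrightarrow> l) (at t)"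
  shows "((\<lambda>s. U (c * s) (f s)) \<longlongrightarrow> U (c * t) l) (at t)"
proof -
  have "continuous_on UNIV (\<lambda>s. U (c * s) l)" by (rule continuous_U[OF continuous_on_const])
  then have 1: "((\<lambda>s. U (c * s) l) \<longlongrightarrow> U (c * t) l) (at t)" by (simp add: continuous_on_def)
  have "((\<lambda>s. norm (f s - l)) \<longlongrightarrow> 0) (at t)"
    by (rule tendsto_norm_zero[OF LIM_zero[OF assms]])
  then have 2: "((\<lambda>s. U (c * s) (f s - l)) \<longlongrightarrow> 0) (at t)"
    by (subst tendsto_norm_zero_iff[symmetric]) simp
  have "((\<lambda>s. U (c * s) (f s - l) + U (c * s) l) \<longlongrightarrow> 0 + U (c * t) l) (at t)"
    by (intro tendsto_add 1 2)
  then show ?thesis by (simp add: mul_diff)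
qed

lemma dmu_sq: "cnj (dmu \<xi>) * dmu \<xi> = of_real (\<xi>\<^sup>2) * (lam \<xi> * lam \<xi>)"
proof -
  have 1: "cnj (dmu \<xi>) * dmu \<xi> = of_real ((norm (dmu \<xi>))\<^sup>2)"
    unfolding mult.commute[of "cnj _"] by (rule complex_norm_square[symmetric])
  have 2: "lam \<xi> * lam \<xi> = of_real ((norm (lam \<xi>))\<^sup>2)"
    using complex_norm_square[of "lam \<xi>"] unfolding cnj_lam by (rule sym)
  have "norm (dmu \<xi>) = \<bar>\<xi>\<bar> * norm (lam \<xi>)" by (simp add: dmu_def lam_def norm_mult norm_divide)
  then have "(norm (dmu \<xi>))\<^sup>2 = \<xi>\<^sup>2 * (norm (lam \<xi>))\<^sup>2" by (simp add: power_mult_distrib)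
  then show ?thesis unfolding 1 2 by simp
qed

lemma bdd_meas_dmu_sq [simp]: "bdd_meas (\<lambda>\<xi>. cnj (dmu \<xi>) * dmu \<xi>)"
  by (intro bdd_meas_mult bdd_meas_cnj bdd_meas_dmu)

lemma Dm2_mul: "bdd_meas m \<Longrightarrow> Dm2 (mul m f) = mul m (Dm2 f)"
  unfolding Dm2_def by (rule mul_commute) simp_all

text \<open>Differentiating the group costs a factor \<open>\<xi>\<^sup>2\<close>, which
  \<open>Lam2\<close> absorbs: the symbol of the difference quotient,
  \<open>quo h (- c * \<xi>\<^sup>2)\<close> times \<open>lam\<close> squared, is bounded by
  \<open>\<bar>c\<bar>\<close> uniformly in \<open>h\<close> and converges pointwise.\<close>

lemma U_Lam2_derivative:
  "((\<lambda>s. U (c * s) (Lam2 p)) has_vector_derivative cscale (- \<i> * of_real c) (Dm2 (U (c * t) p))) (at t)"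
proof -
  define m where "m h \<xi> = quo h (- c * \<xi>\<^sup>2) * (lam \<xi> * lam \<xi>)" for h \<xi>
  define m' where "m' \<xi> = - \<i> * of_real c * (cnj (dmu \<xi>) * dmu \<xi>)" for \<xi>
  have bm': "bdd_meas m'" unfolding m'_def by (intro bdd_meas_mult bdd_meas_const bdd_meas_dmu_sq)
  have bd: "norm (m h \<xi>) \<le> \<bar>c\<bar>" for h \<xi>
  proof -
    have "norm (m h \<xi>) \<le> \<bar>- c * \<xi>\<^sup>2\<bar> * norm (lam \<xi> * lam \<xi>)"
      unfolding m_def norm_mult[of "quo _ _"] by (intro mult_right_mono norm_quo_le(1)) simp
    also have "\<dots> = \<bar>c\<bar> * norm (cnj (dmu \<xi>) * dmu \<xi>)"
      unfolding dmu_sq by (simp add: norm_mult abs_mult norm_power)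
    also have "\<dots> \<le> \<bar>c\<bar> * 1"
      using lam_le(2)[of \<xi>] by (intro mult_left_mono) (auto simp: norm_mult mult_le_one)
    finally show ?thesis by simp
  qed
  have bm: "bdd_meas (m h)" for h
  proof (rule bdd_measI[OF _ bd])
    have "(\<lambda>\<xi>. quo h (- c * \<xi>\<^sup>2)) \<in> borel_measurable borel" unfolding quo_def by measurable
    then show "m h \<in> borel_measurable borel" unfolding m_def by measurable
  qed
  have lim: "((\<lambda>h. mul (m h) (U (c * t) p)) \<longlongrightarrow> mul m' (U (c * t) p)) (at 0)"
  proof (rule mul_strong_tendsto[OF bm bm' bd])
    fix \<xi>
    have "((\<lambda>h. m h \<xi>) \<longlongrightarrow> \<i> * of_real (- c * \<xi>\<^sup>2) * (lam \<xi> * lam \<xi>)) (at 0)"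
      unfolding m_def by (intro tendsto_mult quo_tendsto tendsto_const)
    then show "((\<lambda>h. m h \<xi>) \<longlongrightarrow> m' \<xi>) (at 0)" unfolding m'_def dmu_sq by (simp add: mult_ac)
  qed
  have eq: "(1 / h) *\<^sub>R (U (c * (t + h)) (Lam2 p) - U (c * t) (Lam2 p)) = mul (m h) (U (c * t) p)" if "h \<noteq> 0" for h
  proof -
    have b: "bdd_meas (\<lambda>\<xi>. sch (c * (t + h)) \<xi> * (lam \<xi> * lam \<xi>))" "bdd_meas (\<lambda>\<xi>. sch (c * t) \<xi> * (lam \<xi> * lam \<xi>))"
      "bdd_meas (\<lambda>\<xi>. m h \<xi> * sch (c * t) \<xi>)" using bm by simp_all
    have 1: "U s (Lam2 p) = mul (\<lambda>\<xi>. sch s \<xi> * (lam \<xi> * lam \<xi>)) p" for s by (simp add: mul_mul)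
    have 2: "mul (m h) (U (c * t) p) = mul (\<lambda>\<xi>. m h \<xi> * sch (c * t) \<xi>) p" using bm by (simp add: mul_mul)
    have e: "sch (c * (t + h)) \<xi> = sch (c * t) \<xi> * exp (\<i> * of_real (h * (- c * \<xi>\<^sup>2)))" for \<xi>
      unfolding sch_def exp_add[symmetric] by (simp add: algebra_simps)
    define X where "X = mul (\<lambda>\<xi>. sch (c * (t + h)) \<xi> * (lam \<xi> * lam \<xi>)) p"
    define Y where "Y = mul (\<lambda>\<xi>. sch (c * t) \<xi> * (lam \<xi> * lam \<xi>)) p"
    have "(1 / h) *\<^sub>R (X - Y) = mul (\<lambda>\<xi>. m h \<xi> * sch (c * t) \<xi>) p"
    proof (rule l2_eqI)
      show "AE \<xi> in lborel. rep ((1 / h) *\<^sub>R (X - Y)) \<xi> = rep (mul (\<lambda>\<xi>. m h \<xi> * sch (c * t) \<xi>) p) \<xi>"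
        using rep_scaleR[of "1/h" "X - Y"] rep_diff[of X Y] rep_mul[OF b(1), of p, folded X_def] rep_mul[OF b(2), of p, folded Y_def] rep_mul[OF b(3), of p]
      proof eventually_elim
        case (elim \<xi>)
        show ?case unfolding elim unfolding e m_def quo_def
          using that by (simp add: scaleR_conv_of_real field_simps)
      qed
    qed
    then show ?thesis unfolding 1 2 X_def Y_def .
  qed
  have "((\<lambda>h. (1 / h) *\<^sub>R (U (c * (t + h)) (Lam2 p) - U (c * t) (Lam2 p))) \<longlongrightarrow> mul m' (U (c * t) p)) (at 0)"
    by (rule Lim_transform_eventually[OF lim]) (simp add: eventually_at_filter eq)
  then have "((\<lambda>s. (1 / (s - t)) *\<^sub>R (U (c * s) (Lam2 p) - U (c * t) (Lam2 p))) \<longlongrightarrow> mul m' (U (c * t) p)) (at t)"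
    by (intro LIM_offset_zero_cancel[of "\<lambda>s. (1 / (s - t)) *\<^sub>R (U (c * s) (Lam2 p) - U (c * t) (Lam2 p))" t]) simp
  moreover have "mul m' (U (c * t) p) = cscale (- \<i> * of_real c) (Dm2 (U (c * t) p))"
    unfolding Dm2_def mul_mul[OF bdd_meas_const bdd_meas_dmu_sq] m'_def ..
  ultimately show ?thesis unfolding has_vector_derivative_iff_quotient by simp
qed

text \<open>The increment is split so that the group at time \<open>s\<close> acts on the difference
  quotient of \<open>k\<close>, where strong continuity suffices, and the difference quotient of the
  group acts on the fixed vector \<open>k t\<close>.\<close>

lemma U_product_derivative:
  assumes "(k has_vector_derivative l) (at t)"
  shows "((\<lambda>s. U (c * s) (Lam2 (k s))) has_vector_derivative
    U (c * t) (Lam2 l) + cscale (- \<i> * of_real c) (Dm2 (U (c * t) (k t)))) (at t)"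
proof -
  have 1: "((\<lambda>s. U (c * s) (Lam2 ((1 / (s - t)) *\<^sub>R (k s - k t)))) \<longlongrightarrow> U (c * t) (Lam2 l)) (at t)"
    by (intro U_tendsto continuous_mul bdd_meas_lam) (use assms in \<open>simp add: has_vector_derivative_iff_quotient\<close>)
  have 2: "((\<lambda>s. (1 / (s - t)) *\<^sub>R (U (c * s) (Lam2 (k t)) - U (c * t) (Lam2 (k t)))) \<longlongrightarrow>
      cscale (- \<i> * of_real c) (Dm2 (U (c * t) (k t)))) (at t)"
    using U_Lam2_derivative[of c "k t" t] unfolding has_vector_derivative_iff_quotient .
  have "(1 / (s - t)) *\<^sub>R (U (c * s) (Lam2 (k s)) - U (c * t) (Lam2 (k t)))
    = U (c * s) (Lam2 ((1 / (s - t)) *\<^sub>R (k s - k t))) + (1 / (s - t)) *\<^sub>R (U (c * s) (Lam2 (k t)) - U (c * t) (Lam2 (k t)))" for s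
    by (simp add: mul_scaleR mul_diff scaleR_diff_right)
  then show ?thesis
    unfolding has_vector_derivative_iff_quotient using tendsto_add[OF 1 2] by simp
qed

subsection \<open>Strong solutions and the interaction picture\<close>

context averaged_nonlinearity
begin

text \<open>Evaluation at \<open>x\<close> is a bounded functional on coordinates, so it may be
  taken inside the Bochner integral.\<close>

lemma Q_eq_ev:
  assumes "f \<in> H1"
  shows "Q P \<psi> f = ev (Qt (crd f))"
proof
  fix x
  have "T (- r) (\<lambda>y. P (T r f y)) x * of_real (\<psi> r) = ev (\<psi> r *\<^sub>R twist (crd f) r) x" for r
    unfolding T_eq_ev[OF assms] T_eq_ev[OF P_ev_H1(1)] P_ev_H1(2)
    by (simp add: twist_def ev_scaleR scaleR_conv_of_real mult.commute)
  then have "Q P \<psi> f x = (LINT r|lborel. ev (\<psi> r *\<^sub>R twist (crd f) r) x)" unfolding Q_def by simp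
  also have "\<dots> = ev (Qt (crd f)) x"
    unfolding Qt_def by (rule integral_bounded_linear[OF bounded_linear_ev psi_twist_integrable])
  finally show "Q P \<psi> f x = ev (Qt (crd f)) x" .
qed

text \<open>The time derivative prescribed by the equation, as an element of H^-1 in coordinates.
  The sign of the first term is negative because \<open>Dm2\<close> stands for minus the second
  derivative.\<close>

definition rhs :: "l2 \<Rightarrow> l2" where
  "rhs g = cscale (- \<i> * of_real d) (Dm2 g) + cscale \<i> (Lam2 (Qt g))"

lemma continuous_rhs: "continuous_on S g \<Longrightarrow> continuous_on S (\<lambda>t. rhs (g t))"
  unfolding rhs_def Dm2_def
  by (intro continuous_on_add bounded_linear.continuous_on[OF bounded_linear_mul] bdd_meas_const bdd_meas_dmu_sq bdd_meas_lam
      continuous_on_compose2[OF continuous_Qt[of UNIV]]) auto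

lemma pair_rhs:
  assumes "f \<in> H1" "\<phi> \<in> H1"
  shows "\<i> * pair (rhs (crd f)) \<phi> + of_real d * Dxx f \<phi> + to_Hm1 (Q P \<psi> f) \<phi> = 0"
  using assms
  by (simp add: Dxx_eq Q_eq_ev to_Hm1_eq pair_def rhs_def cinner_add_left cinner_cscale_left algebra_simps)

text \<open>The notion of strong solution with all functionals replaced by their coordinates in
  \<open>l2\<close>.\<close>

definition evolves :: "real \<Rightarrow> real \<Rightarrow> (real \<Rightarrow> l2) \<Rightarrow> bool" where
  "evolves a b g \<longleftrightarrow> continuous_on {a..b} g \<and> (\<forall>t\<in>{a<..<b}. ((\<lambda>s. Lam2 (g s)) has_vector_derivative rhs (g t)) (at t))"

text \<open>The derivative functional of a strong solution matters on \<open>H1\<close> only, and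
  there the equation determines it: it is the pairing with \<open>rhs\<close>.\<close>

lemma strong_solution_evolves:
  assumes "strong_solution d P \<psi> Mm Mp u0 u" "u0 \<in> H1" "Mm > 0" "Mp > 0"
  shows "evolves (- Mm) Mp (\<lambda>t. crd (u t))" "crd (u 0) = crd u0" "\<And>t. t \<in> {-Mm..Mp} \<Longrightarrow> u t \<in> H1"
proof -
  have CH: "u \<in> CH1 {-Mm..Mp}" and AE0: "AE x in lborel. u 0 x = u0 x"
    using assms(1) unfolding strong_solution_def by blast+
  show uH: "u t \<in> H1" if "t \<in> {-Mm..Mp}" for t using CH that unfolding CH1_def by blast
  have c: "continuous_on {-Mm..Mp} (\<lambda>t. crd (u t))" using CH1_iff[of "{-Mm..Mp}" u, OF uH] CH by simp
  show "crd (u 0) = crd u0"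
  proof -
    have "u 0 \<in> H1" by (rule uH) (use assms(3,4) in simp)
    from crd_eq_iff[OF this assms(2)] AE0 show ?thesis by simp
  qed
  obtain u' where u': "\<forall>t\<in>{-Mm<..<Mp}. has_Hm1_derivative u (u' t) t"
    "\<forall>t\<in>{-Mm<..<Mp}. \<forall>\<phi>\<in>H1. \<i> * u' t \<phi> + of_real d * Dxx (u t) \<phi> + to_Hm1 (Q P \<psi> (u t)) \<phi> = 0"
    using assms(1) unfolding strong_solution_def by blast
  have "((\<lambda>s. Lam2 (crd (u s))) has_vector_derivative rhs (crd (u t))) (at t)" if t: "t \<in> {-Mm<..<Mp}" for t
  proof -
    have "u' t \<phi> = pair (rhs (crd (u t))) \<phi>" if "\<phi> \<in> H1" for \<phi>
    proof -
      have "u t \<in> H1" by (rule uH) (use t in simp)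
      from pair_rhs[OF this that] have "\<i> * u' t \<phi> + of_real d * Dxx (u t) \<phi> + to_Hm1 (Q P \<psi> (u t)) \<phi>
        = \<i> * pair (rhs (crd (u t))) \<phi> + of_real d * Dxx (u t) \<phi> + to_Hm1 (Q P \<psi> (u t)) \<phi>"
        using bspec[OF bspec[OF u'(2) t] that] by simp
      then show ?thesis by simp
    qed
    note pair_u' = this
    have "has_Hm1_derivative u (u' t) t \<longleftrightarrow> ((\<lambda>s. Lam2 (crd (u s))) has_vector_derivative rhs (crd (u t))) (at t)"
    proof (rule has_Hm1_derivative_iff[where I="{-Mm<..<Mp}"])
      show "u s \<in> H1" if "s \<in> {-Mm<..<Mp}" for s by (rule uH) (use that in simp)
    qed (use t pair_u' in simp_all)
    then show ?thesis using u'(1) t by blast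
  qed
  then show "evolves (- Mm) Mp (\<lambda>t. crd (u t))" unfolding evolves_def using c by simp
qed

text \<open>The derivative is supplied as the pairing with \<open>rhs (g t)\<close>; its continuity
  in H^-1 follows from that of \<open>rhs\<close> along \<open>g\<close>.\<close>

lemma evolves_strong_solution:
  assumes g: "evolves (- Mm) Mp g" and u0: "u0 \<in> H1" "g 0 = crd u0"
  shows "strong_solution d P \<psi> Mm Mp u0 (\<lambda>t. ev (g t))"
  unfolding strong_solution_def
proof (intro conjI exI[of _ "\<lambda>t. pair (rhs (g t))"] ballI)
  have c: "continuous_on {-Mm..Mp} g"
    and d: "\<And>t. t \<in> {-Mm<..<Mp} \<Longrightarrow> ((\<lambda>s. Lam2 (g s)) has_vector_derivative rhs (g t)) (at t)"
    using g unfolding evolves_def by auto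
  show "(\<lambda>t. ev (g t)) \<in> CH1 {-Mm..Mp}" using c by (subst CH1_iff) simp_all
  show "AE x in lborel. ev (g 0) x = u0 x" using u0 crd_eq_iff[of "ev (g 0)" u0] by simp
  fix t assume t: "t \<in> {-Mm<..<Mp}"
  have "has_Hm1_derivative (\<lambda>t. ev (g t)) (pair (rhs (g t))) t \<longleftrightarrow> ((\<lambda>s. Lam2 (crd (ev (g s)))) has_vector_derivative rhs (g t)) (at t)"
    by (rule has_Hm1_derivative_iff[where I=UNIV]) simp_all
  then show "has_Hm1_derivative (\<lambda>t. ev (g t)) (pair (rhs (g t))) t" using d[OF t] by simp
  have "continuous_on {-Mm<..<Mp} (\<lambda>t. rhs (g t))"
    by (intro continuous_rhs continuous_on_subset[OF c]) auto
  then have "isCont (\<lambda>t. rhs (g t)) t" using t by (simp add: continuous_on_eq_continuous_at)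
  then have "((\<lambda>s. norm (rhs (g s) - rhs (g t))) \<longlongrightarrow> 0) (at t)"
    unfolding isCont_def by (intro tendsto_norm_zero LIM_zero)
  moreover have "Hm1_norm (\<lambda>\<phi>. pair (rhs (g s)) \<phi> - pair (rhs (g t)) \<phi>) = norm (rhs (g s) - rhs (g t))" for s
    by (rule Hm1_pair(2)) (simp add: pair_def cinner_diff_left)
  ultimately show "((\<lambda>s. Hm1_norm (\<lambda>\<phi>. pair (rhs (g s)) \<phi> - pair (rhs (g t)) \<phi>)) \<longlongrightarrow> 0) (at t)" by simp
  fix \<phi> assume "\<phi> \<in> H1"
  then show "\<i> * pair (rhs (g t)) \<phi> + of_real d * Dxx (ev (g t)) \<phi> + to_Hm1 (Q P \<psi> (ev (g t))) \<phi> = 0"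
    using pair_rhs[OF ev_H1[of "g t"]] by simp
qed

lemma interaction_evolves:
  assumes w: "solves M w" and c: "continuous_on {-M..M} w"
  shows "evolves (- M) M (\<lambda>t. U (d * t) (w t))"
  unfolding evolves_def
proof (intro conjI ballI)
  show "continuous_on {-M..M} (\<lambda>t. U (d * t) (w t))" by (rule continuous_U[OF c])
  fix t assume t: "t \<in> {-M<..<M}"
  then have "(w has_vector_derivative G t (w t)) (at t within {-M..M})" using w unfolding solves_def by auto
  then have "(w has_vector_derivative G t (w t)) (at t)"
    using t by (simp add: at_within_Icc_at)
  from U_product_derivative[OF this, of d]
  have "((\<lambda>s. Lam2 (U (d * s) (w s))) has_vector_derivative
    U (d * t) (Lam2 (G t (w t))) + cscale (- \<i> * of_real d) (Dm2 (U (d * t) (w t)))) (at t)"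
    by (simp only: mul_commute[OF bdd_meas_sch bdd_meas_lam])
  moreover have "U (d * t) (Lam2 (G t (w t))) = cscale \<i> (Lam2 (Qt (U (d * t) (w t))))"
  proof -
    have "U (d * t) (Lam2 (G t (w t))) = Lam2 (U (d * t) (G t (w t)))" by (simp only: mul_commute[OF bdd_meas_sch bdd_meas_lam])
    also have "U (d * t) (G t (w t)) = cscale \<i> (Qt (U (d * t) (w t)))"
      unfolding G_def mul_commute[OF bdd_meas_sch bdd_meas_const] U_U by simp
    finally show ?thesis by (simp only: mul_commute[OF bdd_meas_lam bdd_meas_const])
  qed
  ultimately show "((\<lambda>s. Lam2 (U (d * s) (w s))) has_vector_derivative rhs (U (d * t) (w t))) (at t)"
    unfolding rhs_def by (simp add: add.commute)
qed

text \<open>Four factors of \<open>Lam\<close> are needed: two because the equation holds in \<open>H\<^sup>-\<^sup>1\<close>, two more to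
  differentiate the group strongly.\<close>

lemma evolves_interaction:
  assumes g: "evolves a b g" and ab: "a < 0" "0 < b"
  defines "w \<equiv> \<lambda>t. U (- d * t) (g t)"
  shows "continuous_on {a..b} w" "\<And>t. t \<in> {a<..<b} \<Longrightarrow> (w has_vector_derivative G t (w t)) (at t)"
    "\<And>t. U (d * t) (w t) = g t"
proof -
  have c: "continuous_on {a..b} g"
    and d: "\<And>t. t \<in> {a<..<b} \<Longrightarrow> ((\<lambda>s. Lam2 (g s)) has_vector_derivative rhs (g t)) (at t)"
    using g unfolding evolves_def by auto
  show cw: "continuous_on {a..b} w" unfolding w_def by (rule continuous_U[OF c])
  show gw: "U (d * t) (w t) = g t" for t unfolding w_def U_U by simp
  have L: "((\<lambda>s. Lam2 (Lam2 (w s))) has_vector_derivative Lam2 (Lam2 (G t (w t)))) (at t)" if t: "t \<in> {a<..<b}" for t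
  proof -
    have 1: "((\<lambda>s. U (- d * s) (Lam2 (Lam2 (g s)))) has_vector_derivative
      U (- d * t) (Lam2 (rhs (g t))) + cscale (- \<i> * of_real (- d)) (Dm2 (U (- d * t) (Lam2 (g t))))) (at t)"
      by (rule U_product_derivative[OF d[OF t]])
    \<comment> \<open>The dispersive term of the equation cancels the derivative of the
      group.\<close>
    have 2: "U (- d * t) (Lam2 (cscale (- \<i> * of_real d) (Dm2 (g t)))) = - cscale (- \<i> * of_real (- d)) (Dm2 (U (- d * t) (Lam2 (g t))))"
    proof -
      have "U (- d * t) (Lam2 (cscale (- \<i> * of_real d) (Dm2 (g t)))) = cscale (- \<i> * of_real d) (Dm2 (U (- d * t) (Lam2 (g t))))"
        by (simp only: Dm2_mul[OF bdd_meas_sch] Dm2_mul[OF bdd_meas_lam] mul_commute[OF bdd_meas_lam bdd_meas_const] mul_commute[OF bdd_meas_sch bdd_meas_const])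
      also have "\<dots> = cscale (of_real (-1)) (cscale (- \<i> * of_real (- d)) (Dm2 (U (- d * t) (Lam2 (g t)))))"
        by (subst mul_mul) simp_all
      finally show ?thesis by (simp only: mul_of_real) simp
    qed
    have 3: "U (- d * t) (Lam2 (cscale \<i> (Lam2 (Qt (g t))))) = Lam2 (Lam2 (G t (w t)))"
      unfolding G_def gw
      by (simp only: mul_commute[OF bdd_meas_lam bdd_meas_const] mul_commute[OF bdd_meas_sch bdd_meas_const] mul_commute[OF bdd_meas_sch bdd_meas_lam] minus_mult_left)
    have "U (- d * t) (Lam2 (rhs (g t))) + cscale (- \<i> * of_real (- d)) (Dm2 (U (- d * t) (Lam2 (g t)))) = Lam2 (Lam2 (G t (w t)))"
      unfolding rhs_def mul_add[OF bdd_meas_lam] mul_add[OF bdd_meas_sch] 2 3 by simp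
    moreover have "(\<lambda>s. U (- d * s) (Lam2 (Lam2 (g s)))) = (\<lambda>s. Lam2 (Lam2 (w s)))"
      unfolding w_def by (simp only: mul_commute[OF bdd_meas_sch bdd_meas_lam])
    ultimately show ?thesis using 1 by simp
  qed
  have cG: "continuous_on {a..b} (\<lambda>t. G t (w t))" by (rule continuous_G[OF cw])
  \<comment> \<open>So far \<open>w\<close> is known to be differentiable only after four factors of
    \<open>Lam\<close>, but \<open>v\<close> is differentiable in \<open>l2\<close> itself. Their
    difference is constant after these factors, hence constant because \<open>Lam\<close> is
    injective, and \<open>w\<close> inherits the derivative of \<open>v\<close>.\<close>
  define v where "v t = integral {a..t} (\<lambda>t. G t (w t))" for t
  have v: "(v has_vector_derivative G t (w t)) (at t)" if "t \<in> {a<..<b}" for t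
    using integral_has_vector_derivative[OF cG, of t] that unfolding v_def by (simp add: at_within_Icc_at)
  define z where "z t = Lam2 (Lam2 (w t - v t))" for t
  have "(z has_vector_derivative 0) (at t within {a<..<b})" if t: "t \<in> {a<..<b}" for t
  proof -
    have "((\<lambda>s. Lam2 (Lam2 (v s))) has_vector_derivative Lam2 (Lam2 (G t (w t)))) (at t)"
      by (intro bounded_linear.has_vector_derivative[OF bounded_linear_mul] bdd_meas_lam v t)
    from has_vector_derivative_diff[OF L[OF t] this]
    have "(z has_vector_derivative 0) (at t)" unfolding z_def by (simp add: mul_diff)
    then show ?thesis by (rule has_vector_derivative_at_within)
  qed
  then obtain z0 where z0: "\<And>t. t \<in> {a<..<b} \<Longrightarrow> z t = z0"
    using has_vector_derivative_zero_constant[of "{a<..<b}" z] by (metis convex_real_interval(8))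
  have wv: "w t = (w 0 - v 0) + v t" if "t \<in> {a<..<b}" for t
  proof -
    have "z t = z 0" using z0[OF that] z0[of 0] ab by simp
    then have "w t - v t = w 0 - v 0" unfolding z_def by (simp only: Lam_eq_iff)
    then show ?thesis by (simp add: algebra_simps)
  qed
  show "(w has_vector_derivative G t (w t)) (at t)" if t: "t \<in> {a<..<b}" for t
  proof (rule has_vector_derivative_transform_within_open[where S="{a<..<b}"])
    show "((\<lambda>t. (w 0 - v 0) + v t) has_vector_derivative G t (w t)) (at t)"
      using has_vector_derivative_add[OF has_vector_derivative_const v[OF t], of "w 0 - v 0"] by simp
  qed (use t wv in auto)
qed

lemma evolves_unique:
  assumes "evolves a b f" "evolves a b g" "a < 0" "0 < b" "f 0 = g 0" "t \<in> {a..b}"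
  shows "f t = g t"
proof -
  note F = evolves_interaction[OF assms(1,3,4)] and G = evolves_interaction[OF assms(2,3,4)]
  have "U (- d * t) (f t) = U (- d * t) (g t)"
    by (rule solution_unique[OF assms(3,4) F(1) G(1) F(2) G(2)]) (use assms in simp_all)
  then show ?thesis using F(3)[of t] G(3)[of t] by simp
qed

subsection \<open>Conservation laws\<close>

context
  fixes a b :: real and g :: "real \<Rightarrow> l2"
  assumes g: "evolves a b g" and a: "a < 0" and b: "0 < b"
begin

abbreviation (input) "w t \<equiv> U (- d * t) (g t)"

text \<open>The multiplier commutes with the group, which is isometric, so \<open>g\<close> may be
  replaced by its interaction picture. That path is differentiable in \<open>l2\<close>, and only
  the nonlinear term contributes. With \<open>m = lam\<close> this is the mass, with
  \<open>m = dmu\<close> the kinetic energy.\<close>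

lemma quadratic_derivative:
  assumes m: "bdd_meas m" and t: "t \<in> {a<..<b}"
  shows "((\<lambda>t. (norm (mul m (g t)))\<^sup>2) has_real_derivative 2 * inner (mul m (cscale \<i> (Qt (g t)))) (mul m (g t))) (at t)"
proof -
  note W = evolves_interaction[OF g a b]
  define z where "z s = mul m (w s)" for s
  define k where "k = mul m (G t (w t))"
  have z: "(z has_vector_derivative k) (at t)"
    unfolding z_def k_def by (rule bounded_linear.has_vector_derivative[OF bounded_linear_mul[OF m] W(2)[OF t]])
  have "((\<lambda>s. inner (z s) (z s)) has_derivative (\<lambda>h. inner (z t) (h *\<^sub>R k) + inner (h *\<^sub>R k) (z t))) (at t)"
    using z by (intro has_derivative_inner) (simp_all add: has_vector_derivative_def)
  then have D: "((\<lambda>s. inner (z s) (z s)) has_real_derivative 2 * inner k (z t)) (at t)"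
    by (simp add: has_field_derivative_def inner_commute algebra_simps mult_commute_abs)
  have z_eq: "z s = U (- d * s) (mul m (g s))" for s
    unfolding z_def by (rule mul_commute[OF m bdd_meas_sch])
  have nz: "inner (z s) (z s) = (norm (mul m (g s)))\<^sup>2" for s
    unfolding z_eq power2_norm_eq_inner[symmetric] norm_U ..
  have "G t (w t) = U (- d * t) (cscale \<i> (Qt (g t)))"
    unfolding G_def W(3) mul_commute[OF bdd_meas_sch bdd_meas_const] minus_mult_left ..
  then have "k = U (- d * t) (mul m (cscale \<i> (Qt (g t))))"
    unfolding k_def by (simp only: mul_commute[OF m bdd_meas_sch])
  then have "inner k (z t) = inner (mul m (cscale \<i> (Qt (g t)))) (U (- (- d * t)) (U (- d * t) (mul m (g t))))"
    unfolding z_eq by (simp only: inner_U)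
  also have "\<dots> = inner (mul m (cscale \<i> (Qt (g t)))) (mul m (g t))"
    unfolding U_U by simp
  finally show ?thesis using D unfolding nz by simp
qed

lemma continuous_quadratic: "bdd_meas m \<Longrightarrow> continuous_on {a..b} (\<lambda>t. (norm (mul m (g t)))\<^sup>2)"
  using g unfolding evolves_def
  by (intro continuous_on_power continuous_on_norm bounded_linear.continuous_on[OF bounded_linear_mul]) auto

lemma constant_on_interval:
  fixes f :: "real \<Rightarrow> real"
  assumes "continuous_on {a..b} f" "\<And>t. t \<in> {a<..<b} \<Longrightarrow> (f has_real_derivative 0) (at t)" "t \<in> {a..b}"
  shows "f t = f 0"
proof -
  have ab: "a < b" using a b by simp
  have "f s = f a" if "s \<in> {a..b}" for s
    by (rule DERIV_isconst2[OF ab assms(1)]) (use assms(2) that in auto)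
  from this[OF assms(3)] this[of 0] show ?thesis using a b by simp
qed

lemma mass_conserved: "t \<in> {a..b} \<Longrightarrow> (norm (Lam (g t)))\<^sup>2 = (norm (Lam (g 0)))\<^sup>2"
proof (rule constant_on_interval[where f="\<lambda>t. (norm (Lam (g t)))\<^sup>2"])
  show "continuous_on {a..b} (\<lambda>t. (norm (Lam (g t)))\<^sup>2)" by (rule continuous_quadratic) simp
  fix t assume t: "t \<in> {a<..<b}"
  have "inner (Lam (cscale \<i> (Qt (g t)))) (Lam (g t)) = 0"
    using Qt_gauge[of "g t"] unfolding mul_commute[OF bdd_meas_lam bdd_meas_const] by (simp add: inner_i)
  then show "((\<lambda>t. (norm (Lam (g t)))\<^sup>2) has_real_derivative 0) (at t)"
    using quadratic_derivative[OF bdd_meas_lam t] by simp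
qed

lemma Pot_derivative:
  assumes t: "t \<in> {a<..<b}"
  shows "((\<lambda>t. Pot (g t)) has_real_derivative inner (Qt (g t)) (rhs (g t))) (at t)"
proof -
  have c: "continuous_on {a..b} g" and d: "((\<lambda>s. Lam2 (g s)) has_vector_derivative rhs (g t)) (at t)"
    using g t unfolding evolves_def by auto
  have "bounded (g ` {a..b})" by (intro compact_imp_bounded compact_continuous_image c compact_Icc)
  then obtain R where R: "\<And>s. s \<in> {a..b} \<Longrightarrow> norm (g s) \<le> R" unfolding bounded_iff by blast
  define q where "q s = (1 / (s - t)) *\<^sub>R (Lam2 (g s) - Lam2 (g t))" for s
  have q: "(q \<longlongrightarrow> rhs (g t)) (at t)" using d unfolding has_vector_derivative_iff_quotient q_def .
  have "isCont g t" using c t by (intro continuous_on_interior) auto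
  then have gt: "((\<lambda>s. g s - g t) \<longlongrightarrow> 0) (at t)" unfolding isCont_def by (rule LIM_zero)
  define K where "K = mass_psi * Lpot R"
  have err: "((\<lambda>s. K * \<bar>inner (q s) (g s - g t)\<bar>) \<longlongrightarrow> 0) (at t)"
  proof -
    have "((\<lambda>s. K * \<bar>inner (q s) (g s - g t)\<bar>) \<longlongrightarrow> K * \<bar>inner (rhs (g t)) 0\<bar>) (at t)"
      by (intro tendsto_mult tendsto_const tendsto_rabs tendsto_inner q gt)
    then show ?thesis by simp
  qed
  have near: "\<forall>\<^sub>F s in at t. s \<in> {a<..<b}"
    unfolding eventually_at_topological using t by (intro exI[of _ "{a<..<b}"]) simp
  have "((\<lambda>s. (Pot (g s) - Pot (g t)) / (s - t) - inner (Qt (g t)) (q s)) \<longlongrightarrow> 0) (at t)"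
  proof (rule Lim_null_comparison[OF _ err])
    have "\<forall>\<^sub>F s in at t. s \<noteq> t" by (simp add: eventually_at_filter)
    with near show "\<forall>\<^sub>F s in at t. norm ((Pot (g s) - Pot (g t)) / (s - t) - inner (Qt (g t)) (q s)) \<le> K * \<bar>inner (q s) (g s - g t)\<bar>"
    proof eventually_elim
      case (elim s)
      have st: "s - t \<noteq> 0" using elim by simp
      have L: "Lam2 (g s) - Lam2 (g t) = Lam2 (g s - g t)" by (simp add: mul_diff)
      have 1: "inner (Lam (Qt (g t))) (Lam (g s - g t)) = (s - t) * inner (Qt (g t)) (q s)"
        using st unfolding q_def L by (simp add: inner_mul_left)
      \<comment> \<open>One factor of the square is rewritten with the H^-1 difference quotient
        \<open>q\<close>: since \<open>q s\<close> converges and \<open>g s - g t\<close> tends to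
        0, the quadratic remainder is of smaller order than \<open>s - t\<close>.\<close>
      have 2: "(norm (Lam (g s - g t)))\<^sup>2 = (s - t) * inner (q s) (g s - g t)"
        using st unfolding q_def L by (simp add: inner_mul_left power2_norm_eq_inner inner_commute)
      have "\<bar>Pot (g s) - Pot (g t) - inner (Lam (Qt (g t))) (Lam (g s - g t))\<bar> \<le> mass_psi * (Lpot R * (norm (Lam (g s - g t)))\<^sup>2)"
        using elim t by (intro Pot_taylor R) auto
      also have "\<dots> \<le> \<bar>s - t\<bar> * (K * \<bar>inner (q s) (g s - g t)\<bar>)"
      proof -
        have "K * ((s - t) * inner (q s) (g s - g t)) \<le> K * \<bar>(s - t) * inner (q s) (g s - g t)\<bar>"
          by (intro mult_left_mono) (auto simp: K_def mass_psi_nonneg Lpot_nonneg)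
        then show ?thesis unfolding 2 K_def by (simp add: abs_mult mult_ac)
      qed
      finally have 3: "\<bar>Pot (g s) - Pot (g t) - (s - t) * inner (Qt (g t)) (q s)\<bar> \<le> \<bar>s - t\<bar> * (K * \<bar>inner (q s) (g s - g t)\<bar>)" unfolding 1 .
      have "(Pot (g s) - Pot (g t)) / (s - t) - inner (Qt (g t)) (q s) = (Pot (g s) - Pot (g t) - (s - t) * inner (Qt (g t)) (q s)) / (s - t)"
        using st by (simp add: diff_divide_distrib)
      then have "norm ((Pot (g s) - Pot (g t)) / (s - t) - inner (Qt (g t)) (q s)) = \<bar>Pot (g s) - Pot (g t) - (s - t) * inner (Qt (g t)) (q s)\<bar> / \<bar>s - t\<bar>"
        by simp
      also have "\<dots> \<le> K * \<bar>inner (q s) (g s - g t)\<bar>" using 3 st by (simp add: divide_le_eq mult.commute)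
      finally show ?case .
    qed
  qed
  moreover have "((\<lambda>s. inner (Qt (g t)) (q s)) \<longlongrightarrow> inner (Qt (g t)) (rhs (g t))) (at t)"
    by (intro tendsto_inner tendsto_const q)
  ultimately have "((\<lambda>s. ((Pot (g s) - Pot (g t)) / (s - t) - inner (Qt (g t)) (q s)) + inner (Qt (g t)) (q s)) \<longlongrightarrow> 0 + inner (Qt (g t)) (rhs (g t))) (at t)"
    by (rule tendsto_add)
  then show ?thesis unfolding has_field_derivative_iff by simp
qed

lemma energy_conserved:
  "t \<in> {a..b} \<Longrightarrow> d / 2 * (norm (Dm (g t)))\<^sup>2 - Pot (g t) = d / 2 * (norm (Dm (g 0)))\<^sup>2 - Pot (g 0)"
proof (rule constant_on_interval[where f="\<lambda>t. d / 2 * (norm (Dm (g t)))\<^sup>2 - Pot (g t)"])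
  have "continuous_on {a..b} (\<lambda>t. Pot (g t))"
    by (rule continuous_on_compose2[OF continuous_Pot[of UNIV]]) (use g in \<open>auto simp: evolves_def\<close>)
  then show "continuous_on {a..b} (\<lambda>t. d / 2 * (norm (Dm (g t)))\<^sup>2 - Pot (g t))"
    by (intro continuous_on_diff continuous_on_mult continuous_on_const continuous_quadratic bdd_meas_dmu)
  fix t assume t: "t \<in> {a<..<b}"
  \<comment> \<open>Kinetic and potential energy both have derivative \<open>- d * X\<close>. In the
    potential part the nonlinear contribution drops out, because \<open>\<i> * f\<close> is
    orthogonal to \<open>f\<close>; in the kinetic part the linear one has already been removed by
    the interaction picture.\<close>
  define X where "X = inner (Qt (g t)) (cscale \<i> (Dm2 (g t)))"
  have "inner (Qt (g t)) (rhs (g t)) = - d * X"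
  proof -
    have "cscale (- \<i> * of_real d) (Dm2 (g t)) = cscale (of_real (- d)) (cscale \<i> (Dm2 (g t)))"
      by (subst mul_mul) (simp_all add: mult.commute)
    moreover have "inner (Qt (g t)) (cscale \<i> (Lam2 (Qt (g t)))) = 0"
    proof -
      have "inner (Qt (g t)) (cscale \<i> (Lam2 (Qt (g t)))) = inner (Lam (Qt (g t))) (cscale \<i> (Lam (Qt (g t))))"
        unfolding mul_commute[OF bdd_meas_const bdd_meas_lam] by (simp add: inner_mul_left)
      moreover have "inner f (cscale \<i> f) = 0" for f using inner_i[of f f] by (simp add: inner_commute)
      ultimately show ?thesis by simp
    qed
    ultimately show ?thesis unfolding rhs_def inner_add_right by (simp only: mul_of_real inner_scaleR_right X_def)
  qed
  moreover have "inner (Dm (cscale \<i> (Qt (g t)))) (Dm (g t)) = - X"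
  proof -
    have "inner (Dm (cscale \<i> (Qt (g t)))) (Dm (g t)) = inner (cscale \<i> (Qt (g t))) (Dm2 (g t))"
      by (rule trans[OF inner_commute trans[OF inner_Dm2 inner_commute]])
    then show ?thesis by (simp add: X_def inner_i)
  qed
  moreover have "((\<lambda>t. d / 2 * (norm (Dm (g t)))\<^sup>2 - Pot (g t)) has_real_derivative
      d / 2 * (2 * inner (Dm (cscale \<i> (Qt (g t)))) (Dm (g t))) - inner (Qt (g t)) (rhs (g t))) (at t)"
    by (intro DERIV_diff DERIV_cmult quadratic_derivative[OF bdd_meas_dmu t] Pot_derivative[OF t])
  ultimately show "((\<lambda>t. d / 2 * (norm (Dm (g t)))\<^sup>2 - Pot (g t)) has_real_derivative 0) (at t)" by simp
qed

end

subsection \<open>Well-posedness\<close>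

lemma locally_well_posed: "locally_well_posed d P \<psi>"
  unfolding locally_well_posed_def
proof
  fix u0 assume u0: "u0 \<in> H1"
  \<comment> \<open>Data in the unit ball around \<open>u0\<close> have norm at most
    \<open>R / 2\<close>, as the Picard iteration requires.\<close>
  define R where "R = 2 * (norm (crd u0) + 1)"
  have R: "R > 0" by (simp add: R_def add_nonneg_pos)
  \<comment> \<open>Ensures \<open>M * KR R \<le> 1/2\<close>; the added 1 keeps the denominator
    positive when \<open>KR R = 0\<close>.\<close>
  define M where "M = 1 / (2 * (KR R + 1))"
  have M: "M > 0" using KR_nonneg[of R] by (simp add: M_def)
  have small: "M * KR R \<le> 1/2" using KR_nonneg[of R] by (simp add: M_def divide_simps)
  define sol where "sol \<phi> w \<longleftrightarrow> w 0 = crd \<phi> \<and> continuous_on {-M..M} w \<and> (\<forall>t\<in>{-M..M}. norm (w t) \<le> R) \<and> solves M w" for \<phi> w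
  define w where "w \<phi> = (SOME w. sol \<phi> w)" for \<phi>
  define S where "S \<phi> t = ev (U (d * t) (w \<phi> t))" for \<phi> t
  have w: "sol \<phi> (w \<phi>)" if "\<phi> \<in> H1_ball u0 1" for \<phi>
  proof -
    have "\<phi> \<in> H1" "norm (crd \<phi> - crd u0) < 1"
      using that u0 by (auto simp: H1_ball_def H1_norm_eq crd_diff)
    then have "norm (crd \<phi>) \<le> R / 2" using norm_triangle_ineq[of "crd \<phi> - crd u0" "crd u0"] by (simp add: R_def)
    from picard_solution[OF R M small this] show ?thesis unfolding w_def sol_def by (rule someI_ex)
  qed
  have ball: "\<phi> \<in> H1" if "\<phi> \<in> H1_ball u0 1" for \<phi> using that by (simp add: H1_ball_def)
  have ev: "evolves (- M) M (\<lambda>t. U (d * t) (w \<phi> t))" if "\<phi> \<in> H1_ball u0 1" for \<phi>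
    using w[OF that] unfolding sol_def by (intro interaction_evolves) auto
  have S1: "strong_solution d P \<psi> M M \<phi> (S \<phi>)" if "\<phi> \<in> H1_ball u0 1" for \<phi>
    unfolding S_def using w[OF that] by (intro evolves_strong_solution ev that ball) (simp add: sol_def)
  have S2: "AE x in lborel. v t x = S \<phi> t x"
    if phi: "\<phi> \<in> H1_ball u0 1" and v: "strong_solution d P \<psi> M M \<phi> v" and t: "t \<in> {-M..M}" for \<phi> v t
  proof -
    note V = strong_solution_evolves[OF v ball[OF phi] M M]
    have "crd (v t) = U (d * t) (w \<phi> t)"
      by (rule evolves_unique[OF V(1) ev[OF phi] _ M _ t]) (use V(2) w[OF phi] M in \<open>auto simp: sol_def\<close>)
    then show ?thesis using crd_eq_AE_ev[OF V(3)[OF t]] by (simp add: S_def)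
  qed
  have S3: "\<exists>\<delta>>0. \<forall>\<eta>\<in>H1_ball u0 1. H1_norm (\<lambda>x. \<eta> x - \<phi> x) < \<delta> \<longrightarrow> CH1_dist {-M..M} (S \<eta>) (S \<phi>) < \<epsilon>"
    if phi: "\<phi> \<in> H1_ball u0 1" and e: "\<epsilon> > 0" for \<phi> \<epsilon>
  proof -
    \<comment> \<open>Half of \<open>\<epsilon>\<close>, because the distance is a supremum and has
      to be strictly below \<open>\<epsilon>\<close>.\<close>
    have "\<exists>\<delta>>0. \<forall>v. solves M v \<and> (\<forall>t\<in>{-M..M}. norm (v t) \<le> R) \<and> norm (v 0 - w \<phi> 0) < \<delta> \<longrightarrow>
      (\<forall>t\<in>{-M..M}. norm (v t - w \<phi> t) \<le> \<epsilon> / 2)"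
      using w[OF phi] e by (intro solution_dependence[OF R M small]) (auto simp: sol_def)
    then obtain \<delta> where \<delta>: "\<delta> > 0" "\<And>v. solves M v \<Longrightarrow> (\<forall>t\<in>{-M..M}. norm (v t) \<le> R) \<Longrightarrow> norm (v 0 - w \<phi> 0) < \<delta> \<Longrightarrow>
      (\<forall>t\<in>{-M..M}. norm (v t - w \<phi> t) \<le> \<epsilon> / 2)" by blast
    have "CH1_dist {-M..M} (S \<eta>) (S \<phi>) < \<epsilon>" if \<eta>: "\<eta> \<in> H1_ball u0 1" "H1_norm (\<lambda>x. \<eta> x - \<phi> x) < \<delta>" for \<eta>
    proof -
      have "norm (w \<eta> 0 - w \<phi> 0) < \<delta>"
        using w[OF \<eta>(1)] w[OF phi] \<eta>(2) ball[OF \<eta>(1)] ball[OF phi] by (simp add: sol_def H1_norm_eq crd_diff)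
      then have le: "norm (w \<eta> t - w \<phi> t) \<le> \<epsilon> / 2" if "t \<in> {-M..M}" for t
        using \<delta>(2)[of "w \<eta>"] w[OF \<eta>(1)] that by (auto simp: sol_def)
      have "H1_norm (\<lambda>x. S \<eta> t x - S \<phi> t x) = norm (w \<eta> t - w \<phi> t)" for t
        unfolding S_def by (simp add: H1_norm_eq crd_diff flip: mul_diff)
      then have "CH1_dist {-M..M} (S \<eta>) (S \<phi>) \<le> \<epsilon> / 2"
        unfolding CH1_dist_def using le M by (intro cSUP_least) auto
      then show ?thesis using e by simp
    qed
    then show ?thesis using \<delta>(1) by blast
  qed
  show "\<exists>Mm>0. \<exists>Mp>0. \<exists>c\<in>H1. \<exists>\<rho>>0. u0 \<in> H1_ball c \<rho> \<and>
        (\<exists>S. (\<forall>\<phi>\<in>H1_ball c \<rho>.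
                strong_solution d P \<psi> Mm Mp \<phi> (S \<phi>) \<and>
                (\<forall>v. strong_solution d P \<psi> Mm Mp \<phi> v \<longrightarrow>
                   (\<forall>t\<in>{-Mm..Mp}. AE x in lborel. v t x = S \<phi> t x))) \<and>
             (\<forall>\<phi>\<in>H1_ball c \<rho>. \<forall>\<epsilon>>0. \<exists>\<delta>>0. \<forall>\<eta>\<in>H1_ball c \<rho>.
                H1_norm (\<lambda>x. \<eta> x - \<phi> x) < \<delta> \<longrightarrow> CH1_dist {-Mm..Mp} (S \<eta>) (S \<phi>) < \<epsilon>))"
  proof (rule exI[of _ M], rule conjI[OF M], rule exI[of _ M], rule conjI[OF M], rule bexI[OF _ u0],
      rule exI[of _ 1], rule conjI[OF zero_less_one], rule conjI)
    have "H1_norm (\<lambda>x. u0 x - u0 x) = 0"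
      unfolding H1_norm_eq[OF crd_diff(1)[OF u0 u0]] crd_diff(2)[OF u0 u0] by simp
    then show "u0 \<in> H1_ball u0 1" using u0 by (simp add: H1_ball_def)
    show "\<exists>S. (\<forall>\<phi>\<in>H1_ball u0 1.
                strong_solution d P \<psi> M M \<phi> (S \<phi>) \<and>
                (\<forall>v. strong_solution d P \<psi> M M \<phi> v \<longrightarrow>
                   (\<forall>t\<in>{-M..M}. AE x in lborel. v t x = S \<phi> t x))) \<and>
             (\<forall>\<phi>\<in>H1_ball u0 1. \<forall>\<epsilon>>0. \<exists>\<delta>>0. \<forall>\<eta>\<in>H1_ball u0 1.
                H1_norm (\<lambda>x. \<eta> x - \<phi> x) < \<delta> \<longrightarrow> CH1_dist {-M..M} (S \<eta>) (S \<phi>) < \<epsilon>)"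
      by (rule exI[of _ S], intro conjI ballI allI impI) (fact S1, fact S2, fact S3)
  qed
qed

lemma mass_eq: "f \<in> H1 \<Longrightarrow> mass f = (norm (Lam (crd f)))\<^sup>2"
  unfolding mass_def norm_cls[OF H1_crd(1), symmetric] by (simp add: cls_H1)

lemma conservation:
  assumes u: "strong_solution d P \<psi> Mm Mp u0 u" and u0: "u0 \<in> H1" and M: "Mm > 0" "Mp > 0" and t: "t \<in> {-Mm..Mp}"
    and W: "\<And>z. W z = V h (norm z)"
  shows "mass (u t) = mass u0" "energy d h \<psi> (u t) = energy d h \<psi> u0"
proof -
  note E = strong_solution_evolves[OF u u0 M]
  have en: "energy d h \<psi> f = d / 2 * (norm (Dm (crd f)))\<^sup>2 - Pot (crd f)" if "f \<in> H1" for f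
    unfolding energy_def Pot_def pot_def W T_eq_ev[OF that] norm_cls[OF Dx_L2[OF that], symmetric] cls_Dx[OF that] by simp
  have neg: "- Mm < 0" using M by simp
  show "mass (u t) = mass u0"
    using mass_conserved[OF E(1) neg M(2) t] E(2) by (simp add: mass_eq u0 E(3)[OF t])
  show "energy d h \<psi> (u t) = energy d h \<psi> u0"
    using energy_conserved[OF E(1) neg M(2) t] E(2) by (simp add: en u0 E(3)[OF t])
qed

end

subsection \<open>Nonlinearities of the form \<open>h(|z|) z\<close>\<close>

locale gauge_nonlinearity =
  fixes h h' :: "real \<Rightarrow> real" and P :: "complex \<Rightarrow> complex"
  assumes continuous_h: "continuous_on {0..} h"
    and h_derivative: "\<And>a. a > 0 \<Longrightarrow> (h has_real_derivative h' a) (at a)"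
    and continuous_h': "continuous_on {0<..} h'"
    and h'_limit: "((\<lambda>a. h' a * a) \<longlongrightarrow> 0) (at_right 0)"
    and P_eq: "\<And>z. P z = of_real (h (norm z)) * z"
begin

text \<open>The function \<open>h' a * a\<close> of the modulus, extended by zero; the limit
  hypothesis on \<open>h'\<close> makes the extension continuous at the origin.\<close>

definition K :: "complex \<Rightarrow> real" where
  "K z = (if z = 0 then 0 else h' (norm z) * norm z)"

text \<open>The real derivative of \<open>P\<close> at \<open>z\<close> is \<open>w \<mapsto> h(|z|) w + h'(|z|) |z| Re (cnj s w) s\<close> with
  \<open>s = z / |z|\<close>, and \<open>Re (cnj s w) s = (w + s\<^sup>2 cnj w) / 2\<close>.\<close>

definition DA :: "complex \<Rightarrow> complex" where
  "DA z = of_real (h (norm z) + K z / 2)"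

definition DB :: "complex \<Rightarrow> complex" where
  "DB z = of_real (K z / 2) * (sgn z)\<^sup>2"

lemma continuous_h_norm: "continuous_on UNIV (\<lambda>z::complex. h (norm z))"
  by (rule continuous_on_compose2[OF continuous_h]) (auto intro: continuous_intros)

lemma continuous_K: "continuous_on UNIV K"
proof -
  have "isCont K z" for z
  proof (cases "z = 0")
    case True
    have "filterlim (norm :: complex \<Rightarrow> real) (at_right 0) (at 0)"
      unfolding filterlim_at
    proof
      show "((norm :: complex \<Rightarrow> real) \<longlongrightarrow> 0) (at 0)" using tendsto_norm[OF tendsto_ident_at[of "0::complex" UNIV]] by simp
      show "\<forall>\<^sub>F x in at 0. norm (x::complex) \<in> {0<..} \<and> norm x \<noteq> 0" by (simp add: eventually_at_filter)
    qed
    from filterlim_compose[OF h'_limit this] have "((\<lambda>z::complex. h' (norm z) * norm z) \<longlongrightarrow> 0) (at 0)" .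
    then have "(K \<longlongrightarrow> 0) (at 0)"
      by (rule Lim_transform_eventually) (simp add: eventually_at_filter K_def)
    then show ?thesis unfolding isCont_def True by (simp add: K_def)
  next
    case False
    have "continuous_on (- {0::complex}) (\<lambda>z. h' (norm z) * norm z)"
      by (intro continuous_on_mult continuous_on_compose2[OF continuous_h'] continuous_on_norm continuous_on_id) auto
    then have "isCont (\<lambda>z. h' (norm z) * norm z) z"
      using False by (simp add: continuous_on_eq_continuous_at open_Compl)
    moreover have "\<forall>\<^sub>F y in nhds z. h' (norm y) * norm y = K y"
      using False t1_space_nhds[of z 0] by (auto elim!: eventually_mono simp: K_def)
    ultimately show ?thesis using isCont_cong[of "\<lambda>z. h' (norm z) * norm z" K z] by blast
  qed
  then show ?thesis by (simp add: continuous_at_imp_continuous_on)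
qed

lemma continuous_DA: "continuous_on UNIV DA"
  unfolding DA_def
  by (intro continuous_on_of_real continuous_on_add continuous_h_norm continuous_on_divide continuous_K continuous_on_const) simp

lemma norm_DB_le: "norm (DB z) \<le> \<bar>K z\<bar> / 2"
  by (cases "z = 0") (simp_all add: DB_def norm_mult norm_power norm_sgn)

text \<open>The factor \<open>sgn z\<close> is discontinuous at the origin, but it has modulus at
  most 1 and is multiplied by \<open>K z\<close>, which tends to 0.\<close>

lemma continuous_DB: "continuous_on UNIV DB"
proof -
  have K: "isCont K z" for z using continuous_K by (simp add: continuous_on_eq_continuous_at)
  have "isCont DB z" for z
  proof (cases "z = 0")
    case True
    have "(K \<longlongrightarrow> 0) (at 0)" using K[of 0] by (simp add: isCont_def K_def)
    then have "((\<lambda>z. \<bar>K z\<bar> / 2) \<longlongrightarrow> \<bar>0\<bar> / 2) (at 0)" by (intro tendsto_divide tendsto_rabs tendsto_const) simp_all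
    then have lim: "((\<lambda>z. \<bar>K z\<bar> / 2) \<longlongrightarrow> 0) (at 0)" by simp
    have "(DB \<longlongrightarrow> 0) (at 0)"
      by (rule Lim_null_comparison[OF always_eventually[OF allI] lim]) (rule norm_DB_le)
    then show ?thesis unfolding isCont_def True by (simp add: DB_def)
  next
    case False
    have "isCont (\<lambda>z. of_real (K z / 2) * (z /\<^sub>R norm z)\<^sup>2) z"
      using False by (intro continuous_intros isCont_of_real K) auto
    then show ?thesis unfolding DB_def[abs_def] sgn_div_norm .
  qed
  then show ?thesis by (simp add: continuous_at_imp_continuous_on)
qed

lemma DP_eq:
  assumes "z \<noteq> 0"
  shows "of_real (h (norm z)) * w + of_real (h' (norm z) * inner w (sgn z)) * z = DA z * w + DB z * cnj w"
proof -
  define s where "s = sgn z"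
  define a where "a = norm z"
  have a: "a \<noteq> 0" using assms by (simp add: a_def)
  have z: "z = of_real a * s"
    using assms by (simp add: s_def a_def sgn_div_norm scaleR_conv_of_real)
  have ss: "s * cnj s = 1"
    using assms complex_norm_square[of s] by (simp add: s_def norm_sgn)
  have "of_real (2 * inner w s) = w * cnj s + cnj w * s"
    by (simp add: inner_complex_def complex_eq_iff algebra_simps)
  then have "w * cnj s + cnj w * s = 2 * complex_of_real (inner w s)" by simp
  then have i: "complex_of_real (inner w s) = (w * cnj s + cnj w * s) / 2" by simp
  have K: "K z = h' a * a" using assms by (simp add: K_def a_def)
  have "of_real (h' a * inner w s) * z = of_real (h' a * a) * (complex_of_real (inner w s) * s)"
    unfolding z by simp
  also have "complex_of_real (inner w s) * s = (w * (s * cnj s) + cnj w * s\<^sup>2) / 2"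
    unfolding i by (simp add: power2_eq_square algebra_simps)
  finally have *: "of_real (h' a * inner w s) * z = of_real (K z) * ((w + cnj w * s\<^sup>2) / 2)"
    unfolding ss K by simp
  show ?thesis
    unfolding DA_def DB_def a_def[symmetric] s_def[symmetric] * by (simp add: algebra_simps add_divide_distrib)
qed

text \<open>Away from the origin this is the chain rule for the modulus. At the origin the relative
  error of the linear approximation \<open>h 0 * y\<close> is
  \<open>\<bar>h (norm y) - h 0\<bar>\<close>, so continuity of \<open>h\<close> is enough.\<close>

lemma P_has_derivative: "(P has_derivative (\<lambda>w. DA z * w + DB z * cnj w)) (at z)"
proof (cases "z = 0")
  case False
  have n: "norm z > 0" using False by simp
  have "(h has_derivative (\<lambda>x. x * h' (norm z))) (at (norm z))"
    using h_derivative[OF n] by (simp add: has_field_derivative_def mult_commute_abs)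
  from has_derivative_compose[OF has_derivative_norm[OF False] this]
  have "((\<lambda>z. h (norm z)) has_derivative (\<lambda>w. inner w (sgn z) * h' (norm z))) (at z)"
    by (simp add: inner_commute)
  from has_derivative_mult[OF has_derivative_of_real[OF this] has_derivative_ident]
  have "((\<lambda>z. of_real (h (norm z)) * z) has_derivative
    (\<lambda>w. of_real (h (norm z)) * w + of_real (inner w (sgn z) * h' (norm z)) * z)) (at z)" .
  moreover have "(\<lambda>w. of_real (h (norm z)) * w + of_real (inner w (sgn z) * h' (norm z)) * z) = (\<lambda>w. DA z * w + DB z * cnj w)"
    using DP_eq[OF False] by (simp add: mult.commute fun_eq_iff)
  moreover have "P = (\<lambda>z. of_real (h (norm z)) * z)" by (simp add: P_eq fun_eq_iff)
  ultimately show ?thesis by simp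
next
  case True
  have D0: "DA 0 = of_real (h 0)" "DB 0 = 0" by (simp_all add: DA_def DB_def K_def)
  have "isCont (\<lambda>y::complex. h (norm y)) 0"
    using continuous_h_norm by (simp add: continuous_on_eq_continuous_at)
  then have "((\<lambda>y. h (norm y) - h 0) \<longlongrightarrow> 0) (at (0::complex))"
    unfolding isCont_def norm_zero by (rule LIM_zero)
  then have lim: "((\<lambda>y::complex. \<bar>h (norm y) - h 0\<bar>) \<longlongrightarrow> 0) (at 0)" by (rule tendsto_rabs_zero)
  have "((\<lambda>y. norm (P y - P 0 - (DA 0 * (y - 0) + DB 0 * cnj (y - 0))) / norm (y - 0)) \<longlongrightarrow> 0) (at 0)"
  proof (rule Lim_transform_eventually[OF lim])
    show "\<forall>\<^sub>F y in at 0. \<bar>h (norm y) - h 0\<bar> = norm (P y - P 0 - (DA 0 * (y - 0) + DB 0 * cnj (y - 0))) / norm (y - 0)"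
      unfolding eventually_at_filter
    proof (intro always_eventually allI impI)
      fix y :: complex assume "y \<noteq> 0"
      have "P y - P 0 - (DA 0 * (y - 0) + DB 0 * cnj (y - 0)) = of_real (h (norm y) - h 0) * y"
        by (simp add: P_eq D0 algebra_simps)
      then show "\<bar>h (norm y) - h 0\<bar> = norm (P y - P 0 - (DA 0 * (y - 0) + DB 0 * cnj (y - 0))) / norm (y - 0)"
        using \<open>y \<noteq> 0\<close> by (simp add: norm_mult del: of_real_diff)
    qed
  qed
  moreover have "bounded_linear (\<lambda>w. DA 0 * w + DB 0 * cnj w)"
    by (intro bounded_linear_add bounded_linear_mult_right bounded_linear_const_mult bounded_linear_cnj)
  ultimately show ?thesis unfolding True has_derivative_iff_norm by simp
qed

sublocale c1_map P DA DB
  by unfold_locales (simp_all add: continuous_DA continuous_DB P_has_derivative P_eq)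

section \<open>The potential and its quadratic expansion\<close>

definition W :: "complex \<Rightarrow> real" where
  "W z = V h (norm z)"

lemma W_at_0: "W 0 = 0"
  by (simp add: W_def V_def)

lemma V_has_derivative:
  assumes "a > 0"
  shows "(V h has_real_derivative h a * a) (at a)"
proof -
  \<comment> \<open>Going up to \<open>a + 1\<close> makes \<open>a\<close> an interior point, so
    the one-sided derivative of the integral becomes a full one.\<close>
  have "continuous_on {0..a + 1} (\<lambda>s. h s * s)"
    by (intro continuous_on_mult continuous_on_id continuous_on_subset[OF continuous_h]) auto
  from integral_has_real_derivative[OF this, of a]
  have "(V h has_real_derivative h a * a) (at a within {0..a + 1})"
    using assms by (simp add: V_def[abs_def])
  then show ?thesis using assms by (simp add: at_within_Icc_at)
qed

lemma W_bound_near_0: "\<exists>C. \<forall>z. norm z \<le> 1 \<longrightarrow> \<bar>W z\<bar> \<le> C * (norm z)\<^sup>2"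
proof -
  have "compact (h ` {0..1})" by (intro compact_continuous_image continuous_on_subset[OF continuous_h]) auto
  then have "bounded (h ` {0..1})" by (rule compact_imp_bounded)
  then obtain C where C: "\<And>a. a \<in> {0..1} \<Longrightarrow> norm (h a) \<le> C" unfolding bounded_iff by blast
  have "\<bar>W z\<bar> \<le> C * (norm z)\<^sup>2" if "norm z \<le> 1" for z
  proof -
    have "norm (integral {0..norm z} (\<lambda>s. h s * s)) \<le> (C * norm z) * (norm z - 0)"
    proof (rule integral_bound)
      show "continuous_on {0..norm z} (\<lambda>s. h s * s)"
        by (intro continuous_on_mult continuous_on_id continuous_on_subset[OF continuous_h]) auto
      fix s assume s: "s \<in> {0..norm z}"
      have "norm (h s * s) \<le> C * \<bar>s\<bar>"
        using C[of s] s that by (simp add: abs_mult mult_right_mono)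
      also have "\<dots> \<le> C * norm z" using s order_trans[OF norm_ge_zero C[of 0]] by (intro mult_left_mono) auto
      finally show "norm (h s * s) \<le> C * norm z" .
    qed simp
    then show ?thesis by (simp add: W_def V_def power2_eq_square mult.assoc)
  qed
  then show ?thesis by blast
qed

lemma W_has_derivative: "(W has_derivative (\<lambda>w. Re (P z * cnj w))) (at z)"
proof (cases "z = 0")
  case False
  have "norm z > 0" using False by simp
  then have "(V h has_derivative (\<lambda>x. x * (h (norm z) * norm z))) (at (norm z))"
    using V_has_derivative[of "norm z"] by (simp add: has_field_derivative_def mult_commute_abs)
  from has_derivative_compose[OF has_derivative_norm[OF False] this]
  have "(W has_derivative (\<lambda>w. inner (sgn z) w * (h (norm z) * norm z))) (at z)"
    by (simp add: W_def[abs_def] inner_commute)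
  moreover have "inner (sgn z) w * (h (norm z) * norm z) = Re (P z * cnj w)" for w
  proof -
    have "inner (sgn z) w * (h (norm z) * norm z) = h (norm z) * inner (norm z *\<^sub>R sgn z) w" by simp
    also have "norm z *\<^sub>R sgn z = z" using False by (simp add: sgn_div_norm)
    finally show ?thesis by (simp add: P_eq inner_complex_def algebra_simps)
  qed
  ultimately show ?thesis by simp
next
  case True
  obtain C where C: "\<And>z. norm z \<le> 1 \<Longrightarrow> \<bar>W z\<bar> \<le> C * (norm z)\<^sup>2" using W_bound_near_0 by blast
  have "((\<lambda>y::complex. C * norm y) \<longlongrightarrow> C * norm (0::complex)) (at 0)" by (intro tendsto_intros)
  then have lim: "((\<lambda>y::complex. C * norm y) \<longlongrightarrow> 0) (at 0)" by simp
  have n1: "\<forall>\<^sub>F y in at (0::complex). norm y < 1"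
    unfolding eventually_at by (intro exI[of _ 1]) simp
  have n2: "\<forall>\<^sub>F y in at (0::complex). y \<noteq> 0" by (simp add: eventually_at_filter)
  have "((\<lambda>y. norm (W y) / norm y) \<longlongrightarrow> 0) (at 0)"
  proof (rule Lim_null_comparison[OF _ lim])
    show "\<forall>\<^sub>F y in at 0. norm (norm (W y) / norm y) \<le> C * norm y"
      using n1 n2
    proof eventually_elim
      case (elim y)
      have "\<bar>W y\<bar> \<le> (C * norm y) * norm y" using C[of y] elim by (simp add: power2_eq_square mult.assoc)
      then show ?case using elim by (simp add: divide_le_eq)
    qed
  qed
  then show ?thesis unfolding True has_derivative_iff_norm by (simp add: W_at_0 P_eq)
qed

text \<open>The gradient \<open>P\<close> of \<open>W\<close> is Lipschitz on the ball, so along the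
  segment it differs from its value at \<open>z\<close> by at most
  \<open>Lip R * norm (w - z)\<close>; the mean value inequality supplies the second factor.\<close>

lemma W_quadratic:
  assumes "norm z \<le> R" "norm w \<le> R"
  shows "\<bar>W w - W z - Re (P z * cnj (w - z))\<bar> \<le> Lip R * (norm (w - z))\<^sup>2"
proof -
  have "norm (W w - W z - Re (P z * cnj (w - z))) \<le> norm (w - z) * (Lip R * norm (w - z))"
  proof (rule differentiable_bound_linearization[where S="closed_segment z w" and f'="\<lambda>y v. Re (P y * cnj v)"])
    show "z + t *\<^sub>R (w - z) \<in> closed_segment z w" if "t \<in> {0..1}" for t
      using that unfolding closed_segment_def by (auto intro!: exI[of _ t] simp: algebra_simps)
    show "(W has_derivative (\<lambda>v. Re (P x * cnj v))) (at x within closed_segment z w)" for x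
      by (rule has_derivative_at_withinI[OF W_has_derivative])
    show "onorm ((\<lambda>v. Re (P x * cnj v)) - (\<lambda>v. Re (P z * cnj v))) \<le> Lip R * norm (w - z)" if x: "x \<in> closed_segment z w" for x
    proof (rule onorm_bound)
      have "closed_segment z w \<subseteq> cball 0 R" using assms by (intro closed_segment_subset) auto
      then have "norm x \<le> R" using x by auto
      then have "norm (P x - P z) \<le> Lip R * norm (x - z)" using assms(1) by (rule P_lipschitz)
      also have "\<dots> \<le> Lip R * norm (w - z)"
        by (rule mult_left_mono[OF segment_bound(1)[OF x] Lip(1)])
      finally have le: "norm (P x - P z) \<le> Lip R * norm (w - z)" .
      fix v
      have "((\<lambda>v. Re (P x * cnj v)) - (\<lambda>v. Re (P z * cnj v))) v = Re ((P x - P z) * cnj v)"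
        by (simp add: algebra_simps)
      also have "norm \<dots> \<le> norm (P x - P z) * norm v"
        using abs_Re_le_cmod[of "(P x - P z) * cnj v"] by (simp add: norm_mult)
      also have "\<dots> \<le> Lip R * norm (w - z) * norm v" by (rule mult_right_mono[OF le]) simp
      finally show "norm (((\<lambda>v. Re (P x * cnj v)) - (\<lambda>v. Re (P z * cnj v))) v) \<le> Lip R * norm (w - z) * norm v" .
    qed (simp add: Lip(1))
  qed simp
  then show ?thesis by (simp add: power2_eq_square mult_ac)
qed

sublocale nonlinearity P DA DB W
proof
  show "Re (P z * cnj (\<i> * z)) = 0" for z by (simp add: P_eq)
  show "continuous_on UNIV W"
    using has_derivative_continuous[OF W_has_derivative] by (simp add: continuous_at_imp_continuous_on)
  show "W 0 = 0" by (rule W_at_0)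
  show "\<exists>L\<ge>0. \<forall>z w. norm z \<le> R \<and> norm w \<le> R \<longrightarrow> \<bar>W w - W z - Re (P z * cnj (w - z))\<bar> \<le> L * (norm (w - z))\<^sup>2" for R
    using W_quadratic Lip(1) by blast
qed

end

theorem theorem1p3:
  fixes d_av :: real
    and h h' J1 J2 \<psi> :: "real \<Rightarrow> real"
    and P :: "complex \<Rightarrow> complex"
  assumes "d_av \<noteq> 0"
    and "continuous_on {0..} h"
    and "\<And>a. a > 0 \<Longrightarrow> (h has_real_derivative h' a) (at a)"
    and "continuous_on {0<..} h'"
    and "((\<lambda>a. h' a * a) \<longlongrightarrow> 0) (at_right 0)"
    and "mono_on {0..} J1" and "\<And>a. a \<ge> 0 \<Longrightarrow> J1 a \<ge> 0"
    and "mono_on {0..} J2" and "\<And>a. a \<ge> 0 \<Longrightarrow> J2 a \<ge> 0"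
    and "\<And>a. a \<ge> 0 \<Longrightarrow> \<bar>h a\<bar> \<le> J1 a"
    and "\<And>a. a > 0 \<Longrightarrow> \<bar>h' a\<bar> \<le> J2 a * (1 + inverse a)"
    and "integrable lborel \<psi>" and "AE r in lborel. \<psi> r \<ge> 0"
    and "\<And>z. P z = of_real (h (norm z)) * z"
  shows "locally_well_posed d_av P \<psi> \<and>
    (\<forall>Mm>0. \<forall>Mp>0. \<forall>u0\<in>H1. \<forall>u. strong_solution d_av P \<psi> Mm Mp u0 u \<longrightarrow>
       (\<forall>t\<in>{-Mm..Mp}. mass (u t) = mass u0 \<and> energy d_av h \<psi> (u t) = energy d_av h \<psi> u0))"
proof -
  interpret gauge_nonlinearity h h' P
    by unfold_locales (fact assms)+
  interpret averaged_nonlinearity P DA DB W \<psi> d_av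
    by unfold_locales (fact assms)+
  show ?thesis
  proof (intro conjI allI impI ballI)
    show "locally_well_posed d_av P \<psi>" by (rule locally_well_posed)
    fix Mm Mp :: real and u0 u t
    assume "Mm > 0" "Mp > 0" "u0 \<in> H1" "strong_solution d_av P \<psi> Mm Mp u0 u" "t \<in> {-Mm..Mp}"
    note C = conservation[OF this(4,3,1,2,5) W_def]
    show "mass (u t) = mass u0" by (rule C)
    show "energy d_av h \<psi> (u t) = energy d_av h \<psi> u0" by (rule C)
  qed
qed

end
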